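(* The point $\mathbf p=\mathbf 0$ is a strict local minimum of $f_2$. Consequently, there exists $\rho>0$ such that the square $\square=Q_{\mathbf 0}$ is the unique maximizer of $|Q_{\mathbf p}|\mu_1(Q_{\mathbf p})$ on $\overline{B(\mathbf 0,\rho)}\cap\mathcal P$ (i.e. $\mathbf p=\mathbf 0$ is the unique maximizer of $\mathbf p\mapsto|Q_{\mathbf p}|\mu_1(Q_{\mathbf p})$ there).
   Context: $\mu_1(\Omega)$ is the first nonzero Neumann eigenvalue of the Laplacian on $\Omega$. For $\mathbf x,\mathbf y\in\mathbb R^2$, $\mathbf x\times\mathbf y:=x_1y_2-x_2y_1$. Let $\square=[-\tfrac12,\tfrac12]^2$ with vertices $\mathbf v_1^0=(-\tfrac12,-\tfrac12)$, $\mathbf v_2^0=(\tfrac12,-\tfrac12)$, $\mathbf v_3^0=(\tfrac12,\tfrac12)$, $\mathbf v_4^0=(-\tfrac12,\tfrac12)$. For $\mathbf p=(a,b,c,d)\in\mathbb R^4$ define $\Phi_{\mathbf p}(u,v)=(u-au-dv-2buv,\ v-du+av+2cuv)$ on $\square$; $Q_{\mathbf p}$ is the quadrilateral with vertices $\mathbf v_i(\mathbf p)=\Phi_{\mathbf p}(\mathbf v_i^0)$ in this cyclic order, with area $|Q_{\mathbf p}|=1-a^2-d^2$, and $Q_{\mathbf 0}=\square$. Put $c_i(\mathbf p):=(\mathbf v_{i+1}-\mathbf v_i)\times(\mathbf v_{i+2}-\mathbf v_i)$ (indices mod 4) and $\mathcal P:=\{\mathbf p: c_i(\mathbf p)\ge0,\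 i=1,\dots,4\}$. Let $J=\det D\Phi_{\mathbf p}$ and let $g_1,\dots,g_5$ be the functions $\cos(m\pi(x_1+\tfrac12))\cos(n\pi(x_2+\tfrac12))$ for $(m,n)=(1,0),(0,1),(1,1),(2,0),(0,2)$. The $5\times5$ matrices are $$K_{ij}(\mathbf p)=\int_\square(\nabla g_i\cdot\nabla g_j)(\Phi_{\mathbf p})\,J\,du\,dv,$$ $$M_{ij}(\mathbf p)=\int_\square g_i(\Phi_{\mathbf p})g_j(\Phi_{\mathbf p})J\,du\,dv-\frac1{|Q_{\mathbf p}|}\int_\square g_i(\Phi_{\mathbf p})J\,du\,dv\int_\square g_j(\Phi_{\mathbf p})J\,du\,dv$$ (stiffness and mass matrices on $Q_{\mathbf p}$ of the mean-subtracted $g_i$). $\lambda_1(\mathbf p)\le\lambda_2(\mathbf p)$ are the two smallest generalized eigenvalues of $K(\mathbf p)x=\lambda M(\mathbf p)x$, and $f_2(\mathbf p):=\frac1{2|Q_{\mathbf p}|}(\frac1{\lambda_1(\mathbf p)}+\frac1{\lambda_2(\mathbf p)})$. *)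

theory Defs
  imports "HOL-Analysis.Analysis"
begin

section \<open>Neumann eigenvalues of the Laplacian\<close>

definition grad :: "('a::euclidean_space \<Rightarrow> real) \<Rightarrow> 'a \<Rightarrow> 'a" where
  "grad f x = (\<Sum>b\<in>Basis. frechet_derivative f (at x) b *\<^sub>R b)"

definition square_integrable :: "'a::euclidean_space set \<Rightarrow> ('a \<Rightarrow> 'b::euclidean_space) \<Rightarrow> bool" where
  "square_integrable \<Omega> u \<longleftrightarrow>
     u \<in> borel_measurable (lebesgue_on \<Omega>) \<and> integrable (lebesgue_on \<Omega>) (\<lambda>x. (norm (u x))\<^sup>2)"

text \<open>Test functions are the continuously differentiable functions with compact support in
  \<open>\<Omega>\<close>; for weak first-order derivatives they are interchangeable with the smooth ones.\<close>

definition test_function :: "'a::euclidean_space set \<Rightarrow> ('a \<Rightarrow> real) \<Rightarrow> bool" where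
  "test_function \<Omega> \<phi> \<longleftrightarrow>
     compact (closure {x. \<phi> x \<noteq> 0}) \<and> closure {x. \<phi> x \<noteq> 0} \<subseteq> \<Omega> \<and>
     (\<forall>x. \<phi> differentiable at x) \<and> continuous_on UNIV (grad \<phi>)"

definition has_weak_gradient ::
    "'a::euclidean_space set \<Rightarrow> ('a \<Rightarrow> real) \<Rightarrow> ('a \<Rightarrow> 'a) \<Rightarrow> bool" where
  "has_weak_gradient \<Omega> u G \<longleftrightarrow>
     (\<forall>\<phi>. test_function \<Omega> \<phi> \<longrightarrow>
        (LINT x|lebesgue_on \<Omega>. u x *\<^sub>R grad \<phi> x) = - (LINT x|lebesgue_on \<Omega>. \<phi> x *\<^sub>R G x))"

text \<open>\<open>u\<close> belongs to the Sobolev space \<open>H\<^sup>1(\<Omega>)\<close> and \<open>G\<close> is (a representative of) its weak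
  gradient.\<close>

definition H1_with_gradient ::
    "'a::euclidean_space set \<Rightarrow> ('a \<Rightarrow> real) \<Rightarrow> ('a \<Rightarrow> 'a) \<Rightarrow> bool" where
  "H1_with_gradient \<Omega> u G \<longleftrightarrow>
     square_integrable \<Omega> u \<and> square_integrable \<Omega> G \<and> has_weak_gradient \<Omega> u G"

text \<open>The usual weak form of \<open>- \<Delta> u = \<mu> u\<close> in \<open>\<Omega>\<close> with vanishing normal derivative on the
  boundary: the boundary condition is encoded by testing against all of \<open>H\<^sup>1(\<Omega>)\<close>. The set
  \<open>\<Omega>\<close> is meant to be open.\<close>

definition neumann_eigenvalue :: "'a::euclidean_space set \<Rightarrow> real \<Rightarrow> bool" where
  "neumann_eigenvalue \<Omega> \<mu> \<longleftrightarrow>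
     (\<exists>u G. H1_with_gradient \<Omega> u G \<and> \<not> (AE x in lebesgue_on \<Omega>. u x = 0) \<and>
        (\<forall>w H. H1_with_gradient \<Omega> w H \<longrightarrow>
           (LINT x|lebesgue_on \<Omega>. G x \<bullet> H x) = \<mu> * (LINT x|lebesgue_on \<Omega>. u x * w x)))"

definition mu1 :: "'a::euclidean_space set \<Rightarrow> real" where
  "mu1 \<Omega> = (LEAST \<mu>. neumann_eigenvalue \<Omega> \<mu> \<and> \<mu> \<noteq> 0)"

section \<open>Generalized matrix eigenvalues\<close>

definition gen_eigenspace :: "real^'n^'n \<Rightarrow> real^'n^'n \<Rightarrow> real \<Rightarrow> (real^'n) set" where
  "gen_eigenspace K M t = {x. K *v x = t *\<^sub>R (M *v x)}"

definition gen_eigenvalue :: "real^'n^'n \<Rightarrow> real^'n^'n \<Rightarrow> real \<Rightarrow> bool" where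
  "gen_eigenvalue K M t \<longleftrightarrow> (\<exists>x\<in>gen_eigenspace K M t. x \<noteq> 0)"

text \<open>The \<open>k\<close>-th smallest generalized eigenvalue (\<open>k = 1, 2, \<dots>\<close>), counted with multiplicity:
  the least \<open>t\<close> such that the eigenvalues not exceeding \<open>t\<close> have total multiplicity at
  least \<open>k\<close>.\<close>

definition gen_eigenvalue_nth :: "nat \<Rightarrow> real^'n^'n \<Rightarrow> real^'n^'n \<Rightarrow> real" where
  "gen_eigenvalue_nth k K M =
     (LEAST t. k \<le> (\<Sum>s | gen_eigenvalue K M s \<and> s \<le> t. dim (gen_eigenspace K M s)))"

section \<open>The quadrilaterals\<close>

definition cross :: "real^2 \<Rightarrow> real^2 \<Rightarrow> real" where
  "cross x y = x $ 1 * y $ 2 - x $ 2 * y $ 1"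

definition square :: "(real^2) set" where
  "square = cbox (vector [-1/2, -1/2]) (vector [1/2, 1/2])"

text \<open>Vertices are indexed by the type \<open>4\<close>, whose arithmetic is modulo 4, so that \<open>i + 1\<close> is
  the cyclic successor of \<open>i\<close> (and the numeral \<open>4\<close> denotes the index \<open>0\<close>).\<close>

definition vertex0 :: "4 \<Rightarrow> real^2" where
  "vertex0 i =
     (if i = 1 then vector [-1/2, -1/2]
      else if i = 2 then vector [1/2, -1/2]
      else if i = 3 then vector [1/2, 1/2]
      else vector [-1/2, 1/2])"

definition Phi :: "real^4 \<Rightarrow> real^2 \<Rightarrow> real^2" where
  "Phi p w =
     (let a = p $ 1; b = p $ 2; c = p $ 3; d = p $ 4; u = w $ 1; v = w $ 2
      in vector [u - a * u - d * v - 2 * b * u * v, v - d * u + a * v + 2 * c * u * v])"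

definition vertex :: "real^4 \<Rightarrow> 4 \<Rightarrow> real^2" where
  "vertex p i = Phi p (vertex0 i)"

text \<open>The closed region bounded by the polygonal curve through the vertices in cyclic order.\<close>

definition quad :: "real^4 \<Rightarrow> (real^2) set" where
  "quad p =
     (let \<Gamma> = (\<Union>i. closed_segment (vertex p i) (vertex p (i + 1))) in \<Gamma> \<union> inside \<Gamma>)"

definition area :: "real^4 \<Rightarrow> real" where
  "area p = measure lebesgue (quad p)"

definition corner :: "real^4 \<Rightarrow> 4 \<Rightarrow> real" where
  "corner p i = cross (vertex p (i + 1) - vertex p i) (vertex p (i + 2) - vertex p i)"

definition params :: "(real^4) set" where
  "params = {p. \<forall>i. corner p i \<ge> 0}"

section \<open>The finite-dimensional problem\<close>

definition J :: "real^4 \<Rightarrow> real^2 \<Rightarrow> real" where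
  "J p w = det (jacobian (Phi p) (at w))"

definition cos_mode :: "nat \<Rightarrow> nat \<Rightarrow> real^2 \<Rightarrow> real" where
  "cos_mode m n x = cos (m * pi * (x $ 1 + 1/2)) * cos (n * pi * (x $ 2 + 1/2))"

text \<open>The type \<open>5\<close> has the five elements \<open>1, 2, 3, 4, 5 = 0\<close>.\<close>

definition g :: "5 \<Rightarrow> real^2 \<Rightarrow> real" where
  "g i =
     (if i = 1 then cos_mode 1 0
      else if i = 2 then cos_mode 0 1
      else if i = 3 then cos_mode 1 1
      else if i = 4 then cos_mode 2 0
      else cos_mode 0 2)"

definition stiffness :: "real^4 \<Rightarrow> real^5^5" where
  "stiffness p = (\<chi> i j.
     LINT w:square|lborel. (grad (g i) (Phi p w) \<bullet> grad (g j) (Phi p w)) * J p w)"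

definition mass :: "real^4 \<Rightarrow> real^5^5" where
  "mass p = (\<chi> i j.
     (LINT w:square|lborel. g i (Phi p w) * g j (Phi p w) * J p w)
     - 1 / area p * (LINT w:square|lborel. g i (Phi p w) * J p w)
                  * (LINT w:square|lborel. g j (Phi p w) * J p w))"

definition lam :: "nat \<Rightarrow> real^4 \<Rightarrow> real" where
  "lam k p = gen_eigenvalue_nth k (stiffness p) (mass p)"

definition f2 :: "real^4 \<Rightarrow> real" where
  "f2 p = 1 / (2 * area p) * (1 / lam 1 p + 1 / lam 2 p)"

end

theory Submission
  imports Defs
begin

text \<open>On the square \<open>\<lambda>\<^sub>1 = \<lambda>\<^sub>2 = \<pi>\<^sup>2\<close>, so \<open>f2 0 \<le> 1/\<pi>\<^sup>2\<close>. For \<open>p \<noteq> 0\<close> the sum \<open>1/\<lambda>\<^sub>1 + 1/\<lambda>\<^sub>2\<close> is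
  bounded below by Ky Fan's principle on the span of \<open>g 1 + \<alpha> g 3\<close> and \<open>g 2 + \<beta> g 3\<close>, where \<open>\<alpha>, \<beta>\<close>
  are linear in \<open>p\<close> and account for the coupling of the degenerate eigenspace to the mode \<open>g 3\<close>. Expanding the matrix
  entries to second order in \<open>p = (a, b, c, d)\<close>, \<open>\<pi>\<^sup>2 (1/\<lambda>\<^sub>1 + 1/\<lambda>\<^sub>2) - 2 |Q\<^sub>p|\<close> is, up to a positive
  factor, at least \<open>\<pi>\<^sup>4 (a\<^sup>2 + d\<^sup>2) / 2 + 24 (b\<^sup>2 + c\<^sup>2) + O(|p|\<^sup>3)\<close>, hence positive. The Fourier expansion on the
  square, transported by \<open>\<Phi>\<^sub>p\<close>, shows that only the three modes with eigenvalue below \<open>2 \<pi>\<^sup>2\<close> obstruct a spectral gap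
  on \<open>Q\<^sub>p\<close>; this gives the existence of \<open>\<mu>\<^sub>1\<close> and the bound \<open>\<mu>\<^sub>1 \<le> \<lambda>\<^sub>1\<close>, while \<open>\<mu>\<^sub>1 \<ge> \<pi>\<^sup>2\<close> on the
  square. Therefore \<open>|Q\<^sub>p| \<mu>\<^sub>1 \<le> |Q\<^sub>p| \<lambda>\<^sub>1 \<le> 1 / f2 p < \<pi>\<^sup>2\<close> for small \<open>p \<noteq> 0\<close>.\<close>

section \<open>Generalized eigenvalues\<close>

text \<open>At the square the lowest eigenvalue pi^2 is double and splits to first order in a, so
  the smallest eigenvalue alone is not differentiable there; a symmetric function of the pair is.
  The sum of reciprocals suits the purpose because Ky Fan's principle bounds it from below by a
  trace on any two-dimensional trial space: no eigenvalue is expanded, only a few matrix entries.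
  With the bare span of \<open>g 1\<close> and \<open>g 2\<close> the coefficient of b^2 + c^2 would
  be -8, caused by the mean-value correction in the mass matrix; admixing \<open>g 3\<close> adds 32
  and gives 24. On the analytic side, \<open>mu1\<close> is a least element of the set of nonzero
  weak eigenvalues, so nothing can be said about it before an eigenfunction has been produced.
  Compactness is replaced by an inequality in which finitely many moments control the low modes;
  such an inequality survives the change of variables with constants close to 1. The radius 1/100
  makes the map injective on a neighbourhood of the square and keeps its Jacobian between 9/10 and
  11/10.\<close>

lemma linear_coefficient_zero_if_nonneg:
  fixes f q :: real
  assumes "\<And>t. 0 \<le> 2 * t * f + t\<^sup>2 * q"
  shows "f = 0"
proof (rule ccontr)
  assume f: "f \<noteq> 0"
  \<comment> \<open>Any positive s above q/2 would do: at \<open>t = - f / s\<close> the quadratic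
    equals f^2 (q - 2 s) / s^2, which is negative.\<close>
  define s where "s = \<bar>q\<bar> + 1"
  have s: "s > 0" "q < s" unfolding s_def by linarith+
  have "0 \<le> 2 * (- f / s) * f + (- f / s)\<^sup>2 * q" by (rule assms)
  also have "\<dots> = (f\<^sup>2 / s\<^sup>2) * (q - 2 * s)"
    using s by (simp add: field_simps power2_eq_square)
  also have "\<dots> < 0"
    using f s by (intro mult_pos_neg) auto
  finally show False by simp
qed

lemma symmetric_matrix_inner:
  fixes K :: "real^'n^'n"
  assumes "transpose K = K"
  shows "x \<bullet> (K *v y) = y \<bullet> (K *v x)"
proof -
  have "x \<bullet> (K *v y) = (x v* K) \<bullet> y" by (simp add: dot_lmul_matrix)
  also have "x v* K = K *v x" using vector_transpose_matrix[of x K] assms by simp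
  finally show ?thesis by (simp add: inner_commute)
qed

lemma quadratic_form_add_scaled:
  fixes K :: "real^'n^'n"
  assumes "transpose K = K"
  shows "(x + t *\<^sub>R y) \<bullet> (K *v (x + t *\<^sub>R y)) =
    x \<bullet> (K *v x) + 2 * t * (y \<bullet> (K *v x)) + t\<^sup>2 * (y \<bullet> (K *v y))"
  unfolding matrix_vector_right_distrib matrix_vector_mult_scaleR inner_add_left inner_add_right
    inner_scaleR_left inner_scaleR_right symmetric_matrix_inner[OF assms, of x y]
  by (simp add: power2_eq_square distrib_left)

text \<open>The Rayleigh quotient attains its minimum on the compact unit sphere of
  \<open>S\<close>, and vanishing of the first variation in the directions of \<open>S\<close> is
  the eigenvalue equation. It is tested against \<open>S\<close> only, because on a proper subspace
  the residual may be a nonzero vector orthogonal to \<open>S\<close>.\<close>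

lemma rayleigh_minimum_on_subspace:
  fixes K M :: "real^'n^'n"
  assumes K: "transpose K = K" and M: "transpose M = M"
    and Mpos: "\<And>x. x \<noteq> 0 \<Longrightarrow> x \<bullet> (M *v x) > 0"
    and S: "subspace S" and ne: "\<exists>x\<in>S. x \<noteq> 0"
  obtains x l where "x \<in> S" "x \<noteq> 0"
    "\<And>y. y \<in> S \<Longrightarrow> l * (y \<bullet> (M *v y)) \<le> y \<bullet> (K *v y)"
    "\<And>y. y \<in> S \<Longrightarrow> y \<bullet> (K *v x) = l * (y \<bullet> (M *v x))"
proof -
  let ?R = "\<lambda>x. (x \<bullet> (K *v x)) / (x \<bullet> (M *v x))"
  let ?C = "S \<inter> sphere 0 1"
  have cpt: "compact ?C"
    by (simp add: S closed_subspace closed_Int_compact)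
  obtain z where z: "z \<in> S" "z \<noteq> 0" using ne by blast
  have "(1 / norm z) *\<^sub>R z \<in> ?C"
    using z S by (simp add: subspace_scale)
  hence "?C \<noteq> {}" by blast
  moreover have "continuous_on ?C ?R"
  proof (intro continuous_intros linear_continuous_on)
    show "\<forall>x\<in>?C. x \<bullet> (M *v x) \<noteq> 0"
      using Mpos by (metis IntD2 less_irrefl mem_sphere_0 norm_zero zero_neq_one)
  qed
  ultimately obtain x where x: "x \<in> ?C" and xmin: "\<And>y. y \<in> ?C \<Longrightarrow> ?R x \<le> ?R y"
    using continuous_attains_inf[OF cpt] by blast
  define l where "l = ?R x"
  have x0: "x \<noteq> 0" using x by auto
  have *: "l * (y \<bullet> (M *v y)) \<le> y \<bullet> (K *v y)" if y: "y \<in> S" for y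
  proof (cases "y = 0")
    case False
    define c where "c = 1 / norm y"
    have c: "c > 0" using False by (simp add: c_def)
    have "c *\<^sub>R y \<in> ?C" using False y S by (simp add: subspace_scale c_def)
    from xmin[OF this] have "l \<le> ?R y"
      using c by (simp add: l_def matrix_vector_mult_scaleR field_simps)
    thus ?thesis using Mpos[OF False] by (simp add: field_simps)
  qed simp
  have "y \<bullet> (K *v x) = l * (y \<bullet> (M *v x))" if y: "y \<in> S" for y
  proof -
    have "y \<bullet> (K *v x) - l * (y \<bullet> (M *v x)) = 0"
    proof (rule linear_coefficient_zero_if_nonneg)
      fix t :: real
      have "x + t *\<^sub>R y \<in> S" using x y S by (simp add: subspace_add subspace_scale)
      from *[OF this, unfolded quadratic_form_add_scaled[OF K] quadratic_form_add_scaled[OF M]]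
      have "l * (x \<bullet> (M *v x)) + l * (2 * t * (y \<bullet> (M *v x)) + t\<^sup>2 * (y \<bullet> (M *v y)))
        \<le> x \<bullet> (K *v x) + 2 * t * (y \<bullet> (K *v x)) + t\<^sup>2 * (y \<bullet> (K *v y))"
        by (simp add: algebra_simps)
      moreover have "l * (x \<bullet> (M *v x)) = x \<bullet> (K *v x)"
        using Mpos[OF x0] by (simp add: l_def)
      ultimately show "0 \<le> 2 * t * (y \<bullet> (K *v x) - l * (y \<bullet> (M *v x)))
          + t\<^sup>2 * (y \<bullet> (K *v y) - l * (y \<bullet> (M *v y)))"
        by (simp add: algebra_simps)
    qed
    thus ?thesis by simp
  qed
  with * x x0 show ?thesis using that by blast
qed

text \<open>Translates the definition by counted multiplicities into variational terms: the first
  value is the minimum of the Rayleigh quotient, the second its minimum over the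
  \<open>M\<close>-orthogonal complement of the minimiser. Every eigenvalue other than the first has
  its eigenvectors in that complement and is therefore at least the second minimum.\<close>

lemma two_smallest_gen_eigenvalues:
  fixes K M :: "real^'n^'n"
  assumes K: "transpose K = K" and M: "transpose M = M"
    and Mpos: "\<And>x. x \<noteq> 0 \<Longrightarrow> x \<bullet> (M *v x) > 0"
    and card: "CARD('n) \<ge> 2"
  obtains x where "x \<noteq> 0"
    "K *v x = gen_eigenvalue_nth 1 K M *\<^sub>R (M *v x)"
    "\<And>y. gen_eigenvalue_nth 1 K M * (y \<bullet> (M *v y)) \<le> y \<bullet> (K *v y)"
    "\<And>y. y \<bullet> (M *v x) = 0 \<Longrightarrow> gen_eigenvalue_nth 2 K M * (y \<bullet> (M *v y)) \<le> y \<bullet> (K *v y)"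
    "gen_eigenvalue_nth 1 K M \<le> gen_eigenvalue_nth 2 K M"
proof -
  have "\<exists>x\<in>(UNIV :: (real^'n) set). x \<noteq> 0"
    using dim_UNIV[where 'a="real^'n"] by (metis UNIV_I axis_eq_0_iff zero_neq_one)
  from rayleigh_minimum_on_subspace[OF K M Mpos subspace_UNIV this]
  obtain x l1 where x: "x \<noteq> 0" and l1: "\<And>y. l1 * (y \<bullet> (M *v y)) \<le> y \<bullet> (K *v y)"
    and eq1: "\<And>y. y \<bullet> (K *v x) = l1 * (y \<bullet> (M *v x))" by (metis UNIV_I)
  have Kx: "K *v x = l1 *\<^sub>R (M *v x)"
    by (rule vector_eq_ldot[THEN iffD1]) (simp add: eq1)
  let ?S = "{y. y \<bullet> (M *v x) = 0}"
  have Mx: "x \<bullet> (M *v x) > 0" using Mpos x by blast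
  have S: "subspace ?S"
    by (auto simp: subspace_def inner_add_left)
  have split: "y - ((y \<bullet> (M *v x)) / (x \<bullet> (M *v x))) *\<^sub>R x \<in> ?S" for y
    using Mx by (simp add: inner_diff_left)
  \<comment> \<open>Subtracting its \<open>M\<close>-projection onto \<open>x\<close> from a vector
    outside the line of \<open>x\<close> leaves a nonzero vector of the complement that is still in
    \<open>E\<close>.\<close>
  have indep_exists: "\<exists>y\<in>?S \<inter> E. y \<noteq> 0" if E: "subspace E" "x \<in> E" "dim E \<ge> 2" for E
  proof -
    have "\<not> E \<subseteq> span {x}"
    proof
      assume "E \<subseteq> span {x}"
      hence "dim E \<le> card {x}" by (intro dim_le_card) auto
      with E show False by simp
    qed
    then obtain z where z: "z \<in> E" "z \<notin> span {x}" by blast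
    let ?y = "z - ((z \<bullet> (M *v x)) / (x \<bullet> (M *v x))) *\<^sub>R x"
    have "?y \<in> E" using z E by (simp add: subspace_diff subspace_scale)
    moreover have "?y \<noteq> 0"
      using z(2) by (metis eq_iff_diff_eq_0 span_base span_scale insertI1)
    ultimately show ?thesis using split[of z] by blast
  qed
  have "\<exists>y\<in>?S. y \<noteq> 0"
    using indep_exists[of UNIV] card by auto
  from rayleigh_minimum_on_subspace[OF K M Mpos S this]
  obtain x2 l2 where x2: "x2 \<in> ?S" "x2 \<noteq> 0"
    and l2: "\<And>y. y \<in> ?S \<Longrightarrow> l2 * (y \<bullet> (M *v y)) \<le> y \<bullet> (K *v y)"
    and eq2: "\<And>y. y \<in> ?S \<Longrightarrow> y \<bullet> (K *v x2) = l2 * (y \<bullet> (M *v x2))" by blast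
  have x2x: "x \<bullet> (M *v x2) = 0" "x \<bullet> (K *v x2) = 0"
    using x2 symmetric_matrix_inner[OF M, of x x2] symmetric_matrix_inner[OF K, of x x2]
    by (auto simp: eq1)
  \<comment> \<open>Minimality in the complement gives the equation only for directions in it; the
    remaining direction \<open>x\<close> contributes zero to both sides.\<close>
  have Kx2: "K *v x2 = l2 *\<^sub>R (M *v x2)"
  proof (rule vector_eq_ldot[THEN iffD1], rule allI)
    fix y
    let ?c = "(y \<bullet> (M *v x)) / (x \<bullet> (M *v x))"
    show "y \<bullet> (K *v x2) = y \<bullet> (l2 *\<^sub>R (M *v x2))"
      using eq2[OF split[of y]] by (simp add: inner_diff_left x2x)
  qed
  have l12: "l1 \<le> l2"
  proof -
    have "l1 * (x2 \<bullet> (M *v x2)) \<le> l2 * (x2 \<bullet> (M *v x2))" using l1[of x2] by (simp add: Kx2)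
    thus ?thesis using Mpos[OF x2(2)] by simp
  qed
  let ?E = "gen_eigenspace K M"
  have subE: "subspace (?E s)" for s
    by (auto simp: subspace_def gen_eigenspace_def matrix_vector_right_distrib matrix_vector_mult_scaleR
        scaleR_right_distrib mult.commute)
  have xE: "x \<in> ?E l1" "x2 \<in> ?E l2" using Kx Kx2 by (auto simp: gen_eigenspace_def)
  have e12: "gen_eigenvalue K M l1" "gen_eigenvalue K M l2"
    using xE x x2 by (auto simp: gen_eigenvalue_def)
  have orth_ge: "l2 \<le> s" if "y \<in> ?E s" "y \<in> ?S" "y \<noteq> 0" for y s
  proof -
    have "l2 * (y \<bullet> (M *v y)) \<le> s * (y \<bullet> (M *v y))"
      using l2[OF that(2)] that(1) by (simp add: gen_eigenspace_def)
    thus ?thesis using Mpos[OF that(3)] by simp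
  qed
  have ev: "s = l1 \<or> l2 \<le> s" if s: "gen_eigenvalue K M s" for s
  proof -
    obtain y where y: "y \<noteq> 0" "K *v y = s *\<^sub>R (M *v y)"
      using s by (auto simp: gen_eigenvalue_def gen_eigenspace_def)
    have "l1 * (y \<bullet> (M *v x)) = y \<bullet> (K *v x)" by (simp add: eq1)
    also have "\<dots> = x \<bullet> (K *v y)" by (rule symmetric_matrix_inner[OF K])
    also have "\<dots> = s * (y \<bullet> (M *v x))" by (simp add: y(2) symmetric_matrix_inner[OF M, of x y])
    finally have "s = l1 \<or> y \<in> ?S" by auto
    thus ?thesis using orth_ge[of y s] y by (auto simp: gen_eigenspace_def)
  qed
  have dim1: "1 \<le> dim (?E s)" if "gen_eigenvalue K M s" for s
  proof -
    have "\<not> ?E s \<subseteq> {0}" using that by (auto simp: gen_eigenvalue_def)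
    hence "dim (?E s) \<noteq> 0" using dim_eq_0 by blast
    thus ?thesis by linarith
  qed
  \<comment> \<open>The counting function is evaluated only for \<open>t\<close> up to
    \<open>l2\<close>, where its index set is empty, \<open>{l1}\<close> or
    \<open>{l1, l2}\<close>.\<close>
  let ?D = "\<lambda>t. \<Sum>s | gen_eigenvalue K M s \<and> s \<le> t. dim (?E s)"
  have below: "?D t = 0" if "t < l1" for t
  proof -
    have "{s. gen_eigenvalue K M s \<and> s \<le> t} = {}" using ev l12 that by force
    thus ?thesis by (metis sum.empty)
  qed
  have between: "?D t = dim (?E l1)" if "l1 \<le> t" "t < l2 \<or> l1 = t" for t
  proof -
    have "s = l1" if "gen_eigenvalue K M s" "s \<le> t" for s
      using ev[OF that(1)] that(2) l12 \<open>l1 \<le> t\<close> \<open>t < l2 \<or> l1 = t\<close> by linarith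
    hence "{s. gen_eigenvalue K M s \<and> s \<le> t} = {l1}" using that e12 by blast
    thus ?thesis by simp
  qed
  have lam1: "gen_eigenvalue_nth 1 K M = l1"
    unfolding gen_eigenvalue_nth_def
  proof (rule Least_equality)
    show "1 \<le> ?D l1" using between[of l1] dim1[OF e12(1)] by simp
    show "l1 \<le> t" if "1 \<le> ?D t" for t
      using below[of t] that by (cases "t < l1") auto
  qed
  have lam2: "gen_eigenvalue_nth 2 K M = l2"
    unfolding gen_eigenvalue_nth_def
  proof (rule Least_equality)
    show "2 \<le> ?D l2"
    proof (cases "l1 = l2")
      case True
      have "x2 \<noteq> x" using x2x Mx by auto
      have "independent {x2, x}"
      proof (rule independent_insertI)
        show "x2 \<notin> span {x}"
        proof
          assume "x2 \<in> span {x}"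
          then obtain k where "x2 = k *\<^sub>R x" by (auto simp: span_singleton)
          thus False using x2 Mx by auto
        qed
        show "independent {x}" using x by simp
      qed
      moreover have "{x2, x} \<subseteq> ?E l1" using xE True by auto
      ultimately have "card {x2, x} \<le> dim (?E l1)"
        by (intro independent_card_le_dim)
      with \<open>x2 \<noteq> x\<close> have "2 \<le> dim (?E l1)" by simp
      thus ?thesis using between[of l1] True by simp
    next
      case False
      have "s = l1 \<or> s = l2" if "gen_eigenvalue K M s" "s \<le> l2" for s
        using ev[OF that(1)] that(2) by linarith
      hence "{s. gen_eigenvalue K M s \<and> s \<le> l2} = {l1, l2}" using l12 e12 by blast
      thus ?thesis using False dim1[OF e12(1)] dim1[OF e12(2)] by simp
    qed
    show "l2 \<le> t" if "2 \<le> ?D t" for t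
    proof (rule ccontr)
      assume t: "\<not> l2 \<le> t"
      show False
      proof (cases "t < l1")
        case True
        thus ?thesis using below[OF True] that by simp
      next
        case False
        hence "dim (?E l1) \<ge> 2" using between[of t] t that by simp
        from indep_exists[OF subE xE(1) this] obtain y where "y \<in> ?S" "y \<in> ?E l1" "y \<noteq> 0" by blast
        hence "l2 \<le> l1" using orth_ge by blast
        with False t show False by linarith
      qed
    qed
  qed
  show ?thesis
  proof (rule that[of x, unfolded lam1 lam2, OF x Kx l1 _ l12])
    show "l2 * (y \<bullet> (M *v y)) \<le> y \<bullet> (K *v y)" if "y \<bullet> (M *v x) = 0" for y
      using l2 that by simp
  qed
qed

text \<open>The left-hand side below is the trace of \<open>K\<^sub>V\<^sup>-\<^sup>1 M\<^sub>V\<close> times \<open>det K\<^sub>V\<close> for the restrictions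
  to the span \<open>V\<close> of \<open>y1, y2\<close>. The proof evaluates the trace in a \<open>K\<close>-orthogonal basis of \<open>V\<close>
  whose first vector is \<open>M\<close>-orthogonal to the first eigenvector.\<close>

lemma ky_fan_two:
  fixes K M :: "real^'n^'n"
  assumes K: "transpose K = K" and M: "transpose M = M"
    and Mpos: "\<And>x. x \<noteq> 0 \<Longrightarrow> x \<bullet> (M *v x) > 0"
    and Kpos: "\<And>x. x \<noteq> 0 \<Longrightarrow> x \<bullet> (K *v x) > 0"
    and card: "CARD('n) \<ge> 2"
    and indep: "\<And>c1 c2. c1 *\<^sub>R y1 + c2 *\<^sub>R y2 = 0 \<Longrightarrow> c1 = 0 \<and> c2 = 0"
  shows "(y2 \<bullet> (K *v y2)) * (y1 \<bullet> (M *v y1)) + (y1 \<bullet> (K *v y1)) * (y2 \<bullet> (M *v y2))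
      - 2 * (y1 \<bullet> (K *v y2)) * (y1 \<bullet> (M *v y2))
    \<le> (1 / gen_eigenvalue_nth 1 K M + 1 / gen_eigenvalue_nth 2 K M) *
      ((y1 \<bullet> (K *v y1)) * (y2 \<bullet> (K *v y2)) - (y1 \<bullet> (K *v y2))\<^sup>2)"
    (is "?N \<le> (1 / ?l1 + 1 / ?l2) * ?\<Delta>")
    and "0 < gen_eigenvalue_nth 1 K M"
proof -
  obtain x where x: "x \<noteq> 0" "K *v x = ?l1 *\<^sub>R (M *v x)"
    and l1: "\<And>y. ?l1 * (y \<bullet> (M *v y)) \<le> y \<bullet> (K *v y)"
    and l2: "\<And>y. y \<bullet> (M *v x) = 0 \<Longrightarrow> ?l2 * (y \<bullet> (M *v y)) \<le> y \<bullet> (K *v y)"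
    and l12: "?l1 \<le> ?l2"
    by (rule two_smallest_gen_eigenvalues[OF K M Mpos card]) (assumption | rule that)+
  have "?l1 * (x \<bullet> (M *v x)) > 0" using Kpos[OF x(1)] x(2) by simp
  thus l1pos: "0 < ?l1" using Mpos[OF x(1)] by (simp add: zero_less_mult_iff)
  hence l2pos: "0 < ?l2" using l12 by linarith
  \<comment> \<open>One linear condition on a two-dimensional coefficient space has a nonzero
    solution.\<close>
  obtain c1 c2 where c: "c1 \<noteq> 0 \<or> c2 \<noteq> 0"
    and orth: "(c1 *\<^sub>R y1 + c2 *\<^sub>R y2) \<bullet> (M *v x) = 0"
  proof (cases "y1 \<bullet> (M *v x) = 0 \<and> y2 \<bullet> (M *v x) = 0")
    case True
    thus ?thesis using that[of 1 0] by simp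
  next
    case False
    thus ?thesis using that[of "y2 \<bullet> (M *v x)" "- (y1 \<bullet> (M *v x))"]
      by (auto simp: inner_diff_left)
  qed
  let ?z = "c1 *\<^sub>R y1 + c2 *\<^sub>R y2"
  have z0: "?z \<noteq> 0" using c indep by blast
  define k11 k12 k22 where kd: "k11 = y1 \<bullet> (K *v y1)" "k12 = y1 \<bullet> (K *v y2)" "k22 = y2 \<bullet> (K *v y2)"
  define m11 m12 m22 where md: "m11 = y1 \<bullet> (M *v y1)" "m12 = y1 \<bullet> (M *v y2)" "m22 = y2 \<bullet> (M *v y2)"
  have k21: "y2 \<bullet> (K *v y1) = k12" and m21: "y2 \<bullet> (M *v y1) = m12"
    using symmetric_matrix_inner[OF K] symmetric_matrix_inner[OF M] kd md by auto
  have Kq: "(a *\<^sub>R y1 + b *\<^sub>R y2) \<bullet> (K *v (a *\<^sub>R y1 + b *\<^sub>R y2)) = a\<^sup>2 * k11 + 2 * a * b * k12 + b\<^sup>2 * k22" for a b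
    by (simp add: matrix_vector_right_distrib matrix_vector_mult_scaleR inner_add_left inner_add_right
        kd[symmetric] k21 algebra_simps power2_eq_square)
  have Mq: "(a *\<^sub>R y1 + b *\<^sub>R y2) \<bullet> (M *v (a *\<^sub>R y1 + b *\<^sub>R y2)) = a\<^sup>2 * m11 + 2 * a * b * m12 + b\<^sup>2 * m22" for a b
    by (simp add: matrix_vector_right_distrib matrix_vector_mult_scaleR inner_add_left inner_add_right
        md[symmetric] m21 algebra_simps power2_eq_square)
  \<comment> \<open>\<open>s1\<close> and \<open>s2\<close> are the products of \<open>y1\<close>
    and \<open>y2\<close> with \<open>K *v ?z\<close>, so \<open>?w\<close> is
    \<open>K\<close>-orthogonal to \<open>?z\<close>. Its form value is the Gram determinant times
    that of \<open>?z\<close>.\<close>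
  define s1 where "s1 = c1 * k11 + c2 * k12"
  define s2 where "s2 = c1 * k12 + c2 * k22"
  let ?w = "(- s2) *\<^sub>R y1 + s1 *\<^sub>R y2"
  define Kz where "Kz = c1\<^sup>2 * k11 + 2 * c1 * c2 * k12 + c2\<^sup>2 * k22"
  have Kzpos: "Kz > 0" using Kpos[OF z0] unfolding Kq Kz_def .
  have \<Delta>: "?\<Delta> = k11 * k22 - k12\<^sup>2" by (simp add: kd)
  have Kw: "?w \<bullet> (K *v ?w) = ?\<Delta> * Kz"
    unfolding Kq \<Delta> s1_def s2_def Kz_def by algebra
  have N: "?N * Kz = (?z \<bullet> (M *v ?z)) * ?\<Delta> + ?w \<bullet> (M *v ?w)"
    unfolding Mq kd[symmetric] md[symmetric] s1_def s2_def Kz_def by algebra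
  have D0: "?\<Delta> \<ge> 0"
  proof -
    have "?w \<bullet> (K *v ?w) \<ge> 0" using Kpos[of ?w] by (cases "?w = 0") auto
    thus ?thesis unfolding Kw using Kzpos by (simp add: zero_le_mult_iff)
  qed
  \<comment> \<open>\<open>?z\<close> can be charged to the larger eigenvalue because it avoids the
    first eigenvector; for \<open>?w\<close> only the smaller one is available.\<close>
  have zM: "?z \<bullet> (M *v ?z) \<le> Kz / ?l2"
    using l2[OF orth] l2pos unfolding Kq Kz_def[symmetric] by (simp add: field_simps)
  have wM: "?w \<bullet> (M *v ?w) \<le> ?\<Delta> * Kz / ?l1"
    using l1[of ?w] l1pos unfolding Kw by (simp add: field_simps)
  have "?N * Kz \<le> (Kz / ?l2) * ?\<Delta> + ?\<Delta> * Kz / ?l1"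
    unfolding N by (intro add_mono mult_right_mono zM wM D0)
  also have "\<dots> = ((1 / ?l1 + 1 / ?l2) * ?\<Delta>) * Kz"
    by (simp only: divide_inverse mult_1) algebra
  finally show "?N \<le> (1 / ?l1 + 1 / ?l2) * ?\<Delta>" using Kzpos by simp
qed

lemma gen_eigenvalue_nth_lower_bound:
  fixes K M :: "real^'n^'n"
  assumes K: "transpose K = K" and M: "transpose M = M"
    and Mpos: "\<And>x. x \<noteq> 0 \<Longrightarrow> x \<bullet> (M *v x) > 0"
    and card: "CARD('n) \<ge> 2"
    and t: "\<And>x. t * (x \<bullet> (M *v x)) \<le> x \<bullet> (K *v x)"
  shows "t \<le> gen_eigenvalue_nth 1 K M" "t \<le> gen_eigenvalue_nth 2 K M"
proof -
  obtain x where x: "x \<noteq> 0" "K *v x = gen_eigenvalue_nth 1 K M *\<^sub>R (M *v x)"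
    and l12: "gen_eigenvalue_nth 1 K M \<le> gen_eigenvalue_nth 2 K M"
    by (rule two_smallest_gen_eigenvalues[OF K M Mpos card]) (assumption | rule that)+
  have "t * (x \<bullet> (M *v x)) \<le> gen_eigenvalue_nth 1 K M * (x \<bullet> (M *v x))" using t[of x] x(2) by simp
  thus "t \<le> gen_eigenvalue_nth 1 K M" using Mpos[OF x(1)] by simp
  with l12 show "t \<le> gen_eigenvalue_nth 2 K M" by linarith
qed

section \<open>Square-integrable functions\<close>

text \<open>Stated for an arbitrary measure, so that completeness, Cauchy-Schwarz and the abstract
  Parseval identity are independent of the domain; \<open>square_integrable\<close> is the case of
  \<open>lebesgue_on\<close>.\<close>

definition L2 :: "'a measure \<Rightarrow> ('a \<Rightarrow> 'b::euclidean_space) \<Rightarrow> bool" where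
  "L2 M f \<longleftrightarrow> f \<in> borel_measurable M \<and> integrable M (\<lambda>x. (norm (f x))\<^sup>2)"

lemma L2_measurable [measurable_dest]: "L2 M f \<Longrightarrow> f \<in> borel_measurable M"
  by (simp add: L2_def)

lemma L2_dominated:
  assumes "L2 M h" "f \<in> borel_measurable M" "AE x in M. norm (f x) \<le> C * norm (h x)"
  shows "L2 M f"
  unfolding L2_def
proof
  show "integrable M (\<lambda>x. (norm (f x))\<^sup>2)"
  proof (rule Bochner_Integration.integrable_bound)
    show "integrable M (\<lambda>x. C\<^sup>2 * (norm (h x))\<^sup>2)" using assms(1) by (simp add: L2_def)
    show "AE x in M. norm ((norm (f x))\<^sup>2) \<le> norm (C\<^sup>2 * (norm (h x))\<^sup>2)"
      using assms(3)
    proof eventually_elim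
      case (elim x)
      hence "(norm (f x))\<^sup>2 \<le> (C * norm (h x))\<^sup>2" by (intro power_mono) auto
      thus ?case by (simp add: power_mult_distrib)
    qed
  qed (use assms(2) in measurable)
qed (rule assms(2))

lemma norm_add_square_le: "(norm (x + y :: 'a::real_inner))\<^sup>2 \<le> 2 * (norm x)\<^sup>2 + 2 * (norm y)\<^sup>2"
proof -
  have "(norm (x + y))\<^sup>2 + (norm (x - y))\<^sup>2 = 2 * (norm x)\<^sup>2 + 2 * (norm y)\<^sup>2"
    by (simp add: power2_norm_eq_inner inner_add_left inner_add_right inner_diff_left inner_diff_right inner_commute)
  moreover have "0 \<le> (norm (x - y))\<^sup>2" by simp
  ultimately show ?thesis by linarith
qed

lemma L2_add:
  assumes "L2 M f" "L2 M h"
  shows "L2 M (\<lambda>x. f x + h x)"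
  unfolding L2_def
proof
  show [measurable]: "(\<lambda>x. f x + h x) \<in> borel_measurable M" using assms by measurable
  show "integrable M (\<lambda>x. (norm (f x + h x))\<^sup>2)"
  proof (rule Bochner_Integration.integrable_bound)
    show "integrable M (\<lambda>x. 2 * (norm (f x))\<^sup>2 + 2 * (norm (h x))\<^sup>2)"
      using assms by (auto simp: L2_def)
  qed (use norm_add_square_le in auto)
qed

lemma L2_scaleR:
  assumes "L2 M f"
  shows "L2 M (\<lambda>x. c *\<^sub>R f x)"
proof (rule L2_dominated[OF assms])
  show "AE x in M. norm (c *\<^sub>R f x) \<le> \<bar>c\<bar> * norm (f x)" by simp
qed (use assms in measurable)

lemma L2_cmult: "L2 M f \<Longrightarrow> L2 M (\<lambda>x. c * f x :: real)"
  using L2_scaleR[of M f c] by simp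

lemma L2_diff:
  assumes "L2 M f" "L2 M h"
  shows "L2 M (\<lambda>x. f x - h x)"
  using L2_add[OF assms(1) L2_scaleR[OF assms(2), of "-1"]] by simp

lemma L2_sum:
  assumes "\<And>i. i \<in> I \<Longrightarrow> L2 M (f i)"
  shows "L2 M (\<lambda>x. \<Sum>i\<in>I. f i x)"
proof (cases "finite I")
  case True
  thus ?thesis using assms
  proof (induction I)
    case empty
    show ?case by (simp add: L2_def)
  next
    case (insert i I)
    thus ?case by (simp add: L2_add)
  qed
qed (simp add: L2_def)

lemma L2_Pair_iff: "L2 M (\<lambda>x. (f x, h x)) \<longleftrightarrow> L2 M f \<and> L2 M h"
proof safe
  assume L: "L2 M (\<lambda>x. (f x, h x))"
  hence "(\<lambda>x. (f x, h x)) \<in> borel_measurable M" by measurable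
  hence m: "f \<in> borel_measurable M" "h \<in> borel_measurable M"
    by (simp_all add: borel_prod[symmetric] measurable_pair_iff o_def)
  show "L2 M f"
    by (rule L2_dominated[OF L m(1), where C=1]) (auto simp: norm_Pair intro!: AE_I2)
  show "L2 M h"
    by (rule L2_dominated[OF L m(2), where C=1]) (auto simp: norm_Pair intro!: AE_I2)
next
  assume "L2 M f" "L2 M h"
  thus "L2 M (\<lambda>x. (f x, h x))"
    by (auto simp: L2_def norm_Pair)
qed

lemma L2_inner_integrable:
  assumes "L2 M f" "L2 M h"
  shows "integrable M (\<lambda>x. f x \<bullet> h x)"
proof (rule Bochner_Integration.integrable_bound)
  show "integrable M (\<lambda>x. (norm (f x))\<^sup>2 + (norm (h x))\<^sup>2)" using assms by (auto simp: L2_def)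
  show "AE x in M. norm (f x \<bullet> h x) \<le> norm ((norm (f x))\<^sup>2 + (norm (h x))\<^sup>2)"
  proof (rule AE_I2)
    fix x
    have "norm (f x \<bullet> h x) \<le> norm (f x) * norm (h x)" by (simp add: Cauchy_Schwarz_ineq2)
    also have "\<dots> \<le> (norm (f x))\<^sup>2 + (norm (h x))\<^sup>2"
      using sum_squares_bound[of "norm (f x)" "norm (h x)"] mult_nonneg_nonneg[OF norm_ge_zero norm_ge_zero, of "f x" "h x"]
      by linarith
    finally show "norm (f x \<bullet> h x) \<le> norm ((norm (f x))\<^sup>2 + (norm (h x))\<^sup>2)" by simp
  qed
qed (use assms in measurable)

lemma L2_mult_integrable: "L2 M f \<Longrightarrow> L2 M h \<Longrightarrow> integrable M (\<lambda>x. f x * h x :: real)"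
  using L2_inner_integrable[of M f h] by simp

lemma L2_scaleR_integrable:
  fixes f :: "'a \<Rightarrow> real"
  assumes "L2 M f" "L2 M h"
  shows "integrable M (\<lambda>x. f x *\<^sub>R h x)"
proof (rule Bochner_Integration.integrable_bound)
  show "integrable M (\<lambda>x. norm (f x) * norm (h x))"
    using assms by (intro L2_mult_integrable) (auto simp: L2_def)
qed (use assms in \<open>auto intro!: borel_measurable_scaleR\<close>)

lemma (in finite_measure) L2_bounded:
  assumes [measurable]: "f \<in> borel_measurable M" and "\<And>x. x \<in> space M \<Longrightarrow> norm (f x) \<le> C"
  shows "L2 M f"
  unfolding L2_def
proof
  show "integrable M (\<lambda>x. (norm (f x))\<^sup>2)"
    by (rule integrable_const_bound[where B="C\<^sup>2"]) (auto intro!: AE_I2 power_mono assms(2))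
qed measurable

lemma (in finite_measure) L2_integrable: "L2 M f \<Longrightarrow> integrable M f"
  using L2_scaleR_integrable[OF L2_bounded[of "\<lambda>_. 1::real" 1], of f] by simp

lemma L2_norm_add_scaleR_square:
  assumes "L2 M f" "L2 M h"
  shows "(LINT x|M. (norm (f x + t *\<^sub>R h x))\<^sup>2) =
    (LINT x|M. (norm (f x))\<^sup>2) + 2 * t * (LINT x|M. f x \<bullet> h x) + t\<^sup>2 * (LINT x|M. (norm (h x))\<^sup>2)"
proof -
  have "(norm (f x + t *\<^sub>R h x))\<^sup>2 = (norm (f x))\<^sup>2 + 2 * t * (f x \<bullet> h x) + t\<^sup>2 * (norm (h x))\<^sup>2" for x
    unfolding power2_norm_eq_inner
    by (simp add: inner_add_left inner_add_right inner_commute[of "h x" "f x"] power2_eq_square algebra_simps)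
  thus ?thesis
    using assms L2_inner_integrable[OF assms] by (simp add: L2_def)
qed

text \<open>The squared norm of f + t h is a nonnegative quadratic in t, so its discriminant is not
  positive; the case of vanishing leading coefficient is treated apart.\<close>

lemma L2_Cauchy_Schwarz:
  assumes "L2 M f" "L2 M h"
  shows "(LINT x|M. f x \<bullet> h x)\<^sup>2 \<le> (LINT x|M. (norm (f x))\<^sup>2) * (LINT x|M. (norm (h x))\<^sup>2)"
proof -
  let ?f = "LINT x|M. (norm (f x))\<^sup>2" and ?h = "LINT x|M. (norm (h x))\<^sup>2" and ?fg = "LINT x|M. f x \<bullet> h x"
  have q: "0 \<le> ?f + 2 * t * ?fg + t\<^sup>2 * ?h" for t
    unfolding L2_norm_add_scaleR_square[OF assms, symmetric]
    by (rule Bochner_Integration.integral_nonneg) simp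
  show ?thesis
  proof (cases "?h = 0")
    case True
    have "?fg = 0"
    proof (rule ccontr)
      assume "?fg \<noteq> 0"
      \<comment> \<open>At this value of t the nonnegative expression would equal -1.\<close>
      with q[of "- (?f + 1) / (2 * ?fg)"] True show False by (simp add: field_simps)
    qed
    thus ?thesis using True by simp
  next
    case False
    moreover have "?h \<ge> 0" by (rule Bochner_Integration.integral_nonneg) simp
    ultimately have h: "?h > 0" by linarith
    have "0 \<le> (?f + 2 * (- ?fg / ?h) * ?fg + (- ?fg / ?h)\<^sup>2 * ?h) * ?h"
      using q[of "- ?fg / ?h"] h by (intro mult_nonneg_nonneg) auto
    also have "\<dots> = ?f * ?h - ?fg\<^sup>2"
      using h by (simp add: field_simps power2_eq_square)
    finally show ?thesis by simp
  qed
qed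

lemma integrable_nn_integral_le:
  assumes "f \<in> borel_measurable M" "\<And>x. 0 \<le> f x" "(\<integral>\<^sup>+x. ennreal (f x) \<partial>M) \<le> ennreal e" "0 \<le> e"
  shows "integrable M f" "(LINT x|M. f x) \<le> e"
proof -
  show i: "integrable M f"
    using assms by (intro integrableI_nonneg) (auto intro: le_less_trans)
  show "(LINT x|M. f x) \<le> e"
    using assms nn_integral_eq_integral[OF i] by simp
qed

text \<open>Riesz-Fischer: along a fast subsequence the increments are summable in L1, hence
  converge almost everywhere, and Fatou's lemma upgrades pointwise convergence to convergence in
  L2.\<close>

lemma (in finite_measure) L2_complete:
  fixes f :: "nat \<Rightarrow> 'a \<Rightarrow> 'b::euclidean_space"
  assumes L2: "\<And>n. L2 M (f n)"
    and Cauchy: "\<And>e. e > 0 \<Longrightarrow> \<exists>N. \<forall>m\<ge>N. \<forall>n\<ge>N. (LINT x|M. (norm (f m x - f n x))\<^sup>2) \<le> e"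
  obtains h where "L2 M h" "(\<lambda>n. LINT x|M. (norm (f n x - h x))\<^sup>2) \<longlonglongrightarrow> 0"
proof -
  have [measurable]: "f n \<in> borel_measurable M" for n using L2[of n] by measurable
  have "\<forall>k. \<exists>N. \<forall>m\<ge>N. \<forall>n\<ge>N. (LINT x|M. (norm (f m x - f n x))\<^sup>2) \<le> (1/4)^k"
    using Cauchy by simp
  from choice[OF this] obtain N
    where "\<forall>k. \<forall>m\<ge>N k. \<forall>n\<ge>N k. (LINT x|M. (norm (f m x - f n x))\<^sup>2) \<le> (1/4::real)^k" ..
  hence N: "(LINT x|M. (norm (f m x - f n x))\<^sup>2) \<le> (1/4::real)^k" if "m \<ge> N k" "n \<ge> N k" for k m n
    using that by simp
  \<comment> \<open>Partial sums of \<open>N\<close> give a nondecreasing index sequence that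
    dominates \<open>N k\<close>; the squared L2 gaps along it are at most 1/4^k.\<close>
  define R where "R k = (\<Sum>j\<le>k. N j)" for k
  have RN: "R k \<ge> N k" for k unfolding R_def by (rule member_le_sum) auto
  have Rmono: "R k \<le> R (Suc k)" for k unfolding R_def by simp
  have RN': "R m \<ge> N k" if "k \<le> m" for k m
    using lift_Suc_mono_le[of R k m] Rmono that RN[of k] by force
  define d where "d k x = norm (f (R (Suc k)) x - f (R k) x)" for k x
  \<comment> \<open>Finiteness of the measure turns L2 decay into L1 decay. The factor
    \<open>measure M (space M) + 1\<close> stands in for the square root of the measure.\<close>
  have dint: "integrable M (d k)" and dle: "(LINT x|M. d k x) \<le> (measure M (space M) + 1) * (1/2)^k" for k
  proof -
    have D: "L2 M (\<lambda>x. f (R (Suc k)) x - f (R k) x)" by (intro L2_diff L2)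
    have dL: "L2 M (d k)" using D by (simp add: L2_def d_def[abs_def])
    show "integrable M (d k)" by (rule L2_integrable[OF dL])
    have "(LINT x|M. d k x \<bullet> 1)\<^sup>2 \<le> (LINT x|M. (norm (d k x))\<^sup>2) * (LINT x|M. (norm (1::real))\<^sup>2)"
      by (rule L2_Cauchy_Schwarz[OF dL L2_bounded[of _ 1]]) auto
    also have "\<dots> \<le> (1/4)^k * measure M (space M)"
      using N[of k "R (Suc k)" "R k"] RN'[of k "Suc k"] RN[of k]
      by (simp add: d_def mult_right_mono)
    also have "\<dots> \<le> ((measure M (space M) + 1) * (1/2)^k)\<^sup>2"
    proof -
      have "(1/4::real)^k = ((1/2)^k)\<^sup>2"
        by (simp add: power_mult[symmetric] mult.commute[of k 2]) (simp add: power_mult power2_eq_square)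
      moreover have "measure M (space M) \<le> (measure M (space M) + 1)\<^sup>2"
        by (simp add: power2_eq_square algebra_simps)
      ultimately show ?thesis
        by (simp add: power_mult_distrib mult.commute mult_left_mono)
    qed
    finally show "(LINT x|M. d k x) \<le> (measure M (space M) + 1) * (1/2)^k"
      by (intro power2_le_imp_le[of "LINT x|M. d k x"]) (auto intro!: mult_nonneg_nonneg)
  qed
  have dpos: "0 \<le> d k x" for k x by (simp add: d_def)
  have [measurable]: "d k \<in> borel_measurable M" for k using dint by measurable
  have sumd: "summable (\<lambda>k. LINT x|M. d k x)"
  proof (rule summable_comparison_test')
    show "summable (\<lambda>k. (measure M (space M) + 1) * (1/2)^k)"
      by (intro summable_mult summable_geometric) simp
    show "norm (LINT x|M. d k x) \<le> (measure M (space M) + 1) * (1/2)^k" for k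
      using dle[of k] by (simp add: dpos)
  qed
  have "(\<integral>\<^sup>+x. (\<Sum>k. ennreal (d k x)) \<partial>M) = (\<Sum>k. \<integral>\<^sup>+x. ennreal (d k x) \<partial>M)"
    by (rule nn_integral_suminf) simp
  also have "\<dots> = (\<Sum>k. ennreal (LINT x|M. d k x))"
    by (simp add: nn_integral_eq_integral dint dpos)
  also have "\<dots> = ennreal (\<Sum>k. LINT x|M. d k x)"
    by (rule suminf_ennreal2) (auto simp: sumd dpos)
  also have "\<dots> < \<infinity>" by simp
  finally have "AE x in M. (\<Sum>k. ennreal (d k x)) \<noteq> \<infinity>"
    by (intro nn_integral_PInf_AE) auto
  hence conv: "AE x in M. convergent (\<lambda>k. f (R k) x)"
  proof eventually_elim
    case (elim x)
    hence "summable (\<lambda>k. d k x)" by (intro summable_suminf_not_top) (auto simp: dpos)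
    hence "summable (\<lambda>k. f (R (Suc k)) x - f (R k) x)"
      unfolding d_def by (rule summable_norm_cancel)
    hence "convergent (\<lambda>n. \<Sum>k<n. f (R (Suc k)) x - f (R k) x)"
      by (simp add: summable_iff_convergent)
    hence "convergent (\<lambda>n. f (R n) x - f (R 0) x)"
      by (simp only: sum_lessThan_telescope[of "\<lambda>k. f (R k) x"])
    thus ?case by (simp add: convergent_diff_const_right_iff)
  qed
  define h where "h x = lim (\<lambda>k. f (R k) x)" for x
  have [measurable]: "h \<in> borel_measurable M" unfolding h_def by (rule borel_measurable_lim_metric) simp
  have hlim: "AE x in M. (\<lambda>k. f (R k) x) \<longlonglongrightarrow> h x"
    using conv by eventually_elim (simp add: h_def convergent_LIMSEQ_iff)
  \<comment> \<open>Fatou's lemma along the subsequence bounds the distance of \<open>f n\<close>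
    from the limit by the Cauchy bound, and yields square integrability of the difference at the
    same time.\<close>
  have key: "integrable M (\<lambda>x. (norm (f n x - h x))\<^sup>2) \<and> (LINT x|M. (norm (f n x - h x))\<^sup>2) \<le> e"
    if e: "e > 0" and K: "\<And>m. m \<ge> K \<Longrightarrow> (LINT x|M. (norm (f n x - f (R m) x))\<^sup>2) \<le> e" for n e K
  proof -
    have "(\<integral>\<^sup>+x. ennreal ((norm (f n x - h x))\<^sup>2) \<partial>M)
        = (\<integral>\<^sup>+x. liminf (\<lambda>k. ennreal ((norm (f n x - f (R k) x))\<^sup>2)) \<partial>M)"
    proof (rule nn_integral_cong_AE)
      show "AE x in M. ennreal ((norm (f n x - h x))\<^sup>2) = liminf (\<lambda>k. ennreal ((norm (f n x - f (R k) x))\<^sup>2))"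
        using hlim
      proof eventually_elim
        case (elim x)
        hence "(\<lambda>k. ennreal ((norm (f n x - f (R k) x))\<^sup>2)) \<longlonglongrightarrow> ennreal ((norm (f n x - h x))\<^sup>2)"
          by (intro tendsto_intros)
        from lim_imp_Liminf[OF _ this] show ?case by simp
      qed
    qed
    also have "\<dots> \<le> liminf (\<lambda>k. \<integral>\<^sup>+x. ennreal ((norm (f n x - f (R k) x))\<^sup>2) \<partial>M)"
      by (rule nn_integral_liminf) simp
    also have "\<dots> \<le> liminf (\<lambda>k. ennreal e)"
    proof (rule Liminf_mono)
      show "\<forall>\<^sub>F k in sequentially. (\<integral>\<^sup>+x. ennreal ((norm (f n x - f (R k) x))\<^sup>2) \<partial>M) \<le> ennreal e"
        using eventually_ge_at_top[of K]
      proof eventually_elim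
        case (elim k)
        have "L2 M (\<lambda>x. f n x - f (R k) x)" by (intro L2_diff L2)
        hence "(\<integral>\<^sup>+x. ennreal ((norm (f n x - f (R k) x))\<^sup>2) \<partial>M) = ennreal (LINT x|M. (norm (f n x - f (R k) x))\<^sup>2)"
          by (intro nn_integral_eq_integral) (auto simp: L2_def)
        thus ?case using K[OF elim] e by (simp add: ennreal_leI)
      qed
    qed
    also have "\<dots> = ennreal e" by (simp add: Liminf_const)
    finally show ?thesis using e by (auto intro!: integrable_nn_integral_le)
  qed
  have lim: "\<exists>n0. \<forall>n\<ge>n0. integrable M (\<lambda>x. (norm (f n x - h x))\<^sup>2) \<and> (LINT x|M. (norm (f n x - h x))\<^sup>2) \<le> e"
    if e: "e > 0" for e
  proof -
    obtain n0 where n0: "\<And>m n. m \<ge> n0 \<Longrightarrow> n \<ge> n0 \<Longrightarrow> (LINT x|M. (norm (f m x - f n x))\<^sup>2) \<le> e / 1"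
      using Cauchy[OF e] by auto
    obtain k where k: "(1/4::real)^k < e" using real_arch_pow_inv[OF e, of "1/4"] by auto
    show ?thesis
    proof (intro exI[of _ "N k"] allI impI)
      fix n assume "n \<ge> N k"
      thus "integrable M (\<lambda>x. (norm (f n x - h x))\<^sup>2) \<and> (LINT x|M. (norm (f n x - h x))\<^sup>2) \<le> e"
      proof (intro key[of e k n] e)
        fix m assume "k \<le> m"
        thus "(LINT x|M. (norm (f n x - f (R m) x))\<^sup>2) \<le> e"
          using N[of k n "R m"] RN'[of k m] \<open>n \<ge> N k\<close> k by linarith
      qed
    qed
  qed
  obtain n where "integrable M (\<lambda>x. (norm (f n x - h x))\<^sup>2)" using lim[of 1] by auto
  hence "L2 M (\<lambda>x. f n x - h x)" by (auto simp: L2_def)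
  from L2_diff[OF L2[of n] this] have "L2 M h" by simp
  moreover have "(\<lambda>n. LINT x|M. (norm (f n x - h x))\<^sup>2) \<longlonglongrightarrow> 0"
  proof (rule LIMSEQ_I)
    fix e :: real assume "e > 0"
    then obtain n0 where "\<forall>n\<ge>n0. (LINT x|M. (norm (f n x - h x))\<^sup>2) \<le> e / 2" using lim[of "e/2"] by auto
    thus "\<exists>n0. \<forall>n\<ge>n0. norm ((LINT x|M. (norm (f n x - h x))\<^sup>2) - 0) < e"
      using \<open>e > 0\<close> by (intro exI[of _ n0]) force
  qed
  ultimately show ?thesis by (rule that)
qed

lemma L2_tendsto_inner:
  assumes f: "\<And>n. L2 M (f n)" and h: "L2 M h" and w: "L2 M w"
    and lim: "(\<lambda>n. LINT x|M. (norm (f n x - h x))\<^sup>2) \<longlonglongrightarrow> 0"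
  shows "(\<lambda>n. LINT x|M. f n x \<bullet> w x) \<longlonglongrightarrow> (LINT x|M. h x \<bullet> w x)"
proof -
  let ?H = "LINT x|M. (norm (w x))\<^sup>2"
  have "(\<lambda>n. sqrt ((LINT x|M. (norm (f n x - h x))\<^sup>2) * ?H)) \<longlonglongrightarrow> sqrt (0 * ?H)"
    by (intro tendsto_intros lim)
  hence s: "(\<lambda>n. sqrt ((LINT x|M. (norm (f n x - h x))\<^sup>2) * ?H)) \<longlonglongrightarrow> 0" by simp
  have "(\<lambda>n. (LINT x|M. f n x \<bullet> w x) - (LINT x|M. h x \<bullet> w x)) \<longlonglongrightarrow> 0"
  proof (rule Lim_null_comparison[OF _ s], rule always_eventually, rule allI)
    fix n
    have "(LINT x|M. f n x \<bullet> w x) - (LINT x|M. h x \<bullet> w x) = (LINT x|M. (f n x - h x) \<bullet> w x)"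
      using L2_inner_integrable[OF f w] L2_inner_integrable[OF h w] by (simp add: inner_diff_left)
    moreover have "\<bar>LINT x|M. (f n x - h x) \<bullet> w x\<bar> \<le> sqrt ((LINT x|M. (norm (f n x - h x))\<^sup>2) * ?H)"
      using L2_Cauchy_Schwarz[OF L2_diff[OF f h] w] by (intro real_le_rsqrt) simp
    ultimately show "norm ((LINT x|M. f n x \<bullet> w x) - (LINT x|M. h x \<bullet> w x)) \<le> sqrt ((LINT x|M. (norm (f n x - h x))\<^sup>2) * ?H)"
      by simp
  qed
  thus ?thesis by (simp add: LIM_zero_iff)
qed

lemma L2_tendsto_norm_square:
  assumes f: "\<And>n. L2 M (f n)" and h: "L2 M h"
    and lim: "(\<lambda>n. LINT x|M. (norm (f n x - h x))\<^sup>2) \<longlonglongrightarrow> 0"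
  shows "(\<lambda>n. LINT x|M. (norm (f n x))\<^sup>2) \<longlonglongrightarrow> (LINT x|M. (norm (h x))\<^sup>2)"
proof -
  have "(LINT x|M. (norm (f n x))\<^sup>2) = (LINT x|M. (norm (f n x - h x))\<^sup>2) + 2 * (LINT x|M. f n x \<bullet> h x)
      - (LINT x|M. (norm (h x))\<^sup>2)" for n
    using L2_norm_add_scaleR_square[OF f h, of n "-1"] by simp
  moreover have "(\<lambda>n. (LINT x|M. (norm (f n x - h x))\<^sup>2) + 2 * (LINT x|M. f n x \<bullet> h x)
      - (LINT x|M. (norm (h x))\<^sup>2)) \<longlonglongrightarrow> 0 + 2 * (LINT x|M. h x \<bullet> h x) - (LINT x|M. (norm (h x))\<^sup>2)"
    by (intro tendsto_intros lim L2_tendsto_inner f h)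
  ultimately show ?thesis by (simp add: power2_norm_eq_inner)
qed

lemma L2_norm_square_eq_0_iff:
  assumes "L2 M f"
  shows "(LINT x|M. (norm (f x))\<^sup>2) = 0 \<longleftrightarrow> (AE x in M. f x = 0)"
  using assms by (subst integral_nonneg_eq_0_iff_AE) (auto simp: L2_def)

section \<open>Weak gradients\<close>

lemma square_integrable_eq_L2: "square_integrable \<Omega> u \<longleftrightarrow> L2 (lebesgue_on \<Omega>) u"
  by (simp add: square_integrable_def L2_def)

lemma grad_inner_eq:
  assumes "(f has_derivative D) (at x)"
  shows "grad f x \<bullet> v = D v"
proof -
  have D: "frechet_derivative f (at x) = D" using frechet_derivative_at[OF assms] ..
  have lin: "linear D" using assms has_derivative_linear by blast
  have "grad f x \<bullet> v = (\<Sum>b\<in>Basis. (v \<bullet> b) * D b)"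
    by (simp add: grad_def D inner_sum_left inner_sum_right inner_commute[of _ v] mult.commute)
  also have "\<dots> = D (\<Sum>b\<in>Basis. (v \<bullet> b) *\<^sub>R b)"
    by (simp add: linear_sum[OF lin] linear_scale[OF lin])
  finally show ?thesis by (simp add: euclidean_representation)
qed

lemma grad_eqI:
  assumes "(f has_derivative (\<lambda>v. G \<bullet> v)) (at x)"
  shows "grad f x = G"
  by (rule vector_eq_rdot[THEN iffD1]) (simp add: grad_inner_eq[OF assms])

lemma has_derivative_grad:
  assumes "f differentiable (at x)"
  shows "(f has_derivative (\<lambda>v. grad f x \<bullet> v)) (at x)"
proof -
  obtain D where D: "(f has_derivative D) (at x)" using assms by (auto simp: differentiable_def)
  hence "(\<lambda>v. grad f x \<bullet> v) = D" by (auto simp: grad_inner_eq)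
  with D show ?thesis by simp
qed

lemma grad_mult:
  assumes "f differentiable (at x)" "h differentiable (at x)"
  shows "grad (\<lambda>x. f x * h x) x = f x *\<^sub>R grad h x + h x *\<^sub>R grad f x"
  by (rule grad_eqI)
     (auto intro!: derivative_eq_intros has_derivative_grad assms simp: inner_add_left algebra_simps)

lemma test_function_eq_0:
  assumes "x \<notin> closure {x. \<phi> x \<noteq> 0}"
  shows "\<phi> x = 0" "grad \<phi> x = 0"
proof -
  let ?S = "- closure {x. \<phi> x \<noteq> 0}"
  have z: "\<phi> y = 0" if "y \<in> ?S" for y using that closure_subset[of "{x. \<phi> x \<noteq> 0}"] by auto
  show "\<phi> x = 0" using assms z[of x] by blast
  have "((\<lambda>_. 0) has_derivative (\<lambda>v. 0 \<bullet> v)) (at x)" by simp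
  hence "(\<phi> has_derivative (\<lambda>v. 0 \<bullet> v)) (at x)"
  proof (rule has_derivative_transform_within_open)
    show "open ?S" "x \<in> ?S" using assms by auto
    show "0 = \<phi> y" if "y \<in> ?S" for y using z[OF that] by (rule sym)
  qed
  thus "grad \<phi> x = 0" by (rule grad_eqI)
qed

lemma compact_support_continuous_bounded:
  fixes f :: "'a::euclidean_space \<Rightarrow> 'b::real_normed_vector"
  assumes "compact K" "continuous_on UNIV f" "\<And>x. x \<notin> K \<Longrightarrow> f x = 0"
  shows "\<exists>C\<ge>0. \<forall>x. norm (f x) \<le> C"
proof -
  have "bounded (f ` K)"
    by (intro compact_imp_bounded compact_continuous_image assms continuous_on_subset[OF assms(2)]) simp
  then obtain C where C: "\<forall>x\<in>K. norm (f x) \<le> C" by (auto simp: bounded_iff)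
  show ?thesis
  proof (intro exI[of _ "max 0 C"] conjI allI)
    show "norm (f x) \<le> max 0 C" for x
      using C assms(3)[of x] by (cases "x \<in> K") auto
  qed simp
qed

lemma test_functionD:
  assumes "test_function \<Omega> \<phi>"
  shows "continuous_on UNIV \<phi>" "continuous_on UNIV (grad \<phi>)"
    "\<phi> \<in> borel_measurable borel" "grad \<phi> \<in> borel_measurable borel"
    "\<phi> differentiable (at x)" "compact (closure {x. \<phi> x \<noteq> 0})" "closure {x. \<phi> x \<noteq> 0} \<subseteq> \<Omega>"
    "x \<notin> \<Omega> \<Longrightarrow> \<phi> x = 0" "x \<notin> \<Omega> \<Longrightarrow> grad \<phi> x = 0"
proof -
  show 1: "continuous_on UNIV \<phi>"
    using assms by (auto simp: test_function_def continuous_on_eq_continuous_at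
        intro: differentiable_imp_continuous_within)
  show 2: "continuous_on UNIV (grad \<phi>)" using assms by (simp add: test_function_def)
  show "\<phi> \<in> borel_measurable borel" "grad \<phi> \<in> borel_measurable borel"
    using 1 2 by (auto intro: borel_measurable_continuous_onI)
  show "\<phi> differentiable (at x)" "compact (closure {x. \<phi> x \<noteq> 0})" and sub: "closure {x. \<phi> x \<noteq> 0} \<subseteq> \<Omega>"
    using assms by (auto simp: test_function_def)
  show "x \<notin> \<Omega> \<Longrightarrow> \<phi> x = 0" "x \<notin> \<Omega> \<Longrightarrow> grad \<phi> x = 0"
    using sub test_function_eq_0[of x \<phi>] by auto
qed

lemma test_function_bounded:
  assumes "test_function \<Omega> \<phi>"
  shows "\<exists>C\<ge>0. \<forall>x. \<bar>\<phi> x\<bar> \<le> C \<and> norm (grad \<phi> x) \<le> C"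
proof -
  note t = test_functionD[OF assms]
  obtain C1 where C1: "C1 \<ge> 0" "\<forall>x. norm (\<phi> x) \<le> C1"
    using compact_support_continuous_bounded[OF t(6) t(1)] test_function_eq_0(1)[of _ \<phi>] by blast
  obtain C2 where C2: "\<forall>x. norm (grad \<phi> x) \<le> C2"
    using compact_support_continuous_bounded[OF t(6) t(2)] test_function_eq_0(2)[of _ \<phi>] by blast
  show ?thesis
    using C1 C2 by (intro exI[of _ "max C1 C2"]) (auto intro: le_max_iff_disj[THEN iffD2])
qed

lemma borel_measurable_lebesgue_onI [intro]:
  "f \<in> borel_measurable borel \<Longrightarrow> f \<in> borel_measurable (lebesgue_on \<Omega>)"
  by (auto intro!: measurable_restrict_space1 measurable_completion)

lemma finite_measure_lebesgue_on: "\<Omega> \<in> lmeasurable \<Longrightarrow> finite_measure (lebesgue_on \<Omega>)"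
  by (auto intro!: finite_measureI simp: emeasure_restrict_space fmeasurable_def)

lemma test_function_L2:
  assumes "test_function \<Omega>' \<phi>" "\<Omega> \<in> lmeasurable"
  shows "L2 (lebesgue_on \<Omega>) \<phi>" "L2 (lebesgue_on \<Omega>) (grad \<phi>)"
proof -
  obtain C where "C \<ge> 0" "\<And>x. \<bar>\<phi> x\<bar> \<le> C" "\<And>x. norm (grad \<phi> x) \<le> C"
    using test_function_bounded[OF assms(1)] by auto
  thus "L2 (lebesgue_on \<Omega>) \<phi>" "L2 (lebesgue_on \<Omega>) (grad \<phi>)"
    by (auto intro!: finite_measure.L2_bounded[OF finite_measure_lebesgue_on[OF assms(2)], where C=C]
        test_functionD[OF assms(1)])
qed

lemma integral_lebesgue_on_eq_lborel:
  fixes f :: "'a::euclidean_space \<Rightarrow> 'b::euclidean_space"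
  assumes "f \<in> borel_measurable borel" "\<And>x. x \<notin> \<Omega> \<Longrightarrow> f x = 0" "\<Omega> \<in> sets lebesgue"
  shows "(LINT x|lebesgue_on \<Omega>. f x) = (LINT x|lborel. f x)"
proof -
  have "(LINT x|lebesgue_on \<Omega>. f x) = (LINT x|lebesgue. indicator \<Omega> x *\<^sub>R f x)"
    by (rule integral_restrict_space) (use assms(3) in simp)
  also have "(\<lambda>x. indicator \<Omega> x *\<^sub>R f x) = f"
    using assms(2) by (auto simp: indicator_def)
  finally show ?thesis using assms(1) by (simp add: integral_completion)
qed

text \<open>Differentiate the translation-invariant integral of \<open>\<phi>\<close>.\<close>

lemma integral_directional_derivative_0:
  fixes \<phi> :: "'a::euclidean_space \<Rightarrow> real"
  assumes t: "test_function UNIV \<phi>"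
  shows "(LINT x|lborel. grad \<phi> x \<bullet> b) = 0"
proof -
  note bdd = test_function_bounded[OF t] and t = test_functionD[OF t]
  let ?K = "closure {x. \<phi> x \<noteq> 0}"
  have [measurable]: "\<phi> \<in> borel_measurable borel" "grad \<phi> \<in> borel_measurable borel" by (rule t)+
  obtain C where C: "C \<ge> 0" "\<And>x. norm (grad \<phi> x) \<le> C" using bdd by auto
  obtain R where R: "\<And>x. x \<in> ?K \<Longrightarrow> norm x \<le> R"
    using compact_imp_bounded[OF t(6)] by (auto simp: bounded_iff)
  have lip: "\<bar>\<phi> y - \<phi> x\<bar> \<le> C * norm (y - x)" for x y
  proof -
    have "norm (\<phi> y - \<phi> x) \<le> C * norm (y - x)"
    proof (rule differentiable_bound[where S=UNIV and f'="\<lambda>x v. grad \<phi> x \<bullet> v"])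
      show "(\<phi> has_derivative (\<lambda>v. grad \<phi> x \<bullet> v)) (at x within UNIV)" for x
        using has_derivative_grad[OF t(5)] by simp
      show "onorm (\<lambda>v. grad \<phi> x \<bullet> v) \<le> C" for x
      proof (rule onorm_bound[OF C(1)])
        show "norm (grad \<phi> x \<bullet> v) \<le> C * norm v" for v
          using Cauchy_Schwarz_ineq2[of "grad \<phi> x" v] mult_right_mono[OF C(2)[of x], of "norm v"] by simp
      qed
    qed auto
    thus ?thesis by simp
  qed
  have int: "integrable lborel \<phi>"
  proof -
    have "integrable lborel (\<lambda>x. indicator ?K x *\<^sub>R \<phi> x)"
      by (rule borel_integrable_compact[OF t(6) continuous_on_subset[OF t(1)]]) simp
    also have "(\<lambda>x. indicator ?K x *\<^sub>R \<phi> x) = \<phi>"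
    proof
      fix x show "indicator ?K x *\<^sub>R \<phi> x = \<phi> x"
        using test_function_eq_0(1)[of x \<phi>] by (cases "x \<in> ?K") simp_all
    qed
    finally show ?thesis .
  qed
  \<comment> \<open>Difference quotients in direction \<open>b\<close>; each integrates to zero
    because translates of the function have equal integrals.\<close>
  define s where "s n x = (\<phi> (x + (1 / real (Suc n)) *\<^sub>R b) - \<phi> x) * real (Suc n)" for n x
  have int2: "integrable lborel (\<lambda>x. \<phi> (x + c))" and eq: "(LINT x|lborel. \<phi> (x + c)) = (LINT x|lborel. \<phi> x)" for c
  proof -
    have "integrable (distr lborel borel ((+) c)) \<phi>" using int by (simp add: lborel_distr_plus)
    thus "integrable lborel (\<lambda>x. \<phi> (x + c))" by (subst (asm) integrable_distr_eq) (auto simp: add.commute)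
    have "(LINT x|distr lborel borel ((+) c). \<phi> x) = (LINT x|lborel. \<phi> (c + x))"
      by (rule integral_distr) auto
    thus "(LINT x|lborel. \<phi> (x + c)) = (LINT x|lborel. \<phi> x)" by (simp add: lborel_distr_plus add.commute)
  qed
  have s0: "(LINT x|lborel. s n x) = 0" for n
    unfolding s_def using int int2 eq by simp
  have [measurable]: "s n \<in> borel_measurable borel" for n unfolding s_def by measurable
  have "(\<lambda>n. LINT x|lborel. s n x) \<longlonglongrightarrow> (LINT x|lborel. grad \<phi> x \<bullet> b)"
  proof (rule integral_dominated_convergence)
    \<comment> \<open>The translations move points by at most \<open>norm b\<close>, so the enlarged
      ball contains the supports of all difference quotients; the height is the Lipschitz
      bound.\<close>
    let ?w = "\<lambda>x::'a. indicator (cball 0 (R + norm b)) x *\<^sub>R (C * norm b)"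
    show "integrable lborel ?w" by (rule borel_integrable_compact) auto
    show "AE x in lborel. norm (s n x) \<le> ?w x" for n
    proof (rule AE_I2)
      fix x
      show "norm (s n x) \<le> ?w x"
      proof (cases "norm x \<le> R + norm b")
        case True
        have "\<bar>\<phi> (x + (1 / real (Suc n)) *\<^sub>R b) - \<phi> x\<bar> \<le> C * norm ((1 / real (Suc n)) *\<^sub>R b)"
          using lip[of "x + (1 / real (Suc n)) *\<^sub>R b" x] by simp
        hence "\<bar>\<phi> (x + (1 / real (Suc n)) *\<^sub>R b) - \<phi> x\<bar> * real (Suc n) \<le> C * norm ((1 / real (Suc n)) *\<^sub>R b) * real (Suc n)"
          by (intro mult_right_mono) auto
        thus ?thesis using True by (simp add: s_def abs_mult)
      next
        case False
        have "norm ((1 / real (Suc n)) *\<^sub>R b) \<le> norm b" using mult_left_mono[of 1 "1 + real n" "norm b"] by (simp add: divide_simps)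
        hence "norm (x + (1 / real (Suc n)) *\<^sub>R b) > R"
          using False norm_triangle_ineq4[of "x + (1 / real (Suc n)) *\<^sub>R b" "(1 / real (Suc n)) *\<^sub>R b"] by simp
        hence "x + (1 / real (Suc n)) *\<^sub>R b \<notin> ?K" using R[of "x + (1 / real (Suc n)) *\<^sub>R b"] by fastforce
        moreover have "x \<notin> ?K" using False R[of x] norm_ge_zero[of b] by fastforce
        ultimately have "s n x = 0"
          using test_function_eq_0(1)[of x \<phi>] test_function_eq_0(1)[of "x + (1 / real (Suc n)) *\<^sub>R b" \<phi>]
          unfolding s_def by simp
        thus ?thesis using C(1) by simp
      qed
    qed
    show "AE x in lborel. (\<lambda>n. s n x) \<longlonglongrightarrow> grad \<phi> x \<bullet> b"
    proof (rule AE_I2)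
      fix x
      have "((\<lambda>t. \<phi> (x + t *\<^sub>R b)) has_derivative (\<lambda>t. grad \<phi> (x + 0 *\<^sub>R b) \<bullet> (t *\<^sub>R b))) (at 0)"
        by (rule has_derivative_compose[OF _ has_derivative_grad[OF t(5)]])
           (auto intro!: derivative_eq_intros)
      hence "((\<lambda>t. \<phi> (x + t *\<^sub>R b)) has_real_derivative (grad \<phi> x \<bullet> b)) (at 0)"
        by (simp add: has_field_derivative_def mult.commute[of _ "grad \<phi> x \<bullet> b"])
      hence "((\<lambda>t. (\<phi> (x + t *\<^sub>R b) - \<phi> x) / t) \<longlongrightarrow> grad \<phi> x \<bullet> b) (at 0)"
        by (simp add: has_field_derivative_iff)
      moreover have "filterlim (\<lambda>n. 1 / real (Suc n)) (at 0) sequentially"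
        unfolding filterlim_at using LIMSEQ_Suc[OF lim_1_over_n[where 'a=real]] by simp
      ultimately have "(\<lambda>n. (\<phi> (x + (1 / real (Suc n)) *\<^sub>R b) - \<phi> x) / (1 / real (Suc n))) \<longlonglongrightarrow> grad \<phi> x \<bullet> b"
        by (rule filterlim_compose)
      thus "(\<lambda>n. s n x) \<longlonglongrightarrow> grad \<phi> x \<bullet> b" by (simp add: s_def)
    qed
  qed measurable
  hence "(\<lambda>n. 0) \<longlonglongrightarrow> (LINT x|lborel. grad \<phi> x \<bullet> b)" by (simp only: s0)
  thus ?thesis by (metis LIMSEQ_unique tendsto_const)
qed

text \<open>Replaces the vector-valued identity by scalar ones, one for each direction
  \<open>b\<close>; in this form it can be handled with products of real L2 functions and passed
  through a change of variables.\<close>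

lemma weak_gradient_iff:
  assumes u: "L2 (lebesgue_on \<Omega>) u" and G: "L2 (lebesgue_on \<Omega>) G" and \<Omega>: "\<Omega> \<in> lmeasurable"
  shows "has_weak_gradient \<Omega> u G \<longleftrightarrow>
    (\<forall>\<phi> b. test_function \<Omega> \<phi> \<longrightarrow>
      (LINT x|lebesgue_on \<Omega>. u x * (grad \<phi> x \<bullet> b)) = - (LINT x|lebesgue_on \<Omega>. \<phi> x * (G x \<bullet> b)))"
proof -
  have "(LINT x|lebesgue_on \<Omega>. u x *\<^sub>R grad \<phi> x) = - (LINT x|lebesgue_on \<Omega>. \<phi> x *\<^sub>R G x) \<longleftrightarrow>
    (\<forall>b. (LINT x|lebesgue_on \<Omega>. u x * (grad \<phi> x \<bullet> b)) = - (LINT x|lebesgue_on \<Omega>. \<phi> x * (G x \<bullet> b)))"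
    if t: "test_function \<Omega> \<phi>" for \<phi>
  proof -
    note L = test_function_L2[OF t \<Omega>]
    have i: "(LINT x|lebesgue_on \<Omega>. u x *\<^sub>R grad \<phi> x) \<bullet> b = (LINT x|lebesgue_on \<Omega>. u x * (grad \<phi> x \<bullet> b))"
      "(LINT x|lebesgue_on \<Omega>. \<phi> x *\<^sub>R G x) \<bullet> b = (LINT x|lebesgue_on \<Omega>. \<phi> x * (G x \<bullet> b))" for b
      by (simp_all add: integral_inner_left[symmetric] L2_scaleR_integrable u G L)
    show ?thesis
      using vector_eq_rdot[of "LINT x|lebesgue_on \<Omega>. u x *\<^sub>R grad \<phi> x" "- (LINT x|lebesgue_on \<Omega>. \<phi> x *\<^sub>R G x)"]
      by (simp only: i inner_minus_left)
  qed
  thus ?thesis unfolding has_weak_gradient_def by blast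
qed

section \<open>Algebra and limits in the Sobolev space H^1\<close>

lemma H1_iff:
  assumes "\<Omega> \<in> lmeasurable"
  shows "H1_with_gradient \<Omega> u G \<longleftrightarrow> L2 (lebesgue_on \<Omega>) u \<and> L2 (lebesgue_on \<Omega>) G \<and>
    (\<forall>\<phi> b. test_function \<Omega> \<phi> \<longrightarrow>
      (LINT x|lebesgue_on \<Omega>. u x * (grad \<phi> x \<bullet> b)) = - (LINT x|lebesgue_on \<Omega>. \<phi> x * (G x \<bullet> b)))"
  unfolding H1_with_gradient_def square_integrable_eq_L2
  using weak_gradient_iff[OF _ _ assms] by blast

lemma H1_L2: "H1_with_gradient \<Omega> u G \<Longrightarrow> L2 (lebesgue_on \<Omega>) u"
    "H1_with_gradient \<Omega> u G \<Longrightarrow> L2 (lebesgue_on \<Omega>) G"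
  by (simp_all add: H1_with_gradient_def square_integrable_eq_L2)

lemma L2_inner_const:
  assumes "L2 M G"
  shows "L2 M (\<lambda>x. G x \<bullet> b)"
proof (rule L2_dominated[OF assms])
  show "AE x in M. norm (G x \<bullet> b) \<le> norm b * norm (G x)"
    using Cauchy_Schwarz_ineq2[of "G _" b] by (intro AE_I2) (simp add: mult.commute)
qed (use assms in measurable)

lemma H1_add_scaleR:
  assumes \<Omega>: "\<Omega> \<in> lmeasurable" and u: "H1_with_gradient \<Omega> u G" and w: "H1_with_gradient \<Omega> w H"
  shows "H1_with_gradient \<Omega> (\<lambda>x. u x + c * w x) (\<lambda>x. G x + c *\<^sub>R H x)"
proof -
  note u' = u[unfolded H1_iff[OF \<Omega>]] and w' = w[unfolded H1_iff[OF \<Omega>]]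
  show ?thesis
    unfolding H1_iff[OF \<Omega>]
  proof (intro conjI allI impI)
    show "L2 (lebesgue_on \<Omega>) (\<lambda>x. u x + c * w x)" "L2 (lebesgue_on \<Omega>) (\<lambda>x. G x + c *\<^sub>R H x)"
      using u' w' by (auto intro!: L2_add L2_cmult L2_scaleR)
    fix \<phi> b assume t: "test_function \<Omega> \<phi>"
    note L = test_function_L2[OF t \<Omega>]
    have i: "integrable (lebesgue_on \<Omega>) (\<lambda>x. u x * (grad \<phi> x \<bullet> b))"
      "integrable (lebesgue_on \<Omega>) (\<lambda>x. w x * (grad \<phi> x \<bullet> b))"
      "integrable (lebesgue_on \<Omega>) (\<lambda>x. \<phi> x * (G x \<bullet> b))"
      "integrable (lebesgue_on \<Omega>) (\<lambda>x. \<phi> x * (H x \<bullet> b))"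
      using u' w' L by (auto intro!: L2_mult_integrable L2_inner_const)
    have "(LINT x|lebesgue_on \<Omega>. (u x + c * w x) * (grad \<phi> x \<bullet> b)) =
      (LINT x|lebesgue_on \<Omega>. u x * (grad \<phi> x \<bullet> b) + c * (w x * (grad \<phi> x \<bullet> b)))"
      by (simp add: algebra_simps)
    also have "\<dots> = (LINT x|lebesgue_on \<Omega>. u x * (grad \<phi> x \<bullet> b)) + c * (LINT x|lebesgue_on \<Omega>. w x * (grad \<phi> x \<bullet> b))"
      using i by simp
    also have "\<dots> = - ((LINT x|lebesgue_on \<Omega>. \<phi> x * (G x \<bullet> b)) + c * (LINT x|lebesgue_on \<Omega>. \<phi> x * (H x \<bullet> b)))"
      using u' w' t by simp
    also have "\<dots> = - (LINT x|lebesgue_on \<Omega>. \<phi> x * (G x \<bullet> b) + c * (\<phi> x * (H x \<bullet> b)))"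
      using i by simp
    also have "\<dots> = - (LINT x|lebesgue_on \<Omega>. \<phi> x * ((G x + c *\<^sub>R H x) \<bullet> b))"
      by (simp add: algebra_simps inner_add_left)
    finally show "(LINT x|lebesgue_on \<Omega>. (u x + c * w x) * (grad \<phi> x \<bullet> b)) =
      - (LINT x|lebesgue_on \<Omega>. \<phi> x * ((G x + c *\<^sub>R H x) \<bullet> b))" .
  qed
qed

text \<open>The weak gradient is a closed operator: for a fixed test function both sides of its
  defining identity are L2-continuous.\<close>

lemma H1_limit:
  assumes \<Omega>: "\<Omega> \<in> lmeasurable" and un: "\<And>n. H1_with_gradient \<Omega> (u n) (G n)"
    and L: "L2 (lebesgue_on \<Omega>) v" "L2 (lebesgue_on \<Omega>) H"
    and lim: "(\<lambda>n. LINT x|lebesgue_on \<Omega>. (norm (u n x - v x))\<^sup>2) \<longlonglongrightarrow> 0"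
      "(\<lambda>n. LINT x|lebesgue_on \<Omega>. (norm (G n x - H x))\<^sup>2) \<longlonglongrightarrow> 0"
  shows "H1_with_gradient \<Omega> v H"
  unfolding H1_iff[OF \<Omega>]
proof (intro conjI allI impI L)
  fix \<phi> and b :: 'a assume t: "test_function \<Omega> \<phi>"
  note L\<phi> = test_function_L2[OF t \<Omega>]
  have \<phi>b: "L2 (lebesgue_on \<Omega>) (\<lambda>x. \<phi> x *\<^sub>R b)"
    by (rule L2_dominated[OF L\<phi>(1), where C="norm b"]) (use L\<phi>(1) in \<open>auto simp: mult.commute\<close>)
  have "(\<lambda>n. LINT x|lebesgue_on \<Omega>. u n x \<bullet> (grad \<phi> x \<bullet> b)) \<longlonglongrightarrow> (LINT x|lebesgue_on \<Omega>. v x \<bullet> (grad \<phi> x \<bullet> b))"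
    by (rule L2_tendsto_inner[OF H1_L2(1)[OF un] L(1) L2_inner_const[OF L\<phi>(2)] lim(1)])
  moreover have "(\<lambda>n. LINT x|lebesgue_on \<Omega>. G n x \<bullet> (\<phi> x *\<^sub>R b)) \<longlonglongrightarrow> (LINT x|lebesgue_on \<Omega>. H x \<bullet> (\<phi> x *\<^sub>R b))"
    by (rule L2_tendsto_inner[OF H1_L2(2)[OF un] L(2) \<phi>b lim(2)])
  moreover have "(LINT x|lebesgue_on \<Omega>. u n x * (grad \<phi> x \<bullet> b)) = - (LINT x|lebesgue_on \<Omega>. \<phi> x * (G n x \<bullet> b))" for n
    using un[of n] t unfolding H1_iff[OF \<Omega>] by blast
  ultimately have "(\<lambda>n. LINT x|lebesgue_on \<Omega>. \<phi> x * (G n x \<bullet> b)) \<longlonglongrightarrow> (LINT x|lebesgue_on \<Omega>. \<phi> x * (H x \<bullet> b))"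
    "(\<lambda>n. - (LINT x|lebesgue_on \<Omega>. \<phi> x * (G n x \<bullet> b))) \<longlonglongrightarrow> (LINT x|lebesgue_on \<Omega>. v x * (grad \<phi> x \<bullet> b))"
    by simp_all
  from LIMSEQ_unique[OF this(2) tendsto_minus[OF this(1)]]
  show "(LINT x|lebesgue_on \<Omega>. v x * (grad \<phi> x \<bullet> b)) = - (LINT x|lebesgue_on \<Omega>. \<phi> x * (H x \<bullet> b))" .
qed

text \<open>The product of \<open>f\<close> with a test function is a test function on the whole
  space, so every directional derivative of it integrates to zero; the product rule then gives the
  weak identity, with no boundary term whatever the shape of the domain.\<close>

lemma H1_smooth:
  fixes f :: "'a::euclidean_space \<Rightarrow> real"
  assumes \<Omega>: "bounded \<Omega>" "\<Omega> \<in> sets lebesgue"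
    and f: "\<And>x. f differentiable (at x)" "continuous_on UNIV (grad f)"
  shows "H1_with_gradient \<Omega> f (grad f)"
proof -
  have \<Omega>': "\<Omega> \<in> lmeasurable" using \<Omega> by (rule bounded_set_imp_lmeasurable)
  interpret finite_measure "lebesgue_on \<Omega>" by (rule finite_measure_lebesgue_on[OF \<Omega>'])
  have fc: "continuous_on UNIV f"
    using f(1) by (auto simp: continuous_on_eq_continuous_at intro: differentiable_imp_continuous_within)
  have cpt: "compact (closure \<Omega>)" using \<Omega>(1) by (simp add: compact_closure)
  have "bounded (f ` closure \<Omega>)" "bounded (grad f ` closure \<Omega>)"
    by (auto intro!: compact_imp_bounded compact_continuous_image cpt intro: continuous_on_subset[OF fc] continuous_on_subset[OF f(2)])
  then obtain C1 C2 where C: "\<forall>x\<in>closure \<Omega>. norm (f x) \<le> C1" "\<forall>x\<in>closure \<Omega>. norm (grad f x) \<le> C2"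
    by (auto simp: bounded_iff)
  have L: "L2 (lebesgue_on \<Omega>) f" "L2 (lebesgue_on \<Omega>) (grad f)"
    using C closure_subset[of \<Omega>]
    by (auto intro!: L2_bounded[of f C1] L2_bounded[of "grad f" C2] borel_measurable_continuous_onI fc f(2) simp: space_restrict_space subset_eq)
  show ?thesis
    unfolding H1_iff[OF \<Omega>']
  proof (intro conjI allI impI L)
    fix \<phi> b assume t: "test_function \<Omega> \<phi>"
    note tD = test_functionD[OF t] and L\<phi> = test_function_L2[OF t \<Omega>']
    let ?p = "\<lambda>x. f x * \<phi> x"
    have gp: "grad ?p x = f x *\<^sub>R grad \<phi> x + \<phi> x *\<^sub>R grad f x" for x
      by (rule grad_mult[OF f(1) tD(5)])
    have tp: "test_function UNIV ?p"
      unfolding test_function_def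
    proof (intro conjI allI)
      have "closure {x. ?p x \<noteq> 0} \<subseteq> closure {x. \<phi> x \<noteq> 0}"
        by (rule closure_mono) auto
      hence "closure {x. ?p x \<noteq> 0} = closure {x. \<phi> x \<noteq> 0} \<inter> closure {x. ?p x \<noteq> 0}" by blast
      thus "compact (closure {x. ?p x \<noteq> 0})"
        using compact_Int_closed[OF tD(6) closed_closure] by metis
      show "continuous_on UNIV (grad ?p)"
        unfolding gp[abs_def] by (intro continuous_intros fc tD(1,2) f(2))
    qed (auto intro!: f(1) tD(5) differentiable_mult)
    have i: "integrable (lebesgue_on \<Omega>) (\<lambda>x. f x * (grad \<phi> x \<bullet> b))"
      "integrable (lebesgue_on \<Omega>) (\<lambda>x. \<phi> x * (grad f x \<bullet> b))"
      using L L\<phi> by (auto intro!: L2_mult_integrable L2_inner_const)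
    have "0 = (LINT x|lborel. grad ?p x \<bullet> b)" by (rule integral_directional_derivative_0[OF tp, symmetric])
    also have "\<dots> = (LINT x|lebesgue_on \<Omega>. grad ?p x \<bullet> b)"
    proof (rule integral_lebesgue_on_eq_lborel[symmetric])
      show "(\<lambda>x. grad ?p x \<bullet> b) \<in> borel_measurable borel"
        using test_functionD(4)[OF tp] by measurable
    qed (use tD(8,9) \<Omega>(2) in \<open>auto simp: gp\<close>)
    also have "\<dots> = (LINT x|lebesgue_on \<Omega>. f x * (grad \<phi> x \<bullet> b) + \<phi> x * (grad f x \<bullet> b))"
      by (simp add: gp inner_add_left)
    also have "\<dots> = (LINT x|lebesgue_on \<Omega>. f x * (grad \<phi> x \<bullet> b)) + (LINT x|lebesgue_on \<Omega>. \<phi> x * (grad f x \<bullet> b))"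
      using i by simp
    finally show "(LINT x|lebesgue_on \<Omega>. f x * (grad \<phi> x \<bullet> b)) = - (LINT x|lebesgue_on \<Omega>. \<phi> x * (grad f x \<bullet> b))"
      by linarith
  qed
qed

lemma grad_const: "grad (\<lambda>x. c) = (\<lambda>x. 0)"
  by (rule ext, rule grad_eqI) simp

lemma H1_const:
  assumes "bounded \<Omega>" "\<Omega> \<in> sets lebesgue"
  shows "H1_with_gradient \<Omega> (\<lambda>x. c) (\<lambda>x. 0)"
  using H1_smooth[OF assms, of "\<lambda>x. c"] by (simp add: grad_const)

lemma L2_scaleR_integral_bound:
  fixes u :: "'a \<Rightarrow> real"
  assumes "L2 M u" "L2 M \<psi>"
  shows "(norm (LINT x|M. u x *\<^sub>R \<psi> x))\<^sup>2 \<le> (LINT x|M. (u x)\<^sup>2) * (LINT x|M. (norm (\<psi> x))\<^sup>2)"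
proof -
  have n: "L2 M (\<lambda>x. norm (u x))" "L2 M (\<lambda>x. norm (\<psi> x))" using assms by (auto simp: L2_def)
  have "norm (LINT x|M. u x *\<^sub>R \<psi> x) \<le> (LINT x|M. norm (u x *\<^sub>R \<psi> x))"
    by (rule integral_norm_bound)
  also have "\<dots> = (LINT x|M. norm (u x) \<bullet> norm (\<psi> x))" by simp
  finally have "(norm (LINT x|M. u x *\<^sub>R \<psi> x))\<^sup>2 \<le> (LINT x|M. norm (u x) \<bullet> norm (\<psi> x))\<^sup>2"
    by (intro power_mono) auto
  also have "\<dots> \<le> (LINT x|M. (u x)\<^sup>2) * (LINT x|M. (norm (\<psi> x))\<^sup>2)"
    using L2_Cauchy_Schwarz[OF n] by simp
  finally show ?thesis .
qed

text \<open>A minimising sequence for the Rayleigh quotient converges strongly: along a subsequence the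
  moments against \<open>\<psi>\<close> converge, and the parallelogram law for the nonnegative form
  \<open>\<integral>|\<nabla>u|\<^sup>2 - E \<integral>u\<^sup>2\<close> combined with \<open>quasi\<close> (where \<open>E < \<Lambda>\<close>) makes it a Cauchy sequence
  in \<open>H\<^sup>1\<close>. This replaces the Rellich compactness theorem.\<close>

lemma mu1_bounds:
  fixes \<Omega> :: "'a::euclidean_space set" and \<psi> :: "'a \<Rightarrow> 'c::euclidean_space"
  assumes bdd: "bounded \<Omega>" and leb: "\<Omega> \<in> sets lebesgue"
    and \<psi>: "L2 (lebesgue_on \<Omega>) \<psi>" and C: "C \<ge> 0"
    and quasi: "\<And>u G. H1_with_gradient \<Omega> u G \<Longrightarrow>
      \<Lambda> * (LINT x|lebesgue_on \<Omega>. (u x)\<^sup>2) \<le>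
        (LINT x|lebesgue_on \<Omega>. (norm (G x))\<^sup>2) + C * (norm (LINT x|lebesgue_on \<Omega>. u x *\<^sub>R \<psi> x))\<^sup>2"
    and \<kappa>: "\<kappa> > 0"
    and poinc: "\<And>u G. H1_with_gradient \<Omega> u G \<Longrightarrow> (LINT x|lebesgue_on \<Omega>. u x) = 0 \<Longrightarrow>
      \<kappa> * (LINT x|lebesgue_on \<Omega>. (u x)\<^sup>2) \<le> (LINT x|lebesgue_on \<Omega>. (norm (G x))\<^sup>2)"
    and u0: "H1_with_gradient \<Omega> u0 G0" "(LINT x|lebesgue_on \<Omega>. u0 x) = 0"
      "(LINT x|lebesgue_on \<Omega>. (u0 x)\<^sup>2) > 0"
      "(LINT x|lebesgue_on \<Omega>. (norm (G0 x))\<^sup>2) \<le> t * (LINT x|lebesgue_on \<Omega>. (u0 x)\<^sup>2)" "t < \<Lambda>"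
  shows "\<kappa> \<le> mu1 \<Omega>" "mu1 \<Omega> \<le> t"
proof -
  let ?M = "lebesgue_on \<Omega>"
  have \<Omega>: "\<Omega> \<in> lmeasurable" using bdd leb by (rule bounded_set_imp_lmeasurable)
  interpret finite_measure ?M by (rule finite_measure_lebesgue_on[OF \<Omega>])
  define Bf where "Bf u = (LINT x|?M. (u x)\<^sup>2)" for u :: "'a \<Rightarrow> real"
  define Af where "Af G = (LINT x|?M. (norm (G x))\<^sup>2)" for G :: "'a \<Rightarrow> 'a"
  define V where "V = {(u, G). H1_with_gradient \<Omega> u G \<and> (LINT x|?M. u x) = 0}"
  have Bpos: "Bf u \<ge> 0" and Apos: "Af G \<ge> 0" for u G
    unfolding Bf_def Af_def by (rule Bochner_Integration.integral_nonneg, simp)+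
  have VL: "L2 ?M u" "L2 ?M G" if "(u, G) \<in> V" for u G
    using that H1_L2 by (auto simp: V_def)
  have Vlin: "((\<lambda>x. u x + c * w x), (\<lambda>x. G x + c *\<^sub>R H x)) \<in> V" if "(u, G) \<in> V" "(w, H) \<in> V" for u G w H c
    using that H1_add_scaleR[OF \<Omega>, of u G w H c] L2_integrable[OF VL(1)[OF that(1)]] L2_integrable[OF VL(1)[OF that(2)]]
    by (simp add: V_def)
  have Bexp: "Bf (\<lambda>x. u x + c * w x) = Bf u + 2 * c * (LINT x|?M. u x * w x) + c\<^sup>2 * Bf w"
    if "L2 ?M u" "L2 ?M w" for u w c
    using L2_norm_add_scaleR_square[OF that, of c] by (simp add: Bf_def)
  have Aexp: "Af (\<lambda>x. G x + c *\<^sub>R H x) = Af G + 2 * c * (LINT x|?M. G x \<bullet> H x) + c\<^sup>2 * Af H"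
    if "L2 ?M G" "L2 ?M H" for G H c
    using L2_norm_add_scaleR_square[OF that, of c] by (simp add: Af_def)
  have zeroV: "((\<lambda>x. 0), (\<lambda>x. 0)) \<in> V"
    using H1_const[OF bdd leb, of 0] by (simp add: V_def)
  have scaleV: "((\<lambda>x. c * w x), (\<lambda>x. c *\<^sub>R H x)) \<in> V" if "(w, H) \<in> V" for w H c
    using Vlin[OF zeroV that, of c] by simp
  have Bscale: "Bf (\<lambda>x. c * w x) = c\<^sup>2 * Bf w" for c w by (simp add: Bf_def power_mult_distrib)
  have Ascale: "Af (\<lambda>x. c *\<^sub>R H x) = c\<^sup>2 * Af H" for c H by (simp add: Af_def power_mult_distrib)
  \<comment> \<open>Its infimum is the candidate eigenvalue: the least energy among mean-zero
    functions of unit L2 norm.\<close>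
  define R where "R = {Af G | u G. (u, G) \<in> V \<and> Bf u = 1}"
  define E where "E = Inf R"
  have normalize: "Af G / Bf u \<in> R" if "(u, G) \<in> V" "Bf u > 0" for u G
  proof -
    let ?c = "1 / sqrt (Bf u)"
    have c2: "?c\<^sup>2 = 1 / Bf u" using that(2) by (simp add: power_divide)
    have "((\<lambda>x. ?c * u x), (\<lambda>x. ?c *\<^sub>R G x)) \<in> V" by (rule scaleV[OF that(1)])
    moreover have "Bf (\<lambda>x. ?c * u x) = 1" unfolding Bscale c2 using that(2) by simp
    moreover have "Af (\<lambda>x. ?c *\<^sub>R G x) = Af G / Bf u" unfolding Ascale c2 by simp
    ultimately show ?thesis unfolding R_def by (metis (mono_tags, lifting) mem_Collect_eq)
  qed
  have R_ge: "\<kappa> \<le> r" if rR: "r \<in> R" for r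
  proof -
    obtain G u where "r = Af G" "(u, G) \<in> V" "Bf u = 1" using rR unfolding R_def by blast
    thus ?thesis using poinc[of u G] by (simp add: V_def Af_def Bf_def)
  qed
  have bdd_R: "bdd_below R" using R_ge by (rule bdd_belowI)
  have u0V: "(u0, G0) \<in> V" using u0 by (simp add: V_def)
  have Bu0: "Bf u0 > 0" using u0 by (simp add: Bf_def)
  have R_ne: "R \<noteq> {}" using normalize[OF u0V Bu0] by blast
  have E_ge: "\<kappa> \<le> E" unfolding E_def using R_ne R_ge by (rule cInf_greatest)
  have E_le: "E \<le> t"
  proof -
    have "E \<le> Af G0 / Bf u0" unfolding E_def by (rule cInf_lower[OF normalize[OF u0V Bu0] bdd_R])
    also have "\<dots> \<le> t" using u0(4) Bu0 by (simp add: Af_def Bf_def field_simps)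
    finally show ?thesis .
  qed
  have Emin: "E * Bf u \<le> Af G" if "(u, G) \<in> V" for u G
  proof (cases "Bf u = 0")
    case True
    thus ?thesis using Apos by simp
  next
    case False
    hence B: "Bf u > 0" using Bpos[of u] by linarith
    have "E \<le> Af G / Bf u" unfolding E_def by (rule cInf_lower[OF normalize[OF that B] bdd_R])
    thus ?thesis using B by (simp add: field_simps)
  qed
  have "\<exists>p. p \<in> V \<and> Bf (fst p) = 1 \<and> Af (snd p) < E + 1 / real (Suc n)" for n
  proof -
    have "\<exists>r\<in>R. r < E + 1 / real (Suc n)"
      by (rule cInf_lessD[OF R_ne]) (simp add: E_def[symmetric])
    thus ?thesis by (auto simp: R_def)
  qed
  then obtain P where P: "\<And>n. P n \<in> V" "\<And>n. Bf (fst (P n)) = 1" "\<And>n. Af (snd (P n)) < E + 1 / real (Suc n)"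
    by metis
  define u where "u n = fst (P n)" for n
  define G where "G n = snd (P n)" for n
  have uV: "(u n, G n) \<in> V" and uB: "Bf (u n) = 1" and GA: "Af (G n) < E + 1 / real (Suc n)" for n
    using P[of n] by (auto simp: u_def G_def)
  have uL: "L2 ?M (u n)" and GL: "L2 ?M (G n)" for n using VL[OF uV] by auto
  define l where "l n = (LINT x|?M. u n x *\<^sub>R \<psi> x)" for n
  have "bounded (range l)"
  proof (rule boundedI)
    fix y assume "y \<in> range l"
    then obtain n where y: "y = l n" by auto
    have "(norm (l n))\<^sup>2 \<le> (LINT x|?M. (norm (\<psi> x))\<^sup>2)"
      using L2_scaleR_integral_bound[OF uL[of n] \<psi>] uB[of n] by (simp add: l_def Bf_def)
    thus "norm y \<le> sqrt (LINT x|?M. (norm (\<psi> x))\<^sup>2)"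
      unfolding y by (rule real_le_rsqrt)
  qed
  then obtain l0 r where r: "strict_mono r" and lr: "(l \<circ> r) \<longlonglongrightarrow> l0"
    using bounded_imp_convergent_subsequence by blast
  have r_ge: "n \<le> r n" for n by (rule seq_suble[OF r])
  have E\<Lambda>: "E < \<Lambda>" using E_le u0(5) by linarith
  have Epos: "E > 0" using E_ge \<kappa> by linarith
  \<comment> \<open>Function and gradient are paired into one L2 function, so that convergence in
    H^1 is a single application of L2 completeness.\<close>
  define U where "U n x = (u (r n) x, G (r n) x)" for n x
  have UL: "L2 ?M (U n)" for n unfolding U_def using uL GL by (simp add: L2_Pair_iff)
  have diffV: "((\<lambda>x. u m x - u n x), (\<lambda>x. G m x - G n x)) \<in> V" for m n
    using Vlin[OF uV[of m] uV[of n], of "-1"] by simp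
  have Udiff: "(LINT x|?M. (norm (U m x - U n x))\<^sup>2) =
      Bf (\<lambda>x. u (r m) x - u (r n) x) + Af (\<lambda>x. G (r m) x - G (r n) x)" for m n
    using VL[OF diffV[of "r m" "r n"]]
    by (simp add: U_def norm_Pair Bf_def Af_def L2_def)
  \<comment> \<open>The form \<open>Af - E * Bf\<close> of a difference is small, and
    \<open>quasi\<close> controls \<open>(\<Lambda> - E) * Bf\<close>. The factor \<open>k\<close>
    converts the latter into a bound for \<open>(E + 1) * Bf\<close>, which added to the form gives
    the full H^1 norm.\<close>
  define k where "k = (E + 1) / (\<Lambda> - E)"
  have k: "k > 0" using E\<Lambda> Epos by (simp add: k_def)
  have main: "(LINT x|?M. (norm (U m x - U n x))\<^sup>2) \<le>
      (1 + k) * (2 / real (Suc m) + 2 / real (Suc n)) + k * C * (norm ((l \<circ> r) m - (l \<circ> r) n))\<^sup>2" for m n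
  proof -
    let ?m = "r m" and ?n = "r n"
    let ?w = "\<lambda>x. u ?m x - u ?n x" and ?H = "\<lambda>x. G ?m x - G ?n x"
    have "E * Bf (\<lambda>x. u ?m x + 1 * u ?n x) \<le> Af (\<lambda>x. G ?m x + 1 *\<^sub>R G ?n x)"
      by (rule Emin[OF Vlin[OF uV uV]])
    moreover have "E * Bf ?w = 2 * E - 2 * (E * (LINT x|?M. u ?m x * u ?n x))"
    proof -
      have "Bf ?w = 2 - 2 * (LINT x|?M. u ?m x * u ?n x)"
        using Bexp[OF uL uL, of ?m "-1" ?n] uB by simp
      thus ?thesis by (simp only: right_diff_distrib mult.left_commute mult.commute[of E 2])
    qed
    moreover have "E * Bf (\<lambda>x. u ?m x + 1 * u ?n x) = 2 * E + 2 * (E * (LINT x|?M. u ?m x * u ?n x))"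
    proof -
      have "Bf (\<lambda>x. u ?m x + 1 * u ?n x) = 2 + 2 * (LINT x|?M. u ?m x * u ?n x)"
        using Bexp[OF uL uL, of ?m 1 ?n] uB by simp
      thus ?thesis by (simp only: distrib_left mult.left_commute mult.commute[of E 2])
    qed
    moreover have "Af ?H = Af (G ?m) + Af (G ?n) - 2 * (LINT x|?M. G ?m x \<bullet> G ?n x)"
      using Aexp[OF GL GL, of ?m "-1" ?n] by simp
    moreover have "Af (\<lambda>x. G ?m x + 1 *\<^sub>R G ?n x) = Af (G ?m) + Af (G ?n) + 2 * (LINT x|?M. G ?m x \<bullet> G ?n x)"
      using Aexp[OF GL GL, of ?m 1 ?n] by simp
    ultimately have "Af ?H - E * Bf ?w \<le> 2 * Af (G ?m) + 2 * Af (G ?n) - 4 * E"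
      by linarith
    also have "\<dots> \<le> 2 / real (Suc ?m) + 2 / real (Suc ?n)"
    proof -
      have "2 / y = 2 * (1 / y)" for y :: real by simp
      from this[of "real (Suc ?m)"] this[of "real (Suc ?n)"] show ?thesis
        using GA[of ?m] GA[of ?n] by linarith
    qed
    also have "\<dots> \<le> 2 / real (Suc m) + 2 / real (Suc n)"
      using r_ge[of m] r_ge[of n] by (intro add_mono divide_left_mono) auto
    finally have F: "Af ?H - E * Bf ?w \<le> 2 / real (Suc m) + 2 / real (Suc n)" (is "?F \<le> ?\<epsilon>") .
    have "l ?m - l ?n = (LINT x|?M. ?w x *\<^sub>R \<psi> x)"
      using L2_scaleR_integrable[OF uL \<psi>] by (simp add: l_def scaleR_diff_left)
    moreover have "\<Lambda> * Bf ?w \<le> Af ?H + C * (norm (LINT x|?M. ?w x *\<^sub>R \<psi> x))\<^sup>2"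
      using quasi[of ?w ?H] diffV[of ?m ?n] by (simp add: V_def Bf_def Af_def)
    ultimately have "(\<Lambda> - E) * Bf ?w \<le> ?\<epsilon> + C * (norm (l ?m - l ?n))\<^sup>2"
      using F by (simp add: algebra_simps)
    hence B: "(E + 1) * Bf ?w \<le> k * (?\<epsilon> + C * (norm (l ?m - l ?n))\<^sup>2)"
      using E\<Lambda> Epos unfolding k_def
      by (simp only: times_divide_eq_left) (simp add: pos_le_divide_eq mult.assoc mult_left_mono mult.commute mult.left_commute)
    have "Bf ?w + Af ?H = ?F + (E + 1) * Bf ?w" by (simp add: algebra_simps)
    also have "\<dots> \<le> ?\<epsilon> + k * (?\<epsilon> + C * (norm (l ?m - l ?n))\<^sup>2)" using F B by linarith
    also have "\<dots> = (1 + k) * ?\<epsilon> + k * C * (norm (l ?m - l ?n))\<^sup>2" by (simp only: distrib_left distrib_right mult_1 mult.assoc)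
    finally show ?thesis unfolding Udiff by simp
  qed
  have Cau: "\<exists>N. \<forall>m\<ge>N. \<forall>n\<ge>N. (LINT x|?M. (norm (U m x - U n x))\<^sup>2) \<le> e" if e: "e > 0" for e
  proof -
    have "(\<lambda>n. (1 + k) * (4 / real (Suc n))) \<longlonglongrightarrow> (1 + k) * 0"
      by (intro tendsto_intros LIMSEQ_Suc[OF lim_const_over_n])
    hence "\<forall>\<^sub>F n in sequentially. (1 + k) * (4 / real (Suc n)) < e / 2"
      using e by (intro order_tendstoD) auto
    then obtain N1 where N1: "(1 + k) * (4 / real (Suc N1)) < e / 2"
      by (auto simp: eventually_sequentially)
    \<comment> \<open>The cap at 1 makes the square of \<open>d\<close> at most \<open>d\<close>, so
      the quadratic moment term is controlled by a bound linear in \<open>d\<close>.\<close>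
    define d where "d = min 1 (e / (2 * (k * C + 1)))"
    have kC: "k * C \<ge> 0" using k C by simp
    have d: "d > 0" "d \<le> 1" "d * (k * C + 1) \<le> e / 2"
    proof -
      show "d > 0" "d \<le> 1" using e kC by (auto simp: d_def)
      have "d \<le> e / (2 * (k * C + 1))" by (simp add: d_def)
      thus "d * (k * C + 1) \<le> e / 2" using kC by (simp add: field_simps)
    qed
    have "Cauchy (l \<circ> r)" using lr LIMSEQ_imp_Cauchy by blast
    from CauchyD[OF this d(1)] obtain N2 where N2: "\<And>m n. m \<ge> N2 \<Longrightarrow> n \<ge> N2 \<Longrightarrow> norm ((l \<circ> r) m - (l \<circ> r) n) < d"
      by blast
    show ?thesis
    proof (intro exI[of _ "max N1 N2"] allI impI)
      fix m n assume mn: "max N1 N2 \<le> m" "max N1 N2 \<le> n"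
      have "(1 + k) * (2 / real (Suc m) + 2 / real (Suc n)) \<le> (1 + k) * (2 / real (Suc N1) + 2 / real (Suc N1))"
        using mn k by (intro mult_left_mono add_mono divide_left_mono) auto
      also have "\<dots> = (1 + k) * (4 / real (Suc N1))" by simp
      finally have 1: "(1 + k) * (2 / real (Suc m) + 2 / real (Suc n)) \<le> e / 2" using N1 by linarith
      have "(norm ((l \<circ> r) m - (l \<circ> r) n))\<^sup>2 \<le> d\<^sup>2"
        using N2[of m n] mn by (intro power_mono) auto
      also have "\<dots> \<le> d" using d by (simp add: power2_eq_square mult_left_le)
      finally have "k * C * (norm ((l \<circ> r) m - (l \<circ> r) n))\<^sup>2 \<le> k * C * d" by (rule mult_left_mono[OF _ kC])
      also have "\<dots> \<le> e / 2" using d by (simp add: algebra_simps)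
      finally show "(LINT x|?M. (norm (U m x - U n x))\<^sup>2) \<le> e" using main[of m n] 1 by linarith
    qed
  qed
  obtain W where WL: "L2 ?M W" and Wlim: "(\<lambda>n. LINT x|?M. (norm (U n x - W x))\<^sup>2) \<longlonglongrightarrow> 0"
    using L2_complete[OF UL Cau] .
  define v where "v x = fst (W x)" for x
  define H where "H x = snd (W x)" for x
  have Weq: "W = (\<lambda>x. (v x, H x))" by (simp add: v_def H_def)
  have vL: "L2 ?M v" and HL: "L2 ?M H" using WL unfolding Weq L2_Pair_iff by auto
  have split: "(LINT x|?M. (norm (U n x - W x))\<^sup>2) =
    (LINT x|?M. (norm (u (r n) x - v x))\<^sup>2) + (LINT x|?M. (norm (G (r n) x - H x))\<^sup>2)" for n
    using L2_diff[OF uL[of "r n"] vL] L2_diff[OF GL[of "r n"] HL] by (simp add: U_def Weq norm_Pair L2_def)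
  have pos: "0 \<le> (LINT x|?M. (norm (u (r n) x - v x))\<^sup>2)" "0 \<le> (LINT x|?M. (norm (G (r n) x - H x))\<^sup>2)" for n
    by (rule Bochner_Integration.integral_nonneg, simp)+
  have lim1: "(\<lambda>n. LINT x|?M. (norm (u (r n) x - v x))\<^sup>2) \<longlonglongrightarrow> 0"
    by (rule tendsto_sandwich[OF always_eventually always_eventually tendsto_const Wlim]) (use pos split in auto)
  have lim2: "(\<lambda>n. LINT x|?M. (norm (G (r n) x - H x))\<^sup>2) \<longlonglongrightarrow> 0"
    by (rule tendsto_sandwich[OF always_eventually always_eventually tendsto_const Wlim]) (use pos split in auto)
  have H1: "H1_with_gradient \<Omega> v H"
    by (rule H1_limit[OF \<Omega> _ vL HL lim1 lim2]) (use uV in \<open>auto simp: V_def\<close>)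
  have L1: "L2 ?M (\<lambda>x. 1::real)" by (rule L2_bounded[of _ 1]) auto
  have "(LINT x|?M. v x) = 0"
  proof -
    have "(\<lambda>n. LINT x|?M. u (r n) x \<bullet> 1) \<longlonglongrightarrow> (LINT x|?M. v x \<bullet> 1)"
      by (rule L2_tendsto_inner[OF uL vL L1 lim1])
    moreover have "(LINT x|?M. u (r n) x \<bullet> 1) = 0" for n using uV[of "r n"] by (simp add: V_def)
    ultimately show ?thesis using LIMSEQ_unique[OF tendsto_const, of 0] by simp
  qed
  with H1 have vV: "(v, H) \<in> V" by (simp add: V_def)
  have Bv: "Bf v = 1"
  proof -
    have "(\<lambda>n. LINT x|?M. (norm (u (r n) x))\<^sup>2) \<longlonglongrightarrow> (LINT x|?M. (norm (v x))\<^sup>2)"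
      by (rule L2_tendsto_norm_square[OF uL vL lim1])
    moreover have "(LINT x|?M. (norm (u (r n) x))\<^sup>2) = 1" for n using uB[of "r n"] by (simp add: Bf_def)
    ultimately show ?thesis using LIMSEQ_unique[OF tendsto_const, of 1] by (simp add: Bf_def)
  qed
  have AH: "Af H = E"
  proof (rule antisym)
    have "(\<lambda>n. LINT x|?M. (norm (G (r n) x))\<^sup>2) \<longlonglongrightarrow> (LINT x|?M. (norm (H x))\<^sup>2)"
      by (rule L2_tendsto_norm_square[OF GL HL lim2])
    hence a: "(\<lambda>n. Af (G (r n))) \<longlonglongrightarrow> Af H" by (simp add: Af_def)
    have "(\<lambda>n. E + 1 / real (Suc n)) \<longlonglongrightarrow> E + 0"
      by (intro tendsto_intros LIMSEQ_Suc[OF lim_const_over_n])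
    hence b: "(\<lambda>n. E + 1 / real (Suc n)) \<longlonglongrightarrow> E" by simp
    show "Af H \<le> E"
    proof (rule LIMSEQ_le[OF a b], intro exI[of _ 0] allI impI)
      fix n
      have "1 / real (Suc (r n)) \<le> 1 / real (Suc n)" using r_ge[of n] by (intro divide_left_mono) auto
      thus "Af (G (r n)) \<le> E + 1 / real (Suc n)" using GA[of "r n"] by linarith
    qed
    show "E \<le> Af H" using Emin[OF vV] Bv by simp
  qed
  have EL0: "(LINT x|?M. H x \<bullet> K x) = E * (LINT x|?M. v x * w x)" if wV: "(w, K) \<in> V" for w K
  proof -
    have "(LINT x|?M. H x \<bullet> K x) - E * (LINT x|?M. v x * w x) = 0"
    proof (rule linear_coefficient_zero_if_nonneg)
      fix s :: real
      have "E * Bf (\<lambda>x. v x + s * w x) \<le> Af (\<lambda>x. H x + s *\<^sub>R K x)"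
        by (rule Emin[OF Vlin[OF vV wV]])
      thus "0 \<le> 2 * s * ((LINT x|?M. H x \<bullet> K x) - E * (LINT x|?M. v x * w x)) + s\<^sup>2 * (Af K - E * Bf w)"
        unfolding Bexp[OF vL VL(1)[OF wV]] Aexp[OF HL VL(2)[OF wV]] Bv AH by (simp add: algebra_simps)
    qed
    thus ?thesis by simp
  qed
  \<comment> \<open>An arbitrary test function differs from a mean-zero one by a constant, which has
    zero gradient and is orthogonal to \<open>v\<close>.\<close>
  have EL: "(LINT x|?M. H x \<bullet> K x) = E * (LINT x|?M. v x * w x)" if w: "H1_with_gradient \<Omega> w K" for w K
  proof -
    define c where "c = (LINT x|?M. w x) / measure ?M (space ?M)"
    have wL: "L2 ?M w" and wi: "integrable ?M w" using H1_L2[OF w] L2_integrable by auto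
    have "(LINT x|?M. w x * 1)\<^sup>2 \<le> Bf w * measure ?M (space ?M)"
      using L2_Cauchy_Schwarz[OF wL L1] by (simp add: Bf_def)
    \<comment> \<open>For a domain of measure zero, \<open>c\<close> is 0 by division by zero, and
      the preceding bound forces the integral of \<open>w\<close> to vanish too.\<close>
    hence c: "c * measure ?M (space ?M) = (LINT x|?M. w x)"
      by (cases "measure ?M (space ?M) = 0") (auto simp: c_def)
    have "H1_with_gradient \<Omega> (\<lambda>x. w x + (- c) * 1) (\<lambda>x. K x + (- c) *\<^sub>R 0)"
      by (rule H1_add_scaleR[OF \<Omega> w H1_const[OF bdd leb]])
    moreover have "(LINT x|?M. w x + (- c) * 1) = 0"
      using wi c by (simp add: mult.commute)
    ultimately have "((\<lambda>x. w x + (- c) * 1), K) \<in> V" by (simp add: V_def)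
    from EL0[OF this] have "(LINT x|?M. H x \<bullet> K x) = E * (LINT x|?M. v x * w x - c * v x)"
      by (simp add: algebra_simps)
    also have "(LINT x|?M. v x * w x - c * v x) = (LINT x|?M. v x * w x) - c * (LINT x|?M. v x)"
      using L2_mult_integrable[OF vL wL] L2_integrable[OF vL] by simp
    finally show ?thesis using vV by (simp add: V_def)
  qed
  have "mu1 \<Omega> = E"
    unfolding mu1_def
  proof (rule Least_equality)
    have "\<not> (AE x in ?M. v x = 0)"
      using L2_norm_square_eq_0_iff[OF vL] Bv by (simp add: Bf_def)
    hence "neumann_eigenvalue \<Omega> E"
      unfolding neumann_eigenvalue_def using H1 EL by blast
    thus "neumann_eigenvalue \<Omega> E \<and> E \<noteq> 0" using Epos by simp
  next
    fix \<mu> assume \<mu>: "neumann_eigenvalue \<Omega> \<mu> \<and> \<mu> \<noteq> 0"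
    then obtain z K where z: "H1_with_gradient \<Omega> z K" "\<not> (AE x in ?M. z x = 0)"
      and zE: "\<And>w H. H1_with_gradient \<Omega> w H \<Longrightarrow> (LINT x|?M. K x \<bullet> H x) = \<mu> * (LINT x|?M. z x * w x)"
      unfolding neumann_eigenvalue_def by blast
    \<comment> \<open>Testing with the constant 1 shows that an eigenfunction of a nonzero
      eigenvalue has mean zero, so it competes in the infimum defining \<open>E\<close>.\<close>
    have "(LINT x|?M. z x) = 0"
      using zE[OF H1_const[OF bdd leb, of 1]] \<mu> by simp
    hence zV: "(z, K) \<in> V" using z by (simp add: V_def)
    have "E * Bf z \<le> \<mu> * Bf z"
      using Emin[OF zV] zE[OF z(1)] by (simp add: Bf_def Af_def power2_norm_eq_inner) (simp add: power2_eq_square)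
    moreover have "Bf z > 0"
      using L2_norm_square_eq_0_iff[OF VL(1)[OF zV]] z(2) Bpos[of z] by (simp add: Bf_def less_le)
    ultimately show "E \<le> \<mu>" by simp
  qed
  thus "\<kappa> \<le> mu1 \<Omega>" "mu1 \<Omega> \<le> t" using E_ge E_le by auto
qed

section \<open>The bilinear map of the square onto the quadrilateral\<close>

definition open_square :: "(real^2) set" where
  "open_square = box (vector [-1/2, -1/2]) (vector [1/2, 1/2])"

lemma open_open_square: "open open_square"
  by (simp add: open_square_def open_box)

lemma bounded_open_square: "bounded open_square"
  by (simp add: open_square_def bounded_box)

lemma vector_2_eq_axis: "(vector [x, y] :: real^2) = x *\<^sub>R axis 1 1 + y *\<^sub>R axis 2 1"
  by (simp add: vec_eq_iff forall_2 axis_def)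

lemma mem_square: "w \<in> square \<longleftrightarrow> -1/2 \<le> w $ 1 \<and> w $ 1 \<le> 1/2 \<and> -1/2 \<le> w $ 2 \<and> w $ 2 \<le> 1/2"
  by (auto simp: square_def mem_box_cart forall_2)

lemma mem_open_square: "w \<in> open_square \<longleftrightarrow> -1/2 < w $ 1 \<and> w $ 1 < 1/2 \<and> -1/2 < w $ 2 \<and> w $ 2 < 1/2"
  by (auto simp: open_square_def mem_box_cart forall_2)

lemma interior_square: "interior square = open_square"
  by (simp add: square_def open_square_def interior_cbox)

lemma compact_square: "compact square"
  by (simp add: square_def)

lemma Phi_nth:
  "Phi p w $ 1 = w $ 1 - p $ 1 * w $ 1 - p $ 4 * w $ 2 - 2 * p $ 2 * w $ 1 * w $ 2"
  "Phi p w $ 2 = w $ 2 - p $ 4 * w $ 1 + p $ 1 * w $ 2 + 2 * p $ 3 * w $ 1 * w $ 2"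
  by (simp_all add: Phi_def Let_def)

definition DPhi :: "real^4 \<Rightarrow> real^2 \<Rightarrow> real^2 \<Rightarrow> real^2" where
  "DPhi p w h = vector
     [(1 - p $ 1 - 2 * p $ 2 * w $ 2) * h $ 1 + (- p $ 4 - 2 * p $ 2 * w $ 1) * h $ 2,
      (- p $ 4 + 2 * p $ 3 * w $ 2) * h $ 1 + (1 + p $ 1 + 2 * p $ 3 * w $ 1) * h $ 2]"

lemma has_derivative_Phi: "(Phi p has_derivative DPhi p w) (at w within S)"
proof -
  have "Phi p = (\<lambda>w. (w $ 1 - p $ 1 * w $ 1 - p $ 4 * w $ 2 - 2 * p $ 2 * w $ 1 * w $ 2) *\<^sub>R axis 1 1
    + (w $ 2 - p $ 4 * w $ 1 + p $ 1 * w $ 2 + 2 * p $ 3 * w $ 1 * w $ 2) *\<^sub>R axis 2 1)"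
    by (auto simp: Phi_def Let_def vector_2_eq_axis)
  moreover have "(\<dots> has_derivative DPhi p w) (at w within S)"
    unfolding DPhi_def vector_2_eq_axis
    by (auto intro!: derivative_eq_intros bounded_linear.has_derivative[OF bounded_linear_vec_nth] ext
        simp: algebra_simps)
  ultimately show ?thesis by simp
qed

lemma continuous_on_Phi: "continuous_on S (Phi p)"
  by (rule has_derivative_continuous_on[OF has_derivative_Phi])

lemma det_DPhi:
  "det (matrix (DPhi p w)) = (1 - p $ 1 - 2 * p $ 2 * w $ 2) * (1 + p $ 1 + 2 * p $ 3 * w $ 1)
    - (- p $ 4 - 2 * p $ 2 * w $ 1) * (- p $ 4 + 2 * p $ 3 * w $ 2)"
  by (simp add: det_2 matrix_def DPhi_def axis_def)

lemma J_eq_det: "J p w = det (matrix (DPhi p w))"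
  unfolding J_def jacobian_def using frechet_derivative_at[OF has_derivative_Phi] by simp

lemma J_eq:
  "J p w = (1 - (p $ 1)\<^sup>2 - (p $ 4)\<^sup>2) + (2 * p $ 3 * (1 - p $ 1) - 2 * p $ 2 * p $ 4) * w $ 1
    + (2 * p $ 3 * p $ 4 - 2 * p $ 2 * (1 + p $ 1)) * w $ 2"
  unfolding J_eq_det det_DPhi by (simp add: algebra_simps power2_eq_square)

lemma Phi_0: "Phi 0 w = w"
  by (simp add: vec_eq_iff forall_2 Phi_nth)

lemma J_0: "J 0 w = 1"
  by (simp add: J_eq)

lemma abs_nth_le_norm: "\<bar>p $ i\<bar> \<le> norm (p :: real^'n)"
  by (rule component_le_norm_cart)

lemma abs_product_diff_le:
  fixes x y x' y' :: real
  assumes "\<bar>x\<bar> \<le> 1" "\<bar>y'\<bar> \<le> 1"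
  shows "\<bar>x * y - x' * y'\<bar> \<le> \<bar>x - x'\<bar> + \<bar>y - y'\<bar>"
proof -
  have "\<bar>x * (y - y')\<bar> \<le> 1 * \<bar>y - y'\<bar>" "\<bar>y' * (x - x')\<bar> \<le> 1 * \<bar>x - x'\<bar>"
    unfolding abs_mult using assms by (intro mult_right_mono; simp)+
  moreover have "x * y - x' * y' = x * (y - y') + y' * (x - x')" by (simp add: algebra_simps)
  moreover have "\<bar>s + r\<bar> \<le> b + a" if "\<bar>s\<bar> \<le> 1 * a" "\<bar>r\<bar> \<le> 1 * b" for a b s r :: real
    using that by linarith
  ultimately show ?thesis by presburger
qed

text \<open>For small \<open>p\<close> the displacement of \<open>Phi p\<close> from the identity
  has Lipschitz constant at most 1/2; the bilinear terms are the only nonlinear ones. The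
  coordinates range up to 1 rather than 1/2, so that injectivity holds on a neighbourhood of the
  square.\<close>

lemma Phi_expansive:
  assumes p: "norm p \<le> 1/100"
    and w: "\<bar>w $ 1\<bar> \<le> 1" "\<bar>w $ 2\<bar> \<le> 1" and z: "\<bar>z $ 1\<bar> \<le> 1" "\<bar>z $ 2\<bar> \<le> 1"
  shows "norm (w - z) \<le> 2 * norm (Phi p w - Phi p z)"
proof -
  let ?d = "(Phi p w - w) - (Phi p z - z)"
  let ?x = "w $ 1 - z $ 1" and ?y = "w $ 2 - z $ 2" and ?q = "w $ 1 * w $ 2 - z $ 1 * z $ 2"
  have q: "\<bar>?q\<bar> \<le> \<bar>?x\<bar> + \<bar>?y\<bar>" using w z by (intro abs_product_diff_le) auto
  have pp: "\<bar>p $ i * r\<bar> \<le> (1/100) * \<bar>r\<bar>" for i r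
    unfolding abs_mult using abs_nth_le_norm[of p i] p by (intro mult_right_mono) auto
  have d1: "?d $ 1 = - (p $ 1 * ?x) - p $ 4 * ?y - 2 * (p $ 2 * ?q)"
    by (simp add: Phi_nth algebra_simps)
  have d2: "?d $ 2 = - (p $ 4 * ?x) + p $ 1 * ?y + 2 * (p $ 3 * ?q)"
    by (simp add: Phi_nth algebra_simps)
  have lin: "\<bar>- A - B - 2 * C\<bar> \<le> (3/100) * (X + Y) \<and> \<bar>- A + B + 2 * C\<bar> \<le> (3/100) * (X + Y)"
    if "\<bar>A\<bar> \<le> (1/100) * X" "\<bar>B\<bar> \<le> (1/100) * Y" "\<bar>C\<bar> \<le> (1/100) * R" "R \<le> X + Y"
    for A B C X Y R :: real
    using that unfolding abs_le_iff by (simp add: field_simps)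
  have "\<bar>?d $ 1\<bar> \<le> (3/100) * (\<bar>?x\<bar> + \<bar>?y\<bar>)"
    unfolding d1 by (rule lin[OF pp pp pp q, THEN conjunct1])
  moreover have "\<bar>?d $ 2\<bar> \<le> (3/100) * (\<bar>?x\<bar> + \<bar>?y\<bar>)"
    unfolding d2 by (rule lin[OF pp pp pp q, THEN conjunct2])
  moreover have "norm ?d \<le> \<bar>?d $ 1\<bar> + \<bar>?d $ 2\<bar>"
    using norm_le_l1_cart[of ?d] by (simp add: sum_2)
  moreover have "\<bar>?x\<bar> \<le> norm (w - z)" "\<bar>?y\<bar> \<le> norm (w - z)"
    using abs_nth_le_norm[of "w - z" 1] abs_nth_le_norm[of "w - z" 2] by auto
  moreover have "n \<le> m / 2" if "A \<le> (3/100) * (X + Y)" "B \<le> (3/100) * (X + Y)" "n \<le> A + B" "X \<le> m" "Y \<le> m" "0 \<le> m"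
    for A B X Y m n :: real using that by (simp add: field_simps)
  ultimately have "norm ?d \<le> norm (w - z) / 2" using norm_ge_zero[of "w - z"] by blast
  moreover have "norm (w - z) \<le> norm (Phi p w - Phi p z) + norm ?d"
    using norm_triangle_ineq4[of "Phi p w - Phi p z" ?d] by (simp add: algebra_simps)
  ultimately show ?thesis by linarith
qed

lemma inj_on_Phi:
  assumes "norm p \<le> 1/100"
  shows "inj_on (Phi p) {w. \<bar>w $ 1\<bar> \<le> 1 \<and> \<bar>w $ 2\<bar> \<le> 1}"
proof (rule inj_onI)
  fix w z assume "w \<in> {w. \<bar>w $ 1\<bar> \<le> 1 \<and> \<bar>w $ 2\<bar> \<le> 1}" "z \<in> {w. \<bar>w $ 1\<bar> \<le> 1 \<and> \<bar>w $ 2\<bar> \<le> 1}" "Phi p w = Phi p z"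
  thus "w = z" using Phi_expansive[OF assms, of w z] by auto
qed

lemma square_subset_unit_box: "square \<subseteq> {w. \<bar>w $ 1\<bar> \<le> 1 \<and> \<bar>w $ 2\<bar> \<le> 1}"
  by (auto simp: mem_square)

lemma inj_on_Phi_square: "norm p \<le> 1/100 \<Longrightarrow> inj_on (Phi p) square"
  using inj_on_subset[OF inj_on_Phi square_subset_unit_box] .

lemma open_square_subset: "open_square \<subseteq> square"
  using interior_subset[of square] by (simp add: interior_square)

text \<open>One inclusion is invariance of domain. For the other, injectivity on the larger open box
  makes the preimage of the interior an open set contained in the square, hence in its
  interior.\<close>

lemma interior_Phi_square:
  assumes p: "norm p \<le> 1/100"
  shows "interior (Phi p ` square) = Phi p ` open_square"
proof
  let ?U = "{w::real^2. \<bar>w $ 1\<bar> < 1 \<and> \<bar>w $ 2\<bar> < 1}"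
  have Ueq: "?U = box (vector [-1, -1]) (vector [1, 1])"
    by (auto simp: mem_box_cart forall_2 abs_less_iff)
  have U: "open ?U" unfolding Ueq by (rule open_box)
  have inj: "inj_on (Phi p) ?U"
    by (rule inj_on_subset[OF inj_on_Phi[OF p]]) auto
  have sub: "square \<subseteq> ?U" by (auto simp: mem_square)
  have "open (Phi p ` open_square)"
    by (rule invariance_of_domain[OF continuous_on_Phi open_open_square])
       (use inj_on_subset[OF inj] sub open_square_subset in blast)
  thus "Phi p ` open_square \<subseteq> interior (Phi p ` square)"
    using open_square_subset by (intro interior_maximal) auto
  show "interior (Phi p ` square) \<subseteq> Phi p ` open_square"
  proof
    fix x assume x: "x \<in> interior (Phi p ` square)"
    then obtain s where s: "s \<in> square" "x = Phi p s" using interior_subset by blast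
    let ?V = "?U \<inter> Phi p -` interior (Phi p ` square)"
    have "open ?V"
      by (rule continuous_open_preimage[OF continuous_on_Phi U open_interior])
    moreover have "?V \<subseteq> square"
    proof
      fix w assume w: "w \<in> ?V"
      then obtain z where "z \<in> square" "Phi p w = Phi p z" using interior_subset by blast
      thus "w \<in> square" using inj w sub by (metis (no_types, lifting) IntD1 inj_onD subsetD)
    qed
    moreover have "s \<in> ?V" using s x sub by auto
    ultimately have "s \<in> interior square" by (meson interior_maximal subsetD)
    thus "x \<in> Phi p ` open_square" using s by (simp add: interior_square)
  qed
qed

section \<open>The polygonal region as the image of the square\<close>

lemma compact_Phi_square: "compact (Phi p ` square)"
  by (intro compact_continuous_image continuous_on_Phi compact_square)

lemma frontier_Phi_square:
  assumes "norm p \<le> 1/100"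
  shows "frontier (Phi p ` square) = Phi p ` (square - open_square)"
  using inj_on_Phi_square[OF assms] open_square_subset
  by (simp add: frontier_def interior_Phi_square[OF assms] compact_imp_closed[OF compact_Phi_square]
      inj_on_image_set_diff)

text \<open>The connected complement of \<open>T\<close> is unbounded and misses the frontier, so a
  point outside \<open>T\<close> lies in an unbounded component and cannot be inside. This links the
  \<open>inside\<close> of a polygonal curve, as used in \<open>quad\<close>, to a topological
  interior.\<close>

lemma inside_frontier_compact:
  fixes T :: "'a::euclidean_space set"
  assumes T: "compact T" and con: "connected (- T)"
  shows "inside (frontier T) = interior T"
proof
  show "interior T \<subseteq> inside (frontier T)"
    by (rule interior_inside_frontier[OF compact_imp_bounded[OF T]])
  show "inside (frontier T) \<subseteq> interior T"
  proof
    fix x assume x: "x \<in> inside (frontier T)"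
    hence xf: "x \<notin> frontier T" and b: "bounded (connected_component_set (- frontier T) x)"
      by (auto simp: inside_def)
    have sub: "- T \<subseteq> - frontier T"
      using frontier_subset_closed[OF compact_imp_closed[OF T]] by auto
    have "x \<in> T"
    proof (rule ccontr)
      assume "x \<notin> T"
      hence "- T \<subseteq> connected_component_set (- frontier T) x"
        using con sub by (intro connected_component_maximal) auto
      hence "bounded (- T)" using b bounded_subset by blast
      thus False using cobounded_imp_unbounded[of "- T"] compact_imp_bounded[OF T] by simp
    qed
    thus "x \<in> interior T"
      using xf closure_subset by (auto simp: frontier_def)
  qed
qed

text \<open>A bilinear map is affine along lines parallel to the axes, so the sides of the square go
  to straight sides.\<close>

lemma Phi_affine_on_edge:
  assumes "x $ 1 = y $ 1 \<or> x $ 2 = y $ 2"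
  shows "Phi p ((1 - t) *\<^sub>R x + t *\<^sub>R y) = (1 - t) *\<^sub>R Phi p x + t *\<^sub>R Phi p y"
  using assms by (auto simp: vec_eq_iff forall_2 Phi_nth algebra_simps)

lemma Phi_closed_segment:
  assumes "x $ 1 = y $ 1 \<or> x $ 2 = y $ 2"
  shows "Phi p ` closed_segment x y = closed_segment (Phi p x) (Phi p y)"
  by (auto simp: closed_segment_def image_def Phi_affine_on_edge[OF assms])

lemma vertex0_simps:
  "vertex0 1 = vector [-1/2, -1/2]" "vertex0 2 = vector [1/2, -1/2]"
  "vertex0 3 = vector [1/2, 1/2]" "vertex0 4 = vector [-1/2, 1/2]"
  by (simp_all add: vertex0_def)

lemma succ_4: "(1::4) + 1 = 2" "(2::4) + 1 = 3" "(3::4) + 1 = 4" "(4::4) + 1 = 1"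
  "(1::4) + 2 = 3" "(2::4) + 2 = 4" "(3::4) + 2 = 1" "(4::4) + 2 = 2"
  by simp_all

lemma closed_segment_edge_2:
  "closed_segment (vector [-1/2, y]) (vector [1/2, y] :: real^2) = {w. -1/2 \<le> w $ 1 \<and> w $ 1 \<le> 1/2 \<and> w $ 2 = y}"
  (is "?L = ?R")
proof
  show "?L \<subseteq> ?R"
  proof
    fix w assume "w \<in> ?L"
    then obtain t where t: "0 \<le> t" "t \<le> 1" "w = (1 - t) *\<^sub>R vector [-1/2, y] + t *\<^sub>R vector [1/2, y]"
      unfolding closed_segment_def by blast
    show "w \<in> ?R" unfolding t(3) using t(1,2) by (simp add: algebra_simps)
  qed
  show "?R \<subseteq> ?L"
  proof
    fix w assume "w \<in> ?R"
    hence "w = (1 - (w $ 1 + 1/2)) *\<^sub>R vector [-1/2, y] + (w $ 1 + 1/2) *\<^sub>R vector [1/2, y]" "0 \<le> w $ 1 + 1/2" "w $ 1 + 1/2 \<le> 1"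
      by (auto simp: vec_eq_iff forall_2 algebra_simps)
    thus "w \<in> ?L" unfolding closed_segment_def by blast
  qed
qed

lemma closed_segment_edge_1:
  "closed_segment (vector [x, -1/2]) (vector [x, 1/2] :: real^2) = {w. -1/2 \<le> w $ 2 \<and> w $ 2 \<le> 1/2 \<and> w $ 1 = x}"
  (is "?L = ?R")
proof
  show "?L \<subseteq> ?R"
  proof
    fix w assume "w \<in> ?L"
    then obtain t where t: "0 \<le> t" "t \<le> 1" "w = (1 - t) *\<^sub>R vector [x, -1/2] + t *\<^sub>R vector [x, 1/2]"
      unfolding closed_segment_def by blast
    show "w \<in> ?R" unfolding t(3) using t(1,2) by (simp add: algebra_simps)
  qed
  show "?R \<subseteq> ?L"
  proof
    fix w assume "w \<in> ?R"
    hence "w = (1 - (w $ 2 + 1/2)) *\<^sub>R vector [x, -1/2] + (w $ 2 + 1/2) *\<^sub>R vector [x, 1/2]" "0 \<le> w $ 2 + 1/2" "w $ 2 + 1/2 \<le> 1"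
      by (auto simp: vec_eq_iff forall_2 algebra_simps)
    thus "w \<in> ?L" unfolding closed_segment_def by blast
  qed
qed

lemma edges_vertex0:
  "(\<Union>i. closed_segment (vertex0 i) (vertex0 (i + 1))) = square - open_square"
proof -
  have "(\<Union>i. closed_segment (vertex0 i) (vertex0 (i + 1))) =
    closed_segment (vector [-1/2, -1/2]) (vector [1/2, -1/2]) \<union> closed_segment (vector [1/2, -1/2]) (vector [1/2, 1/2])
    \<union> closed_segment (vector [-1/2, 1/2]) (vector [1/2, 1/2]) \<union> closed_segment (vector [-1/2, -1/2]) (vector [-1/2, 1/2])"
    unfolding UNIV_4 UN_insert UN_empty succ_4 vertex0_simps
    using closed_segment_commute[of "vector [1/2, 1/2] :: real^2" "vector [-1/2, 1/2]"]
      closed_segment_commute[of "vector [-1/2, 1/2] :: real^2" "vector [-1/2, -1/2]"] by blast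
  also have "\<dots> = square - open_square"
    unfolding closed_segment_edge_1 closed_segment_edge_2
    by (rule set_eqI) (simp only: Un_iff Diff_iff mem_square mem_open_square mem_Collect_eq, linarith)
  finally show ?thesis .
qed

lemma vertex0_edge: "vertex0 i $ 1 = vertex0 (i + 1) $ 1 \<or> vertex0 i $ 2 = vertex0 (i + 1) $ 2"
proof -
  have "i \<in> {1,2,3,4}" using UNIV_4 by blast
  thus ?thesis by (elim insertE) (simp_all only: succ_4 vertex0_simps, simp_all)
qed

text \<open>The polygon is the image of the boundary of the square, which is the frontier of the
  image. The image is homeomorphic to a compact convex set, so its complement is connected and the
  region enclosed by the polygon is its interior.\<close>

lemma quad_eq:
  assumes p: "norm p \<le> 1/100"
  shows "quad p = Phi p ` square"
proof -
  let ?T = "Phi p ` square"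
  have "(\<Union>i. closed_segment (vertex p i) (vertex p (i + 1))) = Phi p ` (\<Union>i. closed_segment (vertex0 i) (vertex0 (i + 1)))"
    by (simp add: vertex_def image_UN Phi_closed_segment[OF vertex0_edge])
  also have "\<dots> = frontier ?T" by (simp only: edges_vertex0 frontier_Phi_square[OF p])
  finally have \<Gamma>: "(\<Union>i. closed_segment (vertex p i) (vertex p (i + 1))) = frontier ?T" .
  have "square homeomorphic ?T"
    by (rule homeomorphic_compact[OF compact_square continuous_on_Phi refl inj_on_Phi_square[OF p]])
  hence "?T homeomorphic square" by (rule homeomorphic_sym[THEN iffD1])
  hence "connected (- ?T)"
    by (rule connected_complement_homeomorphic_convex_compact) (auto simp: square_def convex_box)
  hence "inside (frontier ?T) = interior ?T" by (rule inside_frontier_compact[OF compact_Phi_square])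
  hence "quad p = frontier ?T \<union> interior ?T" by (simp add: quad_def \<Gamma>)
  also have "\<dots> = ?T"
    using compact_imp_closed[OF compact_Phi_square] closure_closed[of ?T] interior_subset[of ?T] by (auto simp: frontier_def)
  finally show ?thesis .
qed

lemma interior_quad: "norm p \<le> 1/100 \<Longrightarrow> interior (quad p) = Phi p ` open_square"
  by (simp add: quad_eq interior_Phi_square)

lemma quad_0: "quad 0 = square"
  by (simp add: quad_eq Phi_0[abs_def])

lemma zero_in_params: "0 \<in> params"
proof -
  have "corner 0 i \<ge> 0" for i
  proof -
    have "i \<in> {1,2,3,4}" using UNIV_4 by blast
    thus ?thesis by (elim insertE) (simp_all only: corner_def vertex_def Phi_0 succ_4 vertex0_simps cross_def, simp_all)
  qed
  thus ?thesis by (simp add: params_def)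
qed

lemma abs_nth_mult_le:
  assumes "\<bar>r\<bar> \<le> C"
  shows "\<bar>p $ i * r\<bar> \<le> C * norm (p::real^'n)"
proof -
  have "\<bar>p $ i * r\<bar> \<le> norm p * C"
    unfolding abs_mult using assms abs_nth_le_norm[of p i] by (intro mult_mono) auto
  thus ?thesis by (simp add: mult.commute)
qed

lemma square_abs_le: "w \<in> square \<Longrightarrow> \<bar>w $ 1\<bar> \<le> 1/2" "w \<in> square \<Longrightarrow> \<bar>w $ 2\<bar> \<le> 1/2"
  by (auto simp: mem_square abs_le_iff)

lemma J_near_1:
  assumes p: "norm p \<le> 1" and w: "w \<in> square"
  shows "\<bar>J p w - 1\<bar> \<le> 8 * norm p"
proof -
  note b = square_abs_le[OF w]
  have p1: "\<bar>p $ i\<bar> \<le> 1" for i using abs_nth_le_norm[of p i] p by linarith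
  have pu: "\<bar>p $ i * r\<bar> \<le> 1/2" if "\<bar>r\<bar> \<le> 1/2" for i r
    unfolding abs_mult using mult_mono[of "\<bar>p $ i\<bar>" 1 "\<bar>r\<bar>" "1/2"] p1[of i] that by simp
  note bound = abs_nth_mult_le[OF p1, where p=p]
    abs_nth_mult_le[OF b(1), of p] abs_nth_mult_le[OF b(2), of p]
    abs_nth_mult_le[OF pu[OF b(1)], of p] abs_nth_mult_le[OF pu[OF b(2)], of p]
  have eq: "J p w - 1 = - (p $ 1 * p $ 1) - p $ 4 * p $ 4 + 2 * (p $ 3 * w $ 1) - 2 * (p $ 3 * (p $ 1 * w $ 1))
    - 2 * (p $ 2 * (p $ 4 * w $ 1)) + 2 * (p $ 3 * (p $ 4 * w $ 2)) - 2 * (p $ 2 * w $ 2) - 2 * (p $ 2 * (p $ 1 * w $ 2))"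
    unfolding J_eq by (simp add: algebra_simps power2_eq_square)
  have lin: "\<bar>- A - B + 2 * C - 2 * D - 2 * E + 2 * F - 2 * G - 2 * H\<bar> \<le> 8 * n"
    if "\<bar>A\<bar> \<le> 1 * n" "\<bar>B\<bar> \<le> 1 * n" "\<bar>C\<bar> \<le> 1/2 * n" "\<bar>D\<bar> \<le> 1/2 * n" "\<bar>E\<bar> \<le> 1/2 * n" "\<bar>F\<bar> \<le> 1/2 * n"
      "\<bar>G\<bar> \<le> 1/2 * n" "\<bar>H\<bar> \<le> 1/2 * n" for A B C D E F G H n :: real
    using that unfolding abs_le_iff by (simp add: field_simps)
  show ?thesis unfolding eq by (rule lin) (rule bound)+
qed

lemma J_pos:
  assumes "norm p \<le> 1/100" "w \<in> square"
  shows "9/10 \<le> J p w" "J p w \<le> 11/10"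
  using J_near_1[of p w] assms by (auto simp: abs_le_iff)

lemma has_derivative_J:
  "(J p has_derivative (\<lambda>h. vector [2 * p $ 3 * (1 - p $ 1) - 2 * p $ 2 * p $ 4,
      2 * p $ 3 * p $ 4 - 2 * p $ 2 * (1 + p $ 1)] \<bullet> h)) (at w)"
  unfolding J_eq[abs_def]
  by (auto intro!: derivative_eq_intros bounded_linear.has_derivative[OF bounded_linear_vec_nth] ext
      simp: inner_vec_def sum_2 algebra_simps)

lemma continuous_on_J: "continuous_on S (J p)"
  unfolding J_eq[abs_def] by (intro continuous_intros)

lemma borel_measurable_J: "J p \<in> borel_measurable borel"
  by (rule borel_measurable_continuous_onI[OF continuous_on_J])

section \<open>Integration over the quadrilateral\<close>

lemma integrable_lebesgue_on_iff:
  "S \<in> sets lebesgue \<Longrightarrow> integrable (lebesgue_on S) f \<longleftrightarrow> f absolutely_integrable_on S"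
  by (simp add: integrable_restrict_space set_integrable_def)

lemma open_square_lebesgue [simp]: "open_square \<in> sets lebesgue" "open_square \<in> lmeasurable"
  by (simp_all add: open_square_def)

lemma interior_quad_props:
  assumes "norm p \<le> 1/100"
  shows "open (interior (quad p))" "interior (quad p) \<in> sets lebesgue" "bounded (interior (quad p))"
    "interior (quad p) \<in> lmeasurable"
proof -
  show 1: "interior (quad p) \<in> sets lebesgue" by (simp add: borel_open)
  show 2: "bounded (interior (quad p))"
    using compact_imp_bounded[OF compact_Phi_square] bounded_subset interior_subset
    by (metis quad_eq[OF assms])
  show "interior (quad p) \<in> lmeasurable" using 2 1 by (rule bounded_set_imp_lmeasurable)
qed simp

text \<open>Integrability is transferred in both directions: from the quadrilateral to the square
  for pull-backs, and back for functions constructed on the square such as those of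
  \<open>quad_moments\<close>.\<close>

lemma change_of_variables:
  fixes f :: "real^2 \<Rightarrow> real"
  assumes p: "norm p \<le> 1/100"
  shows "integrable (lebesgue_on (interior (quad p))) f \<longleftrightarrow>
      integrable (lebesgue_on open_square) (\<lambda>w. J p w * f (Phi p w))" (is "?L \<longleftrightarrow> ?R")
    and "integrable (lebesgue_on (interior (quad p))) f \<Longrightarrow>
      (LINT x|lebesgue_on (interior (quad p)). f x) = (LINT w|lebesgue_on open_square. J p w * f (Phi p w))"
proof -
  let ?S = open_square and ?V = "interior (quad p)"
  have V: "?V = Phi p ` ?S" by (rule interior_quad[OF p])
  have Vl: "?V \<in> sets lebesgue" by (rule interior_quad_props[OF p])
  have inj: "inj_on (Phi p) ?S" using inj_on_subset[OF inj_on_Phi_square[OF p] open_square_subset] .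
  \<comment> \<open>The vector-valued change of variables is instantiated with codomain
    \<open>real^1\<close> and read back through \<open>vec\<close>.\<close>
  have cov: "(\<lambda>x. \<bar>det (matrix (DPhi p x))\<bar> * f (Phi p x)) absolutely_integrable_on ?S \<and>
      integral ?S (\<lambda>x. \<bar>det (matrix (DPhi p x))\<bar> * f (Phi p x)) = b
      \<longleftrightarrow> f absolutely_integrable_on (Phi p ` ?S) \<and> integral (Phi p ` ?S) f = b" for b
  proof -
    have "(\<lambda>x. \<bar>det (matrix (DPhi p x))\<bar> *\<^sub>R vec (f (Phi p x)) :: real^1) absolutely_integrable_on ?S \<and>
      integral ?S (\<lambda>x. \<bar>det (matrix (DPhi p x))\<bar> *\<^sub>R vec (f (Phi p x))) = (vec b :: real^1)
      \<longleftrightarrow> (\<lambda>x. vec (f x) :: real^1) absolutely_integrable_on (Phi p ` ?S) \<and> integral (Phi p ` ?S) (\<lambda>x. vec (f x)) = (vec b :: real^1)"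
      by (rule has_absolute_integral_change_of_variables[OF open_square_lebesgue(1) has_derivative_Phi inj])
    thus ?thesis by (simp add: absolutely_integrable_on_1_iff integral_on_1_eq)
  qed
  have Jabs: "\<bar>det (matrix (DPhi p w))\<bar> = J p w" if "w \<in> ?S" for w
    using J_pos(1)[OF p, of w] open_square_subset that by (auto simp: J_eq_det)
  have i: "integrable (lebesgue_on ?S) (\<lambda>w. J p w * f (Phi p w)) \<longleftrightarrow>
      (\<lambda>x. \<bar>det (matrix (DPhi p x))\<bar> * f (Phi p x)) absolutely_integrable_on ?S"
    unfolding integrable_lebesgue_on_iff[OF open_square_lebesgue(1), symmetric]
    by (rule Bochner_Integration.integrable_cong) (auto simp: Jabs space_restrict_space)
  show iff: "?L \<longleftrightarrow> ?R"
    unfolding i integrable_lebesgue_on_iff[OF Vl] unfolding V using cov by blast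
  assume L: ?L
  have "(LINT x|lebesgue_on ?V. f x) = integral ?V f"
    by (rule lebesgue_integral_eq_integral[OF L Vl])
  also have "\<dots> = integral ?S (\<lambda>x. \<bar>det (matrix (DPhi p x))\<bar> * f (Phi p x))"
    using cov[of "integral ?V f"] L[unfolded integrable_lebesgue_on_iff[OF Vl]] unfolding V by simp
  also have "\<dots> = integral ?S (\<lambda>w. J p w * f (Phi p w))"
    by (rule Henstock_Kurzweil_Integration.integral_cong) (simp add: Jabs)
  also have "\<dots> = (LINT w|lebesgue_on ?S. J p w * f (Phi p w))"
    by (rule lebesgue_integral_eq_integral[symmetric]) (use iff L in auto)
  finally show "(LINT x|lebesgue_on ?V. f x) = (LINT w|lebesgue_on ?S. J p w * f (Phi p w))" .
qed

text \<open>A composition with a Lebesgue measurable function need not be measurable on general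
  grounds. Here measurability is read off from integrability of the Jacobian times the composition,
  componentwise, by dividing by the positive Jacobian.\<close>

lemma L2_pullback:
  fixes f :: "real^2 \<Rightarrow> 'b::euclidean_space"
  assumes p: "norm p \<le> 1/100" and f: "L2 (lebesgue_on (interior (quad p))) f"
  shows "L2 (lebesgue_on open_square) (\<lambda>w. f (Phi p w))"
proof -
  let ?M = "lebesgue_on open_square"
  interpret V: finite_measure "lebesgue_on (interior (quad p))"
    by (rule finite_measure_lebesgue_on[OF interior_quad_props(4)[OF p]])
  have [measurable]: "J p \<in> borel_measurable ?M" using borel_measurable_J by (rule borel_measurable_lebesgue_onI)
  have pos: "9/10 \<le> J p w" if "w \<in> open_square" for w
    using J_pos(1)[OF p] open_square_subset that by blast
  have "(\<lambda>w. f (Phi p w) \<bullet> i) \<in> borel_measurable ?M" for i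
  proof -
    have "integrable ?M (\<lambda>w. J p w * (f (Phi p w) \<bullet> i))"
      using V.L2_integrable[OF L2_inner_const[OF f]] change_of_variables(1)[OF p, of "\<lambda>x. f x \<bullet> i"] by simp
    hence "(\<lambda>w. (J p w * (f (Phi p w) \<bullet> i)) / J p w) \<in> borel_measurable ?M" by measurable
    moreover have "(J p w * (f (Phi p w) \<bullet> i)) / J p w = f (Phi p w) \<bullet> i" if "w \<in> open_square" for w
      using pos[OF that] by simp
    ultimately show ?thesis by (subst measurable_cong[where g="\<lambda>w. (J p w * (f (Phi p w) \<bullet> i)) / J p w"]) (auto simp: space_restrict_space)
  qed
  hence m: "(\<lambda>w. f (Phi p w)) \<in> borel_measurable ?M"
    by (subst borel_measurable_euclidean_space) auto
  have "integrable ?M (\<lambda>w. J p w * (norm (f (Phi p w)))\<^sup>2)"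
    using f change_of_variables(1)[OF p, of "\<lambda>x. (norm (f x))\<^sup>2"] by (simp add: L2_def)
  hence "integrable ?M (\<lambda>w. 2 * (J p w * (norm (f (Phi p w)))\<^sup>2))" by simp
  hence "integrable ?M (\<lambda>w. (norm (f (Phi p w)))\<^sup>2)"
  proof (rule Bochner_Integration.integrable_bound)
    show "AE w in ?M. norm ((norm (f (Phi p w)))\<^sup>2) \<le> norm (2 * (J p w * (norm (f (Phi p w)))\<^sup>2))"
    proof (rule AE_I2)
      fix w assume "w \<in> space ?M"
      hence "9/10 \<le> J p w" using pos by (simp add: space_restrict_space)
      hence "1 * (norm (f (Phi p w)))\<^sup>2 \<le> (2 * J p w) * (norm (f (Phi p w)))\<^sup>2"
        by (intro mult_right_mono) auto
      thus "norm ((norm (f (Phi p w)))\<^sup>2) \<le> norm (2 * (J p w * (norm (f (Phi p w)))\<^sup>2))"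
        using \<open>9/10 \<le> J p w\<close> by (simp add: abs_mult mult.assoc)
    qed
  qed (use m in measurable)
  with m show ?thesis by (simp add: L2_def)
qed

text \<open>The open sets \<open>\<Omega>\<close> and the complement of \<open>K\<close> cover the
  space; on the second the function vanishes, so the gradient is continuous on each and hence
  everywhere.\<close>

lemma test_functionI:
  assumes K: "compact K" "K \<subseteq> \<Omega>" and op: "open \<Omega>"
    and zero: "\<And>x. x \<notin> K \<Longrightarrow> \<phi> x = 0"
    and der: "\<And>x. x \<in> \<Omega> \<Longrightarrow> (\<phi> has_derivative (\<lambda>h. V x \<bullet> h)) (at x)"
    and cont: "continuous_on \<Omega> V"
  shows "test_function \<Omega> \<phi>" "\<And>x. x \<in> \<Omega> \<Longrightarrow> grad \<phi> x = V x"
proof -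
  show g: "grad \<phi> x = V x" if "x \<in> \<Omega>" for x by (rule grad_eqI[OF der[OF that]])
  have sub: "closure {x. \<phi> x \<noteq> 0} \<subseteq> K"
    using zero by (intro closure_minimal compact_imp_closed K) auto
  have oK: "open (- K)" using K(1) by (simp add: compact_imp_closed open_Compl)
  have der0: "(\<phi> has_derivative (\<lambda>h. 0)) (at x)" if "x \<notin> K" for x
  proof (rule has_derivative_transform_within_open[OF _ oK])
    show "((\<lambda>_. 0) has_derivative (\<lambda>h. 0)) (at x)" by simp
    show "x \<in> - K" using that by simp
    show "0 = \<phi> y" if "y \<in> - K" for y using zero[of y] that by simp
  qed
  have "continuous_on (\<Omega> \<union> - K) (grad \<phi>)"
  proof (rule continuous_on_open_Un[OF op oK])
    show "continuous_on \<Omega> (grad \<phi>)" using cont by (rule continuous_on_eq) (simp add: g)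
    have z: "grad \<phi> x = 0" if "x \<in> - K" for x
    proof (rule grad_eqI)
      show "(\<phi> has_derivative (\<lambda>v. 0 \<bullet> v)) (at x)" using der0[of x] that by simp
    qed
    show "continuous_on (- K) (grad \<phi>)"
      by (rule continuous_on_eq[OF continuous_on_const[of _ 0]]) (simp add: z)
  qed
  moreover have "\<Omega> \<union> - K = UNIV" using K(2) by auto
  ultimately have "continuous_on UNIV (grad \<phi>)" by simp
  moreover have "compact (closure {x. \<phi> x \<noteq> 0})"
    using compact_Int_closed[OF K(1) closed_closure, of "{x. \<phi> x \<noteq> 0}"] sub by (simp add: Int_absorb1)
  moreover have "\<phi> differentiable (at x)" for x
    using der[of x] der0[of x] K(2) unfolding differentiable_def by blast
  ultimately show "test_function \<Omega> \<phi>" using sub K(2) by (auto simp: test_function_def)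
qed

lemma test_function_mult:
  assumes t: "test_function \<Omega> \<psi>" and op: "open \<Omega>"
    and der: "\<And>x. x \<in> \<Omega> \<Longrightarrow> (m has_derivative (\<lambda>h. V x \<bullet> h)) (at x)"
    and cont: "continuous_on \<Omega> V"
  shows "test_function \<Omega> (\<lambda>x. m x * \<psi> x)"
    "\<And>x. x \<in> \<Omega> \<Longrightarrow> grad (\<lambda>x. m x * \<psi> x) x = m x *\<^sub>R grad \<psi> x + \<psi> x *\<^sub>R V x"
proof -
  note tD = test_functionD[OF t]
  let ?K = "closure {x. \<psi> x \<noteq> 0}"
  have d: "((\<lambda>x. m x * \<psi> x) has_derivative (\<lambda>h. (m x *\<^sub>R grad \<psi> x + \<psi> x *\<^sub>R V x) \<bullet> h)) (at x)" if "x \<in> \<Omega>" for x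
    by (rule derivative_eq_intros der[OF that] has_derivative_grad[OF tD(5)] refl)+
       (simp add: inner_add_left algebra_simps)
  have mc: "continuous_on \<Omega> m"
    using der by (auto intro!: has_derivative_continuous_on simp: at_within_open[OF _ op])
  have c: "continuous_on \<Omega> (\<lambda>x. m x *\<^sub>R grad \<psi> x + \<psi> x *\<^sub>R V x)"
    by (intro continuous_intros mc cont continuous_on_subset[OF tD(1)] continuous_on_subset[OF tD(2)]) auto
  have z: "m x * \<psi> x = 0" if "x \<notin> ?K" for x using test_function_eq_0(1)[OF that] by simp
  show "test_function \<Omega> (\<lambda>x. m x * \<psi> x)"
    "\<And>x. x \<in> \<Omega> \<Longrightarrow> grad (\<lambda>x. m x * \<psi> x) x = m x *\<^sub>R grad \<psi> x + \<psi> x *\<^sub>R V x"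
    using test_functionI[OF tD(6) tD(7) op z d c] by auto
qed


section \<open>Transport of weak gradients by the bilinear map\<close>

definition DPhi_adj :: "real^4 \<Rightarrow> real^2 \<Rightarrow> real^2 \<Rightarrow> real^2" where
  "DPhi_adj p w h = vector
     [(1 - p $ 1 - 2 * p $ 2 * w $ 2) * h $ 1 + (- p $ 4 + 2 * p $ 3 * w $ 2) * h $ 2,
      (- p $ 4 - 2 * p $ 2 * w $ 1) * h $ 1 + (1 + p $ 1 + 2 * p $ 3 * w $ 1) * h $ 2]"

definition DPhi_cof :: "real^4 \<Rightarrow> real^2 \<Rightarrow> real^2 \<Rightarrow> real^2" where
  "DPhi_cof p w h = vector
     [(1 + p $ 1 + 2 * p $ 3 * w $ 1) * h $ 1 - (- p $ 4 + 2 * p $ 3 * w $ 2) * h $ 2,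
      (1 - p $ 1 - 2 * p $ 2 * w $ 2) * h $ 2 - (- p $ 4 - 2 * p $ 2 * w $ 1) * h $ 1]"

text \<open>\<open>DPhi_adj\<close> is the transpose of the derivative and \<open>DPhi_cof\<close> its cofactor matrix; the
  transport of a test function to the quadrilateral has gradient \<open>DPhi_cof / J\<close> applied to
  the original one.\<close>

lemma test_function_transport:
  assumes p: "norm p \<le> 1/100" and t: "test_function open_square \<psi>"
  obtains \<phi> where "test_function (interior (quad p)) \<phi>"
    "\<And>w. w \<in> open_square \<Longrightarrow> \<phi> (Phi p w) = \<psi> w"
    "\<And>w. w \<in> open_square \<Longrightarrow> J p w *\<^sub>R grad \<phi> (Phi p w) = DPhi_cof p w (grad \<psi> w)"
proof -
  let ?U = open_square and ?V = "interior (quad p)"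
  note tD = test_functionD[OF t]
  have V: "?V = Phi p ` ?U" by (rule interior_quad[OF p])
  have inj: "inj_on (Phi p) ?U" using inj_on_subset[OF inj_on_Phi_square[OF p] open_square_subset] .
  define inv where "inv = the_inv_into ?U (Phi p)"
  have inv: "inv (Phi p w) = w" if "w \<in> ?U" for w
    unfolding inv_def using the_inv_into_f_f[OF inj that] .
  have invU: "inv x \<in> ?U" and Phi_inv: "Phi p (inv x) = x" if "x \<in> ?V" for x
    using that inv by (auto simp: V)
  have U1: "\<bar>w $ 1\<bar> \<le> 1" "\<bar>w $ 2\<bar> \<le> 1" if "w \<in> ?U" for w
    using square_subset_unit_box open_square_subset that by auto
  \<comment> \<open>By expansiveness the inverse is Lipschitz with constant 2; this is the
    continuity from which its derivative is obtained.\<close>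
  have lip: "norm (inv x - inv y) \<le> 2 * norm (x - y)" if "x \<in> ?V" "y \<in> ?V" for x y
    using Phi_expansive[OF p U1[OF invU[OF that(1)]] U1[OF invU[OF that(2)]]] Phi_inv that by simp
  have cont: "continuous_on ?V inv"
    unfolding continuous_on_iff
  proof (intro ballI allI impI)
    fix x and e :: real assume "x \<in> ?V" "e > 0"
    thus "\<exists>d>0. \<forall>x'\<in>?V. dist x' x < d \<longrightarrow> dist (inv x') (inv x) < e"
      using lip by (intro exI[of _ "e / 2"]) (force simp: dist_norm)
  qed
  have Jpos: "J p w > 0" if "w \<in> ?U" for w
    using J_pos(1)[OF p, of w] open_square_subset that by auto
  \<comment> \<open>Cramer's rule for the inverse of \<open>DPhi p w\<close>.\<close>
  define Inv where "Inv w k = (1 / J p w) *\<^sub>R (vector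
     [(1 + p $ 1 + 2 * p $ 3 * w $ 1) * k $ 1 - (- p $ 4 - 2 * p $ 2 * w $ 1) * k $ 2,
      (1 - p $ 1 - 2 * p $ 2 * w $ 2) * k $ 2 - (- p $ 4 + 2 * p $ 3 * w $ 2) * k $ 1] :: real^2)" for w k :: "real^2"
  have linInv: "bounded_linear (Inv w)" for w
    by (rule linear_conv_bounded_linear[THEN iffD1])
       (auto intro!: linearI simp: Inv_def vec_eq_iff forall_2 algebra_simps add_divide_distrib diff_divide_distrib)
  have InvD: "Inv w (DPhi p w h) = h" if "w \<in> ?U" for w h
  proof -
    let ?A = "1 - p $ 1 - 2 * p $ 2 * w $ 2" and ?B = "- p $ 4 - 2 * p $ 2 * w $ 1"
      and ?C = "- p $ 4 + 2 * p $ 3 * w $ 2" and ?D = "1 + p $ 1 + 2 * p $ 3 * w $ 1"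
    have J: "J p w = ?A * ?D - ?B * ?C" by (simp only: J_eq_det det_DPhi)
    have "?D * (?A * h $ 1 + ?B * h $ 2) - ?B * (?C * h $ 1 + ?D * h $ 2) = J p w * h $ 1"
      "?A * (?C * h $ 1 + ?D * h $ 2) - ?C * (?A * h $ 1 + ?B * h $ 2) = J p w * h $ 2"
      unfolding J by algebra+
    thus ?thesis using Jpos[OF that]
      by (simp add: vec_eq_iff forall_2 Inv_def DPhi_def)
  qed
  have dinv: "(inv has_derivative Inv (inv x)) (at x)" if x: "x \<in> ?V" for x
  proof (rule has_derivative_inverse_basic[where f="Phi p" and T="?V"])
    show "(Phi p has_derivative DPhi p (inv x)) (at (inv x))" by (rule has_derivative_Phi)
    show "Inv (inv x) \<circ> DPhi p (inv x) = id" using InvD[OF invU[OF x]] by auto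
    show "continuous (at x) inv"
      using cont x by (simp add: continuous_on_eq_continuous_at)
  qed (use x Phi_inv linInv in auto)
  define \<phi> where "\<phi> x = (if x \<in> ?V then \<psi> (inv x) else 0)" for x
  define Gr where "Gr x = (1 / J p (inv x)) *\<^sub>R DPhi_cof p (inv x) (grad \<psi> (inv x))" for x
  have InvT: "grad \<psi> w \<bullet> Inv w h = ((1 / J p w) *\<^sub>R DPhi_cof p w (grad \<psi> w)) \<bullet> h" for w h
    by (simp add: inner_vec_def sum_2 Inv_def DPhi_cof_def divide_inverse algebra_simps)
  have der: "(\<phi> has_derivative (\<lambda>h. Gr x \<bullet> h)) (at x)" if x: "x \<in> ?V" for x
  proof (rule has_derivative_transform_within_open[where s="?V"])
    have "((\<lambda>x. \<psi> (inv x)) has_derivative (\<lambda>h. grad \<psi> (inv x) \<bullet> Inv (inv x) h)) (at x)"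
      by (rule has_derivative_compose[OF dinv[OF x] has_derivative_grad[OF tD(5)]])
    thus "((\<lambda>x. \<psi> (inv x)) has_derivative (\<lambda>h. Gr x \<bullet> h)) (at x)" by (simp add: InvT Gr_def)
  qed (use x in \<open>auto simp: \<phi>_def\<close>)
  have cg: "continuous_on ?V Gr"
  proof -
    have "continuous_on ?U (\<lambda>w. (1 / J p w) *\<^sub>R DPhi_cof p w (grad \<psi> w))"
      unfolding DPhi_cof_def vector_2_eq_axis
      by (intro continuous_intros continuous_on_J continuous_on_subset[OF tD(2)] ballI less_imp_neq[THEN not_sym] Jpos) auto
    from continuous_on_compose2[OF this cont] invU show ?thesis
      unfolding Gr_def by blast
  qed
  let ?K = "closure {w. \<psi> w \<noteq> 0}"
  have cK: "compact (Phi p ` ?K)" by (intro compact_continuous_image continuous_on_Phi tD(6))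
  have KV: "Phi p ` ?K \<subseteq> ?V" unfolding V using tD(7) by blast
  have z: "\<phi> x = 0" if "x \<notin> Phi p ` ?K" for x
  proof (cases "x \<in> ?V")
    case True
    have "inv x \<notin> ?K" using that Phi_inv[OF True] by (metis imageI)
    thus ?thesis using test_function_eq_0(1)[of "inv x" \<psi>] by (simp add: \<phi>_def)
  qed (simp add: \<phi>_def)
  have R1: "test_function ?V \<phi>"
    by (rule test_functionI(1)[OF cK KV open_interior _ _ cg]) (rule z der; assumption)+
  have R2: "grad \<phi> x = Gr x" if "x \<in> ?V" for x
    by (rule test_functionI(2)[OF cK KV open_interior _ _ cg that]) (rule z der; assumption)+
  show ?thesis
  proof (rule that[OF R1])
    fix w assume w: "w \<in> ?U"
    hence wV: "Phi p w \<in> ?V" by (simp add: V)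
    show "\<phi> (Phi p w) = \<psi> w" using wV inv[OF w] by (simp add: \<phi>_def)
    show "J p w *\<^sub>R grad \<phi> (Phi p w) = DPhi_cof p w (grad \<psi> w)"
      using R2[OF wV] inv[OF w] Jpos[OF w] by (simp add: Gr_def)
  qed
qed

text \<open>The weak identity on the quadrilateral, tested with the transported function and pulled
  back. On the left the Jacobian of the substitution cancels the denominator in the transported
  gradient, leaving the cofactor matrix.\<close>

lemma weak_gradient_transport:
  assumes p: "norm p \<le> 1/100" and w: "H1_with_gradient (interior (quad p)) w G"
    and t: "test_function open_square \<psi>"
  shows "(LINT u|lebesgue_on open_square. w (Phi p u) * (DPhi_cof p u (grad \<psi> u) \<bullet> b)) =
    - (LINT u|lebesgue_on open_square. (J p u * \<psi> u) * (G (Phi p u) \<bullet> b))"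
proof -
  let ?U = open_square and ?V = "interior (quad p)"
  have Vm: "?V \<in> lmeasurable" by (rule interior_quad_props[OF p])
  obtain \<phi> where \<phi>: "test_function ?V \<phi>" "\<And>w. w \<in> ?U \<Longrightarrow> \<phi> (Phi p w) = \<psi> w"
    "\<And>w. w \<in> ?U \<Longrightarrow> J p w *\<^sub>R grad \<phi> (Phi p w) = DPhi_cof p w (grad \<psi> w)"
    using test_function_transport[OF p t] by blast
  note L = test_function_L2[OF \<phi>(1) Vm] H1_L2[OF w]
  have "(LINT u|lebesgue_on ?U. w (Phi p u) * (DPhi_cof p u (grad \<psi> u) \<bullet> b)) =
    (LINT u|lebesgue_on ?U. J p u * (w (Phi p u) * (grad \<phi> (Phi p u) \<bullet> b)))"
    by (rule Bochner_Integration.integral_cong) (auto simp: space_restrict_space \<phi>(3)[symmetric])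
  also have "\<dots> = (LINT x|lebesgue_on ?V. w x * (grad \<phi> x \<bullet> b))"
    by (rule change_of_variables(2)[OF p, symmetric]) (intro L2_mult_integrable L2_inner_const L)
  also have "\<dots> = - (LINT x|lebesgue_on ?V. \<phi> x * (G x \<bullet> b))"
    using w \<phi>(1) unfolding H1_iff[OF Vm] by blast
  also have "(LINT x|lebesgue_on ?V. \<phi> x * (G x \<bullet> b)) = (LINT u|lebesgue_on ?U. J p u * (\<phi> (Phi p u) * (G (Phi p u) \<bullet> b)))"
    by (rule change_of_variables(2)[OF p]) (intro L2_mult_integrable L2_inner_const L)
  also have "\<dots> = (LINT u|lebesgue_on ?U. (J p u * \<psi> u) * (G (Phi p u) \<bullet> b))"
    by (rule Bochner_Integration.integral_cong) (auto simp: space_restrict_space \<phi>(2))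
  finally show ?thesis .
qed


lemma has_derivative_affine_nth:
  "((\<lambda>w::real^2. c + x * w $ 1 + y * w $ 2) has_derivative (\<lambda>h. vector [x, y] \<bullet> h)) (at w)"
  by (auto intro!: derivative_eq_intros bounded_linear.has_derivative[OF bounded_linear_vec_nth] ext
      simp: inner_vec_def sum_2)

lemma L2_bounded_mult:
  assumes "L2 (lebesgue_on S) f" "m \<in> borel_measurable borel" "\<And>u. u \<in> S \<Longrightarrow> \<bar>m u\<bar> \<le> C"
  shows "L2 (lebesgue_on S) (\<lambda>u. m u * f u :: real)"
proof (rule L2_dominated[OF assms(1)])
  have "m \<in> borel_measurable (lebesgue_on S)" using assms(2) by (rule borel_measurable_lebesgue_onI)
  thus "(\<lambda>u. m u * f u) \<in> borel_measurable (lebesgue_on S)" using assms(1) by measurable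
  show "AE u in lebesgue_on S. norm (m u * f u) \<le> C * norm (f u)"
    by (rule AE_I2) (auto simp: abs_mult space_restrict_space intro!: mult_right_mono assms(3))
qed

lemma L2_nth: "L2 M f \<Longrightarrow> L2 M (\<lambda>u. f u $ i :: real)"
  using L2_inner_const[of M f "axis i 1"] by (simp add: inner_axis)

text \<open>\<open>A\<close>, \<open>B\<close>, \<open>C\<close>, \<open>D\<close> are the entries
  of the derivative of the map, \<open>x\<close> and \<open>y\<close> twice the second and third
  parameter, \<open>j1\<close> and \<open>j2\<close> the partial derivatives of the Jacobian,
  \<open>g1\<close> and \<open>g2\<close> those of a test function with value \<open>X\<close>. The
  terms with \<open>X\<close> cancel because the rows of the cofactor matrix are divergence free;
  those with \<open>g1\<close> and \<open>g2\<close> combine by inverse times matrix. Writing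
  \<open>r\<close> for the reciprocal of \<open>J\<close> makes both claims polynomial
  identities.\<close>

lemma piola_identity:
  fixes A B C D J :: real
  assumes "J = A * D - B * C" "J \<noteq> 0"
  shows "j1 = A * y + x * C \<Longrightarrow>
      D * ((A / J) * g1 + X * ((1 / J) * 0 - (A / J\<^sup>2) * j1)) - C * ((A / J) * g2 + X * ((1 / J) * (- x) - (A / J\<^sup>2) * j2))
      + (A * ((C / J) * g2 + X * ((1 / J) * y - (C / J\<^sup>2) * j2)) - B * ((C / J) * g1 + X * ((1 / J) * 0 - (C / J\<^sup>2) * j1))) = g1"
    and "j2 = - (x * D) - B * y \<Longrightarrow>
      D * ((B / J) * g1 + X * ((1 / J) * (- x) - (B / J\<^sup>2) * j1)) - C * ((B / J) * g2 + X * ((1 / J) * 0 - (B / J\<^sup>2) * j2))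
      + (A * ((D / J) * g2 + X * ((1 / J) * 0 - (D / J\<^sup>2) * j2)) - B * ((D / J) * g1 + X * ((1 / J) * y - (D / J\<^sup>2) * j1))) = g2"
proof -
  define r where "r = 1 / J"
  have r: "J * r = 1" using assms(2) by (simp add: r_def)
  have e: "z / J = z * r" "z / J\<^sup>2 = z * r * r" for z by (simp_all add: r_def power2_eq_square)
  show "j1 = A * y + x * C \<Longrightarrow>
      D * ((A / J) * g1 + X * ((1 / J) * 0 - (A / J\<^sup>2) * j1)) - C * ((A / J) * g2 + X * ((1 / J) * (- x) - (A / J\<^sup>2) * j2))
      + (A * ((C / J) * g2 + X * ((1 / J) * y - (C / J\<^sup>2) * j2)) - B * ((C / J) * g1 + X * ((1 / J) * 0 - (C / J\<^sup>2) * j1))) = g1"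
    unfolding e using assms(1) r by algebra
  show "j2 = - (x * D) - B * y \<Longrightarrow>
      D * ((B / J) * g1 + X * ((1 / J) * (- x) - (B / J\<^sup>2) * j1)) - C * ((B / J) * g2 + X * ((1 / J) * 0 - (B / J\<^sup>2) * j2))
      + (A * ((D / J) * g2 + X * ((1 / J) * 0 - (D / J\<^sup>2) * j2)) - B * ((D / J) * g1 + X * ((1 / J) * y - (D / J\<^sup>2) * j1))) = g2"
    unfolding e using assms(1) r by algebra
qed

text \<open>The chain rule is obtained by testing with \<open>\<psi>\<close> times entries of \<open>D\<Phi> / J\<close>: the second-order terms
  cancel by the Piola identity.\<close>

lemma H1_pullback:
  assumes p: "norm p \<le> 1/100" and w: "H1_with_gradient (interior (quad p)) w G"
  shows "H1_with_gradient open_square (\<lambda>u. w (Phi p u)) (\<lambda>u. DPhi_adj p u (G (Phi p u)))"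
proof -
  let ?U = open_square and ?M = "lebesgue_on open_square"
  let ?W = "\<lambda>u. w (Phi p u)"
  let ?A = "\<lambda>u::real^2. 1 - p $ 1 - 2 * p $ 2 * u $ 2" and ?B = "\<lambda>u::real^2. - p $ 4 - 2 * p $ 2 * u $ 1"
    and ?C = "\<lambda>u::real^2. - p $ 4 + 2 * p $ 3 * u $ 2" and ?D = "\<lambda>u::real^2. 1 + p $ 1 + 2 * p $ 3 * u $ 1"
  interpret finite_measure ?M by (rule finite_measure_lebesgue_on) simp
  have WL: "L2 ?M ?W" by (rule L2_pullback[OF p H1_L2(1)[OF w]])
  have GL: "L2 ?M (\<lambda>u. G (Phi p u))" by (rule L2_pullback[OF p H1_L2(2)[OF w]])
  have bdd: "\<bar>?A u\<bar> \<le> 2" "\<bar>?B u\<bar> \<le> 2" "\<bar>?C u\<bar> \<le> 2" "\<bar>?D u\<bar> \<le> 2" if "u \<in> ?U" for u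
  proof -
    have u: "\<bar>u $ 1\<bar> \<le> 1/2" "\<bar>u $ 2\<bar> \<le> 1/2" using square_abs_le[of u] open_square_subset that by auto
    have b: "\<bar>p $ i\<bar> \<le> 1/100" "\<bar>p $ i * u $ 1\<bar> \<le> 1/200" "\<bar>p $ i * u $ 2\<bar> \<le> 1/200" for i
      using abs_nth_le_norm[of p i] abs_nth_mult_le[OF u(1), of p i] abs_nth_mult_le[OF u(2), of p i] p by auto
    have aux: "\<bar>1 - x - 2 * y\<bar> \<le> 2" "\<bar>- x - 2 * y\<bar> \<le> 2" "\<bar>- x + 2 * y\<bar> \<le> 2" "\<bar>1 + x + 2 * y\<bar> \<le> 2"
      if "\<bar>x\<bar> \<le> 1/100" "\<bar>y\<bar> \<le> 1/200" for x y :: real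
      using that unfolding abs_le_iff by (simp_all add: field_simps)
    show "\<bar>?A u\<bar> \<le> 2" "\<bar>?B u\<bar> \<le> 2" "\<bar>?C u\<bar> \<le> 2" "\<bar>?D u\<bar> \<le> 2"
      using aux(1)[OF b(1,3)] aux(2)[OF b(1,2)] aux(3)[OF b(1,3)] aux(4)[OF b(1,2)] by (simp_all add: mult.assoc)
  qed
  have mb: "?A \<in> borel_measurable borel" "?B \<in> borel_measurable borel" "?C \<in> borel_measurable borel" "?D \<in> borel_measurable borel"
    by (auto intro!: borel_measurable_continuous_onI continuous_intros)
  note multL = L2_bounded_mult[OF _ mb(1) bdd(1)] L2_bounded_mult[OF _ mb(2) bdd(2)]
    L2_bounded_mult[OF _ mb(3) bdd(3)] L2_bounded_mult[OF _ mb(4) bdd(4)]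
  have H1L: "L2 ?M (\<lambda>u. ?A u * G (Phi p u) $ 1 + ?C u * G (Phi p u) $ 2)"
    and H2L: "L2 ?M (\<lambda>u. ?B u * G (Phi p u) $ 1 + ?D u * G (Phi p u) $ 2)"
    by (intro L2_add multL L2_nth GL; assumption)+
  have HL: "L2 ?M (\<lambda>u. DPhi_adj p u (G (Phi p u)))"
  proof -
    have "L2 ?M (\<lambda>u. f u *\<^sub>R axis i (1::real) :: real^2)" if "L2 ?M f" for f and i :: 2
      by (rule L2_dominated[OF that, where C=1]) (use that in auto)
    from L2_add[OF this[OF H1L, of 1] this[OF H2L, of 2]]
    show ?thesis by (simp add: DPhi_adj_def vector_2_eq_axis)
  qed
  have Jpos: "J p u > 0" if "u \<in> ?U" for u
    using J_pos(1)[OF p, of u] open_square_subset that by auto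
  have JD: "J p u = ?A u * ?D u - ?B u * ?C u" for u by (simp only: J_eq_det det_DPhi)
  define gJ where "gJ = (vector [2 * p $ 3 * (1 - p $ 1) - 2 * p $ 2 * p $ 4, 2 * p $ 3 * p $ 4 - 2 * p $ 2 * (1 + p $ 1)] :: real^2)"
  have quotd: "((\<lambda>u. m u / J p u) has_derivative (\<lambda>h. ((1 / J p u) *\<^sub>R gm - (m u / (J p u)\<^sup>2) *\<^sub>R gJ) \<bullet> h)) (at u)"
    if u: "u \<in> ?U" and m: "\<And>u. (m has_derivative (\<lambda>h. gm \<bullet> h)) (at u)" for m gm u
  proof -
    have J': "(J p has_derivative (\<lambda>h. gJ \<bullet> h)) (at u)" unfolding gJ_def by (rule has_derivative_J)
    show ?thesis
      by (rule has_derivative_eq_rhs[OF has_derivative_divide[OF m J']])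
         (use Jpos[OF u] in \<open>auto simp: inner_diff_left field_simps power2_eq_square\<close>)
  qed
  have quotc: "continuous_on ?U (\<lambda>u. (1 / J p u) *\<^sub>R gm - (m u / (J p u)\<^sup>2) *\<^sub>R gJ)"
    if m: "\<And>u. (m has_derivative (\<lambda>h. gm \<bullet> h)) (at u)" for m gm
  proof -
    have "continuous_on ?U m" by (rule has_derivative_continuous_on[OF has_derivative_at_withinI[OF m]])
    moreover have "\<forall>u\<in>?U. J p u \<noteq> 0" using Jpos by force
    ultimately show ?thesis by (intro continuous_intros continuous_on_J) auto
  qed
  have dA: "(?A has_derivative (\<lambda>h. vector [0, - 2 * p $ 2] \<bullet> h)) (at u)"
    and dB: "(?B has_derivative (\<lambda>h. vector [- 2 * p $ 2, 0] \<bullet> h)) (at u)"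
    and dC: "(?C has_derivative (\<lambda>h. vector [0, 2 * p $ 3] \<bullet> h)) (at u)"
    and dD: "(?D has_derivative (\<lambda>h. vector [2 * p $ 3, 0] \<bullet> h)) (at u)" for u
    using has_derivative_affine_nth[of "1 - p $ 1" 0 "- 2 * p $ 2" u] has_derivative_affine_nth[of "- p $ 4" "- 2 * p $ 2" 0 u]
      has_derivative_affine_nth[of "- p $ 4" 0 "2 * p $ 3" u] has_derivative_affine_nth[of "1 + p $ 1" "2 * p $ 3" 0 u]
    by simp_all
  \<comment> \<open>The transported identity is used in direction 1 with the test function
    \<open>t1\<close> and in direction 2 with \<open>t2\<close>, and the results are added; the
    assumption \<open>id\<close> states the Piola cancellation for the pair \<open>m1\<close>,
    \<open>m2\<close>.\<close>
  have key: "(LINT u|?M. ?W u * (grad \<psi> u $ i)) = - (LINT u|?M. \<psi> u * (m1 u * G (Phi p u) $ 1 + m2 u * G (Phi p u) $ 2))"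
    if t: "test_function ?U \<psi>"
      and d1: "\<And>u. (m1 has_derivative (\<lambda>h. gm1 \<bullet> h)) (at u)" and d2: "\<And>u. (m2 has_derivative (\<lambda>h. gm2 \<bullet> h)) (at u)"
      and L1: "L2 ?M (\<lambda>u. m1 u * G (Phi p u) $ 1)" and L2': "L2 ?M (\<lambda>u. m2 u * G (Phi p u) $ 2)"
      and id: "\<And>u X. u \<in> ?U \<Longrightarrow>
        DPhi_cof p u ((m1 u / J p u) *\<^sub>R grad \<psi> u + X *\<^sub>R ((1 / J p u) *\<^sub>R gm1 - (m1 u / (J p u)\<^sup>2) *\<^sub>R gJ)) $ 1
        + DPhi_cof p u ((m2 u / J p u) *\<^sub>R grad \<psi> u + X *\<^sub>R ((1 / J p u) *\<^sub>R gm2 - (m2 u / (J p u)\<^sup>2) *\<^sub>R gJ)) $ 2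
        = grad \<psi> u $ i"
    for \<psi> i m1 m2 gm1 gm2
  proof -
    note L\<psi> = test_function_L2[OF t open_square_lebesgue(2)]
    define t1 where "t1 = (\<lambda>u. m1 u / J p u * \<psi> u)"
    define t2 where "t2 = (\<lambda>u. m2 u / J p u * \<psi> u)"
    have T1: "test_function ?U t1"
      "\<And>u. u \<in> ?U \<Longrightarrow> grad t1 u = (m1 u / J p u) *\<^sub>R grad \<psi> u + \<psi> u *\<^sub>R ((1 / J p u) *\<^sub>R gm1 - (m1 u / (J p u)\<^sup>2) *\<^sub>R gJ)"
      unfolding t1_def by (rule test_function_mult[OF t open_open_square quotd[OF _ d1] quotc[OF d1]]; assumption)+
    have T2: "test_function ?U t2"
      "\<And>u. u \<in> ?U \<Longrightarrow> grad t2 u = (m2 u / J p u) *\<^sub>R grad \<psi> u + \<psi> u *\<^sub>R ((1 / J p u) *\<^sub>R gm2 - (m2 u / (J p u)\<^sup>2) *\<^sub>R gJ)"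
      unfolding t2_def by (rule test_function_mult[OF t open_open_square quotd[OF _ d2] quotc[OF d2]]; assumption)+
    have cofL: "L2 ?M (\<lambda>u. DPhi_cof p u (V u) $ 1)" "L2 ?M (\<lambda>u. DPhi_cof p u (V u) $ 2)" if "L2 ?M V" for V
      unfolding DPhi_cof_def vector_2 by (intro L2_diff multL L2_nth that; assumption)+
    have cof1: "integrable ?M (\<lambda>u. ?W u * DPhi_cof p u (grad t1 u) $ 1)"
      by (intro L2_mult_integrable WL cofL test_function_L2[OF T1(1)] open_square_lebesgue(2))
    have cof2: "integrable ?M (\<lambda>u. ?W u * DPhi_cof p u (grad t2 u) $ 2)"
      by (intro L2_mult_integrable WL cofL test_function_L2[OF T2(1)] open_square_lebesgue(2))
    have r1: "(LINT u|?M. (J p u * t1 u) * (G (Phi p u) \<bullet> axis 1 1)) = (LINT u|?M. \<psi> u * (m1 u * G (Phi p u) $ 1))"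
      by (rule Bochner_Integration.integral_cong) (use Jpos in \<open>force simp: t1_def space_restrict_space inner_axis\<close>)+
    have r2: "(LINT u|?M. (J p u * t2 u) * (G (Phi p u) \<bullet> axis 2 1)) = (LINT u|?M. \<psi> u * (m2 u * G (Phi p u) $ 2))"
      by (rule Bochner_Integration.integral_cong) (use Jpos in \<open>force simp: t2_def space_restrict_space inner_axis\<close>)+
    have "(LINT u|?M. ?W u * (grad \<psi> u $ i)) = (LINT u|?M. ?W u * DPhi_cof p u (grad t1 u) $ 1 + ?W u * DPhi_cof p u (grad t2 u) $ 2)"
    proof (rule Bochner_Integration.integral_cong[OF refl])
      fix u assume "u \<in> space ?M"
      hence u: "u \<in> ?U" by (simp add: space_restrict_space)
      show "?W u * (grad \<psi> u $ i) = ?W u * DPhi_cof p u (grad t1 u) $ 1 + ?W u * DPhi_cof p u (grad t2 u) $ 2"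
        unfolding T1(2)[OF u] T2(2)[OF u] distrib_left[symmetric] id[OF u] ..
    qed
    also have "\<dots> = (LINT u|?M. ?W u * DPhi_cof p u (grad t1 u) $ 1) + (LINT u|?M. ?W u * DPhi_cof p u (grad t2 u) $ 2)"
      using cof1 cof2 by simp
    also have "\<dots> = - (LINT u|?M. \<psi> u * (m1 u * G (Phi p u) $ 1)) - (LINT u|?M. \<psi> u * (m2 u * G (Phi p u) $ 2))"
      using weak_gradient_transport[OF p w T1(1), of "axis 1 1"] weak_gradient_transport[OF p w T2(1), of "axis 2 1"]
      unfolding r1 r2 by (simp add: inner_axis)
    also have "\<dots> = - (LINT u|?M. \<psi> u * (m1 u * G (Phi p u) $ 1) + \<psi> u * (m2 u * G (Phi p u) $ 2))"
      using L2_mult_integrable[OF L\<psi>(1) L1] L2_mult_integrable[OF L\<psi>(1) L2'] by simp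
    finally show ?thesis by (simp add: distrib_left)
  qed
  have j1: "gJ $ 1 = ?A u * (2 * p $ 3) + 2 * p $ 2 * ?C u" and j2: "gJ $ 2 = - (2 * p $ 2 * ?D u) - ?B u * (2 * p $ 3)" for u
    by (simp_all add: gJ_def algebra_simps)
  \<comment> \<open>The first column \<open>?A\<close>, \<open>?C\<close> of the derivative produces
    the first partial derivative; the second column produces the second one in
    \<open>key2\<close>.\<close>
  have key1: "(LINT u|?M. ?W u * (grad \<psi> u $ 1)) = - (LINT u|?M. \<psi> u * (?A u * G (Phi p u) $ 1 + ?C u * G (Phi p u) $ 2))"
    if t: "test_function ?U \<psi>" for \<psi>
  proof (rule key[OF t dA dC])
    fix u X assume u: "u \<in> ?U"
    have J0: "J p u \<noteq> 0" using Jpos[OF u] by simp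
    show "DPhi_cof p u ((?A u / J p u) *\<^sub>R grad \<psi> u + X *\<^sub>R ((1 / J p u) *\<^sub>R vector [0, - 2 * p $ 2] - (?A u / (J p u)\<^sup>2) *\<^sub>R gJ)) $ 1
        + DPhi_cof p u ((?C u / J p u) *\<^sub>R grad \<psi> u + X *\<^sub>R ((1 / J p u) *\<^sub>R vector [0, 2 * p $ 3] - (?C u / (J p u)\<^sup>2) *\<^sub>R gJ)) $ 2
        = grad \<psi> u $ 1"
      using piola_identity(1)[OF JD J0 j1[of u]]
      unfolding DPhi_cof_def vector_2 vector_add_component vector_minus_component vector_scaleR_component real_scaleR_def mult_minus_left .
  qed (intro multL L2_nth GL; assumption)+
  have key2: "(LINT u|?M. ?W u * (grad \<psi> u $ 2)) = - (LINT u|?M. \<psi> u * (?B u * G (Phi p u) $ 1 + ?D u * G (Phi p u) $ 2))"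
    if t: "test_function ?U \<psi>" for \<psi>
  proof (rule key[OF t dB dD])
    fix u X assume u: "u \<in> ?U"
    have J0: "J p u \<noteq> 0" using Jpos[OF u] by simp
    show "DPhi_cof p u ((?B u / J p u) *\<^sub>R grad \<psi> u + X *\<^sub>R ((1 / J p u) *\<^sub>R vector [- 2 * p $ 2, 0] - (?B u / (J p u)\<^sup>2) *\<^sub>R gJ)) $ 1
        + DPhi_cof p u ((?D u / J p u) *\<^sub>R grad \<psi> u + X *\<^sub>R ((1 / J p u) *\<^sub>R vector [2 * p $ 3, 0] - (?D u / (J p u)\<^sup>2) *\<^sub>R gJ)) $ 2
        = grad \<psi> u $ 2"
      using piola_identity(2)[OF JD J0 j2[of u]]
      unfolding DPhi_cof_def vector_2 vector_add_component vector_minus_component vector_scaleR_component real_scaleR_def mult_minus_left .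
  qed (intro multL L2_nth GL; assumption)+
  show ?thesis
    unfolding H1_iff[OF open_square_lebesgue(2)]
  proof (intro conjI allI impI WL HL)
    fix \<psi> and b :: "real^2" assume t: "test_function ?U \<psi>"
    note L\<psi> = test_function_L2[OF t open_square_lebesgue(2)]
    have "(LINT u|?M. ?W u * (grad \<psi> u \<bullet> b)) = (LINT u|?M. b $ 1 * (?W u * grad \<psi> u $ 1) + b $ 2 * (?W u * grad \<psi> u $ 2))"
      by (simp add: inner_vec_def sum_2 algebra_simps)
    also have "\<dots> = b $ 1 * (LINT u|?M. ?W u * grad \<psi> u $ 1) + b $ 2 * (LINT u|?M. ?W u * grad \<psi> u $ 2)"
      using L2_mult_integrable[OF WL L2_nth[OF L\<psi>(2)]] by simp
    also have "\<dots> = - (b $ 1 * (LINT u|?M. \<psi> u * (?A u * G (Phi p u) $ 1 + ?C u * G (Phi p u) $ 2))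
        + b $ 2 * (LINT u|?M. \<psi> u * (?B u * G (Phi p u) $ 1 + ?D u * G (Phi p u) $ 2)))"
      unfolding key1[OF t] key2[OF t] by simp
    also have "\<dots> = - (LINT u|?M. b $ 1 * (\<psi> u * (?A u * G (Phi p u) $ 1 + ?C u * G (Phi p u) $ 2))
        + b $ 2 * (\<psi> u * (?B u * G (Phi p u) $ 1 + ?D u * G (Phi p u) $ 2)))"
      using L2_mult_integrable[OF L\<psi>(1) H1L] L2_mult_integrable[OF L\<psi>(1) H2L] by simp
    also have "\<dots> = - (LINT u|?M. \<psi> u * (DPhi_adj p u (G (Phi p u)) \<bullet> b))"
      by (simp only: DPhi_adj_def inner_vec_def sum_2 vector_2 inner_real_def distrib_left mult_ac)
    finally show "(LINT u|?M. ?W u * (grad \<psi> u \<bullet> b)) = - (LINT u|?M. \<psi> u * (DPhi_adj p u (G (Phi p u)) \<bullet> b))" .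
  qed
qed

section \<open>Cosine modes on the square\<close>

lemma lborel_vec2: "lborel = distr (lborel \<Otimes>\<^sub>M lborel) borel (\<lambda>(x, y). vector [x, y] :: real^2)"
proof (rule lborel_eqI)
  have m: "(\<lambda>(x, y). vector [x, y] :: real^2) \<in> borel_measurable (lborel \<Otimes>\<^sub>M lborel)"
    unfolding vector_2_eq_axis by measurable
  fix l u :: "real^2" assume lu: "\<And>b. b \<in> Basis \<Longrightarrow> l \<bullet> b \<le> u \<bullet> b"
  have le: "l $ i \<le> u $ i" for i using lu[of "axis i 1"] by (auto simp: inner_axis Basis_vec_def)
  have pre: "(\<lambda>(x, y). vector [x, y] :: real^2) -` box l u \<inter> space (lborel \<Otimes>\<^sub>M lborel) = {l $ 1<..<u $ 1} \<times> {l $ 2<..<u $ 2}"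
    by (auto simp: mem_box_cart forall_2 space_pair_measure)
  have B: "(\<Prod>b\<in>Basis. (u - l) \<bullet> b) = (u $ 1 - l $ 1) * (u $ 2 - l $ 2)"
  proof -
    have b: "Basis = {axis 1 1, axis 2 1 :: real^2}" by (auto simp: Basis_vec_def UNIV_2)
    have "axis 1 1 \<noteq> (axis 2 1 :: real^2)" by (simp add: axis_eq_axis)
    thus ?thesis unfolding b by (simp add: inner_axis)
  qed
  show "emeasure (distr (lborel \<Otimes>\<^sub>M lborel) borel (\<lambda>(x, y). vector [x, y])) (box l u) = (\<Prod>b\<in>Basis. (u - l) \<bullet> b)"
    unfolding B using le[of 1] le[of 2]
    by (subst emeasure_distr[OF m]) (auto simp: pre lborel.emeasure_pair_measure_Times ennreal_mult)
qed simp

text \<open>Fubini on the square. The factors are written with \<open>integral\<close> so that they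
  can be evaluated by the fundamental theorem of calculus.\<close>

lemma set_integral_square_product:
  assumes "continuous_on UNIV f" "continuous_on UNIV h"
  shows "(LINT w:square|lborel. f (w $ 1) * h (w $ 2)) = integral {-1/2..1/2} f * integral {-1/2..1/2} (h::real\<Rightarrow>real)"
proof -
  let ?I = "{-1/2..1/2::real}"
  have [measurable]: "f \<in> borel_measurable borel" "h \<in> borel_measurable borel"
    using assms by (auto intro: borel_measurable_continuous_onI)
  have int: "set_integrable lborel ?I f" "set_integrable lborel ?I h"
    unfolding set_integrable_def
    by (intro borel_integrable_compact continuous_on_subset[OF assms(1)] continuous_on_subset[OF assms(2)]; simp)+
  have e: "integral ?I f = (LINT x|lborel. indicator ?I x * f x)" "integral ?I h = (LINT x|lborel. indicator ?I x * h x)"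
    using set_borel_integral_eq_integral(2)[OF int(1)] set_borel_integral_eq_integral(2)[OF int(2)]
    by (simp_all add: set_lebesgue_integral_def)
  define vv :: "real \<times> real \<Rightarrow> real^2" where "vv = (\<lambda>(x, y). vector [x, y])"
  have m: "vv \<in> borel_measurable (lborel \<Otimes>\<^sub>M lborel)"
    unfolding vv_def vector_2_eq_axis by measurable
  have sq [measurable]: "square \<in> sets borel" by (simp add: square_def)
  have [measurable]: "(\<lambda>w::real^2. w $ i) \<in> borel_measurable borel" for i
    by (intro borel_measurable_continuous_onI continuous_intros)
  have ind: "indicator square (vector [x, y]) = (indicator ?I x * indicator ?I y :: real)" for x y
    by (auto simp: indicator_def mem_square)
  let ?F = "\<lambda>(x, y). (indicator ?I x * f x) * (indicator ?I y * h y)"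
  have "integrable lborel (\<lambda>w::real\<times>real. indicator (cbox (-1/2, -1/2) (1/2, 1/2)) w *\<^sub>R (f (fst w) * h (snd w)))"
    by (rule borel_integrable_compact)
       (auto intro!: continuous_intros continuous_on_compose2[OF assms(1)] continuous_on_compose2[OF assms(2)])
  also have "(\<lambda>w::real\<times>real. indicator (cbox (-1/2, -1/2) (1/2, 1/2)) w *\<^sub>R (f (fst w) * h (snd w))) = ?F"
    by (auto simp: indicator_def cbox_Pair_eq fun_eq_iff)
  finally have intF: "integrable (lborel \<Otimes>\<^sub>M lborel) ?F" by (simp add: lborel_prod)
  have "(LINT w:square|lborel. f (w $ 1) * h (w $ 2)) =
    (LINT w|(distr (lborel \<Otimes>\<^sub>M lborel) borel (\<lambda>(x, y). vector [x, y] :: real^2)). indicator square w * (f (w $ 1) * h (w $ 2)))"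
    unfolding lborel_vec2[symmetric] by (simp add: set_lebesgue_integral_def)
  also have "\<dots> = (LINT z|(lborel \<Otimes>\<^sub>M lborel). indicator square (vv z) * (f (vv z $ 1) * h (vv z $ 2)))"
    unfolding vv_def[symmetric]
    by (rule integral_distr[OF m]) measurable
  also have "\<dots> = (LINT z|(lborel \<Otimes>\<^sub>M lborel). ?F z)"
    by (rule Bochner_Integration.integral_cong) (auto simp: ind vv_def)
  also have "\<dots> = (LINT x|lborel. LINT y|lborel. ?F (x, y))"
    by (rule lborel_pair.integral_fst'[OF intF, symmetric])
  also have "\<dots> = (LINT x|lborel. indicator ?I x * f x) * (LINT y|lborel. indicator ?I y * h y)"
    by simp
  finally show ?thesis unfolding e .
qed

lemma set_integrable_square:
  fixes F :: "real^2 \<Rightarrow> 'b::euclidean_space"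
  assumes "continuous_on UNIV F"
  shows "set_integrable lborel square F"
  unfolding set_integrable_def
  by (intro borel_integrable_compact compact_square continuous_on_subset[OF assms]) simp

text \<open>Bridges two conventions: the matrices integrate over the closed square with
  \<open>lborel\<close>, the Sobolev arguments over the open square with \<open>lebesgue_on\<close>.
  The boundary is a null set.\<close>

lemma integral_open_square_eq:
  fixes F :: "real^2 \<Rightarrow> real"
  assumes "continuous_on UNIV F"
  shows "integrable (lebesgue_on open_square) F"
    and "(LINT w|lebesgue_on open_square. F w) = (LINT w:square|lborel. F w)"
proof -
  have ab: "F absolutely_integrable_on square"
    using set_integrable_square[OF assms] borel_measurable_continuous_onI[OF assms]
    by (simp add: set_integrable_def integrable_completion square_def)
  have "F absolutely_integrable_on open_square"
    by (rule set_integrable_subset[OF ab]) (use open_square_subset in auto)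
  thus i: "integrable (lebesgue_on open_square) F" by (simp add: integrable_lebesgue_on_iff)
  have "(LINT w|lebesgue_on open_square. F w) = integral open_square F"
    by (rule lebesgue_integral_eq_integral[OF i]) simp
  also have "\<dots> = integral square F"
    unfolding open_square_def square_def by (rule integral_open_interval)
  also have "\<dots> = (LINT w:square|lborel. F w)"
    using set_borel_integral_eq_integral(2)[OF set_integrable_square[OF assms]] by simp
  finally show "(LINT w|lebesgue_on open_square. F w) = (LINT w:square|lborel. F w)" .
qed

lemma cos_shift_integral:
  "integral {-1/2..1/2} (\<lambda>x::real. cos (real m * pi * (x + 1/2))) = (if m = 0 then 1 else 0)"
proof (cases "m = 0")
  case False
  have "((\<lambda>x. cos (real m * pi * (x + 1/2))) has_integral
      sin (real m * pi * (1/2 + 1/2)) / (real m * pi) - sin (real m * pi * (-1/2 + 1/2)) / (real m * pi)) {-1/2..1/2}"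
    using False
    by (intro fundamental_theorem_of_calculus)
       (auto intro!: derivative_eq_intros simp: has_real_derivative_iff_has_vector_derivative[symmetric])
  thus ?thesis using False by (auto intro!: integral_unique)
qed simp

lemma cos_diff_nat: "cos (real m * x - real n * x) = cos (real (if m \<le> n then n - m else m - n) * x)"
proof (cases "m \<le> n")
  case True
  hence "real m * x - real n * x = - (real (n - m) * x)" by (simp add: of_nat_diff algebra_simps)
  thus ?thesis using True by (simp only: cos_minus if_True)
next
  case False
  hence "real m * x - real n * x = real (m - n) * x" by (simp add: of_nat_diff algebra_simps)
  thus ?thesis using False by simp
qed

lemma cos_times_cos_nat:
  "cos (real m * x) * cos (real n * x) = (cos (real (if m \<le> n then n - m else m - n) * x) + cos (real (m + n) * x)) / 2"
  unfolding cos_times_cos cos_diff_nat by (simp add: algebra_simps)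

lemma cos_shift_orthogonal:
  "integral {-1/2..1/2} (\<lambda>x::real. cos (real m * pi * (x + 1/2)) * cos (real n * pi * (x + 1/2))) =
    (if m = n then if m = 0 then 1 else 1/2 else 0)"
proof -
  have i: "(\<lambda>x::real. cos (real k * pi * (x + 1/2))) integrable_on {-1/2..1/2}" for k
    by (intro integrable_continuous_real continuous_intros)
  have "integral {-1/2..1/2} (\<lambda>x::real. cos (real m * pi * (x + 1/2)) * cos (real n * pi * (x + 1/2))) =
    integral {-1/2..1/2} (\<lambda>x::real. (1/2) * cos (real (if m \<le> n then n - m else m - n) * pi * (x + 1/2)) + (1/2) * cos (real (m + n) * pi * (x + 1/2)))"
    using cos_times_cos_nat[of m "pi * (_ + 1/2)" n]
    by (intro Henstock_Kurzweil_Integration.integral_cong) (simp only: mult.assoc add_divide_distrib)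
  also have "\<dots> = (1/2) * (if (if m \<le> n then n - m else m - n) = 0 then 1 else 0) + (1/2) * (if m + n = 0 then 1 else 0)"
    by (subst Henstock_Kurzweil_Integration.integral_add)
       (use i in \<open>auto simp only: integral_mult_right cos_shift_integral intro!: integrable_on_mult_right\<close>)
  finally show ?thesis by (auto split: if_splits)
qed

lemma continuous_cos_mode: "continuous_on S (cos_mode m n)"
  unfolding cos_mode_def by (intro continuous_intros)

lemma has_derivative_cos_mode:
  "(cos_mode m n has_derivative (\<lambda>h. vector
      [- (real m * pi * sin (real m * pi * (w $ 1 + 1/2)) * cos (real n * pi * (w $ 2 + 1/2))),
       - (real n * pi * cos (real m * pi * (w $ 1 + 1/2)) * sin (real n * pi * (w $ 2 + 1/2)))] \<bullet> h)) (at w)"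
  unfolding cos_mode_def
  by (auto intro!: derivative_eq_intros bounded_linear.has_derivative[OF bounded_linear_vec_nth] ext
      simp: inner_vec_def sum_2 algebra_simps)

lemmas grad_cos_mode = grad_eqI[OF has_derivative_cos_mode]

lemma differentiable_cos_mode: "cos_mode m n differentiable (at w)"
  using has_derivative_cos_mode unfolding differentiable_def by blast

lemma continuous_grad_cos_mode: "continuous_on S (grad (cos_mode m n))"
  unfolding grad_cos_mode[abs_def] vector_2_eq_axis by (intro continuous_intros)

lemma H1_cos_mode: "bounded \<Omega> \<Longrightarrow> \<Omega> \<in> sets lebesgue \<Longrightarrow> H1_with_gradient \<Omega> (cos_mode m n) (grad (cos_mode m n))"
  by (intro H1_smooth differentiable_cos_mode continuous_grad_cos_mode)

lemma H1_cos_mode_square: "H1_with_gradient open_square (cos_mode m n) (grad (cos_mode m n))"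
  by (rule H1_cos_mode[OF bounded_open_square open_square_lebesgue(1)])

text \<open>The squared L2 norm of one cosine factor over a side of the square.\<close>

definition mode_weight :: "nat \<Rightarrow> real" where "mode_weight m = (if m = 0 then 1 else 1/2)"

lemma cos_mode_orthogonal:
  "(LINT w|lebesgue_on open_square. cos_mode m n w * cos_mode m' n' w) =
    (if m = m' \<and> n = n' then mode_weight m * mode_weight n else 0)"
proof -
  have "(LINT w|lebesgue_on open_square. cos_mode m n w * cos_mode m' n' w) =
    (LINT w:square|lborel. cos_mode m n w * cos_mode m' n' w)"
    by (intro integral_open_square_eq continuous_intros continuous_cos_mode)
  also have "\<dots> = (LINT w:square|lborel. (\<lambda>x. cos (real m * pi * (x + 1/2)) * cos (real m' * pi * (x + 1/2))) (w $ 1)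
      * (\<lambda>y. cos (real n * pi * (y + 1/2)) * cos (real n' * pi * (y + 1/2))) (w $ 2))"
    by (simp add: cos_mode_def mult_ac)
  also have "\<dots> = integral {-1/2..1/2} (\<lambda>x. cos (real m * pi * (x + 1/2)) * cos (real m' * pi * (x + 1/2)))
      * integral {-1/2..1/2} (\<lambda>y. cos (real n * pi * (y + 1/2)) * cos (real n' * pi * (y + 1/2)))"
    by (rule set_integral_square_product) (intro continuous_intros)+
  finally show ?thesis unfolding cos_shift_orthogonal by (auto simp: mode_weight_def)
qed

lemma abs_cos_mode_le: "\<bar>cos_mode m n w\<bar> \<le> 1"
  using mult_mono[of "\<bar>cos (real m * pi * (w $ 1 + 1/2))\<bar>" 1 "\<bar>cos (real n * pi * (w $ 2 + 1/2))\<bar>" 1]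
  by (simp add: cos_mode_def abs_mult)

section \<open>Completeness of the cosine modes and Parseval's identity\<close>

lemma cos_mode_mult:
  "cos_mode 1 0 w * cos_mode m n w = (cos_mode (if m = 0 then 1 else m - 1) n w + cos_mode (m + 1) n w) / 2"
  "cos_mode 0 1 w * cos_mode m n w = (cos_mode m (if n = 0 then 1 else n - 1) w + cos_mode m (n + 1) w) / 2"
proof -
  have c: "cos x * cos (real m * x) = (cos (real (if m = 0 then 1 else m - 1) * x) + cos (real (m + 1) * x)) / 2" for x :: real and m
  proof -
    have "(if 1 \<le> m then m - 1 else 1 - m) = (if m = 0 then 1 else m - 1)" by auto
    thus ?thesis using cos_times_cos_nat[of 1 x m] by (simp add: add.commute)
  qed
  have c': "cos x * (cos (real m * x) * y) = (cos (real (if m = 0 then 1 else m - 1) * x) * y + cos (real (m + 1) * x) * y) / 2"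
    "cos x * (y * cos (real m * x)) = (y * cos (real (if m = 0 then 1 else m - 1) * x) + y * cos (real (m + 1) * x)) / 2"
    for x y :: real and m
  proof -
    define X where "X = cos (real (if m = 0 then 1 else m - 1) * x)"
    have 1: "cos x * cos (real m * x) = (X + cos (real (m + 1) * x)) / 2" unfolding X_def by (rule c)
    have "cos x * (cos (real m * x) * y) = (cos x * cos (real m * x)) * y" by simp
    also have "\<dots> = (X * y + cos (real (m + 1) * x) * y) / 2" unfolding 1 by (simp add: field_simps)
    finally show "cos x * (cos (real m * x) * y) = (cos (real (if m = 0 then 1 else m - 1) * x) * y + cos (real (m + 1) * x) * y) / 2"
      unfolding X_def .
    thus "cos x * (y * cos (real m * x)) = (y * cos (real (if m = 0 then 1 else m - 1) * x) + y * cos (real (m + 1) * x)) / 2"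
      by (simp only: mult.commute[of y])
  qed
  show "cos_mode 1 0 w * cos_mode m n w = (cos_mode (if m = 0 then 1 else m - 1) n w + cos_mode (m + 1) n w) / 2"
    using c'(1)[of "pi * (w $ 1 + 1/2)" m "cos (real n * pi * (w $ 2 + 1/2))"] unfolding cos_mode_def mult.assoc by simp
  show "cos_mode 0 1 w * cos_mode m n w = (cos_mode m (if n = 0 then 1 else n - 1) w + cos_mode m (n + 1) w) / 2"
    using c'(2)[of "pi * (w $ 2 + 1/2)" "cos (real m * pi * (w $ 1 + 1/2))" n] unfolding cos_mode_def mult.assoc by simp
qed

text \<open>The algebra for the Stone-Weierstrass theorem is generated by the two lowest modes
  instead of being the span of all modes: closure under products then holds by definition, and only
  products with a generator have to be expanded.\<close>

inductive_set mode_ring :: "(real^2 \<Rightarrow> real) set" where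
  const: "(\<lambda>_. c) \<in> mode_ring"
| mode_1: "cos_mode 1 0 \<in> mode_ring"
| mode_2: "cos_mode 0 1 \<in> mode_ring"
| add: "f \<in> mode_ring \<Longrightarrow> h \<in> mode_ring \<Longrightarrow> (\<lambda>x. f x + h x) \<in> mode_ring"
| mult: "f \<in> mode_ring \<Longrightarrow> h \<in> mode_ring \<Longrightarrow> (\<lambda>x. f x * h x) \<in> mode_ring"

lemma continuous_mode_ring: "f \<in> mode_ring \<Longrightarrow> continuous_on S f"
  by (induction rule: mode_ring.induct) (auto intro!: continuous_intros continuous_cos_mode)

lemma cos_shift_eq_sin: "cos (pi * (x + 1/2)) = - sin (pi * x)"
proof -
  have "pi * (x + 1/2) = pi * x + pi / 2" by (simp add: algebra_simps)
  thus ?thesis by (simp add: cos_add)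
qed

text \<open>The generators separate points because, up to sign, they are sin(pi x) in each
  coordinate, which is injective on [-1/2, 1/2].\<close>

interpretation modes: function_ring_on mode_ring square
proof
  show "compact square" by (rule compact_square)
  show "\<exists>f\<in>mode_ring. f x \<noteq> f y" if xy: "x \<in> square" "y \<in> square" "x \<noteq> y" for x y
  proof (rule ccontr)
    assume "\<not> (\<exists>f\<in>mode_ring. f x \<noteq> f y)"
    hence "cos_mode 1 0 x = cos_mode 1 0 y" "cos_mode 0 1 x = cos_mode 0 1 y"
      using mode_ring.mode_1 mode_ring.mode_2 by blast+
    hence s: "sin (pi * x $ i) = sin (pi * y $ i)" for i
      using exhaust_2[of i] by (auto simp: cos_mode_def cos_shift_eq_sin)
    have r: "- (pi / 2) \<le> pi * z $ i" "pi * z $ i \<le> pi / 2" if "z \<in> square" for z i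
    proof -
      have z: "-1/2 \<le> z $ i" "z $ i \<le> 1/2" using that exhaust_2[of i] by (auto simp: mem_square)
      show "- (pi / 2) \<le> pi * z $ i" "pi * z $ i \<le> pi / 2"
        using mult_left_mono[OF z(1), of pi] mult_left_mono[OF z(2), of pi] by simp_all
    qed
    have "pi * x $ i = pi * y $ i" for i
      using s[of i] sin_inj_pi[OF r(1,2)[OF xy(1)] r(1,2)[OF xy(2)]] by blast
    hence "x = y" by (simp add: vec_eq_iff)
    with xy show False by simp
  qed
qed (auto intro: mode_ring.intros continuous_mode_ring)

text \<open>Orthogonality to all modes is preserved under multiplication by ring elements. The
  induction generalises over \<open>u\<close>, so that the product case can apply the hypothesis for
  the second factor to \<open>u\<close> times the first.\<close>

lemma mode_ring_orthogonal:
  assumes "f \<in> mode_ring" "L2 (lebesgue_on open_square) u"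
    "\<And>m n. (LINT w|lebesgue_on open_square. u w * cos_mode m n w) = 0"
  shows "(LINT w|lebesgue_on open_square. (u w * f w) * cos_mode m n w) = 0"
  using assms
proof (induction arbitrary: u m n rule: mode_ring.induct)
  let ?M = "lebesgue_on open_square"
  have CL: "L2 ?M (cos_mode m n)" for m n by (rule H1_L2(1)[OF H1_cos_mode_square])
  have ringL: "L2 ?M (\<lambda>w. u w * f w)" if f: "f \<in> mode_ring" and u: "L2 ?M u" for u f
  proof -
    have "bounded (f ` square)"
      by (intro compact_imp_bounded compact_continuous_image continuous_mode_ring f compact_square)
    then obtain B where "\<forall>w\<in>square. \<bar>f w\<bar> \<le> B" by (auto simp: bounded_iff)
    hence "\<bar>f w\<bar> \<le> B" if "w \<in> open_square" for w using open_square_subset that by blast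
    from L2_bounded_mult[OF u borel_measurable_continuous_onI[OF continuous_mode_ring[OF f]] this]
    show ?thesis by (simp add: mult.commute)
  qed
  {
    case (const c)
    have "(LINT w|?M. (u w * c) * cos_mode m n w) = c * (LINT w|?M. u w * cos_mode m n w)"
      by (simp add: mult_ac flip: integral_mult_right_zero)
    thus ?case using const by simp
  next
    case mode_1
    have "(LINT w|?M. (u w * cos_mode 1 0 w) * cos_mode m n w) =
      (LINT w|?M. (1/2) * (u w * cos_mode (if m = 0 then 1 else m - 1) n w) + (1/2) * (u w * cos_mode (m + 1) n w))"
      by (intro Bochner_Integration.integral_cong refl) (simp only: mult.assoc cos_mode_mult, simp add: algebra_simps)
    also have "\<dots> = 0"
      using mode_1 L2_mult_integrable[OF mode_1(1) CL] by (simp del: One_nat_def)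
    finally show ?case .
  next
    case mode_2
    have "(LINT w|?M. (u w * cos_mode 0 1 w) * cos_mode m n w) =
      (LINT w|?M. (1/2) * (u w * cos_mode m (if n = 0 then 1 else n - 1) w) + (1/2) * (u w * cos_mode m (n + 1) w))"
      by (intro Bochner_Integration.integral_cong refl) (simp only: mult.assoc cos_mode_mult, simp add: algebra_simps)
    also have "\<dots> = 0"
      using mode_2 L2_mult_integrable[OF mode_2(1) CL] by (simp del: One_nat_def)
    finally show ?case .
  next
    case (add f h)
    have "(LINT w|?M. (u w * (f w + h w)) * cos_mode m n w) =
      (LINT w|?M. (u w * f w) * cos_mode m n w + (u w * h w) * cos_mode m n w)"
      by (simp add: algebra_simps)
    also have "\<dots> = 0"
      using add L2_mult_integrable[OF ringL[OF add(1) add(5)] CL] L2_mult_integrable[OF ringL[OF add(2) add(5)] CL] by simp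
    finally show ?case .
  next
    case (mult f h)
    have "(LINT w|?M. ((u w * f w) * h w) * cos_mode m n w) = 0"
      by (rule mult(4)[OF ringL[OF mult(1) mult(5)] mult(3)[OF mult(5,6)]])
    thus ?case by (simp add: mult.assoc)
  }
qed

lemma finite_measure_open_square: "finite_measure (lebesgue_on open_square)"
  by (rule finite_measure_lebesgue_on[OF open_square_lebesgue(2)])

lemma cos_mode_0: "cos_mode 0 0 w = 1"
  by (simp add: cos_mode_def)

lemma L2_cos_mode: "L2 (lebesgue_on open_square) (cos_mode m n)"
  by (rule H1_L2(1)[OF H1_cos_mode_square])

text \<open>By uniform approximation \<open>u\<close> is orthogonal to every continuous function. It
  remains to approximate a bounded function with the sign of \<open>u\<close> by continuous ones
  almost everywhere.\<close>

lemma cos_mode_complete: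
  assumes u: "L2 (lebesgue_on open_square) u"
    and orth: "\<And>m n. (LINT w|lebesgue_on open_square. u w * cos_mode m n w) = 0"
  shows "AE w in lebesgue_on open_square. u w = 0"
proof -
  let ?M = "lebesgue_on open_square"
  interpret finite_measure ?M by (rule finite_measure_open_square)
  have ui: "integrable ?M u" by (rule L2_integrable[OF u])
  have uf: "integrable ?M (\<lambda>w. u w * f w)" if f: "continuous_on UNIV f" for f
  proof -
    have "bounded (f ` square)"
      by (intro compact_imp_bounded compact_continuous_image compact_square continuous_on_subset[OF f]) simp
    then obtain B where B: "\<forall>w\<in>square. \<bar>f w\<bar> \<le> B" by (auto simp: bounded_iff)
    have "L2 ?M f"
      using B open_square_subset
      by (intro L2_bounded[of f B] borel_measurable_lebesgue_onI borel_measurable_continuous_onI f)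
         (auto simp: space_restrict_space)
    thus ?thesis by (rule L2_mult_integrable[OF u])
  qed
  have cont: "(LINT w|?M. u w * f w) = 0" if f: "continuous_on UNIV f" for f
  proof -
    have "\<bar>LINT w|?M. u w * f w\<bar> \<le> e * (LINT w|?M. \<bar>u w\<bar>)" if e: "e > 0" for e
    proof -
      obtain h where h: "h \<in> mode_ring" "\<forall>w\<in>square. \<bar>f w - h w\<bar> < e"
        using modes.Stone_Weierstrass_basic[OF continuous_on_subset[OF f] e] by auto
      have "(LINT w|?M. (u w * h w) * cos_mode 0 0 w) = 0" by (rule mode_ring_orthogonal[OF h(1) u orth])
      hence "(LINT w|?M. u w * f w) = (LINT w|?M. u w * f w) - (LINT w|?M. u w * h w)" by (simp add: cos_mode_0)
      also have "\<dots> = (LINT w|?M. u w * (f w - h w))"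
        using uf[OF f] uf[OF continuous_mode_ring[OF h(1)]] by (simp add: right_diff_distrib)
      finally have "\<bar>LINT w|?M. u w * f w\<bar> = norm (LINT w|?M. u w * (f w - h w))" by simp
      also have "\<dots> \<le> (LINT w|?M. norm (u w * (f w - h w)))" by (rule integral_norm_bound)
      also have "\<dots> \<le> (LINT w|?M. e * \<bar>u w\<bar>)"
      proof (rule integral_mono_AE)
        show "integrable ?M (\<lambda>w. norm (u w * (f w - h w)))"
          by (intro integrable_norm uf continuous_intros f continuous_mode_ring h)
        show "integrable ?M (\<lambda>w. e * \<bar>u w\<bar>)" using ui by simp
        show "AE w in ?M. norm (u w * (f w - h w)) \<le> e * \<bar>u w\<bar>"
        proof (rule AE_I2)
          fix w assume "w \<in> space ?M"
          hence "w \<in> square" using open_square_subset by (auto simp: space_restrict_space)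
          hence "\<bar>f w - h w\<bar> * \<bar>u w\<bar> \<le> e * \<bar>u w\<bar>" using h(2) by (intro mult_right_mono) (auto intro: less_imp_le)
          thus "norm (u w * (f w - h w)) \<le> e * \<bar>u w\<bar>" by (simp add: abs_mult mult.commute)
        qed
      qed
      finally show ?thesis by simp
    qed
    hence "\<bar>LINT w|?M. u w * f w\<bar> \<le> 0 * (LINT w|?M. \<bar>u w\<bar>)"
    proof (intro tendsto_lowerbound[where F="at_right (0::real)"])
      show "((\<lambda>e. e * (LINT w|?M. \<bar>u w\<bar>)) \<longlongrightarrow> 0 * (LINT w|?M. \<bar>u w\<bar>)) (at_right 0)"
        by (intro tendsto_intros)
    qed (auto simp: eventually_at_filter)
    thus ?thesis by simp
  qed
  \<comment> \<open>A bounded function with the sign of \<open>u\<close>: the product of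
    \<open>u\<close> and \<open>b\<close> is nonnegative and vanishes only where \<open>u\<close>
    does.\<close>
  define b where "b w = u w / (1 + \<bar>u w\<bar>)" for w
  have [measurable]: "u \<in> borel_measurable ?M" using u by measurable
  have "b \<in> borel_measurable ?M" unfolding b_def by measurable
  hence "(\<lambda>w. if w \<in> open_square then b w else 0) \<in> borel_measurable lebesgue"
    by (rule borel_measurable_if_I) simp
  hence "(\<lambda>w. if w \<in> open_square then b w else 0) measurable_on UNIV"
    by (rule lebesgue_measurable_imp_measurable_on_real) simp
  then obtain N h where N: "negligible N" and h: "\<And>n. continuous_on UNIV (h n)"
    and hlim: "\<And>w. w \<notin> N \<Longrightarrow> (\<lambda>n. h n w) \<longlonglongrightarrow> (if w \<in> open_square then b w else 0)"
    unfolding measurable_on_def by auto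
  \<comment> \<open>Truncation keeps continuity and the limit, since \<open>b\<close> has absolute
    value at most 1, and makes the absolute value of \<open>u\<close> a dominating function.\<close>
  define k where "k n w = max (-1) (min 1 (h n w))" for n w
  have k: "continuous_on UNIV (k n)" for n unfolding k_def by (intro continuous_intros h)
  have b1: "\<bar>b w\<bar> \<le> 1" for w by (simp add: b_def abs_divide)
  have Nnull: "N \<in> null_sets lebesgue" using N by (simp add: negligible_iff_null_sets)
  have klim: "AE w in ?M. (\<lambda>n. u w * k n w) \<longlonglongrightarrow> u w * b w"
  proof -
    have "AE w in lebesgue. w \<in> open_square \<longrightarrow> (\<lambda>n. u w * k n w) \<longlonglongrightarrow> u w * b w"
    proof (rule AE_I'[OF Nnull], rule subsetI)
      fix w assume "w \<in> {w \<in> space lebesgue. \<not> (w \<in> open_square \<longrightarrow> (\<lambda>n. u w * k n w) \<longlonglongrightarrow> u w * b w)}"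
      hence w: "w \<in> open_square" and *: "\<not> (\<lambda>n. u w * k n w) \<longlonglongrightarrow> u w * b w" by auto
      show "w \<in> N"
      proof (rule ccontr)
        assume "w \<notin> N"
        hence "(\<lambda>n. h n w) \<longlonglongrightarrow> b w" using hlim[of w] w by simp
        hence "(\<lambda>n. u w * k n w) \<longlonglongrightarrow> u w * max (-1) (min 1 (b w))"
          unfolding k_def by (intro tendsto_intros)
        with * b1[of w] show False by (simp add: abs_le_iff max_def min_def split: if_splits)
      qed
    qed
    thus ?thesis by (subst AE_restrict_space_iff) auto
  qed
  have "(\<lambda>n. LINT w|?M. u w * k n w) \<longlonglongrightarrow> (LINT w|?M. u w * b w)"
  proof (rule integral_dominated_convergence[OF _ _ _ klim])
    show "integrable ?M (\<lambda>w. \<bar>u w\<bar>)" using ui by simp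
    show "(\<lambda>w. u w * b w) \<in> borel_measurable ?M" unfolding b_def by measurable
    show "(\<lambda>w. u w * k n w) \<in> borel_measurable ?M" for n using uf[OF k] by measurable
    show "AE w in ?M. norm (u w * k n w) \<le> \<bar>u w\<bar>" for n
      by (rule AE_I2) (auto simp: abs_mult k_def intro!: mult_left_le)
  qed
  hence "(\<lambda>n. 0) \<longlonglongrightarrow> (LINT w|?M. u w * b w)" by (simp only: cont[OF k])
  from LIMSEQ_unique[OF this tendsto_const] have int0: "(LINT w|?M. u w * b w) = 0" .
  have "integrable ?M (\<lambda>w. u w * b w)"
  proof (rule Bochner_Integration.integrable_bound)
    show "AE w in ?M. norm (u w * b w) \<le> norm (u w)"
      using b1 by (intro AE_I2) (auto simp: abs_mult intro!: mult_left_le)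
  qed (use ui in \<open>auto simp: b_def\<close>)
  hence "AE w in ?M. u w * b w = 0"
    using int0 by (subst (asm) integral_nonneg_eq_0_iff_AE) (auto simp: b_def)
  thus ?thesis by eventually_elim (auto simp: b_def)
qed

text \<open>By Bessel's inequality the partial sums over growing squares of indices form an
  L2-Cauchy sequence. Its limit has the same coefficients as \<open>w\<close>, so completeness
  identifies the two. Square partial sums exhaust the pairs of indices and avoid infinite sums over
  them.\<close>

lemma parseval_limit:
  fixes e :: "nat \<times> nat \<Rightarrow> 'a \<Rightarrow> real"
  assumes "finite_measure M" and eL: "\<And>k. L2 M (e k)"
    and on: "\<And>k l. (LINT x|M. e k x * e l x) = (if k = l then 1 else 0)"
    and complete: "\<And>u. L2 M u \<Longrightarrow> (\<And>k. (LINT x|M. u x * e k x) = 0) \<Longrightarrow> AE x in M. u x = 0"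
    and w: "L2 M w"
  shows "(\<lambda>N. \<Sum>k\<in>{..N}\<times>{..N}. (LINT x|M. w x * e k x)\<^sup>2) \<longlonglongrightarrow> (LINT x|M. (w x)\<^sup>2)"
proof -
  interpret finite_measure M by (rule assms(1))
  define a where "a k = (LINT x|M. w x * e k x)" for k
  define F where "F N = {..N}\<times>{..N::nat}" for N
  have fin: "finite (F N)" for N by (simp add: F_def)
  define s where "s A x = (\<Sum>k\<in>A. a k * e k x)" for A x
  have sL: "L2 M (s A)" for A unfolding s_def by (intro L2_sum L2_cmult eL)
  have se: "(LINT x|M. s A x * e l x) = (if l \<in> A then a l else 0)" if "finite A" for A l
  proof -
    have "(LINT x|M. s A x * e l x) = (LINT x|M. (\<Sum>k\<in>A. a k * (e k x * e l x)))"
      by (simp add: s_def sum_distrib_right mult.assoc)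
    also have "\<dots> = (\<Sum>k\<in>A. a k * (LINT x|M. e k x * e l x))"
      by (subst Bochner_Integration.integral_sum) (auto intro!: L2_mult_integrable eL)
    also have "\<dots> = (if l \<in> A then a l else 0)" using that by (simp add: on if_distrib cong: if_cong)
    finally show ?thesis .
  qed
  have ip: "(LINT x|M. v x * s A x) = (\<Sum>k\<in>A. a k * (LINT x|M. v x * e k x))" if "finite A" "L2 M v" for A v
  proof -
    have "(LINT x|M. v x * s A x) = (LINT x|M. (\<Sum>k\<in>A. a k * (v x * e k x)))"
      by (simp add: s_def sum_distrib_left mult.left_commute)
    also have "\<dots> = (\<Sum>k\<in>A. a k * (LINT x|M. v x * e k x))"
      by (subst Bochner_Integration.integral_sum) (auto intro!: L2_mult_integrable eL that)
    finally show ?thesis .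
  qed
  have ss: "(LINT x|M. (s A x)\<^sup>2) = (\<Sum>k\<in>A. (a k)\<^sup>2)" if "finite A" for A
    using ip[OF that sL, of A] that by (simp add: power2_eq_square se)
  have ws: "(LINT x|M. (w x - s A x)\<^sup>2) = (LINT x|M. (w x)\<^sup>2) - (\<Sum>k\<in>A. (a k)\<^sup>2)" if "finite A" for A
    using L2_norm_add_scaleR_square[OF w sL, of "-1" A] ip[OF that w] ss[OF that]
    by (simp add: a_def[symmetric] power2_eq_square)
  have bound: "(\<Sum>k\<in>A. (a k)\<^sup>2) \<le> (LINT x|M. (w x)\<^sup>2)" if "finite A" for A
  proof -
    have "0 \<le> (LINT x|M. (w x - s A x)\<^sup>2)" by (rule Bochner_Integration.integral_nonneg) simp
    thus ?thesis using ws[OF that] by linarith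
  qed
  define S where "S N = (\<Sum>k\<in>F N. (a k)\<^sup>2)" for N
  have Fmono: "F M \<subseteq> F N" if "M \<le> N" for M N using that by (auto simp: F_def)
  have Smono: "S M \<le> S N" if "M \<le> N" for M N
    unfolding S_def by (rule sum_mono2[OF fin Fmono[OF that]]) simp
  have "convergent S"
    by (rule Bseq_mono_convergent[OF BseqI'[where K="LINT x|M. (w x)\<^sup>2"]])
       (use bound[OF fin] Smono in \<open>auto simp: S_def sum_nonneg\<close>)
  hence CS: "Cauchy S" by (rule convergent_Cauchy)
  have diff: "(LINT x|M. (s (F m) x - s (F n) x)\<^sup>2) = S m - S n" if "n \<le> m" for m n
  proof -
    have "s (F m) x - s (F n) x = s (F m - F n) x" for x
      unfolding s_def by (rule sum_diff[OF fin Fmono[OF that], symmetric])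
    thus ?thesis using ss[of "F m - F n"] fin sum_diff[OF fin Fmono[OF that], of "\<lambda>k. (a k)\<^sup>2"]
      by (simp add: S_def)
  qed
  obtain z where z: "L2 M z" "(\<lambda>N. LINT x|M. (norm (s (F N) x - z x))\<^sup>2) \<longlonglongrightarrow> 0"
  proof (rule L2_complete[of "\<lambda>N. s (F N)"])
    fix \<epsilon> :: real assume "\<epsilon> > 0"
    from CauchyD[OF CS this] obtain N where N: "\<And>m n. m \<ge> N \<Longrightarrow> n \<ge> N \<Longrightarrow> \<bar>S m - S n\<bar> < \<epsilon>" by auto
    show "\<exists>N. \<forall>m\<ge>N. \<forall>n\<ge>N. (LINT x|M. (norm (s (F m) x - s (F n) x))\<^sup>2) \<le> \<epsilon>"
    proof (intro exI[of _ N] allI impI)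
      fix m n assume mn: "N \<le> m" "N \<le> n"
      show "(LINT x|M. (norm (s (F m) x - s (F n) x))\<^sup>2) \<le> \<epsilon>"
      proof (cases "n \<le> m")
        case True
        thus ?thesis using diff[OF True] N[OF mn] by simp
      next
        case False
        hence "n \<ge> m" by simp
        from diff[OF this] show ?thesis using N[OF mn] by (simp add: power2_commute)
      qed
    qed
  qed (use sL in auto)
  have "AE x in M. (w x - z x) = 0"
  proof (rule complete)
    show "L2 M (\<lambda>x. w x - z x)" by (intro L2_diff w z)
    fix k :: "nat \<times> nat"
    obtain i j where k: "k = (i, j)" by (cases k)
    have "(\<lambda>N. LINT x|M. s (F N) x \<bullet> e k x) \<longlonglongrightarrow> (LINT x|M. z x \<bullet> e k x)"
      by (rule L2_tendsto_inner[OF sL z(1) eL z(2)])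
    moreover have "\<forall>\<^sub>F N in sequentially. (LINT x|M. s (F N) x \<bullet> e k x) = a k"
      using eventually_ge_at_top[of "max i j"]
    proof eventually_elim
      case (elim N)
      hence "k \<in> F N" by (simp add: F_def k)
      thus ?case by (simp add: se[OF fin])
    qed
    ultimately have "(LINT x|M. z x * e k x) = a k"
      using LIMSEQ_unique[OF _ tendsto_eventually] by simp
    thus "(LINT x|M. (w x - z x) * e k x) = 0"
      using L2_mult_integrable[OF w eL] L2_mult_integrable[OF z(1) eL] by (simp add: left_diff_distrib a_def)
  qed
  hence "(LINT x|M. (w x - s (F N) x)\<^sup>2) = (LINT x|M. (norm (s (F N) x - z x))\<^sup>2)" for N
    using w z sL[of "F N"] by (intro integral_cong_AE) (auto simp: power2_commute L2_def)
  hence "(\<lambda>N. (LINT x|M. (w x)\<^sup>2) - S N) \<longlonglongrightarrow> 0"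
    using z(2) by (simp add: ws[OF fin] S_def)
  hence "S \<longlonglongrightarrow> (LINT x|M. (w x)\<^sup>2)"
    using tendsto_diff[OF tendsto_const[of "LINT x|M. (w x)\<^sup>2"]] by fastforce
  thus ?thesis unfolding S_def F_def a_def .
qed

section \<open>Cutoff functions and integration by parts up to the boundary\<close>

lemma DERIV_max_square: "((\<lambda>x. (max 0 x)\<^sup>2) has_real_derivative 2 * max 0 x) (at x)"
proof -
  consider "x > 0" | "x < 0" | "x = 0" by linarith
  thus ?thesis
  proof cases
    case 1
    have "((\<lambda>x. x\<^sup>2) has_real_derivative 2 * max 0 x) (at x)"
      using 1 by (auto intro!: derivative_eq_intros)
    thus ?thesis by (rule has_field_derivative_transform_within_open[where S="{0<..}"]) (use 1 in auto)
  next
    case 2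
    have "((\<lambda>x. 0) has_real_derivative 2 * max 0 x) (at x)"
      using 2 by (auto intro!: derivative_eq_intros)
    thus ?thesis by (rule has_field_derivative_transform_within_open[where S="{..<0}"]) (use 2 in auto)
  next
    case 3
    have "((\<lambda>y. (max 0 y)\<^sup>2 / y) \<longlongrightarrow> 0) (at (0::real))"
    proof (rule Lim_null_comparison)
      show "((\<lambda>y::real. \<bar>y\<bar>) \<longlongrightarrow> 0) (at 0)" by (rule tendsto_rabs_zero) (rule tendsto_ident_at)
      show "\<forall>\<^sub>F y in at (0::real). norm ((max 0 y)\<^sup>2 / y) \<le> \<bar>y\<bar>"
        by (rule always_eventually) (auto simp: max_def power2_eq_square)
    qed
    thus ?thesis using 3 by (simp add: has_field_derivative_iff)
  qed
qed

text \<open>With r the positive part of s - 1 this is r^2 / (1 + r^2): continuously differentiable,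
  zero up to s = 1, and tending to 1.\<close>

definition cutoff :: "real \<Rightarrow> real" where
  "cutoff s = (max 0 (s - 1))\<^sup>2 / (1 + (max 0 (s - 1))\<^sup>2)"

definition cutoff' :: "real \<Rightarrow> real" where
  "cutoff' s = 2 * max 0 (s - 1) / (1 + (max 0 (s - 1))\<^sup>2)\<^sup>2"

lemma one_plus_square_pos: "1 + (r::real)\<^sup>2 > 0"
  by (simp add: add_pos_nonneg)

lemma one_plus_square_nonzero: "1 + (r::real)\<^sup>2 \<noteq> 0"
  using one_plus_square_pos[of r] by linarith

lemma DERIV_cutoff: "(cutoff has_real_derivative cutoff' s) (at s)"
proof -
  let ?r = "\<lambda>s::real. (max 0 (s - 1))\<^sup>2"
  have d: "(?r has_real_derivative 2 * max 0 (s - 1)) (at s)"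
  proof -
    have "((\<lambda>s. s - 1) has_real_derivative 1) (at s)" by (auto intro!: derivative_eq_intros)
    from DERIV_chain2[OF DERIV_max_square this] show ?thesis by simp
  qed
  have "1 + ?r s \<noteq> 0" using one_plus_square_pos[of "max 0 (s - 1)"] by linarith
  hence "((\<lambda>s. ?r s / (1 + ?r s)) has_real_derivative
    ((2 * max 0 (s - 1)) * (1 + ?r s) - ?r s * (0 + 2 * max 0 (s - 1))) / ((1 + ?r s) * (1 + ?r s))) (at s)"
    by (intro DERIV_divide DERIV_add d DERIV_const)
  also have "((2 * max 0 (s - 1)) * (1 + ?r s) - ?r s * (0 + 2 * max 0 (s - 1))) / ((1 + ?r s) * (1 + ?r s)) = cutoff' s"
    by (simp add: cutoff'_def power2_eq_square algebra_simps)
  finally show ?thesis unfolding cutoff_def[abs_def] .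
qed

lemma cutoff_eq_0: "s \<le> 1 \<Longrightarrow> cutoff s = 0"
  by (simp add: cutoff_def)

lemma cutoff_range: "0 \<le> cutoff s" "cutoff s \<le> 1"
  using one_plus_square_pos[of "max 0 (s - 1)"] by (auto simp: cutoff_def divide_le_eq)

lemma continuous_cutoff': "continuous_on S cutoff'"
  unfolding cutoff'_def by (intro continuous_intros ballI) (simp add: one_plus_square_nonzero)

lemma continuous_cutoff: "continuous_on S cutoff"
  unfolding cutoff_def by (intro continuous_intros ballI) (simp add: one_plus_square_nonzero)

text \<open>The constant bound on \<open>s * cutoff' s\<close> provides domination and the decaying
  bound provides pointwise convergence to zero. Both come from s being at most 1 + r and (1 + r)^2
  at most 2 (1 + r^2).\<close>

lemma cutoff_estimates:
  assumes "s > 0"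
  shows "\<bar>1 - cutoff s\<bar> \<le> 2 / s" "0 \<le> s * cutoff' s" "s * cutoff' s \<le> 3" "s * cutoff' s \<le> 6 / s"
proof -
  define r where "r = max 0 (s - 1)"
  have r: "r \<ge> 0" "s \<le> 1 + r" by (auto simp: r_def)
  have p: "1 + r\<^sup>2 > 0" by (rule one_plus_square_pos)
  have inv: "1 / (1 + r\<^sup>2) \<le> 2 / s"
  proof -
    have "0 \<le> (1 - r)\<^sup>2" by simp
    hence "(1 + r)\<^sup>2 \<le> 2 * (1 + r\<^sup>2)" by (simp add: power2_eq_square algebra_simps)
    moreover have "1 + r \<le> (1 + r)\<^sup>2" using r(1) by (simp add: power2_eq_square algebra_simps)
    ultimately have "s \<le> 2 * (1 + r\<^sup>2)" using r(2) by linarith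
    thus ?thesis using assms p by (simp add: divide_simps)
  qed
  have "1 - cutoff s = 1 / (1 + r\<^sup>2)"
    using p by (simp add: cutoff_def r_def[symmetric] field_simps)
  thus "\<bar>1 - cutoff s\<bar> \<le> 2 / s" using inv p by simp
  have c': "s * cutoff' s = (s * (2 * r) / (1 + r\<^sup>2)) * (1 / (1 + r\<^sup>2))"
    by (simp add: cutoff'_def r_def[symmetric] power2_eq_square)
  show "0 \<le> s * cutoff' s" unfolding c' using assms r(1) p by simp
  have "s * (2 * r) \<le> (1 + r) * (2 * r)" using r by (intro mult_right_mono) auto
  also have "\<dots> \<le> 3 * (1 + r\<^sup>2)"
    using sum_squares_bound[of 1 r] by (simp add: power2_eq_square algebra_simps)
  finally have q: "s * (2 * r) / (1 + r\<^sup>2) \<le> 3" using p by (simp add: divide_simps)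
  have le3: "s * cutoff' s \<le> 3 * (1 / (1 + r\<^sup>2))"
    unfolding c' using q p by (intro mult_right_mono) auto
  also have "3 * (1 / (1 + r\<^sup>2)) \<le> 3 * 1" using p by (intro mult_left_mono) (auto simp: divide_le_eq)
  finally show "s * cutoff' s \<le> 3" by simp
  show "s * cutoff' s \<le> 6 / s" using le3 inv by linarith
qed

text \<open>A polynomial substitute for the distance of \<open>t\<close> to the ends of [-1/2, 1/2]:
  it factors as (1/2 - t)(1/2 + t), so it lies between half that distance and the distance
  itself.\<close>

definition edge_dist :: "real \<Rightarrow> real" where "edge_dist t = 1/4 - t\<^sup>2"

definition other :: "2 \<Rightarrow> 2" where "other i = (if i = 1 then 2 else 1)"

lemma edge_dist_pos: "w \<in> open_square \<Longrightarrow> 0 < edge_dist (w $ i)"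
proof -
  assume w: "w \<in> open_square"
  have "\<bar>w $ i\<bar> < 1/2" using w exhaust_2[of i] by (auto simp: mem_open_square abs_less_iff)
  hence "\<bar>w $ i\<bar>\<^sup>2 < (1/2)\<^sup>2" by (intro power_strict_mono) auto
  thus ?thesis by (simp add: edge_dist_def power2_eq_square)
qed

definition cut :: "nat \<Rightarrow> real^2 \<Rightarrow> real" where
  "cut n w = cutoff (real n * edge_dist (w $ 1)) * cutoff (real n * edge_dist (w $ 2))"

definition grad_cut :: "nat \<Rightarrow> real^2 \<Rightarrow> real^2" where
  "grad_cut n w = (\<chi> i. cutoff' (real n * edge_dist (w $ i)) * (real n * (- 2 * w $ i)) *
      cutoff (real n * edge_dist (w $ other i)))"

lemma has_derivative_cut: "(cut n has_derivative (\<lambda>h. grad_cut n w \<bullet> h)) (at w)"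
proof -
  have c: "((\<lambda>w::real^2. cutoff (real n * edge_dist (w $ i))) has_derivative
      (\<lambda>h. h $ i * (cutoff' (real n * edge_dist (w $ i)) * (real n * (- 2 * w $ i))))) (at w)" for i
  proof -
    have "((\<lambda>t. real n * edge_dist t) has_real_derivative real n * (- 2 * w $ i)) (at (w $ i))"
      unfolding edge_dist_def by (auto intro!: derivative_eq_intros)
    from DERIV_chain2[OF DERIV_cutoff this]
    have "((\<lambda>t. cutoff (real n * edge_dist t)) has_derivative
        (\<lambda>x. x * (cutoff' (real n * edge_dist (w $ i)) * (real n * (- 2 * w $ i))))) (at (w $ i))"
      unfolding has_field_derivative_def by (rule has_derivative_eq_rhs) (simp add: fun_eq_iff mult.commute)
    from has_derivative_compose[OF bounded_linear_imp_has_derivative[OF bounded_linear_vec_nth[of i]] this]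
    show ?thesis .
  qed
  have "(\<lambda>h. cutoff (real n * edge_dist (w $ 1)) * (h $ 2 * (cutoff' (real n * edge_dist (w $ 2)) * (real n * (- 2 * w $ 2))))
      + h $ 1 * (cutoff' (real n * edge_dist (w $ 1)) * (real n * (- 2 * w $ 1))) * cutoff (real n * edge_dist (w $ 2)))
    = (\<lambda>h. grad_cut n w \<bullet> h)"
    by (auto simp: grad_cut_def inner_vec_def sum_2 other_def)
  with has_derivative_mult[OF c[of 1] c[of 2]] show ?thesis unfolding cut_def[abs_def] by simp
qed

lemma continuous_grad_cut: "continuous_on S (grad_cut n)"
  unfolding grad_cut_def edge_dist_def
  by (intro continuous_on_vec_lambda continuous_intros continuous_on_compose2[OF continuous_cutoff' _ subset_UNIV]
      continuous_on_compose2[OF continuous_cutoff _ subset_UNIV])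

lemma continuous_cut: "continuous_on S (cut n)"
  using has_derivative_cut by (intro has_derivative_continuous_on[OF has_derivative_at_withinI])

lemma cut_range: "0 \<le> cut n w" "cut n w \<le> 1"
  using cutoff_range[of "real n * edge_dist (w $ 1)"] cutoff_range[of "real n * edge_dist (w $ 2)"]
  by (auto simp: cut_def intro!: mult_le_one)

definition cut_support :: "nat \<Rightarrow> (real^2) set" where
  "cut_support n = {w. \<forall>i. 1 \<le> real n * edge_dist (w $ i)}"

lemma cut_support_subset: "cut_support n \<subseteq> open_square"
proof
  fix w assume w: "w \<in> cut_support n"
  have "\<bar>w $ i\<bar> < 1/2" for i
  proof -
    have "0 < real n * edge_dist (w $ i)" using w by (auto simp: cut_support_def intro: less_le_trans[of 0 1])
    hence "0 < edge_dist (w $ i)" by (simp add: zero_less_mult_iff)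
    hence "\<bar>w $ i\<bar>\<^sup>2 < (1/2)\<^sup>2" by (simp add: edge_dist_def power2_eq_square)
    thus ?thesis by (rule power2_less_imp_less) simp
  qed
  from this[of 1] this[of 2] show "w \<in> open_square" by (auto simp: mem_open_square abs_less_iff)
qed

lemma compact_cut_support: "compact (cut_support n)"
proof -
  have "closed (cut_support n)"
    unfolding cut_support_def edge_dist_def by (intro closed_Collect_all closed_Collect_le continuous_intros)
  thus ?thesis
    using bounded_subset[OF bounded_open_square cut_support_subset] by (simp add: compact_eq_bounded_closed)
qed

lemma cut_eq_0: "w \<notin> cut_support n \<Longrightarrow> cut n w = 0"
proof -
  assume "w \<notin> cut_support n"
  then obtain i where "real n * edge_dist (w $ i) \<le> 1" by (auto simp: cut_support_def not_le intro: less_imp_le)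
  thus "cut n w = 0" using exhaust_2[of i] cutoff_eq_0 by (auto simp: cut_def)
qed

lemma abs_grad_cut_le:
  assumes w: "w \<in> open_square" and n: "n > 0"
  shows "edge_dist (w $ i) * \<bar>grad_cut n w $ i\<bar> \<le> 3"
    "edge_dist (w $ i) * \<bar>grad_cut n w $ i\<bar> \<le> 6 / (real n * edge_dist (w $ i))"
proof -
  let ?s = "real n * edge_dist (w $ i)"
  have s: "?s > 0" using edge_dist_pos[OF w, of i] n by simp
  have c': "cutoff' ?s \<ge> 0" using cutoff_estimates(2)[OF s] s by (simp add: zero_le_mult_iff)
  have wi: "\<bar>2 * w $ i\<bar> \<le> 1" using w exhaust_2[of i] by (auto simp: mem_open_square abs_le_iff)
  have "edge_dist (w $ i) * \<bar>grad_cut n w $ i\<bar> =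
      (?s * cutoff' ?s) * (\<bar>2 * w $ i\<bar> * cutoff (real n * edge_dist (w $ other i)))"
    using c' cutoff_range(1) by (simp add: grad_cut_def abs_mult)
  also have "\<dots> \<le> (?s * cutoff' ?s) * 1"
    using wi cutoff_range cutoff_estimates(2)[OF s] by (intro mult_left_mono mult_le_one) auto
  finally have "edge_dist (w $ i) * \<bar>grad_cut n w $ i\<bar> \<le> ?s * cutoff' ?s" by simp
  thus "edge_dist (w $ i) * \<bar>grad_cut n w $ i\<bar> \<le> 3"
    "edge_dist (w $ i) * \<bar>grad_cut n w $ i\<bar> \<le> 6 / ?s"
    using cutoff_estimates(3,4)[OF s] by linarith+
qed

lemma cut_tendsto_1:
  assumes w: "w \<in> open_square"
  shows "(\<lambda>n. cut (Suc n) w) \<longlonglongrightarrow> 1"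
proof -
  have "(\<lambda>n. cutoff (real (Suc n) * edge_dist (w $ i))) \<longlonglongrightarrow> 1" for i
  proof -
    let ?d = "edge_dist (w $ i)"
    have d: "?d > 0" by (rule edge_dist_pos[OF w])
    have "(\<lambda>n. (2 / ?d) * (1 / real (Suc n))) \<longlonglongrightarrow> (2 / ?d) * 0"
      by (intro tendsto_intros LIMSEQ_Suc[OF lim_1_over_n])
    hence z: "(\<lambda>n. (2 / ?d) * (1 / real (Suc n))) \<longlonglongrightarrow> 0" by simp
    have "(\<lambda>n. 1 - cutoff (real (Suc n) * ?d)) \<longlonglongrightarrow> 0"
    proof (rule Lim_null_comparison[OF always_eventually z], rule allI)
      fix n
      have "real (Suc n) * ?d > 0" using d by simp
      from cutoff_estimates(1)[OF this]
      show "norm (1 - cutoff (real (Suc n) * ?d)) \<le> (2 / ?d) * (1 / real (Suc n))" using d by (simp add: field_simps)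
    qed
    from tendsto_diff[OF tendsto_const[of 1] this] show ?thesis by simp
  qed
  from tendsto_mult[OF this[of 1] this[of 2]] show ?thesis by (simp add: cut_def)
qed

text \<open>Multiplying \<open>F\<close> by the cutoff produces admissible test functions. Component
  \<open>i\<close> of the cutoff's gradient becomes large only near the two sides on which
  coordinate \<open>i\<close> is 1/2 or -1/2; there \<open>F\<close> vanishes linearly, so the
  product stays bounded and tends to zero pointwise. Hence \<open>edge\<close> concerns these two
  sides only.\<close>

lemma weak_integration_by_parts:
  assumes w: "H1_with_gradient open_square w H"
    and F: "\<And>x. (F has_derivative (\<lambda>h. V x \<bullet> h)) (at x)" and V: "continuous_on UNIV V"
    and edge: "\<And>x. x \<in> open_square \<Longrightarrow> \<bar>F x\<bar> \<le> C * edge_dist (x $ i)"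
  shows "(LINT x|lebesgue_on open_square. w x * V x $ i) = - (LINT x|lebesgue_on open_square. F x * H x $ i)"
proof -
  let ?M = "lebesgue_on open_square"
  interpret finite_measure ?M by (rule finite_measure_open_square)
  have Fc: "continuous_on UNIV F" using F by (intro has_derivative_continuous_on[OF has_derivative_at_withinI])
  have bdd: "\<exists>B\<ge>0. \<forall>x\<in>open_square. \<bar>f x\<bar> \<le> B" if f: "continuous_on UNIV f" for f :: "real^2 \<Rightarrow> real"
  proof -
    have "bounded (f ` square)"
      by (intro compact_imp_bounded compact_continuous_image compact_square continuous_on_subset[OF f]) simp
    then obtain B where "\<forall>x\<in>square. \<bar>f x\<bar> \<le> B" by (auto simp: bounded_iff)
    thus ?thesis using open_square_subset by (intro exI[of _ "max 0 B"]) (auto intro: max.coboundedI2)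
  qed
  obtain BF where BF: "BF \<ge> 0" "\<And>x. x \<in> open_square \<Longrightarrow> \<bar>F x\<bar> \<le> BF" using bdd[OF Fc] by blast
  have Vi: "continuous_on UNIV (\<lambda>x. V x $ i)" by (intro continuous_intros V)
  obtain BV where BV: "BV \<ge> 0" "\<And>x. x \<in> open_square \<Longrightarrow> \<bar>V x $ i\<bar> \<le> BV" using bdd[OF Vi] by blast
  have C: "C \<ge> 0"
  proof -
    have "0 \<in> open_square" by (simp add: mem_open_square)
    from edge[OF this] have "0 \<le> C * edge_dist 0" by (simp add: order.trans[OF abs_ge_zero])
    thus ?thesis by (simp add: edge_dist_def)
  qed
  have wL: "L2 ?M w" and HL: "L2 ?M H" using H1_L2[OF w] by auto
  have wi: "integrable ?M w" and Hi: "integrable ?M (\<lambda>x. H x $ i)" using L2_integrable wL L2_nth[OF HL] by auto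
  have [measurable]: "w \<in> borel_measurable ?M" "(\<lambda>x. H x $ i) \<in> borel_measurable ?M" using wi Hi by measurable
  have cm: "f \<in> borel_measurable ?M" if "continuous_on UNIV f" for f :: "real^2 \<Rightarrow> real"
    by (intro borel_measurable_lebesgue_onI borel_measurable_continuous_onI that)
  define T where "T n x = cut (Suc n) x * F x" for n x
  have T: "test_function open_square (T n)" "\<And>x. grad (T n) x = cut (Suc n) x *\<^sub>R V x + F x *\<^sub>R grad_cut (Suc n) x" for n
  proof -
    have d: "(T n has_derivative (\<lambda>h. (cut (Suc n) x *\<^sub>R V x + F x *\<^sub>R grad_cut (Suc n) x) \<bullet> h)) (at x)" for x
      unfolding T_def
      by (rule has_derivative_eq_rhs[OF has_derivative_mult[OF has_derivative_cut F]])
         (auto simp: inner_add_left algebra_simps)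
    have z: "T n x = 0" if "x \<notin> cut_support (Suc n)" for x
      unfolding T_def cut_eq_0[OF that] by simp
    show "test_function open_square (T n)"
      by (rule test_functionI(1)[OF compact_cut_support[of "Suc n"] cut_support_subset open_open_square _ d])
         (auto simp: z intro!: continuous_intros continuous_cut continuous_grad_cut
           continuous_on_subset[OF V] continuous_on_subset[OF Fc])
    show "\<And>x. grad (T n) x = cut (Suc n) x *\<^sub>R V x + F x *\<^sub>R grad_cut (Suc n) x" by (rule grad_eqI[OF d])
  qed
  have eq: "(LINT x|?M. w x * (cut (Suc n) x * V x $ i + F x * grad_cut (Suc n) x $ i)) = - (LINT x|?M. T n x * H x $ i)" for n
  proof -
    have "(LINT x|?M. w x * (grad (T n) x \<bullet> axis i 1)) = - (LINT x|?M. T n x * (H x \<bullet> axis i 1))"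
      using w T(1)[of n] unfolding H1_iff[OF open_square_lebesgue(2)] by blast
    thus ?thesis by (simp add: T(2) inner_axis)
  qed
  have lim1: "(\<lambda>n. LINT x|?M. w x * (cut (Suc n) x * V x $ i + F x * grad_cut (Suc n) x $ i)) \<longlonglongrightarrow> (LINT x|?M. w x * V x $ i)"
  proof (rule integral_dominated_convergence[where w="\<lambda>x. (BV + C * 3) * \<bar>w x\<bar>"])
    show "(\<lambda>x. w x * V x $ i) \<in> borel_measurable ?M" using cm[OF Vi] by measurable
    show "(\<lambda>x. w x * (cut (Suc n) x * V x $ i + F x * grad_cut (Suc n) x $ i)) \<in> borel_measurable ?M" for n
    proof -
      have "(\<lambda>x. cut (Suc n) x * V x $ i + F x * grad_cut (Suc n) x $ i) \<in> borel_measurable ?M"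
        by (intro cm continuous_intros continuous_cut continuous_grad_cut Fc V)
      thus ?thesis by measurable
    qed
    show "integrable ?M (\<lambda>x. (BV + C * 3) * \<bar>w x\<bar>)" using wi by simp
    have FG: "\<bar>F x * grad_cut (Suc n) x $ i\<bar> \<le> C * (edge_dist (x $ i) * \<bar>grad_cut (Suc n) x $ i\<bar>)" if "x \<in> open_square" for x n
      using mult_right_mono[OF edge[OF that], of "\<bar>grad_cut (Suc n) x $ i\<bar>"] by (simp add: abs_mult mult.assoc)
    show "AE x in ?M. norm (w x * (cut (Suc n) x * V x $ i + F x * grad_cut (Suc n) x $ i)) \<le> (BV + C * 3) * \<bar>w x\<bar>" for n
    proof (rule AE_I2)
      fix x assume "x \<in> space ?M"
      hence x: "x \<in> open_square" by (simp add: space_restrict_space)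
      have "\<bar>cut (Suc n) x * V x $ i\<bar> \<le> 1 * BV"
        unfolding abs_mult using cut_range[of "Suc n" x] BV(2)[OF x] by (intro mult_mono) auto
      moreover have "\<bar>F x * grad_cut (Suc n) x $ i\<bar> \<le> C * 3"
        using FG[OF x, of n] mult_left_mono[OF abs_grad_cut_le(1)[OF x, of "Suc n" i] C] by simp
      ultimately have "\<bar>cut (Suc n) x * V x $ i + F x * grad_cut (Suc n) x $ i\<bar> \<le> BV + C * 3" by simp
      from mult_right_mono[OF this, of "\<bar>w x\<bar>"]
      show "norm (w x * (cut (Suc n) x * V x $ i + F x * grad_cut (Suc n) x $ i)) \<le> (BV + C * 3) * \<bar>w x\<bar>"
        by (simp add: abs_mult mult.commute)
    qed
    show "AE x in ?M. (\<lambda>n. w x * (cut (Suc n) x * V x $ i + F x * grad_cut (Suc n) x $ i)) \<longlonglongrightarrow> w x * V x $ i"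
    proof (rule AE_I2)
      fix x assume "x \<in> space ?M"
      hence x: "x \<in> open_square" by (simp add: space_restrict_space)
      let ?d = "edge_dist (x $ i)"
      have d: "?d > 0" by (rule edge_dist_pos[OF x])
      have "(\<lambda>n. (C * 6 / ?d) * (1 / real (Suc n))) \<longlonglongrightarrow> (C * 6 / ?d) * 0"
        by (intro tendsto_intros LIMSEQ_Suc[OF lim_1_over_n])
      hence z: "(\<lambda>n. (C * 6 / ?d) * (1 / real (Suc n))) \<longlonglongrightarrow> 0" by simp
      have "(\<lambda>n. F x * grad_cut (Suc n) x $ i) \<longlonglongrightarrow> 0"
      proof (rule Lim_null_comparison[OF always_eventually z], rule allI)
        fix n
        have "\<bar>F x * grad_cut (Suc n) x $ i\<bar> \<le> C * (6 / (real (Suc n) * ?d))"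
          using FG[OF x, of n] mult_left_mono[OF abs_grad_cut_le(2)[OF x, of "Suc n" i] C] by simp
        thus "norm (F x * grad_cut (Suc n) x $ i) \<le> (C * 6 / ?d) * (1 / real (Suc n))"
          by (simp add: mult.commute)
      qed
      hence "(\<lambda>n. w x * (cut (Suc n) x * V x $ i + F x * grad_cut (Suc n) x $ i)) \<longlonglongrightarrow> w x * (1 * V x $ i + 0)"
        by (intro tendsto_intros cut_tendsto_1 x)
      thus "(\<lambda>n. w x * (cut (Suc n) x * V x $ i + F x * grad_cut (Suc n) x $ i)) \<longlonglongrightarrow> w x * V x $ i" by simp
    qed
  qed
  have lim2: "(\<lambda>n. LINT x|?M. T n x * H x $ i) \<longlonglongrightarrow> (LINT x|?M. F x * H x $ i)"
  proof (rule integral_dominated_convergence[where w="\<lambda>x. BF * \<bar>H x $ i\<bar>"])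
    show "(\<lambda>x. F x * H x $ i) \<in> borel_measurable ?M" using cm[OF Fc] by measurable
    show "(\<lambda>x. T n x * H x $ i) \<in> borel_measurable ?M" for n
    proof -
      have "T n \<in> borel_measurable ?M" unfolding T_def by (intro cm continuous_intros continuous_cut Fc)
      thus ?thesis by measurable
    qed
    show "integrable ?M (\<lambda>x. BF * \<bar>H x $ i\<bar>)" using Hi by simp
    show "AE x in ?M. norm (T n x * H x $ i) \<le> BF * \<bar>H x $ i\<bar>" for n
    proof (rule AE_I2)
      fix x assume "x \<in> space ?M"
      hence x: "x \<in> open_square" by (simp add: space_restrict_space)
      have "\<bar>T n x\<bar> \<le> 1 * BF"
        unfolding T_def abs_mult using cut_range[of "Suc n" x] BF(2)[OF x] by (intro mult_mono) auto
      thus "norm (T n x * H x $ i) \<le> BF * \<bar>H x $ i\<bar>" by (simp add: abs_mult mult_right_mono)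
    qed
    show "AE x in ?M. (\<lambda>n. T n x * H x $ i) \<longlonglongrightarrow> F x * H x $ i"
    proof (rule AE_I2)
      fix x assume "x \<in> space ?M"
      hence x: "x \<in> open_square" by (simp add: space_restrict_space)
      have "(\<lambda>n. T n x * H x $ i) \<longlonglongrightarrow> (1 * F x) * H x $ i"
        unfolding T_def by (intro tendsto_intros cut_tendsto_1 x)
      thus "(\<lambda>n. T n x * H x $ i) \<longlonglongrightarrow> F x * H x $ i" by simp
    qed
  qed
  show ?thesis
    using LIMSEQ_unique[OF lim1] tendsto_minus[OF lim2] unfolding eq by simp
qed

text \<open>The sine vanishes at both ends because \<open>m\<close> is an integer. The linear bound
  is taken from the nearer end; the other factor of \<open>edge_dist\<close> is then at least 1/2,
  whence the factor 2.\<close>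

lemma abs_sin_le_edge_dist:
  assumes "\<bar>t\<bar> < 1/2"
  shows "\<bar>sin (real m * pi * (t + 1/2))\<bar> \<le> 2 * real m * pi * edge_dist t"
proof -
  have t: "t < 1/2" "- 1/2 < t" using assms by (auto simp: abs_less_iff)
  have d: "edge_dist t = (1/2 + t) * (1/2 - t)" by (simp add: edge_dist_def power2_eq_square algebra_simps)
  have mp: "real m * pi \<ge> 0" by simp
  have ab: "\<bar>sin x\<bar> \<le> \<bar>x\<bar>" for x :: real by (rule abs_sin_x_le_abs_x)
  show ?thesis
  proof (cases "t \<le> 0")
    case True
    have "\<bar>sin (real m * pi * (t + 1/2))\<bar> \<le> (real m * pi) * (1/2 + t)"
      using ab[of "real m * pi * (t + 1/2)"] t by (simp add: abs_mult add.commute)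
    also have "\<dots> \<le> (real m * pi) * (2 * edge_dist t)"
      unfolding d using mult_left_mono[of 1 "2 * (1/2 - t)" "1/2 + t"] t True by (intro mult_left_mono mp) simp
    finally show ?thesis by (simp only: mult_ac)
  next
    case False
    have "real m * pi * (t + 1/2) = real m * pi - real m * pi * (1/2 - t)" by (simp add: algebra_simps)
    hence "sin (real m * pi * (t + 1/2)) = - ((-1)^m * sin (real m * pi * (1/2 - t)))"
      by (simp add: sin_diff)
    hence "\<bar>sin (real m * pi * (t + 1/2))\<bar> = \<bar>sin (real m * pi * (1/2 - t))\<bar>" by (simp add: abs_mult power_abs)
    also have "\<dots> \<le> (real m * pi) * (1/2 - t)"
      using ab[of "real m * pi * (1/2 - t)"] t by (simp add: abs_mult)
    also have "\<dots> \<le> (real m * pi) * (2 * edge_dist t)"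
      unfolding d using mult_right_mono[of 1 "2 * (1/2 + t)" "1/2 - t"] t False by (intro mult_left_mono mp) simp
    finally show ?thesis by (simp only: mult_ac)
  qed
qed

definition mode_eigenvalue :: "nat \<Rightarrow> nat \<Rightarrow> real" where
  "mode_eigenvalue m n = (real m * pi)\<^sup>2 + (real n * pi)\<^sup>2"

text \<open>The Neumann condition in weak form: component i of the gradient of a mode contains a
  sine that vanishes on the sides perpendicular to direction i, so each component can be integrated
  by parts against any function in H^1.\<close>

lemma cos_mode_neumann:
  assumes w: "H1_with_gradient open_square w H"
  shows "(LINT x|lebesgue_on open_square. grad (cos_mode m n) x \<bullet> H x) =
    mode_eigenvalue m n * (LINT x|lebesgue_on open_square. cos_mode m n x * w x)"
proof -
  let ?M = "lebesgue_on open_square"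
  let ?c1 = "\<lambda>x::real^2. cos (real m * pi * (x $ 1 + 1/2))" and ?s1 = "\<lambda>x::real^2. sin (real m * pi * (x $ 1 + 1/2))"
  let ?c2 = "\<lambda>x::real^2. cos (real n * pi * (x $ 2 + 1/2))" and ?s2 = "\<lambda>x::real^2. sin (real n * pi * (x $ 2 + 1/2))"
  let ?F1 = "\<lambda>x. - (real m * pi * ?s1 x * ?c2 x)" and ?F2 = "\<lambda>x. - (real n * pi * ?c1 x * ?s2 x)"
  let ?V1 = "\<lambda>x. vector [- ((real m * pi)\<^sup>2 * ?c1 x * ?c2 x), real m * pi * (real n * pi) * ?s1 x * ?s2 x] :: real^2"
  let ?V2 = "\<lambda>x. vector [real m * pi * (real n * pi) * ?s1 x * ?s2 x, - ((real n * pi)\<^sup>2 * ?c1 x * ?c2 x)] :: real^2"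
  have wL: "L2 ?M w" and HL: "L2 ?M H" using H1_L2[OF w] by auto
  have i1: "(LINT x|?M. w x * ?V1 x $ 1) = - (LINT x|?M. ?F1 x * H x $ 1)"
  proof (rule weak_integration_by_parts[OF w, where C="real m * pi * (2 * real m * pi)"])
    show "(?F1 has_derivative (\<lambda>h. ?V1 x \<bullet> h)) (at x)" for x
      by (auto intro!: derivative_eq_intros bounded_linear.has_derivative[OF bounded_linear_vec_nth] ext
          simp: inner_vec_def sum_2 algebra_simps power2_eq_square)
    show "continuous_on UNIV ?V1" unfolding vector_2_eq_axis by (intro continuous_intros)
    fix x :: "real^2" assume x: "x \<in> open_square"
    have "\<bar>?s1 x\<bar> \<le> 2 * real m * pi * edge_dist (x $ 1)"
      using x by (intro abs_sin_le_edge_dist) (auto simp: mem_open_square abs_less_iff)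
    hence "\<bar>?s1 x\<bar> * \<bar>?c2 x\<bar> \<le> (2 * real m * pi * edge_dist (x $ 1)) * 1"
      using edge_dist_pos[OF x, of 1] by (intro mult_mono) auto
    from mult_left_mono[OF this, of "real m * pi"]
    show "\<bar>?F1 x\<bar> \<le> real m * pi * (2 * real m * pi) * edge_dist (x $ 1)" by (simp add: abs_mult mult.assoc)
  qed
  have i2: "(LINT x|?M. w x * ?V2 x $ 2) = - (LINT x|?M. ?F2 x * H x $ 2)"
  proof (rule weak_integration_by_parts[OF w, where C="real n * pi * (2 * real n * pi)"])
    show "(?F2 has_derivative (\<lambda>h. ?V2 x \<bullet> h)) (at x)" for x
      by (auto intro!: derivative_eq_intros bounded_linear.has_derivative[OF bounded_linear_vec_nth] ext
          simp: inner_vec_def sum_2 algebra_simps power2_eq_square)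
    show "continuous_on UNIV ?V2" unfolding vector_2_eq_axis by (intro continuous_intros)
    fix x :: "real^2" assume x: "x \<in> open_square"
    have "\<bar>?s2 x\<bar> \<le> 2 * real n * pi * edge_dist (x $ 2)"
      using x by (intro abs_sin_le_edge_dist) (auto simp: mem_open_square abs_less_iff)
    hence "\<bar>?s2 x\<bar> * \<bar>?c1 x\<bar> \<le> (2 * real n * pi * edge_dist (x $ 2)) * 1"
      using edge_dist_pos[OF x, of 2] by (intro mult_mono) auto
    from mult_left_mono[OF this, of "real n * pi"]
    show "\<bar>?F2 x\<bar> \<le> real n * pi * (2 * real n * pi) * edge_dist (x $ 2)" by (simp add: abs_mult mult_ac)
  qed
  have gL: "L2 ?M (\<lambda>x. grad (cos_mode m n) x $ i)" for i
    by (rule L2_nth[OF H1_L2(2)[OF H1_cos_mode_square]])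
  have F1L: "L2 ?M ?F1" using gL[of 1] by (simp add: grad_cos_mode)
  have F2L: "L2 ?M ?F2" using gL[of 2] by (simp add: grad_cos_mode)
  have V: "?V1 x $ 1 = - ((real m * pi)\<^sup>2 * cos_mode m n x)" "?V2 x $ 2 = - ((real n * pi)\<^sup>2 * cos_mode m n x)" for x
    by (simp_all add: cos_mode_def)
  have "(LINT x|?M. grad (cos_mode m n) x \<bullet> H x) = (LINT x|?M. ?F1 x * H x $ 1 + ?F2 x * H x $ 2)"
    by (simp add: grad_cos_mode inner_vec_def sum_2)
  also have "\<dots> = (LINT x|?M. ?F1 x * H x $ 1) + (LINT x|?M. ?F2 x * H x $ 2)"
    by (intro Bochner_Integration.integral_add L2_mult_integrable F1L F2L L2_nth HL)
  also have "\<dots> = (LINT x|?M. (real m * pi)\<^sup>2 * (cos_mode m n x * w x)) + (LINT x|?M. (real n * pi)\<^sup>2 * (cos_mode m n x * w x))"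
    using i1 i2 unfolding V by (simp add: mult_ac)
  also have "\<dots> = mode_eigenvalue m n * (LINT x|?M. cos_mode m n x * w x)"
    by (simp add: mode_eigenvalue_def distrib_right)
  finally show ?thesis .
qed

lemma mode_weight_pos: "mode_weight m > 0"
  by (simp add: mode_weight_def)

text \<open>Bessel's inequality for the gradients and Parseval's identity for the functions themselves.\<close>

lemma square_spectral_gap:
  assumes w: "H1_with_gradient open_square w H" and \<Lambda>: "\<Lambda> \<ge> 0" and S: "finite S"
    and gap: "\<And>m n. (m, n) \<notin> S \<Longrightarrow> \<Lambda> \<le> mode_eigenvalue m n"
  shows "\<Lambda> * (LINT x|lebesgue_on open_square. (w x)\<^sup>2) \<le> (LINT x|lebesgue_on open_square. (norm (H x))\<^sup>2)
    + \<Lambda> * (\<Sum>(m, n)\<in>S. (LINT x|lebesgue_on open_square. w x * cos_mode m n x)\<^sup>2 / (mode_weight m * mode_weight n))"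
proof -
  let ?M = "lebesgue_on open_square"
  define c where "c k = sqrt (mode_weight (fst k) * mode_weight (snd k))" for k :: "nat \<times> nat"
  have c: "c k > 0" "(c k)\<^sup>2 = mode_weight (fst k) * mode_weight (snd k)" for k
    using mode_weight_pos by (simp_all add: c_def less_imp_le)
  define e where "e k x = (1 / c k) * cos_mode (fst k) (snd k) x" for k x
  define E where "E k x = (1 / c k) *\<^sub>R grad (cos_mode (fst k) (snd k)) x" for k x
  define ev where "ev k = mode_eigenvalue (fst k) (snd k)" for k
  have ev0: "ev k \<ge> 0" for k by (simp add: ev_def mode_eigenvalue_def)
  have eL: "L2 ?M (e k)" for k unfolding e_def by (intro L2_cmult L2_cos_mode)
  have EL: "L2 ?M (E k)" for k unfolding E_def by (intro L2_scaleR H1_L2(2)[OF H1_cos_mode_square])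
  have wL: "L2 ?M w" and HL: "L2 ?M H" using H1_L2[OF w] by auto
  have on: "(LINT x|?M. e k x * e l x) = (if k = l then 1 else 0)" for k l
  proof -
    have "(LINT x|?M. e k x * e l x) = (1 / (c k * c l)) * (LINT x|?M. cos_mode (fst k) (snd k) x * cos_mode (fst l) (snd l) x)"
      by (simp add: e_def flip: integral_mult_right_zero)
    also have "\<dots> = (if k = l then 1 else 0)"
    proof (cases "k = l")
      case True
      thus ?thesis using c[of k] mode_weight_pos[of "fst l"] mode_weight_pos[of "snd l"] by (simp add: cos_mode_orthogonal power2_eq_square)
    next
      case False
      hence "\<not> (fst k = fst l \<and> snd k = snd l)" by (simp add: prod_eq_iff)
      thus ?thesis using False by (auto simp: cos_mode_orthogonal)
    qed
    finally show ?thesis .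
  qed
  have complete: "AE x in ?M. u x = 0" if "L2 ?M u" "\<And>k. (LINT x|?M. u x * e k x) = 0" for u
  proof (rule cos_mode_complete[OF that(1)])
    fix m n
    have "(LINT x|?M. u x * e (m, n) x) = (1 / c (m, n)) * (LINT x|?M. u x * cos_mode m n x)"
      by (simp add: e_def mult.left_commute flip: integral_mult_right_zero)
    thus "(LINT x|?M. u x * cos_mode m n x) = 0" using that(2)[of "(m, n)"] c(1)[of "(m, n)"] by simp
  qed
  define a where "a k = (LINT x|?M. w x * e k x)" for k
  have EH: "(LINT x|?M. K x \<bullet> E k x) = ev k * (LINT x|?M. v x * e k x)" if "H1_with_gradient open_square v K" for v K k
  proof -
    have "(LINT x|?M. K x \<bullet> E k x) = (1 / c k) * (LINT x|?M. grad (cos_mode (fst k) (snd k)) x \<bullet> K x)"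
      by (simp add: E_def inner_commute flip: integral_mult_right_zero)
    also have "\<dots> = ev k * (LINT x|?M. v x * e k x)"
      unfolding cos_mode_neumann[OF that] by (simp add: e_def ev_def mult_ac flip: integral_mult_right_zero)
    finally show ?thesis .
  qed
  have eH1: "H1_with_gradient open_square (e k) (E k)" for k
    using H1_add_scaleR[OF open_square_lebesgue(2) H1_const[OF bounded_open_square open_square_lebesgue(1), of 0]
        H1_cos_mode_square[of "fst k" "snd k"], of "1 / c k"] by (simp add: e_def[abs_def] E_def[abs_def])
  have EE: "(LINT x|?M. E k x \<bullet> E l x) = (if k = l then ev l else 0)" for k l
    using EH[OF eH1] by (simp add: on)
  \<comment> \<open>The gradients \<open>E k\<close> are orthogonal with squared norms
    \<open>ev k\<close>, and by \<open>EH\<close> the function \<open>s\<close> is the projection of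
    \<open>H\<close> onto their span. No division by \<open>ev k\<close> occurs, so the constant
    mode is covered.\<close>
  have bessel: "(\<Sum>k\<in>A. ev k * (a k)\<^sup>2) \<le> (LINT x|?M. (norm (H x))\<^sup>2)" if A: "finite A" for A
  proof -
    define s where "s x = (\<Sum>k\<in>A. a k *\<^sub>R E k x)" for x
    have sL: "L2 ?M s" unfolding s_def by (intro L2_sum L2_scaleR EL)
    have ip: "(LINT x|?M. K x \<bullet> s x) = (\<Sum>k\<in>A. a k * (LINT x|?M. K x \<bullet> E k x))" if "L2 ?M K" for K
    proof -
      have "(LINT x|?M. K x \<bullet> s x) = (LINT x|?M. (\<Sum>k\<in>A. a k * (K x \<bullet> E k x)))"
        by (simp add: s_def inner_sum_right)
      also have "\<dots> = (\<Sum>k\<in>A. a k * (LINT x|?M. K x \<bullet> E k x))"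
        by (subst Bochner_Integration.integral_sum) (auto intro!: L2_inner_integrable EL that)
      finally show ?thesis .
    qed
    have sE: "(LINT x|?M. s x \<bullet> E k x) = a k * ev k" if "k \<in> A" for k
    proof -
      have "(LINT x|?M. s x \<bullet> E k x) = (LINT x|?M. E k x \<bullet> s x)" by (simp add: inner_commute)
      thus ?thesis using that A by (simp add: ip[OF EL] EE if_distrib cong: if_cong)
    qed
    have "0 \<le> (LINT x|?M. (norm (H x + (-1) *\<^sub>R s x))\<^sup>2)" by (rule Bochner_Integration.integral_nonneg) simp
    also have "\<dots> = (LINT x|?M. (norm (H x))\<^sup>2) - 2 * (LINT x|?M. H x \<bullet> s x) + (LINT x|?M. s x \<bullet> s x)"
      unfolding L2_norm_add_scaleR_square[OF HL sL] by (simp add: power2_norm_eq_inner)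
    also have "(LINT x|?M. H x \<bullet> s x) = (\<Sum>k\<in>A. ev k * (a k)\<^sup>2)"
      unfolding ip[OF HL] EH[OF w] a_def[symmetric] by (simp add: power2_eq_square mult_ac)
    also have "(LINT x|?M. s x \<bullet> s x) = (\<Sum>k\<in>A. ev k * (a k)\<^sup>2)"
      unfolding ip[OF sL] by (intro sum.cong refl) (simp add: sE power2_eq_square mult_ac)
    finally show ?thesis by linarith
  qed
  have lim: "(\<lambda>N. \<Lambda> * (\<Sum>k\<in>{..N}\<times>{..N}. (a k)\<^sup>2)) \<longlonglongrightarrow> \<Lambda> * (LINT x|?M. (w x)\<^sup>2)"
    unfolding a_def by (intro tendsto_intros parseval_limit[OF finite_measure_open_square eL on complete wL]) auto
  have "\<Lambda> * (LINT x|?M. (w x)\<^sup>2) \<le> (LINT x|?M. (norm (H x))\<^sup>2) + \<Lambda> * (\<Sum>k\<in>S. (a k)\<^sup>2)"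
  proof (rule LIMSEQ_le_const2[OF lim], intro exI[of _ 0] allI impI)
    fix N :: nat
    let ?F = "{..N}\<times>{..N}"
    have "\<Lambda> * (\<Sum>k\<in>?F. (a k)\<^sup>2) = (\<Sum>k\<in>?F. \<Lambda> * (a k)\<^sup>2)" by (simp add: sum_distrib_left)
    also have "\<dots> \<le> (\<Sum>k\<in>?F. ev k * (a k)\<^sup>2 + (if k \<in> S then \<Lambda> * (a k)\<^sup>2 else 0))"
    proof (rule sum_mono)
      fix k assume "k \<in> ?F"
      show "\<Lambda> * (a k)\<^sup>2 \<le> ev k * (a k)\<^sup>2 + (if k \<in> S then \<Lambda> * (a k)\<^sup>2 else 0)"
      proof (cases "k \<in> S")
        case False
        hence "\<Lambda> \<le> ev k" using gap[of "fst k" "snd k"] by (simp add: ev_def)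
        thus ?thesis using False by (simp add: mult_right_mono)
      qed (use ev0[of k] in simp)
    qed
    also have "\<dots> = (\<Sum>k\<in>?F. ev k * (a k)\<^sup>2) + (\<Sum>k\<in>?F \<inter> S. \<Lambda> * (a k)\<^sup>2)"
      by (simp add: sum.distrib sum.inter_restrict)
    also have "\<dots> \<le> (LINT x|?M. (norm (H x))\<^sup>2) + (\<Sum>k\<in>S. \<Lambda> * (a k)\<^sup>2)"
      using \<Lambda> S by (intro add_mono bessel sum_mono2) auto
    finally show "\<Lambda> * (\<Sum>k\<in>?F. (a k)\<^sup>2) \<le> (LINT x|?M. (norm (H x))\<^sup>2) + \<Lambda> * (\<Sum>k\<in>S. (a k)\<^sup>2)"
      by (simp add: sum_distrib_left)
  qed
  also have "(\<Sum>k\<in>S. (a k)\<^sup>2) = (\<Sum>(m, n)\<in>S. (LINT x|?M. w x * cos_mode m n x)\<^sup>2 / (mode_weight m * mode_weight n))"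
  proof (rule sum.cong[OF refl])
    fix k assume "k \<in> S"
    have "a k = (1 / c k) * (LINT x|?M. w x * cos_mode (fst k) (snd k) x)"
      by (simp add: a_def e_def mult.left_commute flip: integral_mult_right_zero)
    thus "(a k)\<^sup>2 = (case k of (m, n) \<Rightarrow> (LINT x|?M. w x * cos_mode m n x)\<^sup>2 / (mode_weight m * mode_weight n))"
      using c(2)[of k] by (simp add: power_divide case_prod_beta)
  qed
  finally show ?thesis .
qed

section \<open>The first Neumann eigenvalue of the quadrilaterals\<close>

text \<open>The matrix differs from the identity by entries of size at most 1/50, so the norm grows
  by a factor of at most 27/25. The constant 117/100 exceeds its square and equals 13/10 times 9/10,
  so that the lower bound 9/10 of the Jacobian leads to the energy factor 13/10.\<close>

lemma norm_DPhi_adj_le: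
  assumes p: "norm p \<le> 1/100" and u: "u \<in> square"
  shows "(norm (DPhi_adj p u h))\<^sup>2 \<le> (117/100) * (norm h)\<^sup>2"
proof -
  note b = square_abs_le[OF u]
  have pb: "\<bar>p $ i\<bar> \<le> 1/100" "\<bar>p $ i * u $ j\<bar> \<le> 1/200" for i j
    using abs_nth_le_norm[of p i] abs_nth_mult_le[of "u $ j" "1/2" p i] b p exhaust_2[of j] by auto
  have e: "\<bar>- x - 2 * y\<bar> \<le> 1/50" "\<bar>- x + 2 * y\<bar> \<le> 1/50" "\<bar>x + 2 * y\<bar> \<le> 1/50" if "\<bar>x\<bar> \<le> 1/100" "\<bar>y\<bar> \<le> 1/200" for x y :: real
    using that unfolding abs_le_iff by (simp_all add: field_simps)
  let ?A = "- p $ 1 - 2 * (p $ 2 * u $ 2)" and ?C = "- p $ 4 + 2 * (p $ 3 * u $ 2)"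
    and ?B = "- p $ 4 - 2 * (p $ 2 * u $ 1)" and ?D = "p $ 1 + 2 * (p $ 3 * u $ 1)"
  have hb: "\<bar>x * h $ i\<bar> \<le> (1/50) * norm h" if "\<bar>x\<bar> \<le> 1/50" for x i
    unfolding abs_mult using that abs_nth_le_norm[of h i] by (intro mult_mono) auto
  have "norm (DPhi_adj p u h - h) \<le> \<bar>(DPhi_adj p u h - h) $ 1\<bar> + \<bar>(DPhi_adj p u h - h) $ 2\<bar>"
    using norm_le_l1_cart[of "DPhi_adj p u h - h"] by (simp add: sum_2)
  also have "\<dots> = \<bar>?A * h $ 1 + ?C * h $ 2\<bar> + \<bar>?B * h $ 1 + ?D * h $ 2\<bar>"
    by (simp add: DPhi_adj_def algebra_simps)
  also have "\<dots> \<le> (\<bar>?A * h $ 1\<bar> + \<bar>?C * h $ 2\<bar>) + (\<bar>?B * h $ 1\<bar> + \<bar>?D * h $ 2\<bar>)"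
    by (intro add_mono abs_triangle_ineq)
  also have "\<dots> \<le> ((1/50) * norm h + (1/50) * norm h) + ((1/50) * norm h + (1/50) * norm h)"
    by (intro add_mono hb e pb)
  finally have "norm (DPhi_adj p u h - h) \<le> (2/25) * norm h" by simp
  hence "norm (DPhi_adj p u h) \<le> (27/25) * norm h"
    using norm_triangle_ineq[of "DPhi_adj p u h - h" h] by simp
  hence "(norm (DPhi_adj p u h))\<^sup>2 \<le> ((27/25) * norm h)\<^sup>2" by (intro power_mono) auto
  also have "\<dots> = (27/25)\<^sup>2 * (norm h)\<^sup>2" by (rule power_mult_distrib)
  also have "\<dots> \<le> (117/100) * (norm h)\<^sup>2" by (intro mult_right_mono) (auto simp: power2_eq_square)
  finally show ?thesis .
qed

lemma quad_mass_le:
  assumes p: "norm p \<le> 1/100" and w: "L2 (lebesgue_on (interior (quad p))) (w :: real^2 \<Rightarrow> real)"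
  shows "(LINT x|lebesgue_on (interior (quad p)). (w x)\<^sup>2) \<le> (11/10) * (LINT u|lebesgue_on open_square. (w (Phi p u))\<^sup>2)"
proof -
  let ?M = "lebesgue_on open_square"
  have wi: "integrable (lebesgue_on (interior (quad p))) (\<lambda>x. (w x)\<^sup>2)" using w by (simp add: L2_def)
  have "(LINT x|lebesgue_on (interior (quad p)). (w x)\<^sup>2) = (LINT u|?M. J p u * (w (Phi p u))\<^sup>2)"
    by (rule change_of_variables(2)[OF p wi])
  also have "\<dots> \<le> (LINT u|?M. (11/10) * (w (Phi p u))\<^sup>2)"
  proof (rule integral_mono_AE)
    show "integrable ?M (\<lambda>u. J p u * (w (Phi p u))\<^sup>2)" using wi change_of_variables(1)[OF p, of "\<lambda>x. (w x)\<^sup>2"] by simp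
    show "integrable ?M (\<lambda>u. (11/10) * (w (Phi p u))\<^sup>2)" using L2_pullback[OF p w] by (simp add: L2_def)
    show "AE u in ?M. J p u * (w (Phi p u))\<^sup>2 \<le> (11/10) * (w (Phi p u))\<^sup>2"
      using J_pos(2)[OF p] open_square_subset by (intro AE_I2 mult_right_mono) (auto simp: space_restrict_space)
  qed
  finally show ?thesis by simp
qed

lemma quad_energy_ge:
  assumes p: "norm p \<le> 1/100" and w: "H1_with_gradient (interior (quad p)) w G"
  shows "(LINT u|lebesgue_on open_square. (norm (DPhi_adj p u (G (Phi p u))))\<^sup>2) \<le>
    (13/10) * (LINT x|lebesgue_on (interior (quad p)). (norm (G x))\<^sup>2)"
proof -
  let ?M = "lebesgue_on open_square"
  have GL: "L2 (lebesgue_on (interior (quad p))) G" by (rule H1_L2[OF w])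
  hence Gi: "integrable (lebesgue_on (interior (quad p))) (\<lambda>x. (norm (G x))\<^sup>2)" by (simp add: L2_def)
  have "(LINT u|?M. (norm (DPhi_adj p u (G (Phi p u))))\<^sup>2) \<le> (LINT u|?M. (13/10) * (J p u * (norm (G (Phi p u)))\<^sup>2))"
  proof (rule integral_mono_AE)
    show "integrable ?M (\<lambda>u. (norm (DPhi_adj p u (G (Phi p u))))\<^sup>2)"
      using H1_L2(2)[OF H1_pullback[OF p w]] by (simp add: L2_def)
    show "integrable ?M (\<lambda>u. (13/10) * (J p u * (norm (G (Phi p u)))\<^sup>2))"
      using Gi change_of_variables(1)[OF p, of "\<lambda>x. (norm (G x))\<^sup>2"] by simp
    show "AE u in ?M. (norm (DPhi_adj p u (G (Phi p u))))\<^sup>2 \<le> (13/10) * (J p u * (norm (G (Phi p u)))\<^sup>2)"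
    proof (rule AE_I2)
      fix u assume "u \<in> space ?M"
      hence u: "u \<in> square" using open_square_subset by (auto simp: space_restrict_space)
      have "(117/100) * (norm (G (Phi p u)))\<^sup>2 \<le> ((13/10) * J p u) * (norm (G (Phi p u)))\<^sup>2"
        using J_pos(1)[OF p u] by (intro mult_right_mono) auto
      thus "(norm (DPhi_adj p u (G (Phi p u))))\<^sup>2 \<le> (13/10) * (J p u * (norm (G (Phi p u)))\<^sup>2)"
        using norm_DPhi_adj_le[OF p u, of "G (Phi p u)"] by simp
    qed
  qed
  also have "\<dots> = (13/10) * (LINT x|lebesgue_on (interior (quad p)). (norm (G x))\<^sup>2)"
    using change_of_variables(2)[OF p Gi] by simp
  finally show ?thesis .
qed

lemma mode_eigenvalue_ge: "(m, n) \<noteq> (0, 0) \<Longrightarrow> pi\<^sup>2 \<le> mode_eigenvalue m n"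
  and mode_eigenvalue_ge2: "(m, n) \<notin> {(0, 0), (1, 0), (0, 1)} \<Longrightarrow> 2 * pi\<^sup>2 \<le> mode_eigenvalue m n"
proof -
  have e: "mode_eigenvalue m n = real (m\<^sup>2 + n\<^sup>2) * pi\<^sup>2"
    by (simp add: mode_eigenvalue_def power_mult_distrib distrib_right)
  have sq: "k\<^sup>2 \<ge> k" "k \<ge> 2 \<Longrightarrow> k\<^sup>2 \<ge> 2" for k :: nat
    using mult_le_mono[of 2 k 1 k] by (auto simp: power2_eq_square)
  show "(m, n) \<noteq> (0, 0) \<Longrightarrow> pi\<^sup>2 \<le> mode_eigenvalue m n"
  proof -
    assume "(m, n) \<noteq> (0, 0)"
    hence "1 \<le> m\<^sup>2 + n\<^sup>2" using sq(1)[of m] sq(1)[of n] by auto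
    hence "1 \<le> real (m\<^sup>2 + n\<^sup>2)" by linarith
    from mult_right_mono[OF this, of "pi\<^sup>2"] show ?thesis unfolding e by simp
  qed
  show "(m, n) \<notin> {(0, 0), (1, 0), (0, 1)} \<Longrightarrow> 2 * pi\<^sup>2 \<le> mode_eigenvalue m n"
  proof -
    assume "(m, n) \<notin> {(0, 0), (1, 0), (0, 1)}"
    hence "m \<ge> 2 \<or> n \<ge> 2 \<or> (m \<ge> 1 \<and> n \<ge> 1)" by auto
    hence "2 \<le> m\<^sup>2 + n\<^sup>2" using sq(1)[of m] sq(1)[of n] sq(2)[of m] sq(2)[of n] by linarith
    hence "2 \<le> real (m\<^sup>2 + n\<^sup>2)" by linarith
    from mult_right_mono[OF this, of "pi\<^sup>2"] show ?thesis unfolding e by simp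
  qed
qed

lemma square_poincare:
  assumes "H1_with_gradient open_square w H"
  shows "pi\<^sup>2 * (LINT x|lebesgue_on open_square. (w x)\<^sup>2) \<le> (LINT x|lebesgue_on open_square. (norm (H x))\<^sup>2)
    + pi\<^sup>2 * (LINT x|lebesgue_on open_square. w x)\<^sup>2"
  using square_spectral_gap[OF assms, of "pi\<^sup>2" "{(0,0)}"] mode_eigenvalue_ge
  by (simp add: mode_weight_def cos_mode_0)

text \<open>The modes (1, 0) and (0, 1) have weight 1/2 and contribute 4 pi^2. The constant mode is
  given the same factor, so that the correction is a multiple of the squared norm of a moment in
  three dimensions, as \<open>mu1_bounds\<close> expects.\<close>

lemma square_poincare_3:
  assumes "H1_with_gradient open_square w H"
  shows "2 * pi\<^sup>2 * (LINT x|lebesgue_on open_square. (w x)\<^sup>2) \<le> (LINT x|lebesgue_on open_square. (norm (H x))\<^sup>2)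
    + 4 * pi\<^sup>2 * ((LINT x|lebesgue_on open_square. w x * cos_mode 0 0 x)\<^sup>2
      + (LINT x|lebesgue_on open_square. w x * cos_mode 1 0 x)\<^sup>2 + (LINT x|lebesgue_on open_square. w x * cos_mode 0 1 x)\<^sup>2)"
proof -
  let ?l = "\<lambda>m n. (LINT x|lebesgue_on open_square. w x * cos_mode m n x)\<^sup>2"
  have "2 * pi\<^sup>2 * (LINT x|lebesgue_on open_square. (w x)\<^sup>2) \<le> (LINT x|lebesgue_on open_square. (norm (H x))\<^sup>2)
    + 2 * pi\<^sup>2 * (\<Sum>(m, n)\<in>{(0, 0), (1, 0), (0, 1)}. ?l m n / (mode_weight m * mode_weight n))"
    by (rule square_spectral_gap[OF assms]) (auto intro!: mode_eigenvalue_ge2)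
  also have "(\<Sum>(m, n)\<in>{(0, 0), (1, 0), (0, 1)}. ?l m n / (mode_weight m * mode_weight n)) = ?l 0 0 + 2 * ?l 1 0 + 2 * ?l 0 1"
    by (simp add: mode_weight_def)
  also have "2 * pi\<^sup>2 * (?l 0 0 + 2 * ?l 1 0 + 2 * ?l 0 1) \<le> 4 * pi\<^sup>2 * (?l 0 0 + ?l 1 0 + ?l 0 1)"
  proof -
    have "pi\<^sup>2 * ?l 0 0 \<ge> 0" by simp
    thus ?thesis by (simp add: algebra_simps)
  qed
  finally show ?thesis by simp
qed

text \<open>\<open>mu1_bounds\<close> needs moments against functions on the quadrilateral itself.
  The mode composed with the inverse map and divided by the Jacobian represents the Fourier
  coefficient of the pull-back.\<close>

lemma quad_moments:
  assumes p: "norm p \<le> 1/100"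
  obtains \<psi> where "L2 (lebesgue_on (interior (quad p))) (\<psi> :: real^2 \<Rightarrow> real)"
    "\<And>w :: real^2 \<Rightarrow> real. L2 (lebesgue_on (interior (quad p))) w \<Longrightarrow>
      (LINT x|lebesgue_on (interior (quad p)). w x * \<psi> x) = (LINT u|lebesgue_on open_square. w (Phi p u) * cos_mode m n u)"
proof -
  let ?M = "lebesgue_on open_square" and ?V = "interior (quad p)"
  have inj: "inj_on (Phi p) open_square" using inj_on_subset[OF inj_on_Phi_square[OF p] open_square_subset] .
  define inv where "inv = the_inv_into open_square (Phi p)"
  have inv: "inv (Phi p u) = u" if "u \<in> open_square" for u
    unfolding inv_def using the_inv_into_f_f[OF inj that] .
  have Jp: "J p u > 0" "9/10 \<le> J p u" if "u \<in> open_square" for u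
    using J_pos(1)[OF p, of u] open_square_subset that by auto
  define \<psi> where "\<psi> x = cos_mode m n (inv x) / J p (inv x)" for x
  have e: "\<psi> (Phi p u) = cos_mode m n u / J p u" if "u \<in> open_square" for u
    using inv[OF that] by (simp add: \<psi>_def)
  interpret finite_measure ?M by (rule finite_measure_open_square)
  have [measurable]: "J p \<in> borel_measurable ?M" "cos_mode m n \<in> borel_measurable ?M"
    using borel_measurable_J L2_cos_mode by (auto intro: borel_measurable_lebesgue_onI)
  have "integrable ?M (\<lambda>u. J p u * \<psi> (Phi p u)) \<longleftrightarrow> integrable ?M (cos_mode m n)"
    by (rule Bochner_Integration.integrable_cong) (use Jp e in \<open>force simp: space_restrict_space\<close>)+
  hence "integrable (lebesgue_on ?V) \<psi>"
    using change_of_variables(1)[OF p, of \<psi>] L2_integrable[OF L2_cos_mode] by simp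
  hence m: "\<psi> \<in> borel_measurable (lebesgue_on ?V)" by measurable
  have "integrable ?M (\<lambda>u. J p u * (\<psi> (Phi p u))\<^sup>2) \<longleftrightarrow> integrable ?M (\<lambda>u. (cos_mode m n u)\<^sup>2 / J p u)"
  proof (rule Bochner_Integration.integrable_cong[OF refl])
    fix u assume "u \<in> space ?M"
    hence "u \<in> open_square" by (simp add: space_restrict_space)
    thus "J p u * (\<psi> (Phi p u))\<^sup>2 = (cos_mode m n u)\<^sup>2 / J p u"
      using Jp(1)[of u] by (simp add: e power_divide power2_eq_square)
  qed
  moreover have "integrable ?M (\<lambda>u. (cos_mode m n u)\<^sup>2 / J p u)"
  proof (rule integrable_const_bound[where B="10/9"])
    show "AE u in ?M. norm ((cos_mode m n u)\<^sup>2 / J p u) \<le> 10/9"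
    proof (rule AE_I2)
      fix u assume "u \<in> space ?M"
      hence u: "u \<in> open_square" by (simp add: space_restrict_space)
      have "\<bar>cos_mode m n u\<bar>\<^sup>2 \<le> 1\<^sup>2" by (intro power_mono abs_cos_mode_le) simp
      hence "(cos_mode m n u)\<^sup>2 / J p u \<le> 1 / (9/10)"
        using Jp[OF u] by (intro frac_le) auto
      thus "norm ((cos_mode m n u)\<^sup>2 / J p u) \<le> 10/9" using Jp[OF u] by simp
    qed
  qed measurable
  ultimately have "integrable (lebesgue_on ?V) (\<lambda>x. (\<psi> x)\<^sup>2)"
    using change_of_variables(1)[OF p, of "\<lambda>x. (\<psi> x)\<^sup>2"] by simp
  with m have L: "L2 (lebesgue_on ?V) \<psi>" by (simp add: L2_def)
  show ?thesis
  proof (rule that[OF L])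
    fix w :: "real^2 \<Rightarrow> real" assume w: "L2 (lebesgue_on ?V) w"
    have "(LINT x|lebesgue_on ?V. w x * \<psi> x) = (LINT u|?M. J p u * (w (Phi p u) * \<psi> (Phi p u)))"
      by (rule change_of_variables(2)[OF p L2_mult_integrable[OF w L]])
    also have "\<dots> = (LINT u|?M. w (Phi p u) * cos_mode m n u)"
      by (rule Bochner_Integration.integral_cong) (use Jp e in \<open>force simp: space_restrict_space\<close>)+
    finally show "(LINT x|lebesgue_on ?V. w x * \<psi> x) = (LINT u|?M. w (Phi p u) * cos_mode m n u)" .
  qed
qed

text \<open>The gap constant is \<open>2 / (11/10 * 13/10) = 200/143\<close>: the eigenvalue \<open>2 \<pi>\<^sup>2\<close> of the mode \<open>(1, 1)\<close>
  divided by the distortions of area and energy under \<open>Phi p\<close>.\<close>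

lemma mu1_quad:
  assumes p: "norm p \<le> 1/100"
    and u0: "H1_with_gradient (interior (quad p)) u0 G0" "(LINT x|lebesgue_on (interior (quad p)). u0 x) = 0"
      "(LINT x|lebesgue_on (interior (quad p)). (u0 x)\<^sup>2) > 0"
      "(LINT x|lebesgue_on (interior (quad p)). (norm (G0 x))\<^sup>2) \<le> t * (LINT x|lebesgue_on (interior (quad p)). (u0 x)\<^sup>2)"
    and t: "t < (200/143) * pi\<^sup>2"
  shows "0 < mu1 (interior (quad p))" "mu1 (interior (quad p)) \<le> t"
    and "p = 0 \<Longrightarrow> pi\<^sup>2 \<le> mu1 (interior (quad p))"
proof -
  let ?V = "interior (quad p)" and ?M = "lebesgue_on (interior (quad p))" and ?N = "lebesgue_on open_square"
  note V = interior_quad_props[OF p]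
  interpret finite_measure ?M by (rule finite_measure_lebesgue_on[OF V(4)])
  interpret N: finite_measure ?N by (rule finite_measure_open_square)
  obtain \<psi>0 where 0: "L2 ?M \<psi>0" "\<And>w :: real^2 \<Rightarrow> real. L2 ?M w \<Longrightarrow> (LINT x|?M. w x * \<psi>0 x) = (LINT u|?N. w (Phi p u) * cos_mode 0 0 u)"
    using quad_moments[OF p, of 0 0] by blast
  obtain \<psi>1 where 1: "L2 ?M \<psi>1" "\<And>w :: real^2 \<Rightarrow> real. L2 ?M w \<Longrightarrow> (LINT x|?M. w x * \<psi>1 x) = (LINT u|?N. w (Phi p u) * cos_mode 1 0 u)"
    using quad_moments[OF p, of 1 0] by blast
  obtain \<psi>2 where 2: "L2 ?M \<psi>2" "\<And>w :: real^2 \<Rightarrow> real. L2 ?M w \<Longrightarrow> (LINT x|?M. w x * \<psi>2 x) = (LINT u|?N. w (Phi p u) * cos_mode 0 1 u)"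
    using quad_moments[OF p, of 0 1] by blast
  define \<psi> where "\<psi> x = (\<psi>0 x, \<psi>1 x, \<psi>2 x)" for x
  have \<psi>L: "L2 ?M \<psi>" unfolding \<psi>_def by (simp add: L2_Pair_iff 0 1 2)
  have \<psi>n: "(norm (LINT x|?M. w x *\<^sub>R \<psi> x))\<^sup>2 = (LINT u|?N. w (Phi p u) * cos_mode 0 0 u)\<^sup>2
      + (LINT u|?N. w (Phi p u) * cos_mode 1 0 u)\<^sup>2 + (LINT u|?N. w (Phi p u) * cos_mode 0 1 u)\<^sup>2" if w: "L2 ?M w" for w :: "real^2 \<Rightarrow> real"
  proof -
    let ?I = "LINT x|?M. w x *\<^sub>R \<psi> x"
    have i: "integrable ?M (\<lambda>x. w x *\<^sub>R \<psi> x)" by (rule L2_scaleR_integrable[OF w \<psi>L])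
    have i2: "integrable ?M (\<lambda>x. snd (w x *\<^sub>R \<psi> x))" by (rule integrable_bounded_linear[OF bounded_linear_snd i])
    have c: "fst ?I = (LINT x|?M. w x * \<psi>0 x)" "fst (snd ?I) = (LINT x|?M. w x * \<psi>1 x)" "snd (snd ?I) = (LINT x|?M. w x * \<psi>2 x)"
      using integral_bounded_linear[OF bounded_linear_fst i] integral_bounded_linear[OF bounded_linear_snd i]
        integral_bounded_linear[OF bounded_linear_fst i2] integral_bounded_linear[OF bounded_linear_snd i2]
      by (simp_all add: \<psi>_def)
    have "(norm ?I)\<^sup>2 = (fst ?I)\<^sup>2 + ((fst (snd ?I))\<^sup>2 + (snd (snd ?I))\<^sup>2)"
      by (simp add: norm_prod_def)
    thus ?thesis unfolding c 0(2)[OF w] 1(2)[OF w] 2(2)[OF w] by simp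
  qed
  have quasi: "(200/143) * pi\<^sup>2 * (LINT x|?M. (w x)\<^sup>2) \<le> (LINT x|?M. (norm (G x))\<^sup>2)
      + 4 * pi\<^sup>2 * (norm (LINT x|?M. w x *\<^sub>R \<psi> x))\<^sup>2" if w: "H1_with_gradient ?V w G" for w G
  proof -
    have wL: "L2 ?M w" by (rule H1_L2[OF w])
    have "2 * pi\<^sup>2 * (LINT u|?N. (w (Phi p u))\<^sup>2) \<le> (13/10) * (LINT x|?M. (norm (G x))\<^sup>2)
      + 4 * pi\<^sup>2 * (norm (LINT x|?M. w x *\<^sub>R \<psi> x))\<^sup>2"
      using square_poincare_3[OF H1_pullback[OF p w]] quad_energy_ge[OF p w] unfolding \<psi>n[OF wL] by linarith
    moreover have "pi\<^sup>2 * (LINT x|?M. (w x)\<^sup>2) \<le> (11/10) * (pi\<^sup>2 * (LINT u|?N. (w (Phi p u))\<^sup>2))"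
      using mult_left_mono[OF quad_mass_le[OF p wL], of "pi\<^sup>2"] by simp
    moreover have "0 \<le> pi\<^sup>2 * (norm (LINT x|?M. w x *\<^sub>R \<psi> x))\<^sup>2" by simp
    ultimately show ?thesis by linarith
  qed
  \<comment> \<open>Among constants, 0 is the best L2 approximation of a mean-zero function.\<close>
  have mean: "(LINT x|?M. (w x)\<^sup>2) \<le> (LINT x|?M. (w x - c)\<^sup>2)" if "L2 ?M w" "(LINT x|?M. w x) = 0" for w :: "real^2 \<Rightarrow> real" and c
  proof -
    have "(LINT x|?M. (w x - c)\<^sup>2) = (LINT x|?M. ((w x)\<^sup>2 - 2 * c * w x) + c\<^sup>2)"
      by (simp add: power2_diff algebra_simps)
    also have "\<dots> = (LINT x|?M. (w x)\<^sup>2) + c\<^sup>2 * measure ?M (space ?M)"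
      using that L2_integrable[OF that(1)] by (simp add: L2_def)
    finally show ?thesis by simp
  qed
  \<comment> \<open>The pull-back of a mean-zero function need not have mean zero on the square, so
    its mean \<open>c\<close> is subtracted first. The constant is half the gap constant, as pi^2
    replaces 2 pi^2.\<close>
  have poinc: "(100/143) * pi\<^sup>2 * (LINT x|?M. (w x)\<^sup>2) \<le> (LINT x|?M. (norm (G x))\<^sup>2)"
    if w: "H1_with_gradient ?V w G" "(LINT x|?M. w x) = 0" for w G
  proof -
    define c where "c = (LINT u|?N. w (Phi p u))"
    have w': "H1_with_gradient ?V (\<lambda>x. w x - c) G"
      using H1_add_scaleR[OF V(4) w(1) H1_const[OF V(3,2), of "- c"], of 1] by simp
    have wi: "integrable ?N (\<lambda>u. w (Phi p u))" by (rule N.L2_integrable[OF L2_pullback[OF p H1_L2(1)[OF w(1)]]])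
    have "measure ?N (space ?N) = (LINT u|?N. cos_mode 0 0 u * cos_mode 0 0 u)" by (simp add: cos_mode_0)
    also have "\<dots> = 1" by (simp only: cos_mode_orthogonal) (simp add: mode_weight_def)
    finally have "(LINT u|?N. w (Phi p u) - c) = 0" using wi by (simp add: c_def)
    hence "pi\<^sup>2 * (LINT u|?N. (w (Phi p u) - c)\<^sup>2) \<le> (13/10) * (LINT x|?M. (norm (G x))\<^sup>2)"
      using square_poincare[OF H1_pullback[OF p w']] quad_energy_ge[OF p w'] by simp
    moreover have "pi\<^sup>2 * (LINT x|?M. (w x)\<^sup>2) \<le> (11/10) * (pi\<^sup>2 * (LINT u|?N. (w (Phi p u) - c)\<^sup>2))"
      using mult_left_mono[OF order_trans[OF mean[OF H1_L2(1)[OF w(1)] w(2), of c] quad_mass_le[OF p H1_L2(1)[OF w']]], of "pi\<^sup>2"]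
      by simp
    ultimately show ?thesis by linarith
  qed
  have "(100/143) * pi\<^sup>2 > 0" by simp
  from mu1_bounds[OF V(3,2) \<psi>L _ quasi this poinc u0 t]
  show "mu1 ?V \<le> t" by simp
  from mu1_bounds(1)[OF V(3,2) \<psi>L _ quasi \<open>(100/143) * pi\<^sup>2 > 0\<close> poinc u0 t]
  have "(100/143) * pi\<^sup>2 \<le> mu1 ?V" by simp
  thus "0 < mu1 ?V" using \<open>(100/143) * pi\<^sup>2 > 0\<close> by linarith
  \<comment> \<open>At the square itself there is no distortion, and the Poincare inequality enters
    with its sharp constant.\<close>
  show "pi\<^sup>2 \<le> mu1 ?V" if "p = 0"
  proof (rule mu1_bounds(1)[OF V(3,2) \<psi>L _ quasi _ _ u0 t])
    fix w G assume w: "H1_with_gradient ?V w G" "(LINT x|?M. w x) = 0"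
    have e: "?V = open_square" using that by (simp add: quad_0 interior_square)
    show "pi\<^sup>2 * (LINT x|?M. (w x)\<^sup>2) \<le> (LINT x|?M. (norm (G x))\<^sup>2)"
      using square_poincare[of w G] w unfolding e by simp
  qed simp_all
qed

section \<open>Stiffness and mass matrices\<close>

lemma integral_quad_eq:
  assumes p: "norm p \<le> 1/100" and F: "continuous_on UNIV F"
  shows "integrable (lebesgue_on (interior (quad p))) F"
    and "(LINT w:square|lborel. F (Phi p w) * J p w) = (LINT x|lebesgue_on (interior (quad p)). F x)"
proof -
  have c: "continuous_on UNIV (\<lambda>w. F (Phi p w) * J p w)"
    by (intro continuous_intros continuous_on_compose2[OF F continuous_on_Phi] continuous_on_J) auto
  note i = integral_open_square_eq[OF c]
  show I: "integrable (lebesgue_on (interior (quad p))) F"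
    using change_of_variables(1)[OF p, of F] i(1) by (simp add: mult.commute)
  show "(LINT w:square|lborel. F (Phi p w) * J p w) = (LINT x|lebesgue_on (interior (quad p)). F x)"
    using change_of_variables(2)[OF p I] i(2) by (simp add: mult.commute)
qed

lemma g_eq_cos_mode: "\<exists>m n. g i = cos_mode m n \<and> (m, n) \<noteq> (0, 0)"
proof -
  have "i = 1 \<Longrightarrow> ?thesis" "i = 2 \<Longrightarrow> ?thesis" "i = 3 \<Longrightarrow> ?thesis" "i = 4 \<Longrightarrow> ?thesis"
    by (rule exI[of _ 1], rule exI[of _ 0], simp add: g_def,
        rule exI[of _ 0], rule exI[of _ 1], simp add: g_def,
        rule exI[of _ 1], rule exI[of _ 1], simp add: g_def,
        rule exI[of _ 2], rule exI[of _ 0], simp add: g_def)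
  moreover have "\<lbrakk>i \<noteq> 1; i \<noteq> 2; i \<noteq> 3; i \<noteq> 4\<rbrakk> \<Longrightarrow> ?thesis"
    by (rule exI[of _ 0], rule exI[of _ 2], simp add: g_def)
  ultimately show ?thesis by blast
qed

lemma continuous_g: "continuous_on S (g i)" and continuous_grad_g: "continuous_on S (grad (g i))"
  and differentiable_g: "g i differentiable (at x)"
  using g_eq_cos_mode[of i] continuous_cos_mode continuous_grad_cos_mode differentiable_cos_mode by auto

lemma stiffness_eq:
  assumes "norm p \<le> 1/100"
  shows "stiffness p $ i $ j = (LINT x|lebesgue_on (interior (quad p)). grad (g i) x \<bullet> grad (g j) x)"
  unfolding stiffness_def
  using integral_quad_eq(2)[OF assms, of "\<lambda>x. grad (g i) x \<bullet> grad (g j) x"]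
  by (simp add: continuous_on_inner continuous_grad_g)

lemma mass_eq:
  assumes "norm p \<le> 1/100"
  shows "mass p $ i $ j = (LINT x|lebesgue_on (interior (quad p)). g i x * g j x)
    - 1 / area p * (LINT x|lebesgue_on (interior (quad p)). g i x) * (LINT x|lebesgue_on (interior (quad p)). g j x)"
  unfolding mass_def
  using integral_quad_eq(2)[OF assms, of "\<lambda>x. g i x * g j x"] integral_quad_eq(2)[OF assms, of "g i"]
    integral_quad_eq(2)[OF assms, of "g j"]
  by (simp add: continuous_on_mult continuous_g)

lemma integral_id_symmetric: "integral {-1/2..1/2} (\<lambda>x::real. x) = 0"
proof -
  have "((\<lambda>x::real. x) has_integral ((1/2)\<^sup>2 / 2 - (-1/2)\<^sup>2 / 2)) {-1/2..1/2}"
    by (intro fundamental_theorem_of_calculus)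
       (auto intro!: derivative_eq_intros simp: has_real_derivative_iff_has_vector_derivative[symmetric])
  thus ?thesis by (simp add: integral_unique power2_eq_square)
qed

lemma set_integral_J: "(LINT w:square|lborel. J p w) = 1 - (p $ 1)\<^sup>2 - (p $ 4)\<^sup>2"
proof -
  have i: "set_integrable lborel square (\<lambda>w::real^2. c * w $ i)" "set_integrable lborel square (\<lambda>w::real^2. c)" for c i
    by (intro set_integrable_square continuous_intros)+
  have 1: "(LINT w:square|lborel. w $ 1) = 0"
    using set_integral_square_product[of "\<lambda>x. x" "\<lambda>x. 1"] by (simp add: continuous_intros integral_id_symmetric[simplified])
  have 2: "(LINT w:square|lborel. w $ 2) = 0"
    using set_integral_square_product[of "\<lambda>x. 1" "\<lambda>x. x"] by (simp add: continuous_intros integral_id_symmetric[simplified])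
  have 0: "(LINT w:square|lborel. 1) = (1::real)"
    using set_integral_square_product[of "\<lambda>x. 1" "\<lambda>x. 1"] by (simp add: continuous_intros)
  have c: "(LINT w:square|lborel. c) = c" for c :: real
    using 0 set_integral_mult_right[of lborel square c "\<lambda>_. 1"] by simp
  show ?thesis
    unfolding J_eq
    by (subst set_integral_add, (intro set_integral_add i)+, subst set_integral_add, (intro i)+)
       (simp add: 1 2 c)
qed

text \<open>The boundary is a differentiable image of a null set, so \<open>area\<close>, defined by
  the closed region, is also the measure of the open set on which the Sobolev space lives.\<close>

lemma measure_interior_quad:
  assumes p: "norm p \<le> 1/100"
  shows "measure lebesgue (interior (quad p)) = area p"
proof -
  have "frontier (quad p) = Phi p ` (square - open_square)"
    by (simp only: quad_eq[OF p] frontier_Phi_square[OF p])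
  moreover have "negligible (Phi p ` (square - open_square))"
  proof (rule negligible_differentiable_image_negligible)
    show "negligible (square - open_square)"
      unfolding square_def open_square_def by (rule negligible_frontier_interval)
    show "Phi p differentiable_on (square - open_square)"
      unfolding differentiable_on_def differentiable_def using has_derivative_Phi by blast
  qed simp
  moreover have "bounded (quad p)"
    using compact_imp_bounded[OF compact_Phi_square] by (simp add: quad_eq[OF p])
  ultimately show ?thesis unfolding area_def by (intro measure_interior) auto
qed

lemma area_eq:
  assumes p: "norm p \<le> 1/100"
  shows "area p = 1 - (p $ 1)\<^sup>2 - (p $ 4)\<^sup>2" "area p > 0"
    "measure (lebesgue_on (interior (quad p))) (space (lebesgue_on (interior (quad p)))) = area p"
proof -
  show m: "measure (lebesgue_on (interior (quad p))) (space (lebesgue_on (interior (quad p)))) = area p"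
    using interior_quad_props(2)[OF p] measure_interior_quad[OF p]
    by (simp add: measure_restrict_space space_restrict_space)
  have "1 - (p $ 1)\<^sup>2 - (p $ 4)\<^sup>2 = (LINT x|lebesgue_on (interior (quad p)). 1)"
    using integral_quad_eq(2)[OF p, of "\<lambda>_. 1"] set_integral_J[of p] by simp
  also have "\<dots> = area p" using m by simp
  finally show A: "area p = 1 - (p $ 1)\<^sup>2 - (p $ 4)\<^sup>2" ..
  have "\<bar>p $ i\<bar>\<^sup>2 \<le> (1/100)\<^sup>2" for i
    using abs_nth_le_norm[of p i] p by (intro power_mono) auto
  from this[of 1] this[of 4] show "area p > 0" unfolding A by (simp add: power2_eq_square)
qed

lemma quadratic_form_expand:
  fixes A :: "real^'n^'n"
  shows "x \<bullet> (A *v x) = (\<Sum>i\<in>UNIV. \<Sum>j\<in>UNIV. x $ i * x $ j * A $ i $ j)"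
  by (simp add: inner_vec_def matrix_vector_mult_def sum_distrib_left mult_ac)

lemma stiffness_quadratic_form:
  assumes p: "norm p \<le> 1/100"
  shows "x \<bullet> (stiffness p *v x) = (LINT y|lebesgue_on (interior (quad p)). (norm (\<Sum>i\<in>UNIV. x $ i *\<^sub>R grad (g i) y))\<^sup>2)"
proof -
  have "(LINT y|lebesgue_on (interior (quad p)). (norm (\<Sum>i\<in>UNIV. x $ i *\<^sub>R grad (g i) y))\<^sup>2) =
    (LINT y|lebesgue_on (interior (quad p)). (\<Sum>i\<in>UNIV. \<Sum>j\<in>UNIV. x $ i * x $ j * (grad (g i) y \<bullet> grad (g j) y)))"
    by (simp add: power2_norm_eq_inner inner_sum_left inner_sum_right sum_distrib_left mult_ac inner_commute)
  also have "\<dots> = (\<Sum>i\<in>UNIV. \<Sum>j\<in>UNIV. x $ i * x $ j * (LINT y|lebesgue_on (interior (quad p)). grad (g i) y \<bullet> grad (g j) y))"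
    by (simp add: Bochner_Integration.integral_sum integral_quad_eq(1)[OF p] continuous_on_inner continuous_grad_g)
  finally show ?thesis by (simp add: quadratic_form_expand stiffness_eq[OF p])
qed

lemma mass_quadratic_form:
  assumes p: "norm p \<le> 1/100"
  shows "x \<bullet> (mass p *v x) = (LINT y|lebesgue_on (interior (quad p)). (\<Sum>i\<in>UNIV. x $ i * g i y)\<^sup>2)
    - 1 / area p * (LINT y|lebesgue_on (interior (quad p)). (\<Sum>i\<in>UNIV. x $ i * g i y))\<^sup>2"
proof -
  let ?M = "lebesgue_on (interior (quad p))"
  have "(LINT y|?M. (\<Sum>i\<in>UNIV. x $ i * g i y)\<^sup>2) = (LINT y|?M. (\<Sum>i\<in>UNIV. \<Sum>j\<in>UNIV. x $ i * x $ j * (g i y * g j y)))"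
    by (simp add: power2_eq_square sum_product mult_ac)
  also have "\<dots> = (\<Sum>i\<in>UNIV. \<Sum>j\<in>UNIV. x $ i * x $ j * (LINT y|?M. g i y * g j y))"
    by (simp add: Bochner_Integration.integral_sum integral_quad_eq(1)[OF p] continuous_on_mult continuous_g)
  finally have 1: "(LINT y|?M. (\<Sum>i\<in>UNIV. x $ i * g i y)\<^sup>2) = (\<Sum>i\<in>UNIV. \<Sum>j\<in>UNIV. x $ i * x $ j * (LINT y|?M. g i y * g j y))" .
  have "(LINT y|?M. (\<Sum>i\<in>UNIV. x $ i * g i y)) = (\<Sum>i\<in>UNIV. x $ i * (LINT y|?M. g i y))"
    by (simp add: Bochner_Integration.integral_sum integral_quad_eq(1)[OF p] continuous_g)
  hence 2: "(LINT y|?M. (\<Sum>i\<in>UNIV. x $ i * g i y))\<^sup>2 = (\<Sum>i\<in>UNIV. \<Sum>j\<in>UNIV. x $ i * x $ j * ((LINT y|?M. g i y) * (LINT y|?M. g j y)))"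
    by (simp add: power2_eq_square sum_product mult_ac)
  show ?thesis
    unfolding 1 2 quadratic_form_expand mass_eq[OF p]
    by (simp add: sum_distrib_left sum_subtractf[symmetric] right_diff_distrib mult_ac)
qed

lemma transpose_stiffness: "transpose (stiffness p) = stiffness p"
  by (simp add: transpose_def stiffness_def vec_eq_iff inner_commute mult_ac)

lemma transpose_mass: "transpose (mass p) = mass p"
  by (simp add: transpose_def mass_def vec_eq_iff mult_ac)

text \<open>An eigenvector gives a combination of the modes. After subtracting its mean over the
  quadrilateral, its squared norm is the mass form and its energy the stiffness form, so its
  Rayleigh quotient is \<open>lam 1 p\<close>. The bound on \<open>lam 1 p\<close> places it below
  the spectral gap required by \<open>mu1_quad\<close>.\<close>

lemma mu1_le_lam:
  assumes p: "norm p \<le> 1/100"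
    and Mpos: "\<And>x. x \<noteq> 0 \<Longrightarrow> x \<bullet> (mass p *v x) > 0"
    and lam: "lam 1 p < (200/143) * pi\<^sup>2"
  shows "0 < mu1 (interior (quad p))" "mu1 (interior (quad p)) \<le> lam 1 p"
    and "p = 0 \<Longrightarrow> pi\<^sup>2 \<le> mu1 (interior (quad p))"
proof -
  let ?V = "interior (quad p)" and ?M = "lebesgue_on (interior (quad p))"
  note V = interior_quad_props[OF p]
  interpret finite_measure ?M by (rule finite_measure_lebesgue_on[OF V(4)])
  obtain x where x: "x \<noteq> 0" "stiffness p *v x = lam 1 p *\<^sub>R (mass p *v x)"
    unfolding lam_def
    by (rule two_smallest_gen_eigenvalues[OF transpose_stiffness transpose_mass Mpos]) (auto intro: that)
  define u where "u y = (\<Sum>i\<in>UNIV. x $ i * g i y)" for y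
  define G where "G y = (\<Sum>i\<in>UNIV. x $ i *\<^sub>R grad (g i) y)" for y
  define c where "c = (LINT y|?M. u y) / area p"
  have uc: "continuous_on UNIV u" unfolding u_def by (intro continuous_intros continuous_g)
  have ui: "integrable ?M u" "integrable ?M (\<lambda>y. (u y)\<^sup>2)"
    by (intro integral_quad_eq(1)[OF p] continuous_intros uc)+
  have d: "((\<lambda>y. u y - c) has_derivative (\<lambda>h. G y \<bullet> h)) (at y)" for y
    unfolding u_def G_def
    by (auto intro!: derivative_eq_intros has_derivative_grad[OF differentiable_g] simp: inner_sum_left)
  have gr: "grad (\<lambda>y. u y - c) = G" by (rule ext, rule grad_eqI[OF d])
  have H1: "H1_with_gradient ?V (\<lambda>y. u y - c) G"
    unfolding gr[symmetric]
  proof (rule H1_smooth[OF V(3,2)])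
    show "(\<lambda>y. u y - c) differentiable (at y)" for y using d unfolding differentiable_def by blast
    show "continuous_on UNIV (grad (\<lambda>y. u y - c))"
      unfolding gr G_def by (intro continuous_intros continuous_grad_g)
  qed
  have A: "area p > 0" by (rule area_eq[OF p])
  have m: "measure ?M ?V = area p" using area_eq(3)[OF p] by (simp add: space_restrict_space)
  have mean: "(LINT y|?M. u y - c) = 0"
    using ui A by (simp add: m c_def)
  have "(LINT y|?M. (u y - c)\<^sup>2) = (LINT y|?M. ((u y)\<^sup>2 - 2 * c * u y) + c\<^sup>2)"
    by (simp add: power2_diff algebra_simps)
  also have "\<dots> = (LINT y|?M. (u y)\<^sup>2) - 2 * c * (LINT y|?M. u y) + c\<^sup>2 * area p"
    using ui by (simp add: m mult.commute)
  also have "\<dots> = (LINT y|?M. (u y)\<^sup>2) - 1 / area p * (LINT y|?M. u y)\<^sup>2"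
    using A by (simp add: c_def field_simps power2_eq_square)
  also have "\<dots> = x \<bullet> (mass p *v x)" by (simp add: mass_quadratic_form[OF p] u_def)
  finally have B: "(LINT y|?M. (u y - c)\<^sup>2) = x \<bullet> (mass p *v x)" .
  have "(LINT y|?M. (norm (G y))\<^sup>2) = x \<bullet> (stiffness p *v x)" by (simp add: stiffness_quadratic_form[OF p] G_def)
  also have "\<dots> = lam 1 p * (LINT y|?M. (u y - c)\<^sup>2)" unfolding B x(2) by simp
  finally have E: "(LINT y|?M. (norm (G y))\<^sup>2) \<le> lam 1 p * (LINT y|?M. (u y - c)\<^sup>2)" by simp
  have Bpos: "0 < (LINT y|?M. (u y - c)\<^sup>2)" unfolding B by (rule Mpos[OF x(1)])
  show "0 < mu1 ?V" "mu1 ?V \<le> lam 1 p" "p = 0 \<Longrightarrow> pi\<^sup>2 \<le> mu1 ?V"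
    by (rule mu1_quad[OF p H1 mean Bpos E lam]; assumption)+
qed

section \<open>Expansions in the parameter\<close>

text \<open>The calculus of O(|p|^k), uniform over the square so that it passes through integrals.
  Quantities depending on \<open>p\<close> alone are treated as functions that ignore
  \<open>w\<close>.\<close>

definition vanishing :: "nat \<Rightarrow> (real^4 \<Rightarrow> real^2 \<Rightarrow> real) \<Rightarrow> bool" where
  "vanishing k F \<longleftrightarrow> (\<exists>C\<ge>0. \<forall>p w. norm p \<le> 1/100 \<longrightarrow> w \<in> square \<longrightarrow> \<bar>F p w\<bar> \<le> C * norm p ^ k)"

lemma vanishing_I: "(\<And>p w. norm p \<le> 1/100 \<Longrightarrow> w \<in> square \<Longrightarrow> \<bar>F p w\<bar> \<le> C * norm p ^ k) \<Longrightarrow> C \<ge> 0 \<Longrightarrow> vanishing k F"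
  unfolding vanishing_def by blast

lemma vanishing_dominated:
  assumes "vanishing k G" "\<And>p w. norm p \<le> 1/100 \<Longrightarrow> w \<in> square \<Longrightarrow> \<bar>F p w\<bar> \<le> \<bar>G p w\<bar>"
  shows "vanishing k F"
  using assms unfolding vanishing_def by (meson order_trans)

lemma vanishing_cong:
  assumes "vanishing k G" "\<And>p w. norm p \<le> 1/100 \<Longrightarrow> w \<in> square \<Longrightarrow> F p w = G p w"
  shows "vanishing k F"
  by (rule vanishing_dominated[OF assms(1)]) (simp add: assms(2))

lemma vanishing_add: assumes "vanishing k F" "vanishing k G" shows "vanishing k (\<lambda>p w. F p w + G p w)"
proof -
  obtain C D where "C \<ge> 0" "D \<ge> 0" and C: "\<And>p w. norm p \<le> 1/100 \<Longrightarrow> w \<in> square \<Longrightarrow> \<bar>F p w\<bar> \<le> C * norm p ^ k"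
    and D: "\<And>p w. norm p \<le> 1/100 \<Longrightarrow> w \<in> square \<Longrightarrow> \<bar>G p w\<bar> \<le> D * norm p ^ k"
    using assms unfolding vanishing_def by blast
  show ?thesis
  proof (rule vanishing_I[where C="C + D"])
    fix p w assume "norm (p :: real^4) \<le> 1/100" "w \<in> square"
    thus "\<bar>F p w + G p w\<bar> \<le> (C + D) * norm p ^ k"
      using C[of p w] D[of p w] abs_triangle_ineq[of "F p w" "G p w"] by (simp add: distrib_right)
  qed (use \<open>C \<ge> 0\<close> \<open>D \<ge> 0\<close> in simp)
qed

lemma vanishing_mult: assumes "vanishing j F" "vanishing k G" shows "vanishing (j + k) (\<lambda>p w. F p w * G p w)"
proof -
  obtain C D where "C \<ge> 0" "D \<ge> 0" and C: "\<And>p w. norm p \<le> 1/100 \<Longrightarrow> w \<in> square \<Longrightarrow> \<bar>F p w\<bar> \<le> C * norm p ^ j"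
    and D: "\<And>p w. norm p \<le> 1/100 \<Longrightarrow> w \<in> square \<Longrightarrow> \<bar>G p w\<bar> \<le> D * norm p ^ k"
    using assms unfolding vanishing_def by blast
  show ?thesis
  proof (rule vanishing_I[where C="C * D"])
    fix p w assume "norm (p :: real^4) \<le> 1/100" "w \<in> square"
    hence "\<bar>F p w\<bar> * \<bar>G p w\<bar> \<le> (C * norm p ^ j) * (D * norm p ^ k)"
      using C D \<open>C \<ge> 0\<close> by (intro mult_mono) auto
    thus "\<bar>F p w * G p w\<bar> \<le> C * D * norm p ^ (j + k)" by (simp add: abs_mult power_add mult_ac)
  qed (use \<open>C \<ge> 0\<close> \<open>D \<ge> 0\<close> in simp)
qed

lemma vanishing_mono: assumes "vanishing j F" "k \<le> j" shows "vanishing k F"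
proof -
  obtain C where "C \<ge> 0" and C: "\<And>p w. norm p \<le> 1/100 \<Longrightarrow> w \<in> square \<Longrightarrow> \<bar>F p w\<bar> \<le> C * norm p ^ j"
    using assms unfolding vanishing_def by blast
  show ?thesis
  proof (rule vanishing_I[OF _ \<open>C \<ge> 0\<close>])
    fix p w assume p: "norm (p :: real^4) \<le> 1/100" "w \<in> square"
    have "norm p ^ j \<le> norm p ^ k" using p assms(2) by (intro power_decreasing) auto
    thus "\<bar>F p w\<bar> \<le> C * norm p ^ k" using C[OF p] mult_left_mono[OF _ \<open>C \<ge> 0\<close>] by fastforce
  qed
qed

lemma vanishing_const: "vanishing 0 (\<lambda>p w. c)"
  by (rule vanishing_I[where C="\<bar>c\<bar>"]) auto

lemma vanishing_cmult: "vanishing k F \<Longrightarrow> vanishing k (\<lambda>p w. c * F p w)"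
  using vanishing_mult[OF vanishing_const, of k F c] by simp

lemma vanishing_uminus: "vanishing k F \<Longrightarrow> vanishing k (\<lambda>p w. - F p w)"
  using vanishing_cmult[of k F "-1"] by simp

lemma vanishing_diff: "vanishing k F \<Longrightarrow> vanishing k G \<Longrightarrow> vanishing k (\<lambda>p w. F p w - G p w)"
  using vanishing_add[OF _ vanishing_uminus, of k F G] by simp

lemma vanishing_nth: "vanishing 1 (\<lambda>p w. p $ i)"
  by (rule vanishing_I[where C=1]) (auto simp: abs_nth_le_norm)

lemma vanishing_var: "vanishing 0 (\<lambda>p w. w $ i)"
proof (rule vanishing_I[where C="1/2"])
  fix p :: "real^4" and w assume "w \<in> square"
  thus "\<bar>w $ i\<bar> \<le> 1/2 * norm p ^ 0" using square_abs_le[of w] exhaust_2[of i] by auto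
qed simp

lemma vanishing_bounded: "(\<And>p w. \<bar>F p w\<bar> \<le> C) \<Longrightarrow> vanishing 0 F"
  by (rule vanishing_I[where C="\<bar>C\<bar>"]) (auto intro: order_trans[OF _ abs_ge_self])

lemma vanishing_sin: "vanishing 0 (\<lambda>p w. sin (F p w))" and vanishing_cos: "vanishing 0 (\<lambda>p w. cos (F p w))"
  by (rule vanishing_bounded[where C=1], simp)+

lemma vanishing_mult_0: "vanishing k F \<Longrightarrow> vanishing 0 G \<Longrightarrow> vanishing k (\<lambda>p w. F p w * G p w)"
  using vanishing_mult[of k F 0 G] by simp

lemma vanishing_0_mult: "vanishing 0 F \<Longrightarrow> vanishing k G \<Longrightarrow> vanishing k (\<lambda>p w. F p w * G p w)"
  using vanishing_mult[of 0 F k G] by simp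

lemma vanishing_1_1: "vanishing 1 F \<Longrightarrow> vanishing 1 G \<Longrightarrow> vanishing 2 (\<lambda>p w. F p w * G p w)"
  using vanishing_mult[of 1 F 1 G] by (simp add: numeral_2_eq_2)

lemma vanishing_1_2: "vanishing 1 F \<Longrightarrow> vanishing 2 G \<Longrightarrow> vanishing 3 (\<lambda>p w. F p w * G p w)"
  using vanishing_mult[of 1 F 2 G] by (simp add: numeral_3_eq_3)

lemma vanishing_2_1: "vanishing 2 F \<Longrightarrow> vanishing 1 G \<Longrightarrow> vanishing 3 (\<lambda>p w. F p w * G p w)"
  using vanishing_mult[of 2 F 1 G] by simp

lemma vanishing_3_2: "vanishing 3 F \<Longrightarrow> vanishing 2 F" and vanishing_3_1: "vanishing 3 F \<Longrightarrow> vanishing 1 F" and vanishing_2_1': "vanishing 2 F \<Longrightarrow> vanishing 1 F"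
  and vanishing_k_0: "vanishing k F \<Longrightarrow> vanishing 0 F"
  by (auto elim: vanishing_mono)

lemma abs_sin_minus_le: "\<bar>sin t - t\<bar> \<le> \<bar>t\<bar> ^ 3" for t :: real
proof -
  have "\<bar>sin t - (\<Sum>m<3. sin_coeff m * t ^ m)\<bar> \<le> inverse (fact 3) * \<bar>t\<bar> ^ 3"
    by (rule Maclaurin_sin_bound)
  hence "\<bar>sin t - t\<bar> \<le> inverse 6 * \<bar>t\<bar> ^ 3"
    by (simp add: sin_coeff_def eval_nat_numeral)
  also have "\<dots> \<le> 1 * \<bar>t\<bar> ^ 3" by (intro mult_right_mono) auto
  finally show ?thesis by simp
qed

lemma cos_eq_sin_half: "cos t = 1 - 2 * (sin (t / 2))\<^sup>2" for t :: real
  using cos_double_sin[of "t / 2"] by simp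

lemma abs_cos_minus_1_le: "\<bar>cos t - 1\<bar> \<le> t\<^sup>2" for t :: real
proof -
  have "\<bar>sin (t / 2)\<bar>\<^sup>2 \<le> \<bar>t / 2\<bar>\<^sup>2" by (intro power_mono abs_sin_x_le_abs_x) simp
  hence "4 * (sin (t / 2))\<^sup>2 \<le> t\<^sup>2" by (simp add: power_divide)
  moreover have "0 \<le> (sin (t / 2))\<^sup>2" by simp
  ultimately have "2 * (sin (t / 2))\<^sup>2 \<le> t\<^sup>2" by linarith
  thus ?thesis unfolding cos_eq_sin_half[of t] by simp
qed

text \<open>The half-angle formula makes the remainder a difference of squares, twice (t/2)^2 -
  sin(t/2)^2, which the cubic sine estimate controls.\<close>

lemma abs_cos_taylor_2_le: "\<bar>cos t - 1 + t\<^sup>2 / 2\<bar> \<le> \<bar>t\<bar> ^ 4" for t :: real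
proof -
  let ?h = "t / 2"
  have "cos t - 1 + t\<^sup>2 / 2 = 2 * ((?h - sin ?h) * (?h + sin ?h))"
    unfolding cos_eq_sin_half[of t] by (simp add: power2_eq_square field_simps)
  moreover have "\<bar>?h - sin ?h\<bar> \<le> \<bar>?h\<bar> ^ 3" using abs_sin_minus_le[of ?h] by (simp add: abs_minus_commute)
  moreover have "\<bar>?h + sin ?h\<bar> \<le> \<bar>?h\<bar> + \<bar>?h\<bar>"
    using abs_triangle_ineq[of ?h "sin ?h"] abs_sin_x_le_abs_x[of ?h] by linarith
  ultimately have "\<bar>cos t - 1 + t\<^sup>2 / 2\<bar> \<le> 2 * (\<bar>?h\<bar> ^ 3 * (\<bar>?h\<bar> + \<bar>?h\<bar>))"
    by (simp only: abs_mult abs_numeral) (intro mult_left_mono mult_mono; simp)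
  also have "\<dots> = \<bar>t\<bar> ^ 4 / 4" by (simp add: eval_nat_numeral)
  also have "\<dots> \<le> \<bar>t\<bar> ^ 4" by simp
  finally show ?thesis .
qed

lemma vanishing_abs_power: assumes "vanishing 1 F" shows "vanishing n (\<lambda>p w. \<bar>F p w\<bar> ^ n)"
proof (induction n)
  case 0
  show ?case using vanishing_const[of 1] by simp
next
  case (Suc n)
  have "vanishing 1 (\<lambda>p w. \<bar>F p w\<bar>)" by (rule vanishing_dominated[OF assms]) simp
  from vanishing_mult[OF this Suc] show ?case by simp
qed

lemma vanishing_sin_taylor: "vanishing 1 F \<Longrightarrow> vanishing 3 (\<lambda>p w. sin (F p w) - F p w)"
  and vanishing_cos_taylor_1: "vanishing 1 F \<Longrightarrow> vanishing 2 (\<lambda>p w. cos (F p w) - 1)"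
  and vanishing_cos_taylor_2: "vanishing 1 F \<Longrightarrow> vanishing 3 (\<lambda>p w. cos (F p w) - 1 + (F p w)\<^sup>2 / 2)"
proof -
  assume F: "vanishing 1 F"
  show "vanishing 3 (\<lambda>p w. sin (F p w) - F p w)"
    by (rule vanishing_dominated[OF vanishing_abs_power[OF F, of 3]]) (simp add: abs_sin_minus_le)
  show "vanishing 2 (\<lambda>p w. cos (F p w) - 1)"
    by (rule vanishing_dominated[OF vanishing_abs_power[OF F, of 2]]) (use abs_cos_minus_1_le in \<open>simp add: power2_abs\<close>)
  have "vanishing 4 (\<lambda>p w. cos (F p w) - 1 + (F p w)\<^sup>2 / 2)"
    by (rule vanishing_dominated[OF vanishing_abs_power[OF F, of 4]]) (use abs_cos_taylor_2_le in auto)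
  thus "vanishing 3 (\<lambda>p w. cos (F p w) - 1 + (F p w)\<^sup>2 / 2)" by (rule vanishing_mono) simp
qed

text \<open>Only the displacement \<open>t\<close> is expanded; the base point \<open>s\<close>
  enters through bounded sine and cosine factors, so no assumption on it is made.\<close>

lemma vanishing_cos_add_2: assumes "vanishing 1 t"
  shows "vanishing 3 (\<lambda>p w. cos (s p w + t p w) - (cos (s p w) - t p w * sin (s p w) - (t p w)\<^sup>2 / 2 * cos (s p w)))"
proof (rule vanishing_cong)
  show "vanishing 3 (\<lambda>p w. cos (s p w) * (cos (t p w) - 1 + (t p w)\<^sup>2 / 2) - sin (s p w) * (sin (t p w) - t p w))"
    by (intro vanishing_diff vanishing_0_mult vanishing_sin vanishing_cos vanishing_sin_taylor vanishing_cos_taylor_2 assms)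
qed (simp add: cos_add algebra_simps)

lemma vanishing_cos_add_1: assumes "vanishing 1 t"
  shows "vanishing 2 (\<lambda>p w. cos (s p w + t p w) - (cos (s p w) - t p w * sin (s p w)))"
proof (rule vanishing_cong)
  show "vanishing 2 (\<lambda>p w. cos (s p w) * (cos (t p w) - 1) - sin (s p w) * (sin (t p w) - t p w))"
    by (intro vanishing_diff vanishing_0_mult vanishing_sin vanishing_cos vanishing_3_2[OF vanishing_sin_taylor] vanishing_cos_taylor_1 assms)
qed (simp add: cos_add algebra_simps)

lemma vanishing_sin_add_1: assumes "vanishing 1 t"
  shows "vanishing 2 (\<lambda>p w. sin (s p w + t p w) - (sin (s p w) + t p w * cos (s p w)))"
proof (rule vanishing_cong)
  show "vanishing 2 (\<lambda>p w. sin (s p w) * (cos (t p w) - 1) + cos (s p w) * (sin (t p w) - t p w))"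
    by (intro vanishing_add vanishing_0_mult vanishing_sin vanishing_cos vanishing_3_2[OF vanishing_sin_taylor] vanishing_cos_taylor_1 assms)
qed (simp add: sin_add algebra_simps)

section \<open>Integrals over the square and one-dimensional moments\<close>

definition Iq :: "(real^2 \<Rightarrow> real) \<Rightarrow> real" where "Iq F = (LINT w:square|lborel. F w)"

lemma Iq_add: "continuous_on UNIV F \<Longrightarrow> continuous_on UNIV G \<Longrightarrow> Iq (\<lambda>w. F w + G w) = Iq F + Iq G"
  unfolding Iq_def by (rule set_integral_add(2)) (intro set_integrable_square; assumption)+

lemma Iq_diff: "continuous_on UNIV F \<Longrightarrow> continuous_on UNIV G \<Longrightarrow> Iq (\<lambda>w. F w - G w) = Iq F - Iq G"
  unfolding Iq_def by (rule set_integral_diff(2)) (intro set_integrable_square; assumption)+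

lemma Iq_cmult: "Iq (\<lambda>w. c * F w) = c * Iq F"
  unfolding Iq_def by (rule set_integral_mult_right)

lemma Iq_sum: "finite I \<Longrightarrow> (\<And>i. i \<in> I \<Longrightarrow> continuous_on UNIV (F i)) \<Longrightarrow> Iq (\<lambda>w. \<Sum>i\<in>I. F i w) = (\<Sum>i\<in>I. Iq (F i))"
proof (induction I rule: finite_induct)
  case empty
  show ?case by (simp add: Iq_def)
next
  case (insert i I)
  thus ?case by (simp add: Iq_add continuous_on_sum)
qed

lemma abs_Iq_le:
  assumes F: "continuous_on UNIV F" and B: "\<And>w. w \<in> square \<Longrightarrow> \<bar>F w\<bar> \<le> B"
  shows "\<bar>Iq F\<bar> \<le> B"
proof -
  let ?M = "lebesgue_on open_square"
  note i = integral_open_square_eq[OF F]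
  have m: "(LINT w|?M. B) = B"
    using integral_open_square_eq(2)[of "\<lambda>w. B"] set_integral_J[of 0]
      set_integral_mult_right[of lborel square B "\<lambda>_. 1"] by (simp add: J_0)
  have "\<bar>LINT w|?M. F w\<bar> \<le> (LINT w|?M. \<bar>F w\<bar>)" using integral_norm_bound[of ?M F] by simp
  also have "\<dots> \<le> (LINT w|?M. B)"
    using B open_square_subset integral_open_square_eq(1)[of "\<lambda>w. B"]
    by (intro integral_mono integrable_abs i(1)) (auto simp: space_restrict_space)
  finally show ?thesis unfolding m i(2) Iq_def .
qed

lemma vanishing_Iq:
  assumes "vanishing k F" "\<And>p. continuous_on UNIV (F p)"
  shows "vanishing k (\<lambda>p w. Iq (F p))"
proof -
  obtain C where "C \<ge> 0" and C: "\<And>p w. norm p \<le> 1/100 \<Longrightarrow> w \<in> square \<Longrightarrow> \<bar>F p w\<bar> \<le> C * norm p ^ k"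
    using assms unfolding vanishing_def by blast
  show ?thesis by (rule vanishing_I[OF abs_Iq_le[OF assms(2) C] \<open>C \<ge> 0\<close>])
qed

definition mom :: "(real \<Rightarrow> real) \<Rightarrow> nat \<Rightarrow> real" where
  "mom f i = integral {-1/2..1/2} (\<lambda>x. f x * x ^ i)"

lemma Iq_monomial:
  assumes f: "continuous_on UNIV f" and h: "continuous_on UNIV h"
  shows "Iq (\<lambda>w. f (w $ 1) * h (w $ 2) * ((w $ 1) ^ i * (w $ 2) ^ j)) = mom f i * mom h j"
  using set_integral_square_product[of "\<lambda>x. f x * x ^ i" "\<lambda>x. h x * x ^ j"] f h
  by (simp add: Iq_def mom_def mult_ac continuous_intros)

lemma continuous_nth_compose: "continuous_on UNIV f \<Longrightarrow> continuous_on S (\<lambda>w::real^'n. f (w $ i))" for f :: "real \<Rightarrow> real"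
  by (rule continuous_on_compose2[of UNIV f]) (auto intro: continuous_intros)

text \<open>All approximating integrands are sums of products of one trigonometric factor per
  coordinate with a polynomial of degree at most two in each coordinate; nine products of
  one-dimensional moments evaluate such an integral.\<close>

lemma Iq_polynomial:
  assumes f: "continuous_on UNIV f" and h: "continuous_on UNIV h"
  shows "Iq (\<lambda>w. f (w $ 1) * h (w $ 2) * (q00 + q10 * w $ 1 + q01 * w $ 2 + q11 * (w $ 1 * w $ 2) + q20 * (w $ 1)\<^sup>2
      + q02 * (w $ 2)\<^sup>2 + q21 * ((w $ 1)\<^sup>2 * w $ 2) + q12 * (w $ 1 * (w $ 2)\<^sup>2) + q22 * ((w $ 1)\<^sup>2 * (w $ 2)\<^sup>2))) =
    q00 * (mom f 0 * mom h 0) + q10 * (mom f 1 * mom h 0) + q01 * (mom f 0 * mom h 1) + q11 * (mom f 1 * mom h 1)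
    + q20 * (mom f 2 * mom h 0) + q02 * (mom f 0 * mom h 2) + q21 * (mom f 2 * mom h 1) + q12 * (mom f 1 * mom h 2)
    + q22 * (mom f 2 * mom h 2)"
proof -
  define q where "q i j = ([[q00, q01, q02], [q10, q11, q12], [q20, q21, q22]] ! i) ! j" for i j
  let ?t = "\<lambda>i j w. f (w $ 1) * h (w $ 2) * ((w $ 1) ^ i * (w $ 2) ^ j) :: real"
  have c: "continuous_on UNIV (\<lambda>w. q i j * ?t i j (w :: real^2))" for i j
    by (intro continuous_intros continuous_nth_compose f h)
  have "Iq (\<lambda>w. \<Sum>i<3. \<Sum>j<3. q i j * ?t i j w) = (\<Sum>i<3. \<Sum>j<3. q i j * (mom f i * mom h j))"
    by (simp add: Iq_sum c continuous_on_sum Iq_cmult Iq_monomial[OF f h])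
  thus ?thesis by (simp add: q_def eval_nat_numeral algebra_simps)
qed

lemma mom_eqI:
  assumes "\<And>x. (F has_real_derivative f x * x ^ i) (at x)"
  shows "mom f i = F (1/2) - F (-1/2)"
proof -
  have "((\<lambda>x. f x * x ^ i) has_integral (F (1/2) - F (-1/2))) {-1/2..1/2}"
    by (rule fundamental_theorem_of_calculus)
       (auto intro!: has_field_derivative_at_within assms simp: has_real_derivative_iff_has_vector_derivative[symmetric])
  thus ?thesis unfolding mom_def by (rule integral_unique)
qed

lemma mom_1: "mom (\<lambda>_. 1) 0 = 1" "mom (\<lambda>_. 1) 1 = 0" "mom (\<lambda>_. 1) 2 = 1/12"
proof -
  show "mom (\<lambda>_. 1) 0 = 1" by (subst mom_eqI[of "\<lambda>x. x"]) (auto intro!: derivative_eq_intros)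
  show "mom (\<lambda>_. 1) 1 = 0" by (subst mom_eqI[of "\<lambda>x. x\<^sup>2 / 2"]) (auto intro!: derivative_eq_intros simp: power2_eq_square)
  show "mom (\<lambda>_. 1) 2 = 1/12" by (subst mom_eqI[of "\<lambda>x. x^3 / 3"]) (auto intro!: derivative_eq_intros simp: eval_nat_numeral)
qed

lemma mom_cos:
  assumes "k \<noteq> 0"
  shows "mom (\<lambda>x. cos (k * x)) 0 = 2 * sin (k / 2) / k" "mom (\<lambda>x. cos (k * x)) 1 = 0"
    "mom (\<lambda>x. cos (k * x)) 2 = sin (k / 2) / (2 * k) + 2 * cos (k / 2) / k\<^sup>2 - 4 * sin (k / 2) / k^3"
proof -
  show "mom (\<lambda>x. cos (k * x)) 0 = 2 * sin (k / 2) / k"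
    by (subst mom_eqI[of "\<lambda>x. sin (k * x) / k"]) (use assms in \<open>auto intro!: derivative_eq_intros\<close>)
  show "mom (\<lambda>x. cos (k * x)) 1 = 0"
    by (subst mom_eqI[of "\<lambda>x. x * sin (k * x) / k + cos (k * x) / k\<^sup>2"])
       (use assms in \<open>auto intro!: derivative_eq_intros simp: field_simps power2_eq_square\<close>)
  show "mom (\<lambda>x. cos (k * x)) 2 = sin (k / 2) / (2 * k) + 2 * cos (k / 2) / k\<^sup>2 - 4 * sin (k / 2) / k^3"
    by (subst mom_eqI[of "\<lambda>x. x\<^sup>2 * sin (k * x) / k + 2 * x * cos (k * x) / k\<^sup>2 - 2 * sin (k * x) / k^3"])
       (use assms in \<open>auto intro!: derivative_eq_intros simp: field_simps eval_nat_numeral\<close>)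
qed

lemma mom_sin:
  assumes "k \<noteq> 0"
  shows "mom (\<lambda>x. sin (k * x)) 0 = 0" "mom (\<lambda>x. sin (k * x)) 1 = - cos (k / 2) / k + 2 * sin (k / 2) / k\<^sup>2"
    "mom (\<lambda>x. sin (k * x)) 2 = 0"
proof -
  show "mom (\<lambda>x. sin (k * x)) 0 = 0"
    by (subst mom_eqI[of "\<lambda>x. - cos (k * x) / k"]) (use assms in \<open>auto intro!: derivative_eq_intros\<close>)
  show "mom (\<lambda>x. sin (k * x)) 1 = - cos (k / 2) / k + 2 * sin (k / 2) / k\<^sup>2"
    by (subst mom_eqI[of "\<lambda>x. - x * cos (k * x) / k + sin (k * x) / k\<^sup>2"])
       (use assms in \<open>auto intro!: derivative_eq_intros simp: field_simps power2_eq_square\<close>)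
  show "mom (\<lambda>x. sin (k * x)) 2 = 0"
    by (subst mom_eqI[of "\<lambda>x. - x\<^sup>2 * cos (k * x) / k + 2 * x * sin (k * x) / k\<^sup>2 + 2 * cos (k * x) / k^3"])
       (use assms in \<open>auto intro!: derivative_eq_intros simp: field_simps eval_nat_numeral\<close>)
qed

lemma mom_2pi:
  "mom (\<lambda>x. cos (2 * pi * x)) 0 = 0" "mom (\<lambda>x. cos (2 * pi * x)) 1 = 0" "mom (\<lambda>x. cos (2 * pi * x)) 2 = - 1 / (2 * pi\<^sup>2)"
  "mom (\<lambda>x. sin (2 * pi * x)) 0 = 0" "mom (\<lambda>x. sin (2 * pi * x)) 1 = 1 / (2 * pi)" "mom (\<lambda>x. sin (2 * pi * x)) 2 = 0"
  using mom_cos[of "2 * pi"] mom_sin[of "2 * pi"] by (simp_all add: power2_eq_square)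

lemma mom_pi:
  "mom (\<lambda>x. cos (pi * x)) 1 = 0"
  "mom (\<lambda>x. sin (pi * x)) 0 = 0" "mom (\<lambda>x. sin (pi * x)) 1 = 2 / pi\<^sup>2" "mom (\<lambda>x. sin (pi * x)) 2 = 0"
  using mom_cos[of pi] mom_sin[of pi] by (simp_all add: power2_eq_square)


section \<open>Taylor expansion of integrals over the quadrilaterals\<close>

definition quad_integral :: "real^4 \<Rightarrow> (real^2 \<Rightarrow> real) \<Rightarrow> real" where
  "quad_integral p F = Iq (\<lambda>w. F (Phi p w) * J p w)"

definition shift1 :: "real^4 \<Rightarrow> real^2 \<Rightarrow> real" where
  "shift1 p w = - (p $ 1) * w $ 1 - p $ 4 * w $ 2 - 2 * p $ 2 * (w $ 1 * w $ 2)"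

definition shift2 :: "real^4 \<Rightarrow> real^2 \<Rightarrow> real" where
  "shift2 p w = - (p $ 4) * w $ 1 + p $ 1 * w $ 2 + 2 * p $ 3 * (w $ 1 * w $ 2)"

definition J_lin :: "real^4 \<Rightarrow> real^2 \<Rightarrow> real" where
  "J_lin p w = 2 * p $ 3 * w $ 1 - 2 * p $ 2 * w $ 2"

text \<open>The part of the Jacobian that is homogeneous of degree two in \<open>p\<close>. There is
  nothing of higher degree, so \<open>J_split\<close> is exact.\<close>

definition J_quad :: "real^4 \<Rightarrow> real^2 \<Rightarrow> real" where
  "J_quad p w = - ((p $ 1)\<^sup>2) - (p $ 4)\<^sup>2 + (- 2 * (p $ 1 * p $ 3) - 2 * (p $ 2 * p $ 4)) * w $ 1
     + (2 * (p $ 3 * p $ 4) - 2 * (p $ 1 * p $ 2)) * w $ 2"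

lemma Phi_shift: "Phi p w $ 1 = w $ 1 + shift1 p w" "Phi p w $ 2 = w $ 2 + shift2 p w"
  by (simp_all add: Phi_nth shift1_def shift2_def algebra_simps)

lemma J_split: "J p w = 1 + J_lin p w + J_quad p w"
  by (simp add: J_eq J_lin_def J_quad_def algebra_simps)

lemma vanishing_shift: "vanishing 1 shift1" "vanishing 1 shift2" "vanishing 1 J_lin"
  unfolding shift1_def[abs_def] shift2_def[abs_def] J_lin_def[abs_def]
  by (intro vanishing_add vanishing_diff vanishing_mult_0 vanishing_cmult vanishing_uminus vanishing_nth vanishing_var)+

lemma vanishing_J_quad: "vanishing 2 J_quad"
  unfolding J_quad_def[abs_def] power2_eq_square
  by (intro vanishing_add vanishing_diff vanishing_mult_0 vanishing_cmult vanishing_uminus vanishing_1_1 vanishing_nth vanishing_var)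

lemma vanishing_J: "vanishing 1 (\<lambda>p w. J p w - 1)" "vanishing 0 J"
proof -
  show 1: "vanishing 1 (\<lambda>p w. J p w - 1)"
    by (rule vanishing_cong[OF vanishing_add[OF vanishing_shift(3) vanishing_2_1'[OF vanishing_J_quad]]]) (simp add: J_split)
  show "vanishing 0 J"
    by (rule vanishing_cong[OF vanishing_add[OF vanishing_k_0[OF 1] vanishing_const[of 1]]]) simp
qed

text \<open>Expansions are made under the integral sign: approximate the pulled-back integrand by an
  explicit \<open>G\<close>, then integrate \<open>G\<close> exactly.\<close>

lemma vanishing_quad_integral:
  assumes v: "vanishing k (\<lambda>p w. F (Phi p w) * J p w - G p w)"
    and F: "continuous_on UNIV F" and G: "\<And>p. continuous_on UNIV (G p)"
    and e: "\<And>p. Iq (G p) = e p"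
  shows "vanishing k (\<lambda>p w. quad_integral p F - e p)"
proof -
  have c: "continuous_on UNIV (\<lambda>w. F (Phi p w) * J p w)" for p
    by (intro continuous_intros continuous_on_compose2[OF F continuous_on_Phi] continuous_on_J) auto
  have "vanishing k (\<lambda>p w. Iq (\<lambda>w. F (Phi p w) * J p w - G p w))"
    by (rule vanishing_Iq[OF v]) (intro continuous_intros c G)
  thus ?thesis by (simp add: Iq_diff c G quad_integral_def e)
qed

text \<open>\<open>s\<close> is a coordinate and \<open>t\<close> its displacement. Beyond the
  Taylor remainder, the discarded terms are displacement times \<open>J_quad\<close> and squared
  displacement times the nonconstant part of the Jacobian, all of third order.\<close>

lemma vanishing_cos_J_2:
  assumes t: "vanishing 1 t"
  shows "vanishing 3 (\<lambda>p w. cos (2 * pi * (s w + t p w)) * J p w -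
    (cos (2 * pi * s w) * (1 + J_lin p w + J_quad p w - 2 * pi\<^sup>2 * (t p w)\<^sup>2)
      + sin (2 * pi * s w) * (- 2 * pi * (t p w * (1 + J_lin p w)))))"
proof -
  have t': "vanishing 1 (\<lambda>p w. 2 * pi * t p w)" by (intro vanishing_cmult t)
  define r where "r = (\<lambda>p w. cos (2 * pi * s w + 2 * pi * t p w) - (cos (2 * pi * s w) - (2 * pi * t p w) * sin (2 * pi * s w)
      - (2 * pi * t p w)\<^sup>2 / 2 * cos (2 * pi * s w)))"
  have r: "vanishing 3 r" unfolding r_def by (rule vanishing_cos_add_2[OF t'])
  show ?thesis
  proof (rule vanishing_cong)
    show "vanishing 3 (\<lambda>p w. r p w * J p w + (- 2 * pi) * ((t p w * J_quad p w) * sin (2 * pi * s w))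
        + (- 2 * pi\<^sup>2) * (((t p w * t p w) * (J_lin p w + J_quad p w)) * cos (2 * pi * s w)))"
      by (intro vanishing_add vanishing_cmult vanishing_mult_0 vanishing_1_2 vanishing_2_1 vanishing_1_1 r t
          vanishing_J vanishing_J_quad vanishing_shift vanishing_sin vanishing_cos vanishing_2_1')
    fix p :: "real^4" and w
    have c: "cos (2 * pi * (s w + t p w)) = r p w + (cos (2 * pi * s w) - (2 * pi * t p w) * sin (2 * pi * s w)
      - (2 * pi * t p w)\<^sup>2 / 2 * cos (2 * pi * s w))" by (simp add: r_def distrib_left)
    show "cos (2 * pi * (s w + t p w)) * J p w -
      (cos (2 * pi * s w) * (1 + J_lin p w + J_quad p w - 2 * pi\<^sup>2 * (t p w)\<^sup>2)
        + sin (2 * pi * s w) * (- 2 * pi * (t p w * (1 + J_lin p w)))) =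
      r p w * J p w + (- 2 * pi) * ((t p w * J_quad p w) * sin (2 * pi * s w))
        + (- 2 * pi\<^sup>2) * (((t p w * t p w) * (J_lin p w + J_quad p w)) * cos (2 * pi * s w))"
      unfolding c J_split by (simp add: power2_eq_square algebra_simps)
  qed
qed

lemma vanishing_sin_J_1:
  assumes t: "vanishing 1 t"
  shows "vanishing 2 (\<lambda>p w. sin (pi * (s w + t p w)) * J p w -
    (sin (pi * s w) * (1 + J_lin p w) + cos (pi * s w) * (pi * t p w)))"
proof -
  have t': "vanishing 1 (\<lambda>p w. pi * t p w)" by (intro vanishing_cmult t)
  define r where "r = (\<lambda>p w. sin (pi * s w + pi * t p w) - (sin (pi * s w) + (pi * t p w) * cos (pi * s w)))"
  have r: "vanishing 2 r" unfolding r_def by (rule vanishing_sin_add_1[OF t'])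
  show ?thesis
  proof (rule vanishing_cong)
    show "vanishing 2 (\<lambda>p w. r p w * J p w + J_quad p w * sin (pi * s w) + pi * ((t p w * (J_lin p w + J_quad p w)) * cos (pi * s w)))"
      by (intro vanishing_add vanishing_cmult vanishing_mult_0 vanishing_1_1 r t
          vanishing_J vanishing_J_quad vanishing_shift vanishing_sin vanishing_cos vanishing_2_1'[OF vanishing_J_quad])
    fix p :: "real^4" and w
    have c: "sin (pi * (s w + t p w)) = r p w + (sin (pi * s w) + (pi * t p w) * cos (pi * s w))"
      by (simp add: r_def distrib_left)
    show "sin (pi * (s w + t p w)) * J p w - (sin (pi * s w) * (1 + J_lin p w) + cos (pi * s w) * (pi * t p w)) =
      r p w * J p w + J_quad p w * sin (pi * s w) + pi * ((t p w * (J_lin p w + J_quad p w)) * cos (pi * s w))"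
      unfolding c J_split by (simp add: algebra_simps)
  qed
qed

lemma vanishing_cos_sin_J_1:
  assumes t: "vanishing 1 t" and t2: "vanishing 1 t2"
  shows "vanishing 2 (\<lambda>p w. cos (2 * pi * (s w + t p w)) * sin (pi * (s2 w + t2 p w)) * J p w -
    (cos (2 * pi * s w) * sin (pi * s2 w) * (1 + J_lin p w) + sin (2 * pi * s w) * sin (pi * s2 w) * (- 2 * pi * t p w)
      + cos (2 * pi * s w) * cos (pi * s2 w) * (pi * t2 p w)))"
proof -
  have t': "vanishing 1 (\<lambda>p w. 2 * pi * t p w)" "vanishing 1 (\<lambda>p w. pi * t2 p w)" by (intro vanishing_cmult t t2)+
  define r where "r = (\<lambda>p w. cos (2 * pi * s w + 2 * pi * t p w) - (cos (2 * pi * s w) - (2 * pi * t p w) * sin (2 * pi * s w)))"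
  define r2 where "r2 = (\<lambda>p w. sin (pi * s2 w + pi * t2 p w) - (sin (pi * s2 w) + (pi * t2 p w) * cos (pi * s2 w)))"
  have r: "vanishing 2 r" unfolding r_def by (rule vanishing_cos_add_1[OF t'(1)])
  have r2: "vanishing 2 r2" unfolding r2_def by (rule vanishing_sin_add_1[OF t'(2)])
  have j: "vanishing 1 (\<lambda>p w. J_lin p w + J_quad p w)"
    by (intro vanishing_add vanishing_shift vanishing_2_1'[OF vanishing_J_quad])
  show ?thesis
  proof (rule vanishing_cong)
    show "vanishing 2 (\<lambda>p w. (r p w * sin (pi * (s2 w + t2 p w))) * J p w
      + ((cos (2 * pi * s w) - 2 * pi * (t p w * sin (2 * pi * s w))) * r2 p w) * J p w
      + (- 2 * pi\<^sup>2) * ((t p w * t2 p w) * (sin (2 * pi * s w) * cos (pi * s2 w)) * J p w)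
      + J_quad p w * (cos (2 * pi * s w) * sin (pi * s2 w))
      + (- 2 * pi) * ((t p w * (J_lin p w + J_quad p w)) * (sin (2 * pi * s w) * sin (pi * s2 w)))
      + pi * ((t2 p w * (J_lin p w + J_quad p w)) * (cos (2 * pi * s w) * cos (pi * s2 w))))"
      by (intro vanishing_add vanishing_cmult vanishing_mult_0[OF vanishing_mult_0[OF r]]
          vanishing_mult_0[OF vanishing_0_mult[OF _ r2]] vanishing_mult_0[OF vanishing_mult_0[OF vanishing_1_1[OF t t2]]]
          vanishing_mult_0[OF vanishing_J_quad] vanishing_mult_0[OF vanishing_1_1[OF t j]] vanishing_mult_0[OF vanishing_1_1[OF t2 j]]
          vanishing_diff vanishing_0_mult vanishing_J vanishing_sin vanishing_cos vanishing_k_0[OF t])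
    fix p :: "real^4" and w
    have c: "cos (2 * pi * (s w + t p w)) = r p w + (cos (2 * pi * s w) - (2 * pi * t p w) * sin (2 * pi * s w))"
      by (simp add: r_def distrib_left)
    have c2: "sin (pi * (s2 w + t2 p w)) = r2 p w + (sin (pi * s2 w) + (pi * t2 p w) * cos (pi * s2 w))"
      by (simp add: r2_def distrib_left)
    show "cos (2 * pi * (s w + t p w)) * sin (pi * (s2 w + t2 p w)) * J p w -
      (cos (2 * pi * s w) * sin (pi * s2 w) * (1 + J_lin p w) + sin (2 * pi * s w) * sin (pi * s2 w) * (- 2 * pi * t p w)
      + cos (2 * pi * s w) * cos (pi * s2 w) * (pi * t2 p w)) =
      (r p w * sin (pi * (s2 w + t2 p w))) * J p w
      + ((cos (2 * pi * s w) - 2 * pi * (t p w * sin (2 * pi * s w))) * r2 p w) * J p w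
      + (- 2 * pi\<^sup>2) * ((t p w * t2 p w) * (sin (2 * pi * s w) * cos (pi * s2 w)) * J p w)
      + J_quad p w * (cos (2 * pi * s w) * sin (pi * s2 w))
      + (- 2 * pi) * ((t p w * (J_lin p w + J_quad p w)) * (sin (2 * pi * s w) * sin (pi * s2 w)))
      + pi * ((t2 p w * (J_lin p w + J_quad p w)) * (cos (2 * pi * s w) * cos (pi * s2 w)))"
      unfolding c c2 J_split by (simp add: power2_eq_square algebra_simps)
  qed
qed

text \<open>Required to second order because this integral enters the diagonal entry
  \<open>defect p 1 1\<close> linearly.\<close>

lemma quad_integral_cos_1:
  "vanishing 3 (\<lambda>p w. quad_integral p (\<lambda>x. cos (2 * pi * x $ 1)) - (p $ 1 + (p $ 1)\<^sup>2))"
proof (rule vanishing_quad_integral)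
  let ?G = "\<lambda>p w. cos (2 * pi * w $ 1) * (1 + J_lin p w + J_quad p w - 2 * pi\<^sup>2 * (shift1 p w)\<^sup>2) + sin (2 * pi * w $ 1) * (- 2 * pi * (shift1 p w * (1 + J_lin p w)))"
  show "vanishing 3 (\<lambda>p w. cos (2 * pi * Phi p w $ 1) * J p w - ?G p w)"
    unfolding Phi_shift by (rule vanishing_cos_J_2[OF vanishing_shift(1)])
  show "continuous_on UNIV (\<lambda>x::real^2. cos (2 * pi * x $ 1))" by (intro continuous_intros)
  show "continuous_on UNIV (?G p)" for p
    unfolding shift1_def shift2_def J_lin_def J_quad_def by (intro continuous_intros)
  have cont: "continuous_on UNIV (\<lambda>x::real. 1::real)" "continuous_on UNIV (\<lambda>x::real. cos (k * x))" "continuous_on UNIV (\<lambda>x::real. sin (k * x))" for k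
    by (intro continuous_intros)+
  show "Iq (?G p) = p $ 1 + (p $ 1)\<^sup>2" for p
  proof -
    \<comment> \<open>The integrand is regrouped into the shape of \<open>Iq_polynomial\<close>:
      \<open>?P0\<close> carries the cosine factor and \<open>?P1\<close> the sine factor.\<close>
    let ?P0 = "\<lambda>w::real^2. cos (2 * pi * w $ 1) * 1 * ((1 - (p $ 1)\<^sup>2 - (p $ 4)\<^sup>2) + (2 * p $ 3 - 2 * (p $ 1 * p $ 3) - 2 * (p $ 2 * p $ 4)) * w $ 1 + (- 2 * p $ 2 + 2 * (p $ 3 * p $ 4) - 2 * (p $ 1 * p $ 2)) * w $ 2 + (- 4 * pi\<^sup>2 * (p $ 1 * p $ 4)) * (w $ 1 * w $ 2) + (- 2 * pi\<^sup>2 * (p $ 1)\<^sup>2) * (w $ 1)\<^sup>2 + (- 2 * pi\<^sup>2 * (p $ 4)\<^sup>2) * (w $ 2)\<^sup>2 + (- 8 * pi\<^sup>2 * (p $ 1 * p $ 2)) * ((w $ 1)\<^sup>2 * w $ 2) + (- 8 * pi\<^sup>2 * (p $ 2 * p $ 4)) * (w $ 1 * (w $ 2)\<^sup>2) + (- 8 * pi\<^sup>2 * (p $ 2)\<^sup>2) * ((w $ 1)\<^sup>2 * (w $ 2)\<^sup>2))"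
    let ?P1 = "\<lambda>w::real^2. sin (2 * pi * w $ 1) * 1 * ((0) + (2 * pi * p $ 1) * w $ 1 + (2 * pi * p $ 4) * w $ 2 + (2 * pi * (2 * p $ 2 - 2 * (p $ 1 * p $ 2) + 2 * (p $ 3 * p $ 4))) * (w $ 1 * w $ 2) + (4 * pi * (p $ 1 * p $ 3)) * (w $ 1)\<^sup>2 + (- 4 * pi * (p $ 2 * p $ 4)) * (w $ 2)\<^sup>2 + (8 * pi * (p $ 2 * p $ 3)) * ((w $ 1)\<^sup>2 * w $ 2) + (- 8 * pi * (p $ 2)\<^sup>2) * (w $ 1 * (w $ 2)\<^sup>2) + (0) * ((w $ 1)\<^sup>2 * (w $ 2)\<^sup>2))"
    have e0: "1 + J_lin p w + J_quad p w - 2 * pi\<^sup>2 * (shift1 p w)\<^sup>2 = (1 - (p $ 1)\<^sup>2 - (p $ 4)\<^sup>2) + (2 * p $ 3 - 2 * (p $ 1 * p $ 3) - 2 * (p $ 2 * p $ 4)) * w $ 1 + (- 2 * p $ 2 + 2 * (p $ 3 * p $ 4) - 2 * (p $ 1 * p $ 2)) * w $ 2 + (- 4 * pi\<^sup>2 * (p $ 1 * p $ 4)) * (w $ 1 * w $ 2) + (- 2 * pi\<^sup>2 * (p $ 1)\<^sup>2) * (w $ 1)\<^sup>2 + (- 2 * pi\<^sup>2 * (p $ 4)\<^sup>2) * (w $ 2)\<^sup>2 + (- 8 * pi\<^sup>2 * (p $ 1 * p $ 2)) * ((w $ 1)\<^sup>2 * w $ 2) + (- 8 * pi\<^sup>2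 * (p $ 2 * p $ 4)) * (w $ 1 * (w $ 2)\<^sup>2) + (- 8 * pi\<^sup>2 * (p $ 2)\<^sup>2) * ((w $ 1)\<^sup>2 * (w $ 2)\<^sup>2)" for w
      by (simp add: shift1_def shift2_def J_lin_def J_quad_def power2_eq_square algebra_simps)
    have e1: "- 2 * pi * (shift1 p w * (1 + J_lin p w)) = (0) + (2 * pi * p $ 1) * w $ 1 + (2 * pi * p $ 4) * w $ 2 + (2 * pi * (2 * p $ 2 - 2 * (p $ 1 * p $ 2) + 2 * (p $ 3 * p $ 4))) * (w $ 1 * w $ 2) + (4 * pi * (p $ 1 * p $ 3)) * (w $ 1)\<^sup>2 + (- 4 * pi * (p $ 2 * p $ 4)) * (w $ 2)\<^sup>2 + (8 * pi * (p $ 2 * p $ 3)) * ((w $ 1)\<^sup>2 * w $ 2) + (- 8 * pi * (p $ 2)\<^sup>2) * (w $ 1 * (w $ 2)\<^sup>2) + (0) * ((w $ 1)\<^sup>2 * (w $ 2)\<^sup>2)" for w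
      by (simp add: shift1_def shift2_def J_lin_def J_quad_def power2_eq_square algebra_simps)
    have i0: "Iq ?P0 = (- 2 * pi\<^sup>2 * (p $ 1)\<^sup>2) * (- 1 / (2 * pi\<^sup>2)) + (- 8 * pi\<^sup>2 * (p $ 2)\<^sup>2) * ((- 1 / (2 * pi\<^sup>2)) * (1 / 12))"
      by (subst Iq_polynomial[of "\<lambda>x. cos (2 * pi * x)" "\<lambda>x. 1" "1 - (p $ 1)\<^sup>2 - (p $ 4)\<^sup>2" "2 * p $ 3 - 2 * (p $ 1 * p $ 3) - 2 * (p $ 2 * p $ 4)" "- 2 * p $ 2 + 2 * (p $ 3 * p $ 4) - 2 * (p $ 1 * p $ 2)" "- 4 * pi\<^sup>2 * (p $ 1 * p $ 4)" "- 2 * pi\<^sup>2 * (p $ 1)\<^sup>2" "- 2 * pi\<^sup>2 * (p $ 4)\<^sup>2" "- 8 * pi\<^sup>2 * (p $ 1 * p $ 2)" "- 8 * pi\<^sup>2 * (p $ 2 * p $ 4)" "- 8 * pi\<^sup>2 * (p $ 2)\<^sup>2", OF cont(2)[of "2 * pi"] cont(1)]) (simp only: mom_1 mom_2pi mom_pi mult_zero_left mult_zero_right add_0_left add_0_right mult_1_right mult_1_left)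
    have i1: "Iq ?P1 = (2 * pi * p $ 1) * (1 / (2 * pi)) + (- 8 * pi * (p $ 2)\<^sup>2) * ((1 / (2 * pi)) * (1 / 12))"
      by (subst Iq_polynomial[of "\<lambda>x. sin (2 * pi * x)" "\<lambda>x. 1" "0" "2 * pi * p $ 1" "2 * pi * p $ 4" "2 * pi * (2 * p $ 2 - 2 * (p $ 1 * p $ 2) + 2 * (p $ 3 * p $ 4))" "4 * pi * (p $ 1 * p $ 3)" "- 4 * pi * (p $ 2 * p $ 4)" "8 * pi * (p $ 2 * p $ 3)" "- 8 * pi * (p $ 2)\<^sup>2" "0", OF cont(3)[of "2 * pi"] cont(1)]) (simp only: mom_1 mom_2pi mom_pi mult_zero_left mult_zero_right add_0_left add_0_right mult_1_right mult_1_left)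
    \<comment> \<open>The squares of the second parameter cancel: they contribute 1/3 through the
      cosine part and -1/3 through the sine part.\<close>
    have v: "((- 2 * pi\<^sup>2 * (p $ 1)\<^sup>2) * (- 1 / (2 * pi\<^sup>2)) + (- 8 * pi\<^sup>2 * (p $ 2)\<^sup>2) * ((- 1 / (2 * pi\<^sup>2)) * (1 / 12))) + ((2 * pi * p $ 1) * (1 / (2 * pi)) + (- 8 * pi * (p $ 2)\<^sup>2) * ((1 / (2 * pi)) * (1 / 12))) = p $ 1 + (p $ 1)\<^sup>2"
      by (simp add: field_simps power2_eq_square)
    have g1: "?G p = (\<lambda>w. ?P0 w + ?P1 w)"
      by (rule ext) (simp only: e0 e1 mult_1_right mult_1_left)
    have g2: "Iq (\<lambda>w. ?P0 w + ?P1 w) = Iq ?P0 + Iq ?P1"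
      by (rule Iq_add[of ?P0 ?P1]) (intro continuous_intros)+
    have g3: "Iq ?P0 + Iq ?P1 = p $ 1 + (p $ 1)\<^sup>2"
      unfolding i0 i1 by (rule v)
    show ?thesis by (rule trans[OF arg_cong[OF g1, of Iq] trans[OF g2 g3]])
  qed
qed

text \<open>Exchanging the two coordinates turns the parameters (a, b, c, d) into (-a, -c, -b, d),
  so this is the previous expansion with the sign of a reversed. The remaining pairs of expansions
  correspond in the same way.\<close>

lemma quad_integral_cos_2:
  "vanishing 3 (\<lambda>p w. quad_integral p (\<lambda>x. cos (2 * pi * x $ 2)) - (- (p $ 1) + (p $ 1)\<^sup>2))"
proof (rule vanishing_quad_integral)
  let ?G = "\<lambda>p w. cos (2 * pi * w $ 2) * (1 + J_lin p w + J_quad p w - 2 * pi\<^sup>2 * (shift2 p w)\<^sup>2) + sin (2 * pi * w $ 2) * (- 2 * pi * (shift2 p w * (1 + J_lin p w)))"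
  show "vanishing 3 (\<lambda>p w. cos (2 * pi * Phi p w $ 2) * J p w - ?G p w)"
    unfolding Phi_shift by (rule vanishing_cos_J_2[OF vanishing_shift(2)])
  show "continuous_on UNIV (\<lambda>x::real^2. cos (2 * pi * x $ 2))" by (intro continuous_intros)
  show "continuous_on UNIV (?G p)" for p
    unfolding shift1_def shift2_def J_lin_def J_quad_def by (intro continuous_intros)
  have cont: "continuous_on UNIV (\<lambda>x::real. 1::real)" "continuous_on UNIV (\<lambda>x::real. cos (k * x))" "continuous_on UNIV (\<lambda>x::real. sin (k * x))" for k
    by (intro continuous_intros)+
  show "Iq (?G p) = - (p $ 1) + (p $ 1)\<^sup>2" for p
  proof -
    let ?P0 = "\<lambda>w::real^2. 1 * cos (2 * pi * w $ 2) * ((1 - (p $ 1)\<^sup>2 - (p $ 4)\<^sup>2) + (2 * p $ 3 - 2 * (p $ 1 * p $ 3) - 2 * (p $ 2 * p $ 4)) * w $ 1 + (- 2 * p $ 2 + 2 * (p $ 3 * p $ 4) - 2 * (p $ 1 * p $ 2)) * w $ 2 + (4 * pi\<^sup>2 * (p $ 1 * p $ 4)) * (w $ 1 * w $ 2) + (- 2 * pi\<^sup>2 * (p $ 4)\<^sup>2) * (w $ 1)\<^sup>2 + (- 2 * pi\<^sup>2 * (p $ 1)\<^sup>2) * (w $ 2)\<^sup>2 + (8 * pi\<^sup>2 * (p $ 3 * p $ 4)) * ((w $ 1)\<^sup>2 * w $ 2) + (- 8 * pi\<^sup>2 * (p $ 1 * p $ 3)) * (w $ 1 * (w $ 2)\<^sup>2)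 + (- 8 * pi\<^sup>2 * (p $ 3)\<^sup>2) * ((w $ 1)\<^sup>2 * (w $ 2)\<^sup>2))"
    let ?P1 = "\<lambda>w::real^2. 1 * sin (2 * pi * w $ 2) * ((0) + (2 * pi * p $ 4) * w $ 1 + (- 2 * pi * p $ 1) * w $ 2 + (- 2 * pi * (2 * p $ 3 + 2 * (p $ 1 * p $ 3) + 2 * (p $ 2 * p $ 4))) * (w $ 1 * w $ 2) + (4 * pi * (p $ 3 * p $ 4)) * (w $ 1)\<^sup>2 + (4 * pi * (p $ 1 * p $ 2)) * (w $ 2)\<^sup>2 + (- 8 * pi * (p $ 3)\<^sup>2) * ((w $ 1)\<^sup>2 * w $ 2) + (8 * pi * (p $ 2 * p $ 3)) * (w $ 1 * (w $ 2)\<^sup>2) + (0) * ((w $ 1)\<^sup>2 * (w $ 2)\<^sup>2))"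
    have e0: "1 + J_lin p w + J_quad p w - 2 * pi\<^sup>2 * (shift2 p w)\<^sup>2 = (1 - (p $ 1)\<^sup>2 - (p $ 4)\<^sup>2) + (2 * p $ 3 - 2 * (p $ 1 * p $ 3) - 2 * (p $ 2 * p $ 4)) * w $ 1 + (- 2 * p $ 2 + 2 * (p $ 3 * p $ 4) - 2 * (p $ 1 * p $ 2)) * w $ 2 + (4 * pi\<^sup>2 * (p $ 1 * p $ 4)) * (w $ 1 * w $ 2) + (- 2 * pi\<^sup>2 * (p $ 4)\<^sup>2) * (w $ 1)\<^sup>2 + (- 2 * pi\<^sup>2 * (p $ 1)\<^sup>2) * (w $ 2)\<^sup>2 + (8 * pi\<^sup>2 * (p $ 3 * p $ 4)) * ((w $ 1)\<^sup>2 * w $ 2) + (- 8 * pi\<^sup>2 * (p $ 1 * p $ 3)) * (w $ 1 * (w $ 2)\<^sup>2) + (- 8 * pi\<^sup>2 * (p $ 3)\<^sup>2) * ((w $ 1)\<^sup>2 * (w $ 2)\<^sup>2)" for w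
      by (simp add: shift1_def shift2_def J_lin_def J_quad_def power2_eq_square algebra_simps)
    have e1: "- 2 * pi * (shift2 p w * (1 + J_lin p w)) = (0) + (2 * pi * p $ 4) * w $ 1 + (- 2 * pi * p $ 1) * w $ 2 + (- 2 * pi * (2 * p $ 3 + 2 * (p $ 1 * p $ 3) + 2 * (p $ 2 * p $ 4))) * (w $ 1 * w $ 2) + (4 * pi * (p $ 3 * p $ 4)) * (w $ 1)\<^sup>2 + (4 * pi * (p $ 1 * p $ 2)) * (w $ 2)\<^sup>2 + (- 8 * pi * (p $ 3)\<^sup>2) * ((w $ 1)\<^sup>2 * w $ 2) + (8 * pi * (p $ 2 * p $ 3)) * (w $ 1 * (w $ 2)\<^sup>2) + (0) * ((w $ 1)\<^sup>2 * (w $ 2)\<^sup>2)" for w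
      by (simp add: shift1_def shift2_def J_lin_def J_quad_def power2_eq_square algebra_simps)
    have i0: "Iq ?P0 = (- 2 * pi\<^sup>2 * (p $ 1)\<^sup>2) * (- 1 / (2 * pi\<^sup>2)) + (- 8 * pi\<^sup>2 * (p $ 3)\<^sup>2) * ((1 / 12) * (- 1 / (2 * pi\<^sup>2)))"
      by (subst Iq_polynomial[of "\<lambda>x. 1" "\<lambda>x. cos (2 * pi * x)" "1 - (p $ 1)\<^sup>2 - (p $ 4)\<^sup>2" "2 * p $ 3 - 2 * (p $ 1 * p $ 3) - 2 * (p $ 2 * p $ 4)" "- 2 * p $ 2 + 2 * (p $ 3 * p $ 4) - 2 * (p $ 1 * p $ 2)" "4 * pi\<^sup>2 * (p $ 1 * p $ 4)" "- 2 * pi\<^sup>2 * (p $ 4)\<^sup>2" "- 2 * pi\<^sup>2 * (p $ 1)\<^sup>2" "8 * pi\<^sup>2 * (p $ 3 * p $ 4)" "- 8 * pi\<^sup>2 * (p $ 1 * p $ 3)" "- 8 * pi\<^sup>2 * (p $ 3)\<^sup>2", OF cont(1) cont(2)[of "2 * pi"]]) (simp only: mom_1 mom_2pi mom_pi mult_zero_left mult_zero_right add_0_left add_0_right mult_1_right mult_1_left)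
    have i1: "Iq ?P1 = (- 2 * pi * p $ 1) * (1 / (2 * pi)) + (- 8 * pi * (p $ 3)\<^sup>2) * ((1 / 12) * (1 / (2 * pi)))"
      by (subst Iq_polynomial[of "\<lambda>x. 1" "\<lambda>x. sin (2 * pi * x)" "0" "2 * pi * p $ 4" "- 2 * pi * p $ 1" "- 2 * pi * (2 * p $ 3 + 2 * (p $ 1 * p $ 3) + 2 * (p $ 2 * p $ 4))" "4 * pi * (p $ 3 * p $ 4)" "4 * pi * (p $ 1 * p $ 2)" "- 8 * pi * (p $ 3)\<^sup>2" "8 * pi * (p $ 2 * p $ 3)" "0", OF cont(1) cont(3)[of "2 * pi"]]) (simp only: mom_1 mom_2pi mom_pi mult_zero_left mult_zero_right add_0_left add_0_right mult_1_right mult_1_left)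
    have v: "((- 2 * pi\<^sup>2 * (p $ 1)\<^sup>2) * (- 1 / (2 * pi\<^sup>2)) + (- 8 * pi\<^sup>2 * (p $ 3)\<^sup>2) * ((1 / 12) * (- 1 / (2 * pi\<^sup>2)))) + ((- 2 * pi * p $ 1) * (1 / (2 * pi)) + (- 8 * pi * (p $ 3)\<^sup>2) * ((1 / 12) * (1 / (2 * pi)))) = - (p $ 1) + (p $ 1)\<^sup>2"
      by (simp add: field_simps power2_eq_square)
    have g1: "?G p = (\<lambda>w. ?P0 w + ?P1 w)"
      by (rule ext) (simp only: e0 e1 mult_1_right mult_1_left)
    have g2: "Iq (\<lambda>w. ?P0 w + ?P1 w) = Iq ?P0 + Iq ?P1"
      by (rule Iq_add[of ?P0 ?P1]) (intro continuous_intros)+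
    have g3: "Iq ?P0 + Iq ?P1 = - (p $ 1) + (p $ 1)\<^sup>2"
      unfolding i0 i1 by (rule v)
    show ?thesis by (rule trans[OF arg_cong[OF g1, of Iq] trans[OF g2 g3]])
  qed
qed

text \<open>First order suffices because \<open>defect p 1 1\<close> contains this mean squared. The
  displacement terms vanish by parity; what remains is the slope of \<open>J_lin\<close> against the
  first moment of the sine.\<close>

lemma quad_integral_sin_1:
  "vanishing 2 (\<lambda>p w. quad_integral p (\<lambda>x. sin (pi * x $ 1)) - (4 * p $ 3 / pi\<^sup>2))"
proof (rule vanishing_quad_integral)
  let ?G = "\<lambda>p w. sin (pi * w $ 1) * (1 + J_lin p w) + cos (pi * w $ 1) * (pi * shift1 p w)"
  show "vanishing 2 (\<lambda>p w. sin (pi * Phi p w $ 1) * J p w - ?G p w)"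
    unfolding Phi_shift by (rule vanishing_sin_J_1[OF vanishing_shift(1)])
  show "continuous_on UNIV (\<lambda>x::real^2. sin (pi * x $ 1))" by (intro continuous_intros)
  show "continuous_on UNIV (?G p)" for p
    unfolding shift1_def shift2_def J_lin_def J_quad_def by (intro continuous_intros)
  have cont: "continuous_on UNIV (\<lambda>x::real. 1::real)" "continuous_on UNIV (\<lambda>x::real. cos (k * x))" "continuous_on UNIV (\<lambda>x::real. sin (k * x))" for k
    by (intro continuous_intros)+
  show "Iq (?G p) = 4 * p $ 3 / pi\<^sup>2" for p
  proof -
    let ?P0 = "\<lambda>w::real^2. sin (pi * w $ 1) * 1 * ((1) + (2 * p $ 3) * w $ 1 + (- 2 * p $ 2) * w $ 2 + (0) * (w $ 1 * w $ 2) + (0) * (w $ 1)\<^sup>2 + (0) * (w $ 2)\<^sup>2 + (0) * ((w $ 1)\<^sup>2 * w $ 2) + (0) * (w $ 1 * (w $ 2)\<^sup>2) + (0) * ((w $ 1)\<^sup>2 * (w $ 2)\<^sup>2))"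
    let ?P1 = "\<lambda>w::real^2. cos (pi * w $ 1) * 1 * ((0) + (pi * (- (p $ 1))) * w $ 1 + (pi * (- (p $ 4))) * w $ 2 + (pi * (- 2 * p $ 2)) * (w $ 1 * w $ 2) + (0) * (w $ 1)\<^sup>2 + (0) * (w $ 2)\<^sup>2 + (0) * ((w $ 1)\<^sup>2 * w $ 2) + (0) * (w $ 1 * (w $ 2)\<^sup>2) + (0) * ((w $ 1)\<^sup>2 * (w $ 2)\<^sup>2))"
    have e0: "1 + J_lin p w = (1) + (2 * p $ 3) * w $ 1 + (- 2 * p $ 2) * w $ 2 + (0) * (w $ 1 * w $ 2) + (0) * (w $ 1)\<^sup>2 + (0) * (w $ 2)\<^sup>2 + (0) * ((w $ 1)\<^sup>2 * w $ 2) + (0) * (w $ 1 * (w $ 2)\<^sup>2) + (0) * ((w $ 1)\<^sup>2 * (w $ 2)\<^sup>2)" for w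
      by (simp add: shift1_def shift2_def J_lin_def J_quad_def power2_eq_square algebra_simps)
    have e1: "pi * shift1 p w = (0) + (pi * (- (p $ 1))) * w $ 1 + (pi * (- (p $ 4))) * w $ 2 + (pi * (- 2 * p $ 2)) * (w $ 1 * w $ 2) + (0) * (w $ 1)\<^sup>2 + (0) * (w $ 2)\<^sup>2 + (0) * ((w $ 1)\<^sup>2 * w $ 2) + (0) * (w $ 1 * (w $ 2)\<^sup>2) + (0) * ((w $ 1)\<^sup>2 * (w $ 2)\<^sup>2)" for w
      by (simp add: shift1_def shift2_def J_lin_def J_quad_def power2_eq_square algebra_simps)
    have i0: "Iq ?P0 = (2 * p $ 3) * (2 / pi\<^sup>2)"
      by (subst Iq_polynomial[of "\<lambda>x. sin (pi * x)" "\<lambda>x. 1" "1" "2 * p $ 3" "- 2 * p $ 2" "0" "0" "0" "0" "0" "0", OF cont(3)[of pi] cont(1)]) (simp only: mom_1 mom_2pi mom_pi mult_zero_left mult_zero_right add_0_left add_0_right mult_1_right mult_1_left)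
    have i1: "Iq ?P1 = 0"
      by (subst Iq_polynomial[of "\<lambda>x. cos (pi * x)" "\<lambda>x. 1" "0" "pi * (- (p $ 1))" "pi * (- (p $ 4))" "pi * (- 2 * p $ 2)" "0" "0" "0" "0" "0", OF cont(2)[of pi] cont(1)]) (simp only: mom_1 mom_2pi mom_pi mult_zero_left mult_zero_right add_0_left add_0_right mult_1_right mult_1_left)
    have v: "((2 * p $ 3) * (2 / pi\<^sup>2)) + (0) = 4 * p $ 3 / pi\<^sup>2"
      by (simp add: field_simps power2_eq_square)
    have g1: "?G p = (\<lambda>w. ?P0 w + ?P1 w)"
      by (rule ext) (simp only: e0 e1 mult_1_right mult_1_left)
    have g2: "Iq (\<lambda>w. ?P0 w + ?P1 w) = Iq ?P0 + Iq ?P1"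
      by (rule Iq_add[of ?P0 ?P1]) (intro continuous_intros)+
    have g3: "Iq ?P0 + Iq ?P1 = 4 * p $ 3 / pi\<^sup>2"
      unfolding i0 i1 by (rule v)
    show ?thesis by (rule trans[OF arg_cong[OF g1, of Iq] trans[OF g2 g3]])
  qed
qed

lemma quad_integral_sin_2:
  "vanishing 2 (\<lambda>p w. quad_integral p (\<lambda>x. sin (pi * x $ 2)) - (- 4 * p $ 2 / pi\<^sup>2))"
proof (rule vanishing_quad_integral)
  let ?G = "\<lambda>p w. sin (pi * w $ 2) * (1 + J_lin p w) + cos (pi * w $ 2) * (pi * shift2 p w)"
  show "vanishing 2 (\<lambda>p w. sin (pi * Phi p w $ 2) * J p w - ?G p w)"
    unfolding Phi_shift by (rule vanishing_sin_J_1[OF vanishing_shift(2)])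
  show "continuous_on UNIV (\<lambda>x::real^2. sin (pi * x $ 2))" by (intro continuous_intros)
  show "continuous_on UNIV (?G p)" for p
    unfolding shift1_def shift2_def J_lin_def J_quad_def by (intro continuous_intros)
  have cont: "continuous_on UNIV (\<lambda>x::real. 1::real)" "continuous_on UNIV (\<lambda>x::real. cos (k * x))" "continuous_on UNIV (\<lambda>x::real. sin (k * x))" for k
    by (intro continuous_intros)+
  show "Iq (?G p) = - 4 * p $ 2 / pi\<^sup>2" for p
  proof -
    let ?P0 = "\<lambda>w::real^2. 1 * sin (pi * w $ 2) * ((1) + (2 * p $ 3) * w $ 1 + (- 2 * p $ 2) * w $ 2 + (0) * (w $ 1 * w $ 2) + (0) * (w $ 1)\<^sup>2 + (0) * (w $ 2)\<^sup>2 + (0) * ((w $ 1)\<^sup>2 * w $ 2) + (0) * (w $ 1 * (w $ 2)\<^sup>2) + (0) * ((w $ 1)\<^sup>2 * (w $ 2)\<^sup>2))"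
    let ?P1 = "\<lambda>w::real^2. 1 * cos (pi * w $ 2) * ((0) + (pi * (- (p $ 4))) * w $ 1 + (pi * p $ 1) * w $ 2 + (pi * (2 * p $ 3)) * (w $ 1 * w $ 2) + (0) * (w $ 1)\<^sup>2 + (0) * (w $ 2)\<^sup>2 + (0) * ((w $ 1)\<^sup>2 * w $ 2) + (0) * (w $ 1 * (w $ 2)\<^sup>2) + (0) * ((w $ 1)\<^sup>2 * (w $ 2)\<^sup>2))"
    have e0: "1 + J_lin p w = (1) + (2 * p $ 3) * w $ 1 + (- 2 * p $ 2) * w $ 2 + (0) * (w $ 1 * w $ 2) + (0) * (w $ 1)\<^sup>2 + (0) * (w $ 2)\<^sup>2 + (0) * ((w $ 1)\<^sup>2 * w $ 2) + (0) * (w $ 1 * (w $ 2)\<^sup>2) + (0) * ((w $ 1)\<^sup>2 * (w $ 2)\<^sup>2)" for w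
      by (simp add: shift1_def shift2_def J_lin_def J_quad_def power2_eq_square algebra_simps)
    have e1: "pi * shift2 p w = (0) + (pi * (- (p $ 4))) * w $ 1 + (pi * p $ 1) * w $ 2 + (pi * (2 * p $ 3)) * (w $ 1 * w $ 2) + (0) * (w $ 1)\<^sup>2 + (0) * (w $ 2)\<^sup>2 + (0) * ((w $ 1)\<^sup>2 * w $ 2) + (0) * (w $ 1 * (w $ 2)\<^sup>2) + (0) * ((w $ 1)\<^sup>2 * (w $ 2)\<^sup>2)" for w
      by (simp add: shift1_def shift2_def J_lin_def J_quad_def power2_eq_square algebra_simps)
    have i0: "Iq ?P0 = (- 2 * p $ 2) * (2 / pi\<^sup>2)"
      by (subst Iq_polynomial[of "\<lambda>x. 1" "\<lambda>x. sin (pi * x)" "1" "2 * p $ 3" "- 2 * p $ 2" "0" "0" "0" "0" "0" "0", OF cont(1) cont(3)[of pi]]) (simp only: mom_1 mom_2pi mom_pi mult_zero_left mult_zero_right add_0_left add_0_right mult_1_right mult_1_left)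
    have i1: "Iq ?P1 = 0"
      by (subst Iq_polynomial[of "\<lambda>x. 1" "\<lambda>x. cos (pi * x)" "0" "pi * (- (p $ 4))" "pi * p $ 1" "pi * (2 * p $ 3)" "0" "0" "0" "0" "0", OF cont(1) cont(2)[of pi]]) (simp only: mom_1 mom_2pi mom_pi mult_zero_left mult_zero_right add_0_left add_0_right mult_1_right mult_1_left)
    have v: "((- 2 * p $ 2) * (2 / pi\<^sup>2)) + (0) = - 4 * p $ 2 / pi\<^sup>2"
      by (simp add: field_simps power2_eq_square)
    have g1: "?G p = (\<lambda>w. ?P0 w + ?P1 w)"
      by (rule ext) (simp only: e0 e1 mult_1_right mult_1_left)
    have g2: "Iq (\<lambda>w. ?P0 w + ?P1 w) = Iq ?P0 + Iq ?P1"
      by (rule Iq_add[of ?P0 ?P1]) (intro continuous_intros)+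
    have g3: "Iq ?P0 + Iq ?P1 = - 4 * p $ 2 / pi\<^sup>2"
      unfolding i0 i1 by (rule v)
    show ?thesis by (rule trans[OF arg_cong[OF g1, of Iq] trans[OF g2 g3]])
  qed
qed

text \<open>First order suffices because this entry is later multiplied by
  \<open>trial_coeff1\<close>, itself of first order. Only the bilinear displacement of the first
  coordinate survives the integration.\<close>

lemma quad_integral_cos_sin:
  "vanishing 2 (\<lambda>p w. quad_integral p (\<lambda>x. cos (2 * pi * x $ 1) * sin (pi * x $ 2)) - (4 * p $ 2 / pi\<^sup>2))"
proof (rule vanishing_quad_integral)
  let ?G = "\<lambda>p w. cos (2 * pi * w $ 1) * sin (pi * w $ 2) * (1 + J_lin p w) + sin (2 * pi * w $ 1) * sin (pi * w $ 2) * (- 2 * pi * shift1 p w) + cos (2 * pi * w $ 1) * cos (pi * w $ 2) * (pi * shift2 p w)"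
  show "vanishing 2 (\<lambda>p w. cos (2 * pi * Phi p w $ 1) * sin (pi * Phi p w $ 2) * J p w - ?G p w)"
    unfolding Phi_shift by (rule vanishing_cos_sin_J_1[OF vanishing_shift(1,2)])
  show "continuous_on UNIV (\<lambda>x::real^2. cos (2 * pi * x $ 1) * sin (pi * x $ 2))" by (intro continuous_intros)
  show "continuous_on UNIV (?G p)" for p
    unfolding shift1_def shift2_def J_lin_def J_quad_def by (intro continuous_intros)
  have cont: "continuous_on UNIV (\<lambda>x::real. 1::real)" "continuous_on UNIV (\<lambda>x::real. cos (k * x))" "continuous_on UNIV (\<lambda>x::real. sin (k * x))" for k
    by (intro continuous_intros)+
  show "Iq (?G p) = 4 * p $ 2 / pi\<^sup>2" for p
  proof -
    let ?P0 = "\<lambda>w::real^2. cos (2 * pi * w $ 1) * sin (pi * w $ 2) * ((1) + (2 * p $ 3) * w $ 1 + (- 2 * p $ 2) * w $ 2 + (0) * (w $ 1 * w $ 2) + (0) * (w $ 1)\<^sup>2 + (0) * (w $ 2)\<^sup>2 + (0) * ((w $ 1)\<^sup>2 * w $ 2) + (0) * (w $ 1 * (w $ 2)\<^sup>2) + (0) * ((w $ 1)\<^sup>2 * (w $ 2)\<^sup>2))"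
    let ?P1 = "\<lambda>w::real^2. sin (2 * pi * w $ 1) * sin (pi * w $ 2) * ((0) + ((- 2 * pi) * (- (p $ 1))) * w $ 1 + ((- 2 * pi) * (- (p $ 4))) * w $ 2 + ((- 2 * pi) * (- 2 * p $ 2)) * (w $ 1 * w $ 2) + (0) * (w $ 1)\<^sup>2 + (0) * (w $ 2)\<^sup>2 + (0) * ((w $ 1)\<^sup>2 * w $ 2) + (0) * (w $ 1 * (w $ 2)\<^sup>2) + (0) * ((w $ 1)\<^sup>2 * (w $ 2)\<^sup>2))"
    let ?P2 = "\<lambda>w::real^2. cos (2 * pi * w $ 1) * cos (pi * w $ 2) * ((0) + (pi * (- (p $ 4))) * w $ 1 + (pi * p $ 1) * w $ 2 + (pi * (2 * p $ 3)) * (w $ 1 * w $ 2) + (0) * (w $ 1)\<^sup>2 + (0) * (w $ 2)\<^sup>2 + (0) * ((w $ 1)\<^sup>2 * w $ 2) + (0) * (w $ 1 * (w $ 2)\<^sup>2) + (0) * ((w $ 1)\<^sup>2 * (w $ 2)\<^sup>2))"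
    have e0: "1 + J_lin p w = (1) + (2 * p $ 3) * w $ 1 + (- 2 * p $ 2) * w $ 2 + (0) * (w $ 1 * w $ 2) + (0) * (w $ 1)\<^sup>2 + (0) * (w $ 2)\<^sup>2 + (0) * ((w $ 1)\<^sup>2 * w $ 2) + (0) * (w $ 1 * (w $ 2)\<^sup>2) + (0) * ((w $ 1)\<^sup>2 * (w $ 2)\<^sup>2)" for w
      by (simp add: shift1_def shift2_def J_lin_def J_quad_def power2_eq_square algebra_simps)
    have e1: "- 2 * pi * shift1 p w = (0) + ((- 2 * pi) * (- (p $ 1))) * w $ 1 + ((- 2 * pi) * (- (p $ 4))) * w $ 2 + ((- 2 * pi) * (- 2 * p $ 2)) * (w $ 1 * w $ 2) + (0) * (w $ 1)\<^sup>2 + (0) * (w $ 2)\<^sup>2 + (0) * ((w $ 1)\<^sup>2 * w $ 2) + (0) * (w $ 1 * (w $ 2)\<^sup>2) + (0) * ((w $ 1)\<^sup>2 * (w $ 2)\<^sup>2)" for w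
      by (simp add: shift1_def shift2_def J_lin_def J_quad_def power2_eq_square algebra_simps)
    have e2: "pi * shift2 p w = (0) + (pi * (- (p $ 4))) * w $ 1 + (pi * p $ 1) * w $ 2 + (pi * (2 * p $ 3)) * (w $ 1 * w $ 2) + (0) * (w $ 1)\<^sup>2 + (0) * (w $ 2)\<^sup>2 + (0) * ((w $ 1)\<^sup>2 * w $ 2) + (0) * (w $ 1 * (w $ 2)\<^sup>2) + (0) * ((w $ 1)\<^sup>2 * (w $ 2)\<^sup>2)" for w
      by (simp add: shift1_def shift2_def J_lin_def J_quad_def power2_eq_square algebra_simps)
    have i0: "Iq ?P0 = 0"
      by (subst Iq_polynomial[of "\<lambda>x. cos (2 * pi * x)" "\<lambda>x. sin (pi * x)" "1" "2 * p $ 3" "- 2 * p $ 2" "0" "0" "0" "0" "0" "0", OF cont(2)[of "2 * pi"] cont(3)[of pi]]) (simp only: mom_1 mom_2pi mom_pi mult_zero_left mult_zero_right add_0_left add_0_right mult_1_right mult_1_left)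
    have i1: "Iq ?P1 = ((- 2 * pi) * (- 2 * p $ 2)) * ((1 / (2 * pi)) * (2 / pi\<^sup>2))"
      by (subst Iq_polynomial[of "\<lambda>x. sin (2 * pi * x)" "\<lambda>x. sin (pi * x)" "0" "(- 2 * pi) * (- (p $ 1))" "(- 2 * pi) * (- (p $ 4))" "(- 2 * pi) * (- 2 * p $ 2)" "0" "0" "0" "0" "0", OF cont(3)[of "2 * pi"] cont(3)[of pi]]) (simp only: mom_1 mom_2pi mom_pi mult_zero_left mult_zero_right add_0_left add_0_right mult_1_right mult_1_left)
    have i2: "Iq ?P2 = 0"
      by (subst Iq_polynomial[of "\<lambda>x. cos (2 * pi * x)" "\<lambda>x. cos (pi * x)" "0" "pi * (- (p $ 4))" "pi * p $ 1" "pi * (2 * p $ 3)" "0" "0" "0" "0" "0", OF cont(2)[of "2 * pi"] cont(2)[of pi]]) (simp only: mom_1 mom_2pi mom_pi mult_zero_left mult_zero_right add_0_left add_0_right mult_1_right mult_1_left)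
    have v: "(0) + (((- 2 * pi) * (- 2 * p $ 2)) * ((1 / (2 * pi)) * (2 / pi\<^sup>2))) + (0) = 4 * p $ 2 / pi\<^sup>2"
      by (simp add: field_simps power2_eq_square)
    have g1: "?G p = (\<lambda>w. ?P0 w + ?P1 w + ?P2 w)"
      by (rule ext) (simp only: e0 e1 e2 mult_1_right mult_1_left)
    have g2: "Iq (\<lambda>w. ?P0 w + ?P1 w + ?P2 w) = Iq ?P0 + Iq ?P1 + Iq ?P2"
      by (subst Iq_add[of "\<lambda>w. ?P0 w + ?P1 w" ?P2], (intro continuous_intros)+, subst Iq_add[of ?P0 ?P1], (intro continuous_intros)+, rule refl)
    have g3: "Iq ?P0 + Iq ?P1 + Iq ?P2 = 4 * p $ 2 / pi\<^sup>2"
      unfolding i0 i1 i2 by (rule v)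
    show ?thesis by (rule trans[OF arg_cong[OF g1, of Iq] trans[OF g2 g3]])
  qed
qed

lemma quad_integral_sin_cos:
  "vanishing 2 (\<lambda>p w. quad_integral p (\<lambda>x. cos (2 * pi * x $ 2) * sin (pi * x $ 1)) - (- 4 * p $ 3 / pi\<^sup>2))"
proof (rule vanishing_quad_integral)
  let ?G = "\<lambda>p w. cos (2 * pi * w $ 2) * sin (pi * w $ 1) * (1 + J_lin p w) + sin (2 * pi * w $ 2) * sin (pi * w $ 1) * (- 2 * pi * shift2 p w) + cos (2 * pi * w $ 2) * cos (pi * w $ 1) * (pi * shift1 p w)"
  show "vanishing 2 (\<lambda>p w. cos (2 * pi * Phi p w $ 2) * sin (pi * Phi p w $ 1) * J p w - ?G p w)"
    unfolding Phi_shift by (rule vanishing_cos_sin_J_1[OF vanishing_shift(2,1)])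
  show "continuous_on UNIV (\<lambda>x::real^2. cos (2 * pi * x $ 2) * sin (pi * x $ 1))" by (intro continuous_intros)
  show "continuous_on UNIV (?G p)" for p
    unfolding shift1_def shift2_def J_lin_def J_quad_def by (intro continuous_intros)
  have cont: "continuous_on UNIV (\<lambda>x::real. 1::real)" "continuous_on UNIV (\<lambda>x::real. cos (k * x))" "continuous_on UNIV (\<lambda>x::real. sin (k * x))" for k
    by (intro continuous_intros)+
  show "Iq (?G p) = - 4 * p $ 3 / pi\<^sup>2" for p
  proof -
    let ?P0 = "\<lambda>w::real^2. sin (pi * w $ 1) * cos (2 * pi * w $ 2) * ((1) + (2 * p $ 3) * w $ 1 + (- 2 * p $ 2) * w $ 2 + (0) * (w $ 1 * w $ 2) + (0) * (w $ 1)\<^sup>2 + (0) * (w $ 2)\<^sup>2 + (0) * ((w $ 1)\<^sup>2 * w $ 2) + (0) * (w $ 1 * (w $ 2)\<^sup>2) + (0) * ((w $ 1)\<^sup>2 * (w $ 2)\<^sup>2))"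
    let ?P1 = "\<lambda>w::real^2. sin (pi * w $ 1) * sin (2 * pi * w $ 2) * ((0) + ((- 2 * pi) * (- (p $ 4))) * w $ 1 + ((- 2 * pi) * p $ 1) * w $ 2 + ((- 2 * pi) * (2 * p $ 3)) * (w $ 1 * w $ 2) + (0) * (w $ 1)\<^sup>2 + (0) * (w $ 2)\<^sup>2 + (0) * ((w $ 1)\<^sup>2 * w $ 2) + (0) * (w $ 1 * (w $ 2)\<^sup>2) + (0) * ((w $ 1)\<^sup>2 * (w $ 2)\<^sup>2))"
    let ?P2 = "\<lambda>w::real^2. cos (pi * w $ 1) * cos (2 * pi * w $ 2) * ((0) + (pi * (- (p $ 1))) * w $ 1 + (pi * (- (p $ 4))) * w $ 2 + (pi * (- 2 * p $ 2)) * (w $ 1 * w $ 2) + (0) * (w $ 1)\<^sup>2 + (0) * (w $ 2)\<^sup>2 + (0) * ((w $ 1)\<^sup>2 * w $ 2) + (0) * (w $ 1 * (w $ 2)\<^sup>2) + (0) * ((w $ 1)\<^sup>2 * (w $ 2)\<^sup>2))"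
    have e0: "1 + J_lin p w = (1) + (2 * p $ 3) * w $ 1 + (- 2 * p $ 2) * w $ 2 + (0) * (w $ 1 * w $ 2) + (0) * (w $ 1)\<^sup>2 + (0) * (w $ 2)\<^sup>2 + (0) * ((w $ 1)\<^sup>2 * w $ 2) + (0) * (w $ 1 * (w $ 2)\<^sup>2) + (0) * ((w $ 1)\<^sup>2 * (w $ 2)\<^sup>2)" for w
      by (simp add: shift1_def shift2_def J_lin_def J_quad_def power2_eq_square algebra_simps)
    have e1: "- 2 * pi * shift2 p w = (0) + ((- 2 * pi) * (- (p $ 4))) * w $ 1 + ((- 2 * pi) * p $ 1) * w $ 2 + ((- 2 * pi) * (2 * p $ 3)) * (w $ 1 * w $ 2) + (0) * (w $ 1)\<^sup>2 + (0) * (w $ 2)\<^sup>2 + (0) * ((w $ 1)\<^sup>2 * w $ 2) + (0) * (w $ 1 * (w $ 2)\<^sup>2) + (0) * ((w $ 1)\<^sup>2 * (w $ 2)\<^sup>2)" for w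
      by (simp add: shift1_def shift2_def J_lin_def J_quad_def power2_eq_square algebra_simps)
    have e2: "pi * shift1 p w = (0) + (pi * (- (p $ 1))) * w $ 1 + (pi * (- (p $ 4))) * w $ 2 + (pi * (- 2 * p $ 2)) * (w $ 1 * w $ 2) + (0) * (w $ 1)\<^sup>2 + (0) * (w $ 2)\<^sup>2 + (0) * ((w $ 1)\<^sup>2 * w $ 2) + (0) * (w $ 1 * (w $ 2)\<^sup>2) + (0) * ((w $ 1)\<^sup>2 * (w $ 2)\<^sup>2)" for w
      by (simp add: shift1_def shift2_def J_lin_def J_quad_def power2_eq_square algebra_simps)
    have i0: "Iq ?P0 = 0"
      by (subst Iq_polynomial[of "\<lambda>x. sin (pi * x)" "\<lambda>x. cos (2 * pi * x)" "1" "2 * p $ 3" "- 2 * p $ 2" "0" "0" "0" "0" "0" "0", OF cont(3)[of pi] cont(2)[of "2 * pi"]]) (simp only: mom_1 mom_2pi mom_pi mult_zero_left mult_zero_right add_0_left add_0_right mult_1_right mult_1_left)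
    have i1: "Iq ?P1 = ((- 2 * pi) * (2 * p $ 3)) * ((2 / pi\<^sup>2) * (1 / (2 * pi)))"
      by (subst Iq_polynomial[of "\<lambda>x. sin (pi * x)" "\<lambda>x. sin (2 * pi * x)" "0" "(- 2 * pi) * (- (p $ 4))" "(- 2 * pi) * p $ 1" "(- 2 * pi) * (2 * p $ 3)" "0" "0" "0" "0" "0", OF cont(3)[of pi] cont(3)[of "2 * pi"]]) (simp only: mom_1 mom_2pi mom_pi mult_zero_left mult_zero_right add_0_left add_0_right mult_1_right mult_1_left)
    have i2: "Iq ?P2 = 0"
      by (subst Iq_polynomial[of "\<lambda>x. cos (pi * x)" "\<lambda>x. cos (2 * pi * x)" "0" "pi * (- (p $ 1))" "pi * (- (p $ 4))" "pi * (- 2 * p $ 2)" "0" "0" "0" "0" "0", OF cont(2)[of pi] cont(2)[of "2 * pi"]]) (simp only: mom_1 mom_2pi mom_pi mult_zero_left mult_zero_right add_0_left add_0_right mult_1_right mult_1_left)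
    have v: "(0) + (((- 2 * pi) * (2 * p $ 3)) * ((2 / pi\<^sup>2) * (1 / (2 * pi)))) + (0) = - 4 * p $ 3 / pi\<^sup>2"
      by (simp add: field_simps power2_eq_square)
    have g1: "?G p = (\<lambda>w. ?P0 w + ?P1 w + ?P2 w)"
      by (rule ext) (simp only: e0 e1 e2 mult_1_right mult_1_left, simp only: mult.commute)
    have g2: "Iq (\<lambda>w. ?P0 w + ?P1 w + ?P2 w) = Iq ?P0 + Iq ?P1 + Iq ?P2"
      by (subst Iq_add[of "\<lambda>w. ?P0 w + ?P1 w" ?P2], (intro continuous_intros)+, subst Iq_add[of ?P0 ?P1], (intro continuous_intros)+, rule refl)
    have g3: "Iq ?P0 + Iq ?P1 + Iq ?P2 = - 4 * p $ 3 / pi\<^sup>2"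
      unfolding i0 i1 i2 by (rule v)
    show ?thesis by (rule trans[OF arg_cong[OF g1, of Iq] trans[OF g2 g3]])
  qed
qed

section \<open>First-order stability of integrals\<close>

definition near :: "(real^2 \<Rightarrow> real) \<Rightarrow> bool" where
  "near F \<longleftrightarrow> vanishing 1 (\<lambda>p w. F (Phi p w) - F w) \<and> vanishing 0 (\<lambda>p w. F w) \<and> vanishing 0 (\<lambda>p w. F (Phi p w))"

text \<open>Here the two boundedness clauses of \<open>near\<close> are used: the difference of
  products is split into two terms, each of which keeps one bounded factor.\<close>

lemma near_mult: assumes "near F" "near G" shows "near (\<lambda>x. F x * G x)"
proof -
  have "vanishing 1 (\<lambda>p w. F (Phi p w) * G (Phi p w) - F w * G w)"
  proof (rule vanishing_cong)
    show "vanishing 1 (\<lambda>p w. (F (Phi p w) - F w) * G (Phi p w) + F w * (G (Phi p w) - G w))"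
      using assms unfolding near_def by (intro vanishing_add vanishing_mult_0 vanishing_0_mult) auto
  qed (simp add: algebra_simps)
  thus ?thesis using assms unfolding near_def by (auto intro!: vanishing_mult_0)
qed

lemma near_add: assumes "near F" "near G" shows "near (\<lambda>x. F x + G x)"
proof -
  have "vanishing 1 (\<lambda>p w. (F (Phi p w) + G (Phi p w)) - (F w + G w))"
  proof (rule vanishing_cong)
    show "vanishing 1 (\<lambda>p w. (F (Phi p w) - F w) + (G (Phi p w) - G w))"
      using assms unfolding near_def by (intro vanishing_add) auto
  qed (simp add: algebra_simps)
  thus ?thesis using assms unfolding near_def by (auto intro!: vanishing_add)
qed

lemma near_const: "near (\<lambda>x. c)"
  unfolding near_def using vanishing_I[where F="\<lambda>p w. 0" and C=0 and k=1] by (auto intro: vanishing_const)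

lemma near_cmult: "near F \<Longrightarrow> near (\<lambda>x. c * F x)"
  by (rule near_mult[OF near_const])

lemma vanishing_Phi_nth: "vanishing 1 (\<lambda>p w. Phi p w $ i - w $ i)"
proof -
  have "vanishing 1 (\<lambda>p w. Phi p w $ 1 - w $ 1)" "vanishing 1 (\<lambda>p w. Phi p w $ 2 - w $ 2)"
    using vanishing_shift(1,2) by (simp_all add: Phi_shift)
  thus ?thesis using exhaust_2[of i] by auto
qed

lemma near_cos: "near (\<lambda>x. cos (k * (x $ i + 1/2)))" and near_sin: "near (\<lambda>x. sin (k * (x $ i + 1/2)))"
proof -
  let ?s = "\<lambda>(p::real^4) (w::real^2). k * (w $ i + 1/2)" and ?t = "\<lambda>p w. k * (Phi p w $ i - w $ i)"
  have t: "vanishing 1 ?t" by (intro vanishing_cmult vanishing_Phi_nth)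
  have "vanishing 1 (\<lambda>p w. cos (k * (Phi p w $ i + 1/2)) - cos (k * (w $ i + 1/2)))"
  proof (rule vanishing_cong)
    show "vanishing 1 (\<lambda>p w. (cos (?s p w + ?t p w) - (cos (?s p w) - ?t p w * sin (?s p w))) - ?t p w * sin (?s p w))"
      by (intro vanishing_diff vanishing_2_1'[OF vanishing_cos_add_1[OF t]] vanishing_mult_0 t vanishing_sin)
  qed (simp add: algebra_simps)
  thus "near (\<lambda>x. cos (k * (x $ i + 1/2)))" unfolding near_def by (auto intro: vanishing_cos)
  have "vanishing 1 (\<lambda>p w. sin (k * (Phi p w $ i + 1/2)) - sin (k * (w $ i + 1/2)))"
  proof (rule vanishing_cong)
    show "vanishing 1 (\<lambda>p w. (sin (?s p w + ?t p w) - (sin (?s p w) + ?t p w * cos (?s p w))) + ?t p w * cos (?s p w))"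
      by (intro vanishing_add vanishing_2_1'[OF vanishing_sin_add_1[OF t]] vanishing_mult_0 t vanishing_cos)
  qed (simp add: algebra_simps)
  thus "near (\<lambda>x. sin (k * (x $ i + 1/2)))" unfolding near_def by (auto intro: vanishing_sin)
qed

lemma near_cos_mode: "near (cos_mode m n)"
  unfolding cos_mode_def[abs_def] by (intro near_mult near_cos)

lemma near_grad_cos_mode: "near (\<lambda>x. grad (cos_mode m n) x $ i)"
proof -
  have "near (\<lambda>x. - 1 * (real m * pi * (sin (real m * pi * (x $ 1 + 1/2)) * cos (real n * pi * (x $ 2 + 1/2)))))"
    "near (\<lambda>x. - 1 * (real n * pi * (cos (real m * pi * (x $ 1 + 1/2)) * sin (real n * pi * (x $ 2 + 1/2)))))"
    by (intro near_cmult near_mult near_cos near_sin)+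
  thus ?thesis using exhaust_2[of i] by (auto simp: grad_cos_mode mult.assoc)
qed

lemma near_g: "near (g i)" and near_grad_g: "near (\<lambda>x. grad (g i) x $ k)"
  using g_eq_cos_mode[of i] near_cos_mode near_grad_cos_mode by auto

lemma quad_integral_near:
  assumes F: "near F" "continuous_on UNIV F"
  shows "vanishing 1 (\<lambda>p w. quad_integral p F - Iq F)"
proof (rule vanishing_quad_integral[OF _ F(2) F(2) refl])
  show "vanishing 1 (\<lambda>p w. F (Phi p w) * J p w - F w)"
  proof (rule vanishing_cong)
    show "vanishing 1 (\<lambda>p w. (F (Phi p w) - F w) * J p w + F w * (J p w - 1))"
      using F unfolding near_def by (intro vanishing_add vanishing_mult_0 vanishing_0_mult vanishing_J) auto
  qed (simp add: algebra_simps)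
qed

lemma quad_integral_0: "quad_integral 0 F = Iq F"
  by (simp add: quad_integral_def Phi_0 J_0)

lemma continuous_quad_integrand: "continuous_on UNIV F \<Longrightarrow> continuous_on UNIV (\<lambda>w. F (Phi p w) * J p w)"
  by (rule continuous_on_mult[OF continuous_on_compose2[where g=F and s=UNIV and t=UNIV, OF _ continuous_on_Phi subset_UNIV] continuous_on_J])

lemma quad_integral_add: "continuous_on UNIV F \<Longrightarrow> continuous_on UNIV G \<Longrightarrow>
    quad_integral p (\<lambda>x. F x + G x) = quad_integral p F + quad_integral p G"
  unfolding quad_integral_def distrib_right by (intro Iq_add continuous_quad_integrand)

lemma quad_integral_diff: "continuous_on UNIV F \<Longrightarrow> continuous_on UNIV G \<Longrightarrow>
    quad_integral p (\<lambda>x. F x - G x) = quad_integral p F - quad_integral p G"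
  unfolding quad_integral_def left_diff_distrib by (intro Iq_diff continuous_quad_integrand)

lemma quad_integral_cmult: "quad_integral p (\<lambda>x. c * F x) = c * quad_integral p F"
  unfolding quad_integral_def mult.assoc by (rule Iq_cmult)

lemma quad_integral_1: "norm p \<le> 1/100 \<Longrightarrow> quad_integral p (\<lambda>x. 1) = area p"
  using set_integral_J[of p] by (simp add: quad_integral_def Iq_def area_eq)

lemma stiffness_quad_integral: "stiffness p $ i $ j = quad_integral p (\<lambda>x. grad (g i) x \<bullet> grad (g j) x)"
  by (simp add: stiffness_def quad_integral_def Iq_def)

lemma mass_quad_integral:
  "mass p $ i $ j = quad_integral p (\<lambda>x. g i x * g j x) - 1 / area p * quad_integral p (g i) * quad_integral p (g j)"
  by (simp add: mass_def quad_integral_def Iq_def)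

lemma area_aux: "1 - x * x - y * y - 1 = - (x * x) - y * (y::real)"
  by simp

lemma area_ge: assumes "norm p \<le> 1/100" shows "3/4 \<le> area p"
proof -
  have "\<bar>p $ i\<bar>\<^sup>2 \<le> (1/3)\<^sup>2" for i using abs_nth_le_norm[of p i] assms by (intro power_mono) auto
  hence "(p $ i)\<^sup>2 \<le> 1/9" for i by (simp add: power_divide)
  from this[of 1] this[of 4] show ?thesis unfolding area_eq(1)[OF assms] by linarith
qed

lemma vanishing_area: "vanishing 2 (\<lambda>p w. area p - 1)" "vanishing 0 (\<lambda>p w. 1 / area p)" "vanishing 2 (\<lambda>p w. 1 / area p - 1)"
proof -
  show 1: "vanishing 2 (\<lambda>p w. area p - 1)"
    by (rule vanishing_cong[OF vanishing_diff[OF vanishing_uminus[OF vanishing_1_1[OF vanishing_nth[of 1] vanishing_nth[of 1]]] vanishing_1_1[OF vanishing_nth[of 4] vanishing_nth[of 4]]]])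
       (unfold area_eq(1) power2_eq_square, rule area_aux)
  show 2: "vanishing 0 (\<lambda>p w. 1 / area p)"
  proof (rule vanishing_I[where C=2])
    fix p :: "real^4" assume "norm p \<le> 1/100"
    from area_ge[OF this] show "\<bar>1 / area p\<bar> \<le> 2 * norm p ^ 0" by (simp add: divide_simps)
  qed simp
  show "vanishing 2 (\<lambda>p w. 1 / area p - 1)"
  proof (rule vanishing_cong[OF vanishing_uminus[OF vanishing_mult_0[OF 1 2]]])
    fix p :: "real^4" assume "norm p \<le> 1/100"
    from area_ge[OF this] show "1 / area p - 1 = - ((area p - 1) * (1 / area p))" by (simp add: field_simps)
  qed
qed

section \<open>Stiffness and mass matrices at the square and near it\<close>

lemma exhaust_5: "(x::5) = 1 \<or> x = 2 \<or> x = 3 \<or> x = 4 \<or> x = 5"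
proof (induct x)
  case (of_int z)
  then have "0 \<le> z" "z < 5" by simp_all
  then have "z = 0 \<or> z = 1 \<or> z = 2 \<or> z = 3 \<or> z = 4" by arith
  then show ?case by auto
qed

text \<open>With the five functions indexed by their frequencies, the entries at the square follow
  from the orthogonality relations in one stroke instead of case by case.\<close>

definition mode_index :: "5 \<Rightarrow> nat \<times> nat" where
  "mode_index i = (if i = 1 then (1, 0) else if i = 2 then (0, 1) else if i = 3 then (1, 1) else if i = 4 then (2, 0) else (0, 2))"

lemma g_mode_index: "g i = cos_mode (fst (mode_index i)) (snd (mode_index i))"
  by (simp add: g_def mode_index_def)

lemma mode_index_inj: "mode_index i = mode_index j \<longleftrightarrow> i = j"
  using exhaust_5[of i] exhaust_5[of j] by (elim disjE) (simp_all add: mode_index_def)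

lemma mode_index_nonzero: "mode_index i \<noteq> (0, 0)"
  by (simp add: mode_index_def)

definition index_weight :: "5 \<Rightarrow> real" where
  "index_weight i = mode_weight (fst (mode_index i)) * mode_weight (snd (mode_index i))"

definition index_eigenvalue :: "5 \<Rightarrow> real" where
  "index_eigenvalue i = mode_eigenvalue (fst (mode_index i)) (snd (mode_index i))"

lemma index_weight_ge: "1/4 \<le> index_weight i"
  by (simp add: index_weight_def mode_weight_def)

lemma index_eigenvalue_ge: "pi\<^sup>2 \<le> index_eigenvalue i"
  unfolding index_eigenvalue_def by (rule mode_eigenvalue_ge) (use mode_index_nonzero[of i] in \<open>simp add: prod_eq_iff\<close>)

lemma Iq_eq: "continuous_on UNIV F \<Longrightarrow> Iq F = (LINT w|lebesgue_on open_square. F w)"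
  by (simp add: Iq_def integral_open_square_eq(2))

lemma Iq_g_g: "Iq (\<lambda>x. g i x * g j x) = (if i = j then index_weight i else 0)"
  using mode_index_inj[of i j]
  by (simp add: Iq_eq continuous_on_mult continuous_g)
     (simp add: g_mode_index cos_mode_orthogonal index_weight_def prod_eq_iff)

lemma Iq_g: "Iq (g i) = 0"
proof -
  have "Iq (g i) = (LINT w|lebesgue_on open_square. cos_mode (fst (mode_index i)) (snd (mode_index i)) w * cos_mode 0 0 w)"
    by (simp add: Iq_eq continuous_g cos_mode_0) (simp add: g_mode_index)
  thus ?thesis using mode_index_nonzero[of i] by (simp only: cos_mode_orthogonal) (auto simp: prod_eq_iff)
qed

lemma Iq_grad_g: "Iq (\<lambda>x. grad (g i) x \<bullet> grad (g j) x) = (if i = j then index_eigenvalue i * index_weight i else 0)"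
proof -
  have "Iq (\<lambda>x. grad (g i) x \<bullet> grad (g j) x) = (LINT w|lebesgue_on open_square. grad (g i) w \<bullet> grad (g j) w)"
    by (intro Iq_eq continuous_intros continuous_grad_g)
  also have "\<dots> = index_eigenvalue i * (LINT w|lebesgue_on open_square. g i w * g j w)"
    unfolding g_mode_index index_eigenvalue_def by (rule cos_mode_neumann[OF H1_cos_mode_square])
  also have "(LINT w|lebesgue_on open_square. g i w * g j w) = Iq (\<lambda>x. g i x * g j x)"
    by (rule Iq_eq[symmetric]) (intro continuous_intros continuous_g)
  finally show ?thesis by (simp add: Iq_g_g)
qed

lemma near_gg: "near (\<lambda>x. g i x * g j x)" and near_grad_gg: "near (\<lambda>x. grad (g i) x \<bullet> grad (g j) x)"
  by (auto simp: inner_vec_def sum_2 intro!: near_mult near_add near_g near_grad_g)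

lemma vanishing_quad_integral_g: "vanishing 1 (\<lambda>p w. quad_integral p (g i))"
  using quad_integral_near[OF near_g continuous_g, of i] by (simp add: Iq_g)

lemma vanishing_stiffness: "vanishing 1 (\<lambda>p w. stiffness p $ i $ j - (if i = j then index_eigenvalue i * index_weight i else 0))"
  using quad_integral_near[OF near_grad_gg, of i j] unfolding stiffness_quad_integral Iq_grad_g
  by (simp add: continuous_on_inner continuous_grad_g)

lemma vanishing_mass: "vanishing 1 (\<lambda>p w. mass p $ i $ j - (if i = j then index_weight i else 0))"
proof (rule vanishing_cong)
  have "vanishing 1 (\<lambda>p w. quad_integral p (\<lambda>x. g i x * g j x) - Iq (\<lambda>x. g i x * g j x))"
    by (intro quad_integral_near near_gg continuous_intros continuous_g)
  moreover have "vanishing 1 (\<lambda>p w. (1 / area p * quad_integral p (g i)) * quad_integral p (g j))"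
    by (rule vanishing_mult_0[OF vanishing_0_mult[OF vanishing_area(2) vanishing_quad_integral_g] vanishing_k_0[OF vanishing_quad_integral_g]])
  ultimately show "vanishing 1 (\<lambda>p w. (quad_integral p (\<lambda>x. g i x * g j x) - Iq (\<lambda>x. g i x * g j x)) - (1 / area p * quad_integral p (g i)) * quad_integral p (g j))"
    by (rule vanishing_diff)
qed (simp add: mass_quad_integral Iq_g_g)

lemma vanishing_abs: "vanishing k F \<Longrightarrow> vanishing k (\<lambda>p w. \<bar>F p w\<bar>)"
  by (erule vanishing_dominated) simp

lemma vanishing_zero: "vanishing k (\<lambda>p w. 0)"
  by (rule vanishing_I[where C=0]) auto

lemma vanishing_sum: "finite I \<Longrightarrow> (\<And>i. i \<in> I \<Longrightarrow> vanishing k (F i)) \<Longrightarrow> vanishing k (\<lambda>p w. \<Sum>i\<in>I. F i p w)"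
  by (induction I rule: finite_induct) (auto intro: vanishing_add vanishing_zero)

lemma zero_in_square: "0 \<in> square"
  by (simp add: mem_square)

lemma vanishing_scalar_bound:
  assumes "vanishing k (\<lambda>p w. f p)"
  shows "\<exists>C\<ge>0. \<forall>p. norm p \<le> 1/100 \<longrightarrow> \<bar>f p\<bar> \<le> C * norm p ^ k"
proof -
  from assms obtain C where "C \<ge> 0" and C: "\<forall>p w. norm p \<le> 1/100 \<longrightarrow> w \<in> square \<longrightarrow> \<bar>f p\<bar> \<le> C * norm p ^ k"
    unfolding vanishing_def by (elim exE conjE)
  show ?thesis
  proof (intro exI[of _ C] conjI allI impI)
    fix p :: "real^4" assume "norm p \<le> 1/100"
    with C zero_in_square show "\<bar>f p\<bar> \<le> C * norm p ^ k" by iprover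
  qed fact
qed

lemma norm_square_eq_sum: "(norm x)\<^sup>2 = (\<Sum>i\<in>UNIV. (x $ i)\<^sup>2)" for x :: "real^'n"
  by (simp add: power2_norm_eq_inner inner_vec_def) (simp add: power2_eq_square)

text \<open>The sum of the absolute entry errors bounds the error of the form, uniformly in the
  vector.\<close>

lemma quadratic_form_perturbation:
  fixes B :: "real^4 \<Rightarrow> real^'n^'n"
  assumes "\<And>i j. vanishing 1 (\<lambda>p w. B p $ i $ j - D $ i $ j)"
  shows "\<exists>C\<ge>0. \<forall>p x. norm p \<le> 1/100 \<longrightarrow> \<bar>x \<bullet> (B p *v x) - x \<bullet> (D *v x)\<bar> \<le> C * norm p * (norm x)\<^sup>2"
proof -
  let ?s = "\<lambda>p. \<Sum>i\<in>UNIV. \<Sum>j\<in>UNIV. \<bar>B p $ i $ j - D $ i $ j\<bar>"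
  have v: "vanishing 1 (\<lambda>p w. ?s p)" by (intro vanishing_sum vanishing_abs assms) auto
  from vanishing_scalar_bound[OF v] obtain C where C1: "C \<ge> 0"
    and C2: "\<forall>p. norm p \<le> 1/100 \<longrightarrow> \<bar>?s p\<bar> \<le> C * norm p ^ 1" by (elim exE conjE)
  show ?thesis
  proof (intro exI[of _ C] conjI allI impI C1)
    fix p :: "real^4" and x :: "real^'n" assume p: "norm p \<le> 1/100"
    have "x \<bullet> (B p *v x) - x \<bullet> (D *v x) = (\<Sum>i\<in>UNIV. \<Sum>j\<in>UNIV. x $ i * x $ j * (B p $ i $ j - D $ i $ j))"
      by (simp add: quadratic_form_expand sum_subtractf right_diff_distrib)
    also have "\<bar>\<dots>\<bar> \<le> (\<Sum>i\<in>UNIV. \<Sum>j\<in>UNIV. \<bar>x $ i * x $ j * (B p $ i $ j - D $ i $ j)\<bar>)"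
      by (rule order_trans[OF sum_abs sum_mono[OF sum_abs]])
    also have "\<dots> \<le> (\<Sum>i\<in>UNIV. \<Sum>j\<in>UNIV. (norm x)\<^sup>2 * \<bar>B p $ i $ j - D $ i $ j\<bar>)"
    proof (intro sum_mono)
      fix i j
      have "\<bar>x $ i\<bar> * \<bar>x $ j\<bar> \<le> norm x * norm x" by (intro mult_mono abs_nth_le_norm) auto
      thus "\<bar>x $ i * x $ j * (B p $ i $ j - D $ i $ j)\<bar> \<le> (norm x)\<^sup>2 * \<bar>B p $ i $ j - D $ i $ j\<bar>"
        by (simp add: abs_mult power2_eq_square mult_right_mono)
    qed
    also have "\<dots> = (norm x)\<^sup>2 * ?s p" by (simp add: sum_distrib_left)
    also have "\<dots> \<le> (norm x)\<^sup>2 * (C * norm p)"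
      by (intro mult_left_mono order_trans[OF abs_ge_self C2[rule_format, OF p, unfolded power_one_right]]) simp
    finally show "\<bar>x \<bullet> (B p *v x) - x \<bullet> (D *v x)\<bar> \<le> C * norm p * (norm x)\<^sup>2" by (simp add: mult_ac)
  qed
qed

lemma diagonal_quadratic_form: "x \<bullet> ((\<chi> i j. if i = j then d i else 0) *v x) = (\<Sum>i\<in>UNIV. d i * (x $ i)\<^sup>2)" for x :: "real^'n"
proof -
  have "(\<Sum>j\<in>UNIV. x $ i * x $ j * (if i = j then d i else 0)) = d i * (x $ i)\<^sup>2" for i
    by (simp add: if_distrib cong: if_cong) (simp add: power2_eq_square)
  thus ?thesis by (simp add: quadratic_form_expand)
qed

lemma positive_definite_near_0:
  fixes B :: "real^4 \<Rightarrow> real^'n^'n"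
  assumes v: "\<And>i j. vanishing 1 (\<lambda>p w. B p $ i $ j - (if i = j then d i else 0))" and d: "\<And>i. d i \<ge> 1/4"
  shows "\<exists>\<epsilon>>0. \<epsilon> \<le> 1/100 \<and> (\<forall>p x. norm p < \<epsilon> \<longrightarrow> x \<noteq> 0 \<longrightarrow> x \<bullet> (B p *v x) > 0)"
proof -
  let ?D = "(\<chi> i j. if i = j then d i else 0) :: real^'n^'n"
  have v': "vanishing 1 (\<lambda>p w. B p $ i $ j - ?D $ i $ j)" for i j using v[of i j] by simp
  from quadratic_form_perturbation[OF v'] obtain C where C1: "C \<ge> 0"
    and C2: "\<forall>p x. norm p \<le> 1/100 \<longrightarrow> \<bar>x \<bullet> (B p *v x) - x \<bullet> (?D *v x)\<bar> \<le> C * norm p * (norm x)\<^sup>2" by (elim exE conjE)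
  show ?thesis
  \<comment> \<open>The radius keeps the perturbation below 1/8 of the squared norm, half of the
    lower bound 1/4 for the diagonal. Adding 1 allows \<open>C\<close> to be zero.\<close>
  proof (intro exI[of _ "min (1/100) (1 / (8 * (C + 1)))"] conjI allI impI)
    show "0 < min (1/100) (1 / (8 * (C + 1)))" using C1 by simp
    fix p :: "real^4" and x :: "real^'n" assume p: "norm p < min (1/100) (1 / (8 * (C + 1)))" and x: "x \<noteq> 0"
    have "norm p * (8 * (C + 1)) < 1" using p C1 by (simp add: pos_less_divide_eq)
    hence "8 * (C * norm p) + 8 * norm p < 1" by (simp add: algebra_simps)
    hence "C * norm p < 1/8" using norm_ge_zero[of p] by linarith
    hence "C * norm p * (norm x)\<^sup>2 < 1/8 * (norm x)\<^sup>2" by (rule mult_strict_right_mono) (use x in simp)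
    moreover have "1/4 * (norm x)\<^sup>2 \<le> x \<bullet> (?D *v x)"
      unfolding diagonal_quadratic_form norm_square_eq_sum sum_distrib_left using d by (intro sum_mono mult_right_mono) auto
    moreover have "\<bar>x \<bullet> (B p *v x) - x \<bullet> (?D *v x)\<bar> \<le> C * norm p * (norm x)\<^sup>2" using C2[rule_format, of p x] p by simp
    moreover have "(norm x)\<^sup>2 > 0" using x by simp
    ultimately show "x \<bullet> (B p *v x) > 0" by linarith
  qed simp
qed

lemma mass_positive_definite: "\<exists>\<epsilon>>0. \<epsilon> \<le> 1/100 \<and> (\<forall>p x. norm p < \<epsilon> \<longrightarrow> x \<noteq> 0 \<longrightarrow> x \<bullet> (mass p *v x) > 0)"
  by (rule positive_definite_near_0[OF vanishing_mass index_weight_ge])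

lemma pi_square_gt_9: "9 < pi\<^sup>2"
  using power_strict_mono[OF pi_gt3, of 2] by simp

lemma stiffness_positive_definite: "\<exists>\<epsilon>>0. \<epsilon> \<le> 1/100 \<and> (\<forall>p x. norm p < \<epsilon> \<longrightarrow> x \<noteq> 0 \<longrightarrow> x \<bullet> (stiffness p *v x) > 0)"
proof (rule positive_definite_near_0[OF vanishing_stiffness])
  show "1/4 \<le> index_eigenvalue i * index_weight i" for i
    using mult_mono[of 1 "index_eigenvalue i" "1/4" "index_weight i"] index_eigenvalue_ge[of i] index_weight_ge[of i] pi_square_gt_9 by simp
qed

text \<open>At the square both matrices are diagonal with ratios at least pi^2. An upper bound is
  the direction wanted, since for the other parameters \<open>f2\<close> is shown to exceed
  1/pi^2.\<close>

lemma f2_0_le: "f2 0 \<le> 1 / pi\<^sup>2"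
proof -
  have Mpos: "x \<bullet> (mass 0 *v x) > 0" if "x \<noteq> 0" for x using mass_positive_definite that by force
  have M: "mass 0 = (\<chi> i j. if i = j then index_weight i else 0)"
    by (simp add: vec_eq_iff mass_quad_integral quad_integral_0 Iq_g_g Iq_g)
  have K: "stiffness 0 = (\<chi> i j. if i = j then index_eigenvalue i * index_weight i else 0)"
    by (simp add: vec_eq_iff stiffness_quad_integral quad_integral_0 Iq_grad_g)
  have le: "pi\<^sup>2 * (x \<bullet> (mass 0 *v x)) \<le> x \<bullet> (stiffness 0 *v x)" for x
    unfolding M K diagonal_quadratic_form sum_distrib_left mult.assoc[symmetric]
    using index_eigenvalue_ge index_weight_ge
    by (intro sum_mono mult_right_mono) (auto intro: order_trans[of 0 "1/4"])
  have l: "pi\<^sup>2 \<le> lam 1 0" "pi\<^sup>2 \<le> lam 2 0"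
    unfolding lam_def by (rule gen_eigenvalue_nth_lower_bound[OF transpose_stiffness transpose_mass Mpos _ le]; simp)+
  have "area 0 = 1" by (simp add: area_eq)
  hence "f2 0 = 1/2 * (1 / lam 1 0 + 1 / lam 2 0)" by (simp add: f2_def)
  also have "\<dots> \<le> 1/2 * (1 / pi\<^sup>2 + 1 / pi\<^sup>2)"
    using l by (intro mult_left_mono add_mono divide_left_mono) (auto intro!: mult_pos_pos intro: less_le_trans[of 0 "pi\<^sup>2"])
  finally show ?thesis by simp
qed

text \<open>One spare order in \<open>p\<close> is traded for an arbitrarily small constant.\<close>

lemma vanishing_scalar_small:
  assumes "vanishing (Suc k) (\<lambda>p w. f p)" "e > 0"
  shows "\<exists>\<epsilon>>0. \<epsilon> \<le> 1/100 \<and> (\<forall>p. norm p < \<epsilon> \<longrightarrow> \<bar>f p\<bar> \<le> e * norm p ^ k)"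
proof -
  from vanishing_scalar_bound[OF assms(1)] obtain C where C1: "C \<ge> 0"
    and C2: "\<forall>p. norm p \<le> 1/100 \<longrightarrow> \<bar>f p\<bar> \<le> C * norm p ^ Suc k" by (elim exE conjE)
  show ?thesis
  proof (intro exI[of _ "min (1/100) (e / (C + 1))"] conjI allI impI)
    show "0 < min (1/100) (e / (C + 1))" using C1 assms(2) by simp
    fix p :: "real^4" assume p: "norm p < min (1/100) (e / (C + 1))"
    hence "norm p * (C + 1) < e" using C1 by (simp add: pos_less_divide_eq)
    hence "C * norm p + norm p < e" by (simp add: algebra_simps)
    hence c: "C * norm p \<le> e" using norm_ge_zero[of p] by linarith
    have "\<bar>f p\<bar> \<le> C * norm p ^ Suc k" using C2 p by simp
    also have "C * norm p ^ Suc k = (C * norm p) * norm p ^ k" by simp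
    also have "\<dots> \<le> e * norm p ^ k" by (rule mult_right_mono[OF c]) simp
    finally show "\<bar>f p\<bar> \<le> e * norm p ^ k" .
  qed (rule min.cobounded1)
qed

section \<open>The strict minimum\<close>

lemma g_sin: "g 1 = (\<lambda>x. - sin (pi * x $ 1))" "g 2 = (\<lambda>x. - sin (pi * x $ 2))"
    "g 3 = (\<lambda>x. sin (pi * x $ 1) * sin (pi * x $ 2))"
  by (simp_all add: g_def cos_mode_def[abs_def] cos_shift_eq_sin)

lemma sin_shift_eq_cos: "sin (pi * (x + 1/2)) = cos (pi * x)"
  by (simp add: distrib_left sin_add)

lemma grad_g_cos: "grad (g 1) x = vector [- (pi * cos (pi * x $ 1)), 0]" "grad (g 2) x = vector [0, - (pi * cos (pi * x $ 2))]"
    "grad (g 3) x = vector [pi * (cos (pi * x $ 1) * sin (pi * x $ 2)), pi * (sin (pi * x $ 1) * cos (pi * x $ 2))]"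
  by (simp_all add: g_def grad_cos_mode cos_shift_eq_sin sin_shift_eq_cos mult.assoc)

lemma inner_vector_2: "(vector [a, b] :: real^2) \<bullet> vector [c, d] = a * c + b * d"
  by (simp add: inner_vec_def sum_2)

lemma cos_twice: "cos (2 * pi * x) = (cos (pi * x))\<^sup>2 - (sin (pi * x))\<^sup>2" "cos (2 * pi * x) = 2 * (cos (pi * x))\<^sup>2 - 1"
  using cos_double[of "pi * x"] cos_double_cos[of "pi * x"] by (simp_all add: mult.assoc)

text \<open>At p = 0 this matrix vanishes on the degenerate eigenspace, so its expansion isolates
  the perturbation. The integrands also simplify: on the diagonal, pi^2 times the squared function
  minus the squared gradient is a single cosine of the double angle.\<close>

definition defect :: "real^4 \<Rightarrow> 5 \<Rightarrow> 5 \<Rightarrow> real" where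
  "defect p i j = pi\<^sup>2 * mass p $ i $ j - stiffness p $ i $ j"

lemma defect_eq: "defect p i j = quad_integral p (\<lambda>x. pi\<^sup>2 * (g i x * g j x) - grad (g i) x \<bullet> grad (g j) x)
    - pi\<^sup>2 * (1 / area p * quad_integral p (g i) * quad_integral p (g j))"
proof -
  have "quad_integral p (\<lambda>x. pi\<^sup>2 * (g i x * g j x) - grad (g i) x \<bullet> grad (g j) x) =
      quad_integral p (\<lambda>x. pi\<^sup>2 * (g i x * g j x)) - quad_integral p (\<lambda>x. grad (g i) x \<bullet> grad (g j) x)"
    by (rule quad_integral_diff) (intro continuous_intros continuous_g continuous_grad_g)+
  thus ?thesis unfolding defect_def mass_quad_integral stiffness_quad_integral quad_integral_cmult by (simp add: right_diff_distrib)
qed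

lemma quad_integral_uminus: "quad_integral p (\<lambda>x. - F x) = - quad_integral p F"
  using quad_integral_cmult[of p "-1" F] by simp

lemma defect_11: "defect p 1 1 = - pi\<^sup>2 * quad_integral p (\<lambda>x. cos (2 * pi * x $ 1))
    - pi\<^sup>2 * (1 / area p * (quad_integral p (\<lambda>x. sin (pi * x $ 1)))\<^sup>2)"
proof -
  have "(\<lambda>x. pi\<^sup>2 * (g 1 x * g 1 x) - grad (g 1) x \<bullet> grad (g 1) x) = (\<lambda>x. - pi\<^sup>2 * cos (2 * pi * x $ 1))"
    by (rule ext) (simp only: grad_g_cos inner_vector_2 cos_twice(1) power2_eq_square, simp add: g_sin algebra_simps)
  thus ?thesis unfolding defect_eq by (simp only: quad_integral_cmult) (simp add: g_sin quad_integral_uminus power2_eq_square)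
qed

lemma defect_22: "defect p 2 2 = - pi\<^sup>2 * quad_integral p (\<lambda>x. cos (2 * pi * x $ 2))
    - pi\<^sup>2 * (1 / area p * (quad_integral p (\<lambda>x. sin (pi * x $ 2)))\<^sup>2)"
proof -
  have "(\<lambda>x. pi\<^sup>2 * (g 2 x * g 2 x) - grad (g 2) x \<bullet> grad (g 2) x) = (\<lambda>x. - pi\<^sup>2 * cos (2 * pi * x $ 2))"
    by (rule ext) (simp only: grad_g_cos inner_vector_2 cos_twice(1) power2_eq_square, simp add: g_sin algebra_simps)
  thus ?thesis unfolding defect_eq by (simp only: quad_integral_cmult) (simp add: g_sin quad_integral_uminus power2_eq_square)
qed

lemma defect_13: "defect p 1 3 = pi\<^sup>2 * quad_integral p (\<lambda>x. cos (2 * pi * x $ 1) * sin (pi * x $ 2))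
    - pi\<^sup>2 * (1 / area p * quad_integral p (g 1) * quad_integral p (g 3))"
proof -
  have "(\<lambda>x. pi\<^sup>2 * (g 1 x * g 3 x) - grad (g 1) x \<bullet> grad (g 3) x) = (\<lambda>x. pi\<^sup>2 * (cos (2 * pi * x $ 1) * sin (pi * x $ 2)))"
    by (rule ext) (simp only: grad_g_cos inner_vector_2 cos_twice(1) power2_eq_square, simp add: g_sin algebra_simps)
  thus ?thesis unfolding defect_eq by (simp only: quad_integral_cmult)
qed

lemma defect_23: "defect p 2 3 = pi\<^sup>2 * quad_integral p (\<lambda>x. cos (2 * pi * x $ 2) * sin (pi * x $ 1))
    - pi\<^sup>2 * (1 / area p * quad_integral p (g 2) * quad_integral p (g 3))"
proof -
  have "(\<lambda>x. pi\<^sup>2 * (g 2 x * g 3 x) - grad (g 2) x \<bullet> grad (g 3) x) = (\<lambda>x. pi\<^sup>2 * (cos (2 * pi * x $ 2) * sin (pi * x $ 1)))"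
    by (rule ext) (simp only: grad_g_cos inner_vector_2 cos_twice(1) power2_eq_square, simp add: g_sin algebra_simps)
  thus ?thesis unfolding defect_eq by (simp only: quad_integral_cmult)
qed

lemma vanishing_mean_product: "vanishing 2 (\<lambda>p w. pi\<^sup>2 * (1 / area p * quad_integral p (g i) * quad_integral p (g j)))"
  by (intro vanishing_cmult vanishing_1_1 vanishing_0_mult vanishing_area(2) vanishing_quad_integral_g)

text \<open>The difference of squares factors into a second-order and a first-order term; replacing
  the reciprocal of the area by 1 costs two further orders.\<close>

lemma vanishing_mean_square:
  assumes "vanishing 2 (\<lambda>p w. h p - e * p $ i)"
  shows "vanishing 3 (\<lambda>p w. pi\<^sup>2 * (1 / area p * (h p)\<^sup>2) - pi\<^sup>2 * (e\<^sup>2 * (p $ i)\<^sup>2))"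
proof (rule vanishing_cong)
  have e: "vanishing 1 (\<lambda>p w. e * p $ i)" by (intro vanishing_cmult vanishing_nth)
  have h: "vanishing 1 (\<lambda>p w. h p)"
    by (rule vanishing_cong[OF vanishing_add[OF vanishing_2_1'[OF assms] e]]) simp
  show "vanishing 3 (\<lambda>p w. pi\<^sup>2 * (1 / area p * ((h p - e * p $ i) * (h p + e * p $ i)) + (1 / area p - 1) * ((e * p $ i) * (e * p $ i))))"
    by (intro vanishing_cmult vanishing_add[OF vanishing_0_mult[OF vanishing_area(2) vanishing_2_1[OF assms vanishing_add[OF h e]]]
      vanishing_2_1[OF vanishing_area(3) vanishing_mult_0[OF e vanishing_k_0[OF e]]]])
qed (simp only: power2_eq_square, simp add: algebra_simps)

lemma vanishing_defect_11: "vanishing 3 (\<lambda>p w. defect p 1 1 - (- pi\<^sup>2 * (p $ 1 + (p $ 1)\<^sup>2) - 16 / pi\<^sup>2 * (p $ 3)\<^sup>2))"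
proof (rule vanishing_cong)
  have "vanishing 2 (\<lambda>p w. quad_integral p (\<lambda>x. sin (pi * x $ 1)) - 4 / pi\<^sup>2 * p $ 3)"
    using quad_integral_sin_1 by simp
  note vanishing_mean_square[OF this]
  thus "vanishing 3 (\<lambda>p w. - pi\<^sup>2 * (quad_integral p (\<lambda>x. cos (2 * pi * x $ 1)) - (p $ 1 + (p $ 1)\<^sup>2))
     - (pi\<^sup>2 * (1 / area p * (quad_integral p (\<lambda>x. sin (pi * x $ 1)))\<^sup>2) - pi\<^sup>2 * ((4 / pi\<^sup>2)\<^sup>2 * (p $ 3)\<^sup>2)))"
    by (rule vanishing_diff[OF vanishing_cmult[OF quad_integral_cos_1]])
  have "pi\<^sup>2 * ((4 / pi\<^sup>2)\<^sup>2 * z) = 16 / pi\<^sup>2 * z" for z :: real by (simp add: power2_eq_square)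
  thus "defect p 1 1 - (- pi\<^sup>2 * (p $ 1 + (p $ 1)\<^sup>2) - 16 / pi\<^sup>2 * (p $ 3)\<^sup>2) =
    - pi\<^sup>2 * (quad_integral p (\<lambda>x. cos (2 * pi * x $ 1)) - (p $ 1 + (p $ 1)\<^sup>2))
     - (pi\<^sup>2 * (1 / area p * (quad_integral p (\<lambda>x. sin (pi * x $ 1)))\<^sup>2) - pi\<^sup>2 * ((4 / pi\<^sup>2)\<^sup>2 * (p $ 3)\<^sup>2))" for p
    unfolding defect_11 by (simp only: right_diff_distrib)
qed

lemma vanishing_defect_22: "vanishing 3 (\<lambda>p w. defect p 2 2 - (- pi\<^sup>2 * (- (p $ 1) + (p $ 1)\<^sup>2) - 16 / pi\<^sup>2 * (p $ 2)\<^sup>2))"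
proof (rule vanishing_cong)
  have "vanishing 2 (\<lambda>p w. quad_integral p (\<lambda>x. sin (pi * x $ 2)) - - 4 / pi\<^sup>2 * p $ 2)"
    using quad_integral_sin_2 by simp
  note vanishing_mean_square[OF this]
  thus "vanishing 3 (\<lambda>p w. - pi\<^sup>2 * (quad_integral p (\<lambda>x. cos (2 * pi * x $ 2)) - (- (p $ 1) + (p $ 1)\<^sup>2))
     - (pi\<^sup>2 * (1 / area p * (quad_integral p (\<lambda>x. sin (pi * x $ 2)))\<^sup>2) - pi\<^sup>2 * ((- 4 / pi\<^sup>2)\<^sup>2 * (p $ 2)\<^sup>2)))"
    by (rule vanishing_diff[OF vanishing_cmult[OF quad_integral_cos_2]])
  have "pi\<^sup>2 * ((- 4 / pi\<^sup>2)\<^sup>2 * z) = 16 / pi\<^sup>2 * z" for z :: real by (simp add: power2_eq_square)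
  thus "defect p 2 2 - (- pi\<^sup>2 * (- (p $ 1) + (p $ 1)\<^sup>2) - 16 / pi\<^sup>2 * (p $ 2)\<^sup>2) =
    - pi\<^sup>2 * (quad_integral p (\<lambda>x. cos (2 * pi * x $ 2)) - (- (p $ 1) + (p $ 1)\<^sup>2))
     - (pi\<^sup>2 * (1 / area p * (quad_integral p (\<lambda>x. sin (pi * x $ 2)))\<^sup>2) - pi\<^sup>2 * ((- 4 / pi\<^sup>2)\<^sup>2 * (p $ 2)\<^sup>2))" for p
    unfolding defect_22 by (simp only: right_diff_distrib)
qed

lemma vanishing_defect_13: "vanishing 2 (\<lambda>p w. defect p 1 3 - 4 * p $ 2)"
proof (rule vanishing_cong[OF vanishing_diff[OF vanishing_cmult[OF quad_integral_cos_sin, of "pi\<^sup>2"] vanishing_mean_product[of 1 3]]])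
  show "defect p 1 3 - 4 * p $ 2 = pi\<^sup>2 * (quad_integral p (\<lambda>x. cos (2 * pi * x $ 1) * sin (pi * x $ 2)) - 4 * p $ 2 / pi\<^sup>2)
      - pi\<^sup>2 * (1 / area p * quad_integral p (g 1) * quad_integral p (g 3))" for p
    unfolding defect_13 right_diff_distrib by simp
qed

lemma vanishing_defect_23: "vanishing 2 (\<lambda>p w. defect p 2 3 - - 4 * p $ 3)"
proof (rule vanishing_cong[OF vanishing_diff[OF vanishing_cmult[OF quad_integral_sin_cos, of "pi\<^sup>2"] vanishing_mean_product[of 2 3]]])
  show "defect p 2 3 - - 4 * p $ 3 = pi\<^sup>2 * (quad_integral p (\<lambda>x. cos (2 * pi * x $ 2) * sin (pi * x $ 1)) - - 4 * p $ 3 / pi\<^sup>2)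
      - pi\<^sup>2 * (1 / area p * quad_integral p (g 2) * quad_integral p (g 3))" for p
    unfolding defect_23 right_diff_distrib by simp
qed

lemma vanishing_defect_33: "vanishing 1 (\<lambda>p w. defect p 3 3 - - pi\<^sup>2 / 4)"
proof (rule vanishing_cong[OF vanishing_diff[OF vanishing_cmult[OF vanishing_mass[of 3 3], of "pi\<^sup>2"] vanishing_stiffness[of 3 3]]])
  have "index_weight 3 = 1/4" "index_eigenvalue 3 = 2 * pi\<^sup>2"
    by (simp_all add: index_weight_def index_eigenvalue_def mode_index_def mode_weight_def mode_eigenvalue_def algebra_simps)
  thus "defect p 3 3 - - pi\<^sup>2 / 4 = pi\<^sup>2 * (mass p $ 3 $ 3 - (if (3::5) = 3 then index_weight 3 else 0))
      - (stiffness p $ 3 $ 3 - (if (3::5) = 3 then index_eigenvalue 3 * index_weight 3 else 0))" for p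
    by (simp add: defect_def algebra_simps)
qed

lemma quad_integral_cos_square:
  assumes "norm p \<le> 1/100"
  shows "quad_integral p (\<lambda>x. pi\<^sup>2 * (cos (pi * x $ i))\<^sup>2) = pi\<^sup>2 / 2 * (area p + quad_integral p (\<lambda>x. cos (2 * pi * x $ i)))"
proof -
  have "quad_integral p (\<lambda>x. pi\<^sup>2 * (cos (pi * x $ i))\<^sup>2) = quad_integral p (\<lambda>x. pi\<^sup>2 / 2 * (1 + cos (2 * pi * x $ i)))"
    by (simp only: cos_twice(2)) simp
  also have "\<dots> = pi\<^sup>2 / 2 * (quad_integral p (\<lambda>x. 1) + quad_integral p (\<lambda>x. cos (2 * pi * x $ i)))"
    unfolding quad_integral_cmult by (subst quad_integral_add) (auto intro!: continuous_intros)
  finally show ?thesis unfolding quad_integral_1[OF assms] .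
qed

lemma stiffness_diagonal:
  assumes "norm p \<le> 1/100"
  shows "stiffness p $ 1 $ 1 = pi\<^sup>2 / 2 * (area p + quad_integral p (\<lambda>x. cos (2 * pi * x $ 1)))"
    and "stiffness p $ 2 $ 2 = pi\<^sup>2 / 2 * (area p + quad_integral p (\<lambda>x. cos (2 * pi * x $ 2)))"
  unfolding quad_integral_cos_square[OF assms, symmetric] stiffness_quad_integral grad_g_cos inner_vector_2
  by (simp_all add: power2_eq_square mult_ac)

text \<open>\<open>g 1\<close> and \<open>g 2\<close> depend on different coordinates, so their
  gradients are orthogonal at every point, for every \<open>p\<close>.\<close>

lemma stiffness_12: "stiffness p $ 1 $ 2 = 0"
proof -
  have "stiffness p $ 1 $ 2 = quad_integral p (\<lambda>x. 0 * 1)"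
    unfolding stiffness_quad_integral grad_g_cos inner_vector_2 by simp
  also have "\<dots> = 0" by (simp only: quad_integral_cmult)
  finally show ?thesis .
qed

lemma vanishing_stiffness_11: "vanishing 2 (\<lambda>p w. stiffness p $ 1 $ 1 - (pi\<^sup>2 / 2 + pi\<^sup>2 / 2 * p $ 1))"
proof (rule vanishing_cong[OF vanishing_cmult[OF vanishing_add[OF vanishing_area(1) vanishing_add[OF vanishing_3_2[OF quad_integral_cos_1] vanishing_1_1[OF vanishing_nth[of 1] vanishing_nth[of 1]]]], of "pi\<^sup>2 / 2"]])
  fix p :: "real^4" assume "norm p \<le> 1/100"
  note e = stiffness_diagonal(1)[OF this]
  have "l / 2 * (A + q) - (l / 2 + l / 2 * a) = l / 2 * (A - 1 + (q - (a + a\<^sup>2) + a * a))" for l A q a :: real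
    by (simp add: field_simps power2_eq_square)
  thus "stiffness p $ 1 $ 1 - (pi\<^sup>2 / 2 + pi\<^sup>2 / 2 * p $ 1) =
    pi\<^sup>2 / 2 * (area p - 1 + (quad_integral p (\<lambda>x. cos (2 * pi * x $ 1)) - (p $ 1 + (p $ 1)\<^sup>2) + p $ 1 * p $ 1))"
    unfolding e .
qed

lemma vanishing_stiffness_22: "vanishing 2 (\<lambda>p w. stiffness p $ 2 $ 2 - (pi\<^sup>2 / 2 - pi\<^sup>2 / 2 * p $ 1))"
proof (rule vanishing_cong[OF vanishing_cmult[OF vanishing_add[OF vanishing_area(1) vanishing_add[OF vanishing_3_2[OF quad_integral_cos_2] vanishing_1_1[OF vanishing_nth[of 1] vanishing_nth[of 1]]]], of "pi\<^sup>2 / 2"]])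
  fix p :: "real^4" assume "norm p \<le> 1/100"
  note e = stiffness_diagonal(2)[OF this]
  have "l / 2 * (A + q) - (l / 2 - l / 2 * a) = l / 2 * (A - 1 + (q - (- a + a\<^sup>2) + a * a))" for l A q a :: real
    by (simp add: field_simps power2_eq_square)
  thus "stiffness p $ 2 $ 2 - (pi\<^sup>2 / 2 - pi\<^sup>2 / 2 * p $ 1) =
    pi\<^sup>2 / 2 * (area p - 1 + (quad_integral p (\<lambda>x. cos (2 * pi * x $ 2)) - (- (p $ 1) + (p $ 1)\<^sup>2) + p $ 1 * p $ 1))"
    unfolding e .
qed


text \<open>The coefficients maximise the second-order terms of \<open>n1\<close> and \<open>n2\<close> below, which are quadratic in them.\<close>

definition trial_coeff1 :: "real^4 \<Rightarrow> real" where "trial_coeff1 p = 16 / pi\<^sup>2 * p $ 2"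
definition trial_coeff2 :: "real^4 \<Rightarrow> real" where "trial_coeff2 p = - 16 / pi\<^sup>2 * p $ 3"

lemma vanishing_trial_coeff: "vanishing 1 (\<lambda>p w. trial_coeff1 p)" "vanishing 1 (\<lambda>p w. trial_coeff2 p)"
  unfolding trial_coeff1_def trial_coeff2_def by (intro vanishing_cmult vanishing_nth)+

section \<open>The trial space and its matrix entries\<close>

definition trial1 :: "real^4 \<Rightarrow> real^5" where "trial1 p = axis 1 1 + trial_coeff1 p *\<^sub>R axis 3 1"
definition trial2 :: "real^4 \<Rightarrow> real^5" where "trial2 p = axis 2 1 + trial_coeff2 p *\<^sub>R axis 3 1"

lemma axis_bilinear: "(axis i 1 + s *\<^sub>R axis k 1) \<bullet> (A *v (axis j 1 + t *\<^sub>R axis l 1)) =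
    A $ i $ j + t * A $ i $ l + s * A $ k $ j + s * t * A $ k $ l" for A :: "real^'n^'n"
proof -
  have "axis i 1 \<bullet> (A *v axis j 1) = A $ i $ j" for i j
    by (simp add: matrix_vector_mult_basis inner_axis_axis inner_axis' column_def)
  thus ?thesis
    by (simp add: matrix_vector_right_distrib matrix_vector_mult_scaleR inner_add_left inner_add_right algebra_simps)
qed

lemma stiffness_symmetric: "stiffness p $ i $ j = stiffness p $ j $ i" and mass_symmetric: "mass p $ i $ j = mass p $ j $ i"
  using transpose_stiffness[of p] transpose_mass[of p] by (simp_all add: transpose_def vec_eq_iff)

definition k1 :: "real^4 \<Rightarrow> real" where "k1 p = trial1 p \<bullet> (stiffness p *v trial1 p)"
definition k2 :: "real^4 \<Rightarrow> real" where "k2 p = trial2 p \<bullet> (stiffness p *v trial2 p)"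
definition k12 :: "real^4 \<Rightarrow> real" where "k12 p = trial1 p \<bullet> (stiffness p *v trial2 p)"
definition m12 :: "real^4 \<Rightarrow> real" where "m12 p = trial1 p \<bullet> (mass p *v trial2 p)"
definition n1 :: "real^4 \<Rightarrow> real" where "n1 p = pi\<^sup>2 * (trial1 p \<bullet> (mass p *v trial1 p)) - k1 p"
definition n2 :: "real^4 \<Rightarrow> real" where "n2 p = pi\<^sup>2 * (trial2 p \<bullet> (mass p *v trial2 p)) - k2 p"

text \<open>The second-order part of \<open>n1\<close>. In its last term, 64/pi^2 is the maximum of
  8 t - pi^2 t^2 / 4, attained at t = 16/pi^2: twice the coupling \<open>defect p 1 3\<close> plus
  the quadratic term from \<open>defect p 3 3\<close>, with the second parameter scaled out.\<close>

definition q1 :: "real^4 \<Rightarrow> real" where "q1 p = - pi\<^sup>2 * (p $ 1 * p $ 1) - 16 / pi\<^sup>2 * (p $ 3 * p $ 3) + 64 / pi\<^sup>2 * (p $ 2 * p $ 2)"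
definition q2 :: "real^4 \<Rightarrow> real" where "q2 p = - pi\<^sup>2 * (p $ 1 * p $ 1) - 16 / pi\<^sup>2 * (p $ 2 * p $ 2) + 64 / pi\<^sup>2 * (p $ 3 * p $ 3)"

lemma vanishing_q: "vanishing 2 (\<lambda>p w. q1 p)" "vanishing 2 (\<lambda>p w. q2 p)"
  unfolding q1_def q2_def by (intro vanishing_add vanishing_diff vanishing_cmult vanishing_1_1 vanishing_nth)+

lemma k1_eq: "k1 p = stiffness p $ 1 $ 1 + 2 * (trial_coeff1 p * stiffness p $ 1 $ 3) + trial_coeff1 p * trial_coeff1 p * stiffness p $ 3 $ 3"
  and k2_eq: "k2 p = stiffness p $ 2 $ 2 + 2 * (trial_coeff2 p * stiffness p $ 2 $ 3) + trial_coeff2 p * trial_coeff2 p * stiffness p $ 3 $ 3"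
  and k12_eq: "k12 p = trial_coeff2 p * stiffness p $ 1 $ 3 + trial_coeff1 p * stiffness p $ 2 $ 3 + trial_coeff1 p * trial_coeff2 p * stiffness p $ 3 $ 3"
  and m12_eq: "m12 p = mass p $ 1 $ 2 + trial_coeff2 p * mass p $ 1 $ 3 + trial_coeff1 p * mass p $ 2 $ 3 + trial_coeff1 p * trial_coeff2 p * mass p $ 3 $ 3"
  by (simp_all add: k1_def k2_def k12_def m12_def trial1_def trial2_def axis_bilinear stiffness_12
      stiffness_symmetric[of p 3 1] stiffness_symmetric[of p 3 2] mass_symmetric[of p 3 1] mass_symmetric[of p 3 2])

lemma n1_eq: "n1 p = defect p 1 1 + 2 * (trial_coeff1 p * defect p 1 3) + trial_coeff1 p * trial_coeff1 p * defect p 3 3"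
  and n2_eq: "n2 p = defect p 2 2 + 2 * (trial_coeff2 p * defect p 2 3) + trial_coeff2 p * trial_coeff2 p * defect p 3 3"
  unfolding n1_def n2_def k1_eq k2_eq defect_def trial1_def trial2_def axis_bilinear
    mass_symmetric[of p 3 1] mass_symmetric[of p 3 2] by (simp_all add: algebra_simps)

lemma vanishing_stiffness_13: "vanishing 1 (\<lambda>p w. stiffness p $ 1 $ 3)" "vanishing 1 (\<lambda>p w. stiffness p $ 2 $ 3)"
  and vanishing_mass_12: "vanishing 1 (\<lambda>p w. mass p $ 1 $ 2)" "vanishing 1 (\<lambda>p w. mass p $ 1 $ 3)" "vanishing 1 (\<lambda>p w. mass p $ 2 $ 3)"
  using vanishing_stiffness[of 1 3] vanishing_stiffness[of 2 3] vanishing_mass[of 1 2] vanishing_mass[of 1 3] vanishing_mass[of 2 3] by simp_all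

lemma vanishing_entry: assumes "vanishing 1 (\<lambda>p w. f p - c)" shows "vanishing 0 (\<lambda>p w. f p)"
  by (rule vanishing_cong[OF vanishing_add[OF vanishing_k_0[OF assms] vanishing_const[of c]]]) simp

lemma vanishing_k1: "vanishing 2 (\<lambda>p w. k1 p - (pi\<^sup>2 / 2 + pi\<^sup>2 / 2 * p $ 1))"
proof (rule vanishing_cong)
  show "vanishing 2 (\<lambda>p w. (stiffness p $ 1 $ 1 - (pi\<^sup>2 / 2 + pi\<^sup>2 / 2 * p $ 1)) + 2 * (trial_coeff1 p * stiffness p $ 1 $ 3)
      + trial_coeff1 p * trial_coeff1 p * stiffness p $ 3 $ 3)"
    by (rule vanishing_add[OF vanishing_add[OF vanishing_stiffness_11 vanishing_cmult[OF vanishing_1_1[OF vanishing_trial_coeff(1) vanishing_stiffness_13(1)]]]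
      vanishing_mult_0[OF vanishing_1_1[OF vanishing_trial_coeff(1) vanishing_trial_coeff(1)] vanishing_entry[OF vanishing_stiffness]]])
qed (simp add: k1_eq)

lemma vanishing_k2: "vanishing 2 (\<lambda>p w. k2 p - (pi\<^sup>2 / 2 - pi\<^sup>2 / 2 * p $ 1))"
proof (rule vanishing_cong)
  show "vanishing 2 (\<lambda>p w. (stiffness p $ 2 $ 2 - (pi\<^sup>2 / 2 - pi\<^sup>2 / 2 * p $ 1)) + 2 * (trial_coeff2 p * stiffness p $ 2 $ 3)
      + trial_coeff2 p * trial_coeff2 p * stiffness p $ 3 $ 3)"
    by (rule vanishing_add[OF vanishing_add[OF vanishing_stiffness_22 vanishing_cmult[OF vanishing_1_1[OF vanishing_trial_coeff(2) vanishing_stiffness_13(2)]]]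
      vanishing_mult_0[OF vanishing_1_1[OF vanishing_trial_coeff(2) vanishing_trial_coeff(2)] vanishing_entry[OF vanishing_stiffness]]])
qed (simp add: k2_eq)

text \<open>There is no first-order part because \<open>stiffness_12\<close> vanishes. Hence a
  first-order bound on \<open>m12\<close> makes their product in \<open>excess\<close>
  cubic.\<close>

lemma vanishing_k12: "vanishing 2 (\<lambda>p w. k12 p)"
  unfolding k12_eq
  by (rule vanishing_add[OF vanishing_add[OF vanishing_1_1[OF vanishing_trial_coeff(2) vanishing_stiffness_13(1)] vanishing_1_1[OF vanishing_trial_coeff(1) vanishing_stiffness_13(2)]]
      vanishing_mult_0[OF vanishing_1_1[OF vanishing_trial_coeff(1) vanishing_trial_coeff(2)] vanishing_entry[OF vanishing_stiffness]]])

lemma vanishing_m12: "vanishing 1 (\<lambda>p w. m12 p)"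
  unfolding m12_eq
  by (rule vanishing_add[OF vanishing_add[OF vanishing_add[OF vanishing_mass_12(1) vanishing_2_1'[OF vanishing_1_1[OF vanishing_trial_coeff(2) vanishing_mass_12(2)]]]
       vanishing_2_1'[OF vanishing_1_1[OF vanishing_trial_coeff(1) vanishing_mass_12(3)]]]
      vanishing_2_1'[OF vanishing_mult_0[OF vanishing_1_1[OF vanishing_trial_coeff(1) vanishing_trial_coeff(2)] vanishing_entry[OF vanishing_mass]]]])

lemma vanishing_n1: "vanishing 3 (\<lambda>p w. n1 p + pi\<^sup>2 * p $ 1 - q1 p)"
proof (rule vanishing_cong)
  show "vanishing 3 (\<lambda>p w. (defect p 1 1 - (- pi\<^sup>2 * (p $ 1 + (p $ 1)\<^sup>2) - 16 / pi\<^sup>2 * (p $ 3)\<^sup>2))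
      + 2 * (trial_coeff1 p * (defect p 1 3 - 4 * p $ 2)) + trial_coeff1 p * trial_coeff1 p * (defect p 3 3 - - pi\<^sup>2 / 4))"
    by (rule vanishing_add[OF vanishing_add[OF vanishing_defect_11 vanishing_cmult[OF vanishing_1_2[OF vanishing_trial_coeff(1) vanishing_defect_13]]]
      vanishing_2_1[OF vanishing_1_1[OF vanishing_trial_coeff(1) vanishing_trial_coeff(1)] vanishing_defect_33]])
  have identity: "d1 + 2 * (16 / L * b * d3) + (16 / L * b) * (16 / L * b) * d33 + L * a - (- L * (a * a) - 16 / L * (c * c) + 64 / L * (b * b)) =
      (d1 - (- L * (a + a\<^sup>2) - 16 / L * c\<^sup>2)) + 2 * (16 / L * b * (d3 - 4 * b)) + (16 / L * b) * (16 / L * b) * (d33 - - L / 4)"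
    if "L \<noteq> 0" for L a b c d1 d3 d33 :: real using that by (simp add: field_simps power2_eq_square)
  show "n1 p + pi\<^sup>2 * p $ 1 - q1 p = (defect p 1 1 - (- pi\<^sup>2 * (p $ 1 + (p $ 1)\<^sup>2) - 16 / pi\<^sup>2 * (p $ 3)\<^sup>2))
      + 2 * (trial_coeff1 p * (defect p 1 3 - 4 * p $ 2)) + trial_coeff1 p * trial_coeff1 p * (defect p 3 3 - - pi\<^sup>2 / 4)" for p
    unfolding n1_eq q1_def trial_coeff1_def by (rule identity) simp
qed

lemma vanishing_n2: "vanishing 3 (\<lambda>p w. n2 p - pi\<^sup>2 * p $ 1 - q2 p)"
proof (rule vanishing_cong)
  show "vanishing 3 (\<lambda>p w. (defect p 2 2 - (- pi\<^sup>2 * (- (p $ 1) + (p $ 1)\<^sup>2) - 16 / pi\<^sup>2 * (p $ 2)\<^sup>2))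
      + 2 * (trial_coeff2 p * (defect p 2 3 - - 4 * p $ 3)) + trial_coeff2 p * trial_coeff2 p * (defect p 3 3 - - pi\<^sup>2 / 4))"
    by (rule vanishing_add[OF vanishing_add[OF vanishing_defect_22 vanishing_cmult[OF vanishing_1_2[OF vanishing_trial_coeff(2) vanishing_defect_23]]]
      vanishing_2_1[OF vanishing_1_1[OF vanishing_trial_coeff(2) vanishing_trial_coeff(2)] vanishing_defect_33]])
  have identity: "d1 + 2 * (- 16 / L * b * d3) + (- 16 / L * b) * (- 16 / L * b) * d33 - L * a - (- L * (a * a) - 16 / L * (c * c) + 64 / L * (b * b)) =
      (d1 - (- L * (- a + a\<^sup>2) - 16 / L * c\<^sup>2)) + 2 * (- 16 / L * b * (d3 - - 4 * b)) + (- 16 / L * b) * (- 16 / L * b) * (d33 - - L / 4)"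
    if "L \<noteq> 0" for L a b c d1 d3 d33 :: real using that by (simp add: field_simps power2_eq_square)
  show "n2 p - pi\<^sup>2 * p $ 1 - q2 p = (defect p 2 2 - (- pi\<^sup>2 * (- (p $ 1) + (p $ 1)\<^sup>2) - 16 / pi\<^sup>2 * (p $ 2)\<^sup>2))
      + 2 * (trial_coeff2 p * (defect p 2 3 - - 4 * p $ 3)) + trial_coeff2 p * trial_coeff2 p * (defect p 3 3 - - pi\<^sup>2 / 4)" for p
    unfolding n2_eq q2_def trial_coeff2_def by (rule identity) simp
qed

text \<open>Ky Fan's principle makes \<open>\<pi>\<^sup>2 (1/\<lambda>\<^sub>1 + 1/\<lambda>\<^sub>2) - 2 |Q\<^sub>p|\<close> at least \<open>excess p\<close> divided by \<open>k1 k2 - k12\<^sup>2\<close>;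
  the contributions \<open>\<minusplus> \<pi>\<^sup>2 a\<close> of first order to \<open>n1\<close> and \<open>n2\<close> cancel up to second order.\<close>

definition excess :: "real^4 \<Rightarrow> real" where
  "excess p = k2 p * n1 p + k1 p * n2 p + 2 * (k1 p * k2 p * (p $ 1 * p $ 1 + p $ 4 * p $ 4)) - 2 * (pi\<^sup>2 * (k12 p * m12 p))"

definition excess_leading :: "real^4 \<Rightarrow> real" where
  "excess_leading p = (pi\<^sup>2)\<^sup>2 / 2 * (p $ 1 * p $ 1 + p $ 4 * p $ 4) + 24 * (p $ 2 * p $ 2 + p $ 3 * p $ 3)"

lemma vanishing_k1k2: "vanishing 1 (\<lambda>p w. k1 p * k2 p - (pi\<^sup>2)\<^sup>2 / 4)"
proof (rule vanishing_cong)
  let ?l = "pi\<^sup>2 / 2"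
  have k: "vanishing 1 (\<lambda>p w. k1 p - ?l)" "vanishing 1 (\<lambda>p w. k2 p - ?l)"
    by (rule vanishing_cong[OF vanishing_add[OF vanishing_2_1'[OF vanishing_k1] vanishing_cmult[OF vanishing_nth[of 1], of ?l]]], simp)
       (rule vanishing_cong[OF vanishing_diff[OF vanishing_2_1'[OF vanishing_k2] vanishing_cmult[OF vanishing_nth[of 1], of ?l]]], simp)
  show "vanishing 1 (\<lambda>p w. (k1 p - ?l) * k2 p + ?l * (k2 p - ?l))"
    by (rule vanishing_add[OF vanishing_mult_0[OF k(1) vanishing_entry[OF k(2)]] vanishing_cmult[OF k(2)]])
qed (simp add: power2_eq_square algebra_simps)

text \<open>To first order \<open>n1\<close> and \<open>n2\<close> are -pi^2 a and pi^2 a, and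
  \<open>k1\<close> and \<open>k2\<close> are pi^2/2 times 1 + a and 1 - a. The cross terms add pi^4
  a^2, which exactly offsets the -pi^4 a^2 coming from \<open>q1\<close> and \<open>q2\<close>; the
  a^2 and d^2 that remain come from the area.\<close>

lemma vanishing_excess: "vanishing 3 (\<lambda>p w. excess p - excess_leading p)"
proof (rule vanishing_cong)
  let ?l = "pi\<^sup>2 / 2"
  have a: "vanishing 1 (\<lambda>p w. p $ 1)" and la: "vanishing 1 (\<lambda>p w. ?l * p $ 1)" and La: "vanishing 1 (\<lambda>p w. pi\<^sup>2 * p $ 1)"
    by (intro vanishing_cmult vanishing_nth)+
  have N: "vanishing 1 (\<lambda>p w. n1 p)" "vanishing 1 (\<lambda>p w. n2 p)"
    by (rule vanishing_cong[OF vanishing_add[OF vanishing_diff[OF vanishing_3_1[OF vanishing_n1] La] vanishing_2_1'[OF vanishing_q(1)]]], simp)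
       (rule vanishing_cong[OF vanishing_add[OF vanishing_add[OF vanishing_3_1[OF vanishing_n2] La] vanishing_2_1'[OF vanishing_q(2)]]], simp)
  have l: "vanishing 0 (\<lambda>p w. ?l - ?l * p $ 1)" "vanishing 0 (\<lambda>p w. ?l + ?l * p $ 1)"
    by (intro vanishing_add vanishing_diff vanishing_const vanishing_k_0[OF la])+
  have ad: "vanishing 2 (\<lambda>p w. p $ 1 * p $ 1 + p $ 4 * p $ 4)" by (intro vanishing_add vanishing_1_1 vanishing_nth)
  have A: "vanishing 3 (\<lambda>p w. ((k2 p - (?l - ?l * p $ 1)) * n1 p + (?l - ?l * p $ 1) * (n1 p + pi\<^sup>2 * p $ 1 - q1 p)) - (?l * p $ 1) * q1 p)"
    by (rule vanishing_diff[OF vanishing_add[OF vanishing_2_1[OF vanishing_k2 N(1)] vanishing_0_mult[OF l(1) vanishing_n1]] vanishing_1_2[OF la vanishing_q(1)]])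
  have B: "vanishing 3 (\<lambda>p w. ((k1 p - (?l + ?l * p $ 1)) * n2 p + (?l + ?l * p $ 1) * (n2 p - pi\<^sup>2 * p $ 1 - q2 p)) + (?l * p $ 1) * q2 p)"
    by (rule vanishing_add[OF vanishing_add[OF vanishing_2_1[OF vanishing_k1 N(2)] vanishing_0_mult[OF l(2) vanishing_n2]] vanishing_1_2[OF la vanishing_q(2)]])
  have C: "vanishing 3 (\<lambda>p w. 2 * ((k1 p * k2 p - (pi\<^sup>2)\<^sup>2 / 4) * (p $ 1 * p $ 1 + p $ 4 * p $ 4)) - 2 * (pi\<^sup>2 * (k12 p * m12 p)))"
    by (rule vanishing_diff[OF vanishing_cmult[OF vanishing_1_2[OF vanishing_k1k2 ad]] vanishing_cmult[OF vanishing_cmult[OF vanishing_2_1[OF vanishing_k12 vanishing_m12]]]])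
  show "vanishing 3 (\<lambda>p w. ((k2 p - (?l - ?l * p $ 1)) * n1 p + (?l - ?l * p $ 1) * (n1 p + pi\<^sup>2 * p $ 1 - q1 p) - (?l * p $ 1) * q1 p)
    + ((k1 p - (?l + ?l * p $ 1)) * n2 p + (?l + ?l * p $ 1) * (n2 p - pi\<^sup>2 * p $ 1 - q2 p) + (?l * p $ 1) * q2 p)
    + (2 * ((k1 p * k2 p - (pi\<^sup>2)\<^sup>2 / 4) * (p $ 1 * p $ 1 + p $ 4 * p $ 4)) - 2 * (pi\<^sup>2 * (k12 p * m12 p))))"
    by (rule vanishing_add[OF vanishing_add[OF A B] C])
  have q: "?l * (q1 p + q2 p) = - (pi\<^sup>2)\<^sup>2 * (p $ 1 * p $ 1) + 24 * (p $ 2 * p $ 2 + p $ 3 * p $ 3)" for p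
    unfolding q1_def q2_def by (simp add: algebra_simps power2_eq_square)
  have lead: "excess_leading p = (pi\<^sup>2)\<^sup>2 * (p $ 1 * p $ 1) + ?l * (q1 p + q2 p) + (pi\<^sup>2)\<^sup>2 / 2 * (p $ 1 * p $ 1 + p $ 4 * p $ 4)" for p
    unfolding excess_leading_def q by simp
  have identity: "K2 * N1 + K1 * N2 + 2 * (K1 * K2 * s) - 2 * (L * (K12 * M12)) - (L\<^sup>2 * (a * a) + L / 2 * (Q1 + Q2) + L\<^sup>2 / 2 * s) =
    ((K2 - (L / 2 - L / 2 * a)) * N1 + (L / 2 - L / 2 * a) * (N1 + L * a - Q1) - (L / 2 * a) * Q1)
    + ((K1 - (L / 2 + L / 2 * a)) * N2 + (L / 2 + L / 2 * a) * (N2 - L * a - Q2) + (L / 2 * a) * Q2)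
    + (2 * ((K1 * K2 - L\<^sup>2 / 4) * s) - 2 * (L * (K12 * M12)))" for K1 K2 N1 N2 s L K12 M12 a Q1 Q2 :: real
    by (simp add: field_simps power2_eq_square)
  show "excess p - excess_leading p = ((k2 p - (?l - ?l * p $ 1)) * n1 p + (?l - ?l * p $ 1) * (n1 p + pi\<^sup>2 * p $ 1 - q1 p) - (?l * p $ 1) * q1 p)
    + ((k1 p - (?l + ?l * p $ 1)) * n2 p + (?l + ?l * p $ 1) * (n2 p - pi\<^sup>2 * p $ 1 - q2 p) + (?l * p $ 1) * q2 p)
    + (2 * ((k1 p * k2 p - (pi\<^sup>2)\<^sup>2 / 4) * (p $ 1 * p $ 1 + p $ 4 * p $ 4)) - 2 * (pi\<^sup>2 * (k12 p * m12 p)))" for p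
    unfolding lead excess_def by (rule identity)
qed

lemma excess_leading_ge: "24 * (norm p)\<^sup>2 \<le> excess_leading p"
proof -
  have "9\<^sup>2 \<le> (pi\<^sup>2)\<^sup>2" using pi_square_gt_9 by (intro power_mono) auto
  hence "24 \<le> (pi\<^sup>2)\<^sup>2 / 2" by simp
  hence "24 * (p $ 1 * p $ 1 + p $ 4 * p $ 4) \<le> (pi\<^sup>2)\<^sup>2 / 2 * (p $ 1 * p $ 1 + p $ 4 * p $ 4)"
    by (intro mult_right_mono) auto
  thus ?thesis unfolding excess_leading_def norm_square_eq_sum sum_4 power2_eq_square[of "p $ _"] by (simp only: distrib_left)
qed


section \<open>Ky Fan's bound on the trial space and the conclusion\<close>

lemma trial_independent:
  assumes "c1 *\<^sub>R trial1 p + c2 *\<^sub>R trial2 p = 0"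
  shows "c1 = 0 \<and> c2 = 0"
proof -
  have "(c1 *\<^sub>R trial1 p + c2 *\<^sub>R trial2 p) $ 1 = 0" "(c1 *\<^sub>R trial1 p + c2 *\<^sub>R trial2 p) $ 2 = 0"
    unfolding assms by simp_all
  thus ?thesis by (simp add: trial1_def trial2_def axis_def)
qed

lemma ky_fan_trial:
  assumes Mpos: "\<And>x. x \<noteq> 0 \<Longrightarrow> x \<bullet> (mass p *v x) > 0" and Kpos: "\<And>x. x \<noteq> 0 \<Longrightarrow> x \<bullet> (stiffness p *v x) > 0"
  shows "k2 p * (trial1 p \<bullet> (mass p *v trial1 p)) + k1 p * (trial2 p \<bullet> (mass p *v trial2 p)) - 2 * k12 p * m12 p
      \<le> (1 / lam 1 p + 1 / lam 2 p) * (k1 p * k2 p - (k12 p)\<^sup>2)"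
    and "0 < lam 1 p"
  unfolding k1_def k2_def k12_def m12_def lam_def
  by (rule ky_fan_two[where K="stiffness p" and M="mass p" and ?y1.0="trial1 p" and ?y2.0="trial2 p", OF transpose_stiffness transpose_mass];
      (erule Mpos Kpos trial_independent | simp))+

text \<open>Here \<open>L\<close> is pi^2, \<open>S\<close> the sum of the reciprocal eigenvalues,
  \<open>N\<close> and \<open>D\<close> the numerator and determinant in Ky Fan's bound,
  \<open>A\<close> the area and \<open>W\<close> the excess. The point is the identity L N - 2 A D =
  W + 2 A k12^2.\<close>

lemma f2_gt_aux:
  fixes L S N D k1 k2 k12 m1 m2 m12 A W s :: real
  assumes "N = k2 * m1 + k1 * m2 - 2 * k12 * m12" "N \<le> S * D" "D = k1 * k2 - k12\<^sup>2" "A = 1 - s"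
    and "W = k2 * (L * m1 - k1) + k1 * (L * m2 - k2) + 2 * (k1 * k2 * s) - 2 * (L * (k12 * m12))"
    and "W > 0" "D > 0" "A > 0" "L > 0"
  shows "1 / L < 1 / (2 * A) * S"
proof -
  have "L * N - 2 * A * D = W + 2 * A * k12\<^sup>2" unfolding assms(1,3,4,5) by (simp add: algebra_simps power2_eq_square)
  moreover have "0 \<le> 2 * A * k12\<^sup>2" using \<open>A > 0\<close> by simp
  ultimately have "2 * A * D < L * N" using \<open>W > 0\<close> by linarith
  also have "L * N \<le> L * (S * D)" using assms(2) \<open>L > 0\<close> by simp
  finally have "(2 * A) * D < (L * S) * D" by (simp add: mult_ac)
  hence "2 * A < L * S" using \<open>D > 0\<close> by simp
  thus ?thesis using \<open>A > 0\<close> \<open>L > 0\<close> by (simp add: field_simps)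
qed

lemma f2_gt: "\<exists>\<epsilon>>0. \<epsilon> \<le> 1/100 \<and> (\<forall>p. norm p < \<epsilon> \<longrightarrow> p \<noteq> 0 \<longrightarrow> 1 / pi\<^sup>2 < f2 p)"
proof -
  obtain e1 where e1: "e1 > 0" "e1 \<le> 1/100" "\<forall>p x. norm p < e1 \<longrightarrow> x \<noteq> 0 \<longrightarrow> x \<bullet> (mass p *v x) > 0"
    using mass_positive_definite by (elim exE conjE)
  obtain e2 where e2: "e2 > 0" "e2 \<le> 1/100" "\<forall>p x. norm p < e2 \<longrightarrow> x \<noteq> 0 \<longrightarrow> x \<bullet> (stiffness p *v x) > 0"
    using stiffness_positive_definite by (elim exE conjE)
  have "vanishing (Suc 2) (\<lambda>p w. excess p - excess_leading p)" using vanishing_excess by (simp add: numeral_2_eq_2 numeral_3_eq_3)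
  from vanishing_scalar_small[OF this zero_less_one] obtain e3 where e3: "e3 > 0" "e3 \<le> 1/100"
    "\<forall>p. norm p < e3 \<longrightarrow> \<bar>excess p - excess_leading p\<bar> \<le> 1 * (norm p)\<^sup>2"
    by (elim exE conjE)
  have "vanishing (Suc 0) (\<lambda>p w. (k1 p * k2 p - (pi\<^sup>2)\<^sup>2 / 4) - k12 p * k12 p)"
    using vanishing_diff[OF vanishing_k1k2 vanishing_mult_0[OF vanishing_2_1'[OF vanishing_k12] vanishing_k_0[OF vanishing_k12]]]
    unfolding One_nat_def .
  from vanishing_scalar_small[OF this zero_less_one] obtain e4 where e4: "e4 > 0" "e4 \<le> 1/100"
    "\<forall>p. norm p < e4 \<longrightarrow> \<bar>(k1 p * k2 p - (pi\<^sup>2)\<^sup>2 / 4) - k12 p * k12 p\<bar> \<le> 1 * norm p ^ 0"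
    by (elim exE conjE)
  show ?thesis
  proof (intro exI[of _ "min (min e1 e2) (min e3 e4)"] conjI allI impI)
    show "min (min e1 e2) (min e3 e4) > 0" using e1(1) e2(1) e3(1) e4(1) by simp
    show "min (min e1 e2) (min e3 e4) \<le> 1/100" using e1(2) by linarith
    fix p :: "real^4" assume p: "norm p < min (min e1 e2) (min e3 e4)" and "p \<noteq> 0"
    have p1: "norm p < e1" and p2: "norm p < e2" and p3: "norm p < e3" and p4: "norm p < e4" using p by simp_all
    have p0: "norm p \<le> 1/100" using p1 e1(2) by simp
    have Mpos: "x \<bullet> (mass p *v x) > 0" if "x \<noteq> 0" for x using e1(3) p1 that by simp
    have Kpos: "x \<bullet> (stiffness p *v x) > 0" if "x \<noteq> 0" for x using e2(3) p2 that by simp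
    have W: "excess p > 0"
    proof -
      have "\<bar>excess p - excess_leading p\<bar> \<le> (norm p)\<^sup>2" using e3(3)[rule_format, OF p3] by simp
      moreover have "(norm p)\<^sup>2 > 0" using \<open>p \<noteq> 0\<close> by simp
      ultimately show ?thesis using excess_leading_ge[of p] by linarith
    qed
    have D: "k1 p * k2 p - (k12 p)\<^sup>2 > 0"
    proof -
      have "9\<^sup>2 \<le> (pi\<^sup>2)\<^sup>2" using pi_square_gt_9 by (intro power_mono) auto
      hence "81 / 4 \<le> (pi\<^sup>2)\<^sup>2 / 4" by simp
      moreover have "\<bar>(k1 p * k2 p - (pi\<^sup>2)\<^sup>2 / 4) - k12 p * k12 p\<bar> \<le> 1" using e4(3)[rule_format, OF p4] by simp
      ultimately show ?thesis unfolding power2_eq_square[of "k12 p"] by linarith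
    qed
    have A: "area p = 1 - (p $ 1 * p $ 1 + p $ 4 * p $ 4)"
      unfolding area_eq(1)[OF p0] power2_eq_square by (rule diff_diff_eq)
    show "1 / pi\<^sup>2 < f2 p"
      unfolding f2_def
      by (rule f2_gt_aux[OF refl ky_fan_trial(1)[OF Mpos Kpos] refl A excess_def[of p, unfolded n1_def n2_def] W D area_eq(2)[OF p0]]) (use pi_square_gt_9 in simp_all)
  qed
qed

lemma lam_minimal:
  assumes Mpos: "\<And>x. x \<noteq> 0 \<Longrightarrow> x \<bullet> (mass p *v x) > 0"
  shows "lam 1 p * (y \<bullet> (mass p *v y)) \<le> y \<bullet> (stiffness p *v y)" and "lam 1 p \<le> lam 2 p"
proof -
  have card: "2 \<le> CARD(5)" by simp
  note smallest = two_smallest_gen_eigenvalues[OF transpose_stiffness[of p] transpose_mass[of p] Mpos card, folded lam_def]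
  show "lam 1 p * (y \<bullet> (mass p *v y)) \<le> y \<bullet> (stiffness p *v y)" by (rule smallest) iprover+
  show "lam 1 p \<le> lam 2 p" by (rule smallest) iprover+
qed

lemma lam_1_0_le: "lam 1 0 \<le> pi\<^sup>2"
proof -
  have Mpos: "x \<bullet> (mass 0 *v x) > 0" if "x \<noteq> 0" for x using mass_positive_definite that by force
  have e: "axis 1 1 \<bullet> (A *v axis 1 1) = A $ 1 $ 1" for A :: "real^5^5" using axis_bilinear[of 1 0 1 A 1 0 1] by simp
  have "mass 0 $ 1 $ 1 = index_weight 1" "stiffness 0 $ 1 $ 1 = pi\<^sup>2 * index_weight 1"
    by (simp_all add: mass_quad_integral stiffness_quad_integral quad_integral_0 Iq_g_g Iq_g Iq_grad_g index_eigenvalue_def mode_index_def mode_eigenvalue_def)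
  hence "lam 1 0 * index_weight 1 \<le> pi\<^sup>2 * index_weight 1" using lam_minimal(1)[OF Mpos, of "axis 1 1", unfolded e] by simp
  thus ?thesis using index_weight_ge[of 1] by simp
qed

theorem theorem5p4:
  shows "(\<exists>\<epsilon>>0. \<forall>p\<in>ball 0 \<epsilon>. p \<noteq> 0 \<longrightarrow> f2 0 < f2 p) \<and>
    quad 0 = square \<and>
    (\<exists>\<rho>>0. 0 \<in> cball 0 \<rho> \<inter> params \<and>
       (\<forall>p\<in>cball 0 \<rho> \<inter> params. p \<noteq> 0 \<longrightarrow>
          area p * mu1 (interior (quad p)) < area 0 * mu1 (interior (quad 0))))"
proof -
  obtain e1 where e1: "e1 > 0" "e1 \<le> 1/100" "\<forall>p x. norm p < e1 \<longrightarrow> x \<noteq> 0 \<longrightarrow> x \<bullet> (mass p *v x) > 0"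
    using mass_positive_definite by (elim exE conjE)
  obtain e2 where e2: "e2 > 0" "e2 \<le> 1/100" "\<forall>p x. norm p < e2 \<longrightarrow> x \<noteq> 0 \<longrightarrow> x \<bullet> (stiffness p *v x) > 0"
    using stiffness_positive_definite by (elim exE conjE)
  obtain e3 where e3: "e3 > 0" "e3 \<le> 1/100" "\<forall>p. norm p < e3 \<longrightarrow> p \<noteq> 0 \<longrightarrow> 1 / pi\<^sup>2 < f2 p"
    using f2_gt by (elim exE conjE)
  have Mpos: "x \<bullet> (mass p *v x) > 0" if "norm p < e1" "x \<noteq> 0" for p x using e1(3) that by iprover
  have at_0: "pi\<^sup>2 \<le> mu1 (interior (quad 0))"
  proof -
    have "lam 1 0 < 200 / 143 * pi\<^sup>2" using lam_1_0_le pi_square_gt_9 by linarith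
    thus ?thesis by (intro mu1_le_lam(3)[OF _ Mpos]) (use e1(1) in simp_all)
  qed
  have less: "area p * mu1 (interior (quad p)) < pi\<^sup>2"
    if p: "norm p < e1" "norm p < e2" "norm p < e3" "p \<noteq> 0" for p
  proof -
    have p0: "norm p \<le> 1/100" using p(1) e1(2) by simp
    have Mp: "x \<bullet> (mass p *v x) > 0" if "x \<noteq> 0" for x using Mpos[OF p(1) that] .
    have Kp: "x \<bullet> (stiffness p *v x) > 0" if "x \<noteq> 0" for x using e2(3) p(2) that by simp
    note l1 = ky_fan_trial(2)[OF Mp Kp]
    have l12: "lam 1 p \<le> lam 2 p" by (rule lam_minimal(2)[OF Mp])
    have A: "area p > 0" by (rule area_eq(2)[OF p0])
    have "1 / lam 2 p \<le> 1 / lam 1 p" using l1 l12 by (intro divide_left_mono) auto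
    hence "1 / lam 1 p + 1 / lam 2 p \<le> 2 * (1 / lam 1 p)" by linarith
    hence "f2 p \<le> 1 / (2 * area p) * (2 * (1 / lam 1 p))" unfolding f2_def using A by (intro mult_left_mono) auto
    also have "\<dots> = 1 / (area p * lam 1 p)" by simp
    finally have "1 / pi\<^sup>2 < 1 / (area p * lam 1 p)" using e3(3) p(3,4) by fastforce
    hence al: "area p * lam 1 p < pi\<^sup>2" using A l1 by (simp add: field_simps)
    \<comment> \<open>The area is at least 3/4, which exceeds 143/200; so the bound on area times
      \<open>lam 1 p\<close> already puts \<open>lam 1 p\<close> below the threshold of
      \<open>mu1_le_lam\<close>.\<close>
    have "(143 / 200) * lam 1 p \<le> area p * lam 1 p"
      using area_ge[OF p0] l1 by (intro mult_right_mono) auto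
    hence "lam 1 p < 200 / 143 * pi\<^sup>2" using al by linarith
    from mu1_le_lam(2)[OF p0 Mp this] have "area p * mu1 (interior (quad p)) \<le> area p * lam 1 p"
      using A by (intro mult_left_mono) auto
    with al show ?thesis by linarith
  qed
  show ?thesis
  proof (intro conjI)
    show "\<exists>\<epsilon>>0. \<forall>p\<in>ball 0 \<epsilon>. p \<noteq> 0 \<longrightarrow> f2 0 < f2 p"
    proof (intro exI[of _ e3] conjI ballI impI e3(1))
      fix p :: "real^4" assume "p \<in> ball 0 e3" "p \<noteq> 0"
      hence "1 / pi\<^sup>2 < f2 p" using e3(3) by simp
      thus "f2 0 < f2 p" using f2_0_le by linarith
    qed
    show "quad 0 = square" by (rule quad_0)
    \<comment> \<open>Halving places the closed ball inside all three open balls.\<close>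
    define \<rho> where "\<rho> = min (min e1 e2) e3 / 2"
    have \<rho>: "\<rho> > 0" "\<rho> < e1" "\<rho> < e2" "\<rho> < e3" using e1(1) e2(1) e3(1) unfolding \<rho>_def by linarith+
    show "\<exists>\<rho>>0. 0 \<in> cball 0 \<rho> \<inter> params \<and>
       (\<forall>p\<in>cball 0 \<rho> \<inter> params. p \<noteq> 0 \<longrightarrow>
          area p * mu1 (interior (quad p)) < area 0 * mu1 (interior (quad 0)))"
    proof (intro exI[of _ \<rho>] conjI ballI impI \<rho>(1))
      show "0 \<in> cball 0 \<rho> \<inter> params" using \<rho>(1) zero_in_params by simp
      fix p assume "p \<in> cball 0 \<rho> \<inter> params" "p \<noteq> 0"
      hence "area p * mu1 (interior (quad p)) < pi\<^sup>2" using \<rho> by (intro less) auto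
      also have "pi\<^sup>2 \<le> area 0 * mu1 (interior (quad 0))" using at_0 by (simp add: area_eq)
      finally show "area p * mu1 (interior (quad p)) < area 0 * mu1 (interior (quad 0))" .
    qed
  qed
qed

end
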